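(* Let $K\in\mathcal{K}_P$ be a polytope-type convex domain in $\mathbb{R}^{n+1}$ and let $\Sigma\subset\overline{K}$ be an embedded, compact, mean convex (i.e. $H>0$) $C^2$-hypersurface with boundary $\partial\Sigma$. Let $\Omega$ denote the domain enclosed by $\Sigma$ and $\partial K$. Assume that $\partial\Sigma\subset{\rm Reg}(\partial K)\cup{\rm Sing}_0(\partial K)$, that $\Sigma$ intersects $\partial K$ transversally, and that 1. $\langle\nu(x),\bar N(x)\rangle\le0$ for $x\in\partial\Sigma\cap{\rm Reg}(\partial K)$; 2. for $x\in\partial\Sigma\cap{\rm Sing}_0(\partial K)$, $\langle\nu(x),\bar N_{ij}^{\alpha}(x)\rangle\le0$ for $\alpha=1,2$, when $x\in{\rm int}(F_i\cap F_j)$. Then $$\int_\Sigma\frac1H\,dA\ \ge\ \frac{n+1}{n}|\Omega|.$$ Moreover, equality holds if and only if $\Sigma$ is a free boundary spherical cap and $\partial K\cap\overline{\Omega}$ is a part of the boundary of the convex cone $\mathcal{C}$ whose sector is determined by $\Sigma$.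
   Context: Polytopes: a convex polytope with non-empty interior is $P=\bigcap_{j\in J}\{u_j\le0\}\subset\mathbb{R}^{n+1}$, with $J$ a finite index set and $u_j$ affine linear functions, assumed irredundant ($P\ne\bigcap_{j\in J,j\ne l}\{u_j\le0\}$ for every $l\in J$). Its facets (dimension $n$) are $f_i=\{u_i=0\}\cap P$; its "edges" here mean its faces of dimension $n-1$, each of the form $f_i\cap f_j$ with $i\ne j$, and $f_{ij}^0$ denotes the relative interior of such an edge $f_i\cap f_j$. Polytope-type convex domains: $\mathcal{K}_P$ is the class of convex domains $K\subset\mathbb{R}^{n+1}$ for which there is a bi-Lipschitz homeomorphism $\Psi:P\to K$ from such a convex polytope $P$ with $\Psi|_{f_j}:f_j\to\Psi(f_j)$ smooth for every $j\in J$. Put $F_j=\Psi(f_j)$. ${\rm Reg}(\partial K)$ is the set of regular points of $\partial K$; it is the union of the relative interiors of the $F_j$. ${\rm Sing}_0(\partial K)=\bigcup_{i,j\in J}\Psi(f_{ij}^0)$; each of its points lies in the relative interior ${\rm int}(F_i\cap F_j)=\Psi(f^0_{ij})$ for two smooth pieces $F_i,F_j$. For $x\in{\rm Reg}(\partial K)$, $\bar N(x)$ is the outward unit normal to $\partial K$. For $x\in{\rm int}(F_i\cap F_j)$, $\bar N_{ij}^1(x)$ and $\bar N_{ij}^2(x)$ are the outward unit normals at $x$ to $F_i$ and $F_j$ respectively. Hypersurfaces: $\nu$ is the unit normal of $\Sigma$ pointing outward from $\Omega$, $H$ is the mean curvature (the sum of the principal curvatures, i.e. the trace of $d\nu$),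 $dA$ is the area element, and $|\Omega|$ is Lebesgue measure. A spherical cap is a part of a round sphere. $\Sigma$ is free boundary if $\langle\nu,\bar N\rangle=0$ on $\partial\Sigma\cap{\rm Reg}(\partial K)$ and $\langle\nu,\bar N_{ij}^\alpha\rangle=0$, $\alpha=1,2$, at points of $\partial\Sigma\cap{\rm int}(F_i\cap F_j)$. Cones: a convex cone is $\mathcal{C}=x_0+\{tx: t\in[0,\infty),\,x\in\omega\}$ with $\omega\subset\mathbb{S}^n$ a spherically convex domain (the sector) and $x_0\in\mathbb{R}^{n+1}$ the vertex. For $\Sigma$ a part of a sphere centered at $c$, the cone determined by $\Sigma$ is the one with vertex $c$ generated by $\Sigma$, i.e. $\{c+t(x-c): x\in\Sigma,\ t\ge0\}$. *)

theory Defs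
  imports "HOL-Analysis.Analysis"
begin

text \<open>Regularity classes: on an open set of a finite-dimensional space, continuity of all iterated
  directional derivatives in fixed directions is the same as membership in \<open>C\<^sup>k\<close>.\<close>

fun Ck_on :: "nat \<Rightarrow> ('a::euclidean_space \<Rightarrow> 'b::euclidean_space) \<Rightarrow> 'a set \<Rightarrow> bool" where
  "Ck_on 0 f U \<longleftrightarrow> continuous_on U f"
| "Ck_on (Suc k) f U \<longleftrightarrow>
     (\<forall>x\<in>U. f differentiable (at x)) \<and> (\<forall>v. Ck_on k (\<lambda>x. frechet_derivative f (at x) v) U)"

text \<open>Smoothness on an arbitrary (e.g. closed, lower-dimensional) set means existence of a smooth
  extension to an open neighbourhood.\<close>

definition smooth_map_on :: "'a::euclidean_space set \<Rightarrow> ('a \<Rightarrow> 'b::euclidean_space) \<Rightarrow> bool" where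
  "smooth_map_on S f \<longleftrightarrow>
     (\<exists>U G. open U \<and> S \<subseteq> U \<and> (\<forall>k. Ck_on k G U) \<and> (\<forall>x\<in>S. G x = f x))"

definition gradient :: "('a::euclidean_space \<Rightarrow> real) \<Rightarrow> 'a \<Rightarrow> 'a" where
  "gradient g x = (THE D. GDERIV g x :> D)"

text \<open>One-sided velocities are used so that the definition also gives the full tangent space of a
  smooth piece at points of its boundary.\<close>

definition tangent_space :: "'a::euclidean_space set \<Rightarrow> 'a \<Rightarrow> 'a set" where
  "tangent_space S x = span {v. \<exists>\<gamma>::real \<Rightarrow> 'a. \<gamma> 0 = x \<and> \<gamma> ` {0..1} \<subseteq> S \<and>
     (\<gamma> has_vector_derivative v) (at 0 within {0..1})}"

definition polytope_of :: "'j set \<Rightarrow> ('j \<Rightarrow> 'a::euclidean_space \<Rightarrow> real) \<Rightarrow> 'a set" where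
  "polytope_of J u = (\<Inter>j\<in>J. {x. u j x \<le> 0})"

definition convex_polytope :: "'j set \<Rightarrow> ('j \<Rightarrow> 'a::euclidean_space \<Rightarrow> real) \<Rightarrow> bool" where
  "convex_polytope J u \<longleftrightarrow>
     finite J \<and> (\<forall>j\<in>J. \<exists>a b. u j = (\<lambda>x. a \<bullet> x + b)) \<and>
     interior (polytope_of J u) \<noteq> {} \<and>
     (\<forall>l\<in>J. polytope_of J u \<noteq> polytope_of (J - {l}) u)"

definition facet :: "'j set \<Rightarrow> ('j \<Rightarrow> 'a::euclidean_space \<Rightarrow> real) \<Rightarrow> 'j \<Rightarrow> 'a set" where
  "facet J u i = {x. u i x = 0} \<inter> polytope_of J u"

text \<open>The intersection of two facets is an edge only if it has codimension 2 in the ambient space.\<close>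

definition edge_indices :: "'j set \<Rightarrow> ('j \<Rightarrow> 'a::euclidean_space \<Rightarrow> real) \<Rightarrow> ('j \<times> 'j) set" where
  "edge_indices J u = {(i, j). i \<in> J \<and> j \<in> J \<and> i \<noteq> j \<and>
     aff_dim (facet J u i \<inter> facet J u j) = int DIM('a) - 2}"

text \<open>The target of the bi-Lipschitz map is \<open>closure K\<close>, so that \<open>K\<close> may be either an open domain or
  its closure; the source, an intersection of closed half-spaces, is closed in any case.\<close>

definition polytope_type_domain ::
  "'j set \<Rightarrow> ('j \<Rightarrow> 'a::euclidean_space \<Rightarrow> real) \<Rightarrow> ('a \<Rightarrow> 'a) \<Rightarrow> 'a set \<Rightarrow> bool" where
  "polytope_type_domain J u \<Psi> K \<longleftrightarrow>
     convex_polytope J u \<and> convex K \<and>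
     (\<exists>\<Phi> L M. homeomorphism (polytope_of J u) (closure K) \<Psi> \<Phi> \<and>
        L-lipschitz_on (polytope_of J u) \<Psi> \<and> M-lipschitz_on (closure K) \<Phi>) \<and>
     (\<forall>j\<in>J. smooth_map_on (facet J u j) \<Psi>)"

definition piece ::
  "'j set \<Rightarrow> ('j \<Rightarrow> 'a::euclidean_space \<Rightarrow> real) \<Rightarrow> ('a \<Rightarrow> 'a) \<Rightarrow> 'j \<Rightarrow> 'a set" where
  "piece J u \<Psi> j = \<Psi> ` facet J u j"

definition Reg :: "'j set \<Rightarrow> ('j \<Rightarrow> 'a::euclidean_space \<Rightarrow> real) \<Rightarrow> ('a \<Rightarrow> 'a) \<Rightarrow> 'a set" where
  "Reg J u \<Psi> = (\<Union>j\<in>J. \<Psi> ` rel_interior (facet J u j))"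

definition edge_interior ::
  "'j set \<Rightarrow> ('j \<Rightarrow> 'a::euclidean_space \<Rightarrow> real) \<Rightarrow> ('a \<Rightarrow> 'a) \<Rightarrow> 'j \<Rightarrow> 'j \<Rightarrow> 'a set" where
  "edge_interior J u \<Psi> i j = \<Psi> ` rel_interior (facet J u i \<inter> facet J u j)"

definition Sing0 :: "'j set \<Rightarrow> ('j \<Rightarrow> 'a::euclidean_space \<Rightarrow> real) \<Rightarrow> ('a \<Rightarrow> 'a) \<Rightarrow> 'a set" where
  "Sing0 J u \<Psi> = (\<Union>(i, j)\<in>edge_indices J u. edge_interior J u \<Psi> i j)"

text \<open>The outward unit normal at \<open>x\<close> to a hypersurface \<open>F\<close> contained in the boundary of the convex
  set \<open>K\<close>. Outward means that \<open>K\<close> lies in the half-space bounded by the tangent hyperplane and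
  opposite to the normal.\<close>

definition outer_normal :: "'a::euclidean_space set \<Rightarrow> 'a set \<Rightarrow> 'a \<Rightarrow> 'a" where
  "outer_normal K F x =
     (THE N. norm N = 1 \<and> (\<forall>v\<in>tangent_space F x. N \<bullet> v = 0) \<and> (\<forall>y\<in>K. N \<bullet> (y - x) \<le> 0))"

definition C2_equation :: "'a::euclidean_space set \<Rightarrow> 'a set \<Rightarrow> ('a \<Rightarrow> real) \<Rightarrow> bool" where
  "C2_equation \<Sigma> U g \<longleftrightarrow>
     open U \<and> Ck_on 2 g U \<and> (\<forall>y\<in>U. gradient g y \<noteq> 0) \<and> (\<forall>y\<in>\<Sigma> \<inter> U. g y = 0)"

definition hs_interior :: "'a::euclidean_space set \<Rightarrow> 'a set" where
  "hs_interior \<Sigma> = {x\<in>\<Sigma>. \<exists>U g. x \<in> U \<and> C2_equation \<Sigma> U g \<and> \<Sigma> \<inter> U = {y\<in>U. g y = 0}}"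

definition hs_boundary :: "'a::euclidean_space set \<Rightarrow> 'a set" where
  "hs_boundary \<Sigma> = \<Sigma> - hs_interior \<Sigma>"

text \<open>A compact embedded \<open>C\<^sup>2\<close>-hypersurface with boundary, \<open>C\<^sup>2\<close> up to the boundary: near each of its
  points it is part of an embedded \<open>C\<^sup>2\<close>-hypersurface without boundary. No regularity of the boundary
  itself is imposed, because \<open>\<partial>\<Sigma>\<close> has corners where it crosses an edge of the container: the
  intersection of a sphere with a polyhedral cone must be admitted.\<close>

definition compact_C2_hypersurface :: "'a::euclidean_space set \<Rightarrow> bool" where
  "compact_C2_hypersurface \<Sigma> \<longleftrightarrow>
     compact \<Sigma> \<and> \<Sigma> \<noteq> {} \<and> \<Sigma> \<subseteq> closure (hs_interior \<Sigma>) \<and>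
     (\<forall>x\<in>\<Sigma>. \<exists>U g. x \<in> U \<and> C2_equation \<Sigma> U g)"

text \<open>Outwardness is imposed at interior points only; at boundary points it is inherited through
  the continuity of \<open>\<nu>\<close>, while the normal line there may leave the container in both directions.\<close>

definition outward_unit_normal_field ::
  "'a::euclidean_space set \<Rightarrow> 'a set \<Rightarrow> ('a \<Rightarrow> 'a) \<Rightarrow> bool" where
  "outward_unit_normal_field \<Sigma> \<Omega> \<nu> \<longleftrightarrow>
     (\<forall>x\<in>\<Sigma>. \<exists>U g. x \<in> U \<and> C2_equation \<Sigma> U g \<and> (\<forall>y\<in>\<Sigma> \<inter> U. \<nu> y = sgn (gradient g y))) \<and>
     (\<forall>x\<in>hs_interior \<Sigma>. \<forall>\<^sub>F t in at_right 0. x - t *\<^sub>R \<nu> x \<in> \<Omega> \<and> x + t *\<^sub>R \<nu> x \<notin> \<Omega>)"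

text \<open>The trace of \<open>d\<nu>\<close>. For an extension \<open>\<eta>\<close> of \<open>\<nu>\<close> by unit vectors one has
  \<open>D\<eta>(\<eta>) \<bullet> \<eta> = 0\<close>, so the trace of \<open>D\<eta>\<close> over the whole space equals the trace of \<open>d\<nu>\<close> over the
  tangent space and does not depend on the extension; at boundary points this follows by
  continuity from the interior.\<close>

definition mean_curvature :: "'a::euclidean_space set \<Rightarrow> ('a \<Rightarrow> 'a) \<Rightarrow> 'a \<Rightarrow> real" where
  "mean_curvature \<Sigma> \<nu> x =
     (THE h. \<exists>U \<eta>. open U \<and> x \<in> U \<and> Ck_on 1 \<eta> U \<and> (\<forall>y\<in>U. norm (\<eta> y) = 1) \<and>
        (\<forall>y\<in>\<Sigma> \<inter> U. \<eta> y = \<nu> y) \<and> h = (\<Sum>b\<in>Basis. frechet_derivative \<eta> (at x) b \<bullet> b))"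

text \<open>The area element is \<open>sqrt (det (g\<^sub>i\<^sub>j)) dp\<close> in every parametrisation, \<open>g\<^sub>i\<^sub>j\<close> being the first
  fundamental form. A compact \<open>C\<^sup>2\<close>-hypersurface is covered by finitely many parametrised pieces,
  which determines the measure. Images of Borel sets rather than of open sets are used in order to
  reach boundary points, near which only a part of the parametrised patch belongs to \<open>\<Sigma>\<close>.\<close>

definition parametrisation :: "(real^'n) set \<Rightarrow> (real^'n \<Rightarrow> 'a::euclidean_space) \<Rightarrow> bool" where
  "parametrisation V \<phi> \<longleftrightarrow>
     open V \<and> Ck_on 1 \<phi> V \<and> inj_on \<phi> V \<and> (\<forall>p\<in>V. inj (frechet_derivative \<phi> (at p)))"

definition area_density :: "(real^'n \<Rightarrow> 'a::euclidean_space) \<Rightarrow> real^'n \<Rightarrow> real" where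
  "area_density \<phi> p = sqrt (det (\<chi> i j.
     frechet_derivative \<phi> (at p) (axis i 1) \<bullet> frechet_derivative \<phi> (at p) (axis j 1)))"

definition area_measure :: "'n::finite itself \<Rightarrow> 'a::euclidean_space set \<Rightarrow> 'a measure" where
  "area_measure _ \<Sigma> =
     (THE \<mu>. sets \<mu> = sets (restrict_space borel \<Sigma>) \<and>
        (\<forall>V (\<phi> :: real^'n \<Rightarrow> 'a) B.
           parametrisation V \<phi> \<and> B \<in> sets borel \<and> B \<subseteq> V \<and> \<phi> ` B \<subseteq> \<Sigma> \<longrightarrow>
           emeasure \<mu> (\<phi> ` B) = (\<integral>\<^sup>+p\<in>B. ennreal (area_density \<phi> p) \<partial>lborel)))"

definition enclosed_domain :: "'a::euclidean_space set \<Rightarrow> 'a set \<Rightarrow> 'a set \<Rightarrow> bool" where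
  "enclosed_domain K \<Sigma> \<Omega> \<longleftrightarrow>
     \<Omega> \<in> components (interior K - \<Sigma>) \<and> bounded \<Omega> \<and> \<Sigma> \<subseteq> frontier \<Omega>"

text \<open>Transversality to the piecewise smooth hypersurface \<open>\<partial>K\<close> means transversality to every smooth
  piece, the pieces including their boundary points.\<close>

definition transversal_to_boundary ::
  "'j set \<Rightarrow> ('j \<Rightarrow> 'a::euclidean_space \<Rightarrow> real) \<Rightarrow> ('a \<Rightarrow> 'a) \<Rightarrow> 'a set \<Rightarrow> bool" where
  "transversal_to_boundary J u \<Psi> \<Sigma> \<longleftrightarrow>
     (\<forall>j\<in>J. \<forall>x\<in>\<Sigma> \<inter> piece J u \<Psi> j.
        {v + w |v w. v \<in> tangent_space \<Sigma> x \<and> w \<in> tangent_space (piece J u \<Psi> j) x} = UNIV)"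

definition free_boundary ::
  "'j set \<Rightarrow> ('j \<Rightarrow> 'a::euclidean_space \<Rightarrow> real) \<Rightarrow> ('a \<Rightarrow> 'a) \<Rightarrow> 'a set \<Rightarrow> 'a set \<Rightarrow> ('a \<Rightarrow> 'a) \<Rightarrow> bool"
  where
  "free_boundary J u \<Psi> K \<Sigma> \<nu> \<longleftrightarrow>
     (\<forall>x\<in>hs_boundary \<Sigma> \<inter> Reg J u \<Psi>. \<nu> x \<bullet> outer_normal K (frontier K) x = 0) \<and>
     (\<forall>(i, j)\<in>edge_indices J u. \<forall>x\<in>hs_boundary \<Sigma> \<inter> edge_interior J u \<Psi> i j.
        \<nu> x \<bullet> outer_normal K (piece J u \<Psi> i) x = 0 \<and>
        \<nu> x \<bullet> outer_normal K (piece J u \<Psi> j) x = 0)"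

text \<open>A spherically convex domain may contain any part of its boundary. Antipodal points are joined
  by no unique minimal geodesic and are exempt, as in a closed hemisphere.\<close>

definition spherically_convex_domain :: "'a::euclidean_space set \<Rightarrow> bool" where
  "spherically_convex_domain \<omega> \<longleftrightarrow>
     \<omega> \<subseteq> sphere 0 1 \<and>
     (\<exists>W. openin (top_of_set (sphere 0 1)) W \<and> connected W \<and> W \<noteq> {} \<and> W \<subseteq> \<omega> \<and> \<omega> \<subseteq> closure W) \<and>
     (\<forall>x\<in>\<omega>. \<forall>y\<in>\<omega>. x + y \<noteq> 0 \<longrightarrow> (\<forall>s\<in>{0..1}. sgn ((1 - s) *\<^sub>R x + s *\<^sub>R y) \<in> \<omega>))"

definition cone_over :: "'a::euclidean_space \<Rightarrow> 'a set \<Rightarrow> 'a set" where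
  "cone_over x0 \<omega> = {x0 + t *\<^sub>R x |t x. 0 \<le> t \<and> x \<in> \<omega>}"

definition sector_of :: "'a::euclidean_space \<Rightarrow> 'a set \<Rightarrow> 'a set" where
  "sector_of c \<Sigma> = (\<lambda>x. sgn (x - c)) ` \<Sigma>"

end

theory Submission
  imports Defs "HOL-Analysis.Analysis"
begin

text \<open>The domain is swept out by inward normals. Write n for \<open>CARD('n)\<close>, H for
  the mean curvature and \<open>\<zeta> (x, t) = x - t *\<^sub>R \<nu> x\<close>. Each y in \<Omega>
  has a nearest point x on \<Sigma>, and the claim is that y = \<zeta> (x, t) with t = dist y x. At
  an interior point of \<Sigma> this is the first-order condition
  \<open>nearest_point_normal\<close> together with the choice of side in
  \<open>nearest_point_outward\<close>. At a boundary point only one-sided variations exist, and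
  there the sign conditions on \<nu> enter: all outer normals of K at x are controlled by those of
  the adjacent smooth pieces (\<open>normal_cone_generated_le\<close>), so \<nu> x has nonpositive
  product with every one of them, and a separation argument shows that y - x is still a multiple of
  \<nu> x (\<open>nearest_boundary_point\<close>). Transversality provides tangent directions
  pointing into K, and it makes the normal lines over the boundary of \<Sigma> a null set
  (\<open>boundary_null\<close>).

  If x is nearest to y, the ball of radius t about y touches \<Sigma> from inside, so t times each
  principal curvature is at most 1 (\<open>touching_ball_shape\<close>). The Jacobian of \<zeta>
  with respect to area times length is the product of the factors 1 - t k over the principal
  curvatures k. By the inequality of arithmetic and geometric means it is at most (1 - t H / n)^n,
  and t is at most n / H (\<open>touch_bounds\<close>). The area formula \<open>tube\<close> bounds
  the volume of \<Omega> by the integral of these weights, and each fibre contributes n / ((n + 1)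
  H) (\<open>weight_integral\<close>). This is the inequality \<open>volume_le_integral_rad\<close>.

  If equality holds, no open part of the full tube 0 < t < n / H can be wasted
  (\<open>equality_interior\<close>), so every point of \<Sigma> has an inner touching ball of
  radius n / H. Let y0 be a point of the closure of \<Omega> at maximal distance r0 from \<Sigma>;
  then n / H is at most r0 everywhere. Suppose that a direction v leads from y0 into K but y0 + r0 v
  is not on \<Sigma>. A ball near y0 in direction v, of volume comparable to \<epsilon>^(n + 1), is
  then covered by normals starting in a thin shell outside the sphere of radius r0, with weights of
  order \<epsilon>^n on a parameter interval of length of order \<epsilon>. Since the area of the
  shell tends to 0 with \<epsilon>, this is impossible (\<open>cap_in_hypersurface\<close>). So the
  sphere about y0 is contained in \<Sigma> as far as it lies in inner directions; connectedness of
  \<Omega> gives the rest of the description (\<open>equality_cap\<close>). The free boundary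
  property follows because the centre lies in the closure of K, which reverses the assumed
  inequalities (\<open>free_boundary_sphere\<close>).

  Conversely, for a cap the normals are radial, \<zeta> is injective, and open radii over interior
  points of \<Sigma> cannot leave \<Omega> without meeting \<Sigma> or the frontier of the cone. All
  inequalities are then equalities (\<open>cap_equality\<close>).\<close>

section \<open>Spectral theorem for symmetric maps; determinant and trace in an eigenbasis\<close>

text \<open>The defect \<open>v = f x0 - M *\<^sub>R x0\<close> is orthogonal to \<open>x0\<close>.
  Moving from \<open>x0\<close> by \<open>s *\<^sub>R v\<close> changes
  \<open>f y \<bullet> y - M * (y \<bullet> y)\<close> by \<open>2 * s * (v \<bullet> v)\<close> to
  first order, so maximality at \<open>x0\<close> forces \<open>v = 0\<close>.\<close>

lemma selfadjoint_maximiser_eigenvector: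
  fixes f :: "'a::euclidean_space \<Rightarrow> 'a"
  assumes f: "linear f" and S: "subspace S" and inv: "\<And>x. x \<in> S \<Longrightarrow> f x \<in> S"
    and sym: "\<And>x y. x \<in> S \<Longrightarrow> y \<in> S \<Longrightarrow> f x \<bullet> y = x \<bullet> f y"
    and x0: "x0 \<in> S" "norm x0 = 1" and le: "\<And>y. y \<in> S \<Longrightarrow> f y \<bullet> y \<le> M * (y \<bullet> y)"
    and eq: "f x0 \<bullet> x0 = M"
  shows "f x0 = M *\<^sub>R x0"
proof -
  interpret f: linear f by fact
  define v where "v = f x0 - M *\<^sub>R x0"
  have vS: "v \<in> S" unfolding v_def using S inv x0 by (simp add: subspace_diff subspace_mul)
  have x01: "x0 \<bullet> x0 = 1" using x0 by (simp add: dot_square_norm)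
  have v0: "v \<bullet> x0 = 0" unfolding v_def using eq x01 by (simp add: inner_diff_left)
  have orth: "f x0 \<bullet> v = v \<bullet> v"
    using v0 unfolding v_def by (simp add: inner_diff_left inner_diff_right inner_commute algebra_simps)
  have key: "2 * s * (v \<bullet> v) + s\<^sup>2 * (f v \<bullet> v - M * (v \<bullet> v)) \<le> 0" for s :: real
  proof -
    have "x0 + s *\<^sub>R v \<in> S" using S x0 vS by (simp add: subspace_add subspace_mul)
    from le[OF this] have "f (x0 + s *\<^sub>R v) \<bullet> (x0 + s *\<^sub>R v) \<le> M * ((x0 + s *\<^sub>R v) \<bullet> (x0 + s *\<^sub>R v))" .
    moreover have "f (x0 + s *\<^sub>R v) \<bullet> (x0 + s *\<^sub>R v) = M + 2 * s * (v \<bullet> v) + s\<^sup>2 * (f v \<bullet> v)"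
    proof -
      have "f v \<bullet> x0 = v \<bullet> v" using sym[OF vS x0(1)] orth by (simp add: inner_commute)
      then show ?thesis
        by (simp add: f.add f.scaleR inner_add_left inner_add_right eq orth power2_eq_square algebra_simps)
    qed
    moreover have "(x0 + s *\<^sub>R v) \<bullet> (x0 + s *\<^sub>R v) = 1 + s\<^sup>2 * (v \<bullet> v)"
      using v0 x01 by (simp add: inner_add_left inner_add_right inner_commute power2_eq_square)
    ultimately have "M + 2 * s * (v \<bullet> v) + s\<^sup>2 * (f v \<bullet> v) \<le> M * (1 + s\<^sup>2 * (v \<bullet> v))" by simp
    then show ?thesis by (simp add: algebra_simps)
  qed
  have "v \<bullet> v = 0"
  proof (rule ccontr)
    assume "v \<bullet> v \<noteq> 0"
    then have p: "v \<bullet> v > 0" by simp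
    define c where "c = f v \<bullet> v - M * (v \<bullet> v)"
    \<comment> \<open>Small enough that the quadratic term cannot compensate the linear one; the
      summand 1 covers the case \<open>c = 0\<close>.\<close>
    define s where "s = (v \<bullet> v) / (\<bar>c\<bar> + 1)"
    have s: "s > 0" unfolding s_def using p by simp
    have "2 * (v \<bullet> v) + s * c \<le> 0"
      using key[of s] s unfolding c_def[symmetric] power2_eq_square
      by (metis (no_types, opaque_lifting) distrib_left mult.assoc mult.left_commute mult_le_0_iff not_le)
    moreover have "s * \<bar>c\<bar> \<le> v \<bullet> v"
      unfolding s_def using p by (simp add: field_simps)
    ultimately show False using p s by (smt (verit) abs_ge_minus_self mult_left_mono mult_minus_right)
  qed
  then show ?thesis unfolding v_def by simp
qed

text \<open>Induction on the dimension: a maximiser of the Rayleigh quotient on the unit sphere of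
  \<open>S\<close> is an eigenvector, and its orthogonal complement in \<open>S\<close> is again
  invariant. Symmetry is demanded on \<open>S\<close> only, since the shape operator is known to be
  symmetric on tangent vectors only.\<close>

lemma selfadjoint_eigenbasis:
  fixes f :: "'a::euclidean_space \<Rightarrow> 'a"
  assumes f: "linear f" and S: "subspace S" and inv: "\<And>x. x \<in> S \<Longrightarrow> f x \<in> S"
    and sym: "\<And>x y. x \<in> S \<Longrightarrow> y \<in> S \<Longrightarrow> f x \<bullet> y = x \<bullet> f y"
  shows "\<exists>B l. B \<subseteq> S \<and> pairwise orthogonal B \<and> (\<forall>b\<in>B. norm b = 1) \<and> span B = S \<and>
      finite B \<and> card B = dim S \<and> (\<forall>b\<in>B. f b = l b *\<^sub>R b)"
  using S inv sym
proof (induction "dim S" arbitrary: S rule: less_induct)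
  case (less S)
  interpret f: linear f by fact
  show ?case
  proof (cases "S \<subseteq> {0}")
    case True
    then have "S = {0}" using less.prems(1) subspace_0 by blast
    then show ?thesis by (intro exI[of _ "{}"]) (auto simp: pairwise_def)
  next
    case False
    define K where "K = S \<inter> sphere 0 1"
    have "closed S" using less.prems(1) closed_subspace by blast
    then have cK: "compact K" unfolding K_def by (simp add: closed_Int_compact)
    obtain z where z: "z \<in> S" "z \<noteq> 0" using False by auto
    have "sgn z \<in> K" unfolding K_def using z less.prems(1)
      by (simp add: sgn_div_norm subspace_mul)
    then have neK: "K \<noteq> {}" by auto
    have "continuous_on K (\<lambda>x. f x \<bullet> x)"
      by (intro continuous_intros linear_continuous_on) (simp add: f linear_conv_bounded_linear[symmetric])
    then obtain x0 where x0: "x0 \<in> K" "\<And>y. y \<in> K \<Longrightarrow> f y \<bullet> y \<le> f x0 \<bullet> x0"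
      using continuous_attains_sup[OF cK neK] by blast
    define M where "M = f x0 \<bullet> x0"
    have x0S: "x0 \<in> S" "norm x0 = 1" using x0 by (auto simp: K_def)
    have le: "f y \<bullet> y \<le> M * (y \<bullet> y)" if y: "y \<in> S" for y
    proof (cases "y = 0")
      case True then show ?thesis by (simp add: f.zero)
    next
      case False
      have "sgn y \<in> K" unfolding K_def using y False less.prems(1) by (simp add: sgn_div_norm subspace_mul)
      from x0(2)[OF this] have "f (sgn y) \<bullet> sgn y \<le> M" unfolding M_def .
      then have "(f y \<bullet> y) / (norm y)\<^sup>2 \<le> M"
        by (simp add: sgn_div_norm f.scaleR power2_eq_square divide_simps)
      then show ?thesis using False by (simp add: power2_norm_eq_inner divide_simps mult.commute)
    qed
    have fx0: "f x0 = M *\<^sub>R x0"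
      by (rule selfadjoint_maximiser_eigenvector[OF f less.prems x0S le])
        (auto simp: M_def)
    define S' where "S' = S \<inter> {y. x0 \<bullet> y = 0}"
    have S': "subspace S'" unfolding S'_def using less.prems(1) by (intro subspace_inter) (auto simp: subspace_hyperplane)
    have ps: "S' \<subset> S"
    proof -
      have "x0 \<notin> S'" using x0S by (auto simp: S'_def dot_square_norm)
      then show ?thesis using x0S unfolding S'_def by blast
    qed
    then have d: "dim S' < dim S"
      by (metis S' less.prems(1) dim_psubset span_eq_iff)
    \<comment> \<open>For \<open>x\<close> orthogonal to \<open>x0\<close>, symmetry moves
      \<open>f\<close> to \<open>x0\<close>, which is an eigenvector.\<close>
    have inv': "f x \<in> S'" if "x \<in> S'" for x
      using that less.prems(2,3) x0S fx0 unfolding S'_def by (metis (mono_tags, lifting) IntD1 IntD2 IntI inner_scaleR_left mem_Collect_eq mult_zero_right)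
    have "\<exists>B l. B \<subseteq> S' \<and> pairwise orthogonal B \<and> (\<forall>b\<in>B. norm b = 1) \<and> span B = S' \<and>
      finite B \<and> card B = dim S' \<and> (\<forall>b\<in>B. f b = l b *\<^sub>R b)"
      by (rule less.hyps[OF d S' inv']) (auto simp: S'_def less.prems)
    then obtain B l where B: "B \<subseteq> S'" "pairwise orthogonal B" "\<forall>b\<in>B. norm b = 1" "span B = S'"
      "finite B" "card B = dim S'" "\<forall>b\<in>B. f b = l b *\<^sub>R b" by blast
    have x0B: "x0 \<notin> B" using B(1) x0S by (auto simp: S'_def dot_square_norm)
    have pw: "pairwise orthogonal (insert x0 B)"
      using B(1,2) by (auto simp: pairwise_insert orthogonal_def S'_def inner_commute)
    have nm: "\<forall>b\<in>insert x0 B. norm b = 1" using B(3) x0S by auto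
    have sp: "span (insert x0 B) = S"
    proof
      show "span (insert x0 B) \<subseteq> S"
        using B(1) x0S less.prems(1) by (intro span_minimal) (auto simp: S'_def)
      show "S \<subseteq> span (insert x0 B)"
      proof
        fix x assume x: "x \<in> S"
        have "x - (x0 \<bullet> x) *\<^sub>R x0 \<in> S'"
          unfolding S'_def using x x0S less.prems(1)
          by (auto simp: subspace_diff subspace_mul inner_diff_right dot_square_norm)
        then show "x \<in> span (insert x0 B)" using B(4) by (auto simp: span_insert)
      qed
    qed
    have "independent (insert x0 B)"
      using pw nm by (intro pairwise_orthogonal_independent) force+
    then have cd: "card (insert x0 B) = dim S"
      by (metis dim_eq_card_independent dim_span sp)
    show ?thesis
      by (intro exI[of _ "insert x0 B"] exI[of _ "\<lambda>b. if b = x0 then M else l b"])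
        (use pw nm sp cd B x0S x0B fx0 in \<open>auto simp: S'_def\<close>)
  qed
qed

text \<open>With the eigenvectors as columns of an orthogonal matrix \<open>Q\<close> and the
  eigenvalues in a diagonal matrix \<open>D\<close>, the eigenvalue equations read
  \<open>matrix f ** Q = Q ** D\<close>.\<close>

lemma det_eigenbasis:
  fixes f :: "real^'n \<Rightarrow> real^'n"
  assumes f: "linear f" and B: "finite B" "card B = CARD('n)" "pairwise orthogonal B" "\<forall>b\<in>B. norm b = 1"
    and eig: "\<forall>b\<in>B. f b = l b *\<^sub>R b"
  shows "det (matrix f) = (\<Prod>b\<in>B. l b)"
proof -
  obtain h where h: "bij_betw h (UNIV::'n set) B"
    using B(1,2) finite_same_card_bij[of "UNIV::'n set" B] by auto
  define Q :: "real^'n^'n" where "Q = (\<chi> i j. h j $ i)"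
  define D :: "real^'n^'n" where "D = (\<chi> i j. if i = j then l (h j) else 0)"
  have colQ: "column j Q = h j" for j by (simp add: Q_def column_def vec_eq_iff)
  have hB: "h j \<in> B" for j using h by (auto simp: bij_betw_def)
  have "orthogonal_matrix Q"
    unfolding orthogonal_matrix_orthonormal_columns colQ
  proof (intro conjI allI impI)
    fix i j :: 'n assume "i \<noteq> j"
    then have "h i \<noteq> h j" using h by (auto simp: bij_betw_def inj_on_def)
    then show "orthogonal (h i) (h j)" using B(3) hB unfolding pairwise_def by blast
  qed (use B(4) hB in blast)
  then have dQ: "det Q \<noteq> 0" using det_orthogonal_matrix[of Q] by auto
  have "matrix f ** Q = Q ** D"
  proof -
    have "(matrix f ** Q) $ i $ j = (Q ** D) $ i $ j" for i j
    proof -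
      have "(matrix f ** Q) $ i $ j = (matrix f *v h j) $ i"
        by (simp add: matrix_matrix_mult_def matrix_vector_mult_def Q_def)
      also have "\<dots> = f (h j) $ i" using f by (simp add: matrix_works linear_matrix_vector_mul_eq)
      also have "\<dots> = l (h j) * h j $ i" using eig hB by simp
      also have "\<dots> = (Q ** D) $ i $ j"
        by (simp add: matrix_matrix_mult_def Q_def D_def if_distrib cong: if_cong)
      finally show ?thesis .
    qed
    then show ?thesis by (simp add: vec_eq_iff)
  qed
  then have "det (matrix f) * det Q = det Q * det D" by (metis det_mul)
  then have "det (matrix f) = det D" using dQ by simp
  also have "\<dots> = (\<Prod>j\<in>UNIV. l (h j))" by (subst det_diagonal) (auto simp: D_def)
  also have "\<dots> = (\<Prod>b\<in>B. l b)" using h by (rule prod.reindex_bij_betw)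
  finally show ?thesis .
qed

lemma trace_orthonormal_basis:
  fixes f :: "'a::euclidean_space \<Rightarrow> 'a"
  assumes f: "linear f" and B: "finite B" "pairwise orthogonal B" "\<forall>b\<in>B. norm b = 1" "span B = UNIV"
  shows "(\<Sum>b\<in>Basis. f b \<bullet> b) = (\<Sum>b\<in>B. f b \<bullet> b)"
proof -
  interpret f: linear f by fact
  have exp: "x = (\<Sum>b\<in>B. (x \<bullet> b) *\<^sub>R b)" for x
  proof (rule euclidean_eqI)
    have *: "(x - (\<Sum>b\<in>B. (x \<bullet> b) *\<^sub>R b)) \<bullet> c = 0" if "c \<in> B" for c
    proof -
      have "(\<Sum>b\<in>B. (x \<bullet> b) *\<^sub>R b) \<bullet> c = (\<Sum>b\<in>B. (x \<bullet> b) * (b \<bullet> c))" by (simp add: inner_sum_left)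
      also have "\<dots> = (\<Sum>b\<in>B. if b = c then x \<bullet> c else 0)"
        using B(2,3) that by (intro sum.cong) (auto simp: pairwise_def orthogonal_def dot_square_norm)
      also have "\<dots> = x \<bullet> c" using B(1) that by simp
      finally show ?thesis by (simp add: inner_diff_left)
    qed
    have "orthogonal (x - (\<Sum>b\<in>B. (x \<bullet> b) *\<^sub>R b)) y" if "y \<in> span B" for y
      using that by (rule orthogonal_to_span) (use * in \<open>simp add: orthogonal_def\<close>)
    then have "x - (\<Sum>b\<in>B. (x \<bullet> b) *\<^sub>R b) = 0"
      using B(4) by (metis UNIV_I orthogonal_self)
    then show "x \<bullet> i = (\<Sum>b\<in>B. (x \<bullet> b) *\<^sub>R b) \<bullet> i" for i by simp
  qed
  have "(\<Sum>b\<in>Basis. f b \<bullet> b) = (\<Sum>i\<in>Basis. \<Sum>b\<in>B. (i \<bullet> b) * (f b \<bullet> i))"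
  proof (rule sum.cong[OF refl])
    fix i :: 'a
    have "f i \<bullet> i = f (\<Sum>b\<in>B. (i \<bullet> b) *\<^sub>R b) \<bullet> i" by (rule arg_cong[OF exp])
    also have "\<dots> = (\<Sum>b\<in>B. (i \<bullet> b) * (f b \<bullet> i))" by (simp add: f.sum f.scaleR inner_sum_left)
    finally show "f i \<bullet> i = (\<Sum>b\<in>B. (i \<bullet> b) * (f b \<bullet> i))" .
  qed
  also have "\<dots> = (\<Sum>b\<in>B. \<Sum>i\<in>Basis. (f b \<bullet> i) * (b \<bullet> i))"
    by (subst sum.swap) (simp add: mult.commute inner_commute)
  also have "\<dots> = (\<Sum>b\<in>B. f b \<bullet> b)" by (intro sum.cong refl euclidean_inner[symmetric])
  finally show ?thesis .
qed

section \<open>Transfer between Euclidean spaces of equal dimension; the absolute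
  determinant\<close>

text \<open>The change of variables theorems of the library require a well-ordered finite index type.\<close>

typedef (overloaded) ('a::euclidean_space) basis_index = "{..<DIM('a)}"
  by (rule exI[of _ 0]) simp

instantiation basis_index :: (euclidean_space) wellorder
begin

definition "(i :: 'a basis_index) \<le> j \<longleftrightarrow> Rep_basis_index i \<le> Rep_basis_index j"
definition "(i :: 'a basis_index) < j \<longleftrightarrow> Rep_basis_index i < Rep_basis_index j"

instance
proof
  fix x y z :: "'a basis_index"
  show "x < y \<longleftrightarrow> x \<le> y \<and> \<not> y \<le> x" "x \<le> x" "x \<le> y \<or> y \<le> x"
    unfolding less_eq_basis_index_def less_basis_index_def by linarith+
  show "x \<le> z" if "x \<le> y" "y \<le> z"
    using that unfolding less_eq_basis_index_def by (rule le_trans)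
  show "x = y" if "x \<le> y" "y \<le> x"
    using that unfolding less_eq_basis_index_def Rep_basis_index_inject[symmetric] by (rule le_antisym)
next
  fix P :: "'a basis_index \<Rightarrow> bool" and a
  assume step: "\<And>x. (\<And>y. y < x \<Longrightarrow> P y) \<Longrightarrow> P x"
  show "P a"
  proof (induction "Rep_basis_index a" arbitrary: a rule: less_induct)
    case less
    show ?case by (rule step) (use less in \<open>simp add: less_basis_index_def\<close>)
  qed
qed

end

instance basis_index :: (euclidean_space) finite
proof
  have "finite (Rep_basis_index ` (UNIV::'a basis_index set))"
    by (rule finite_subset[of _ "{..<DIM('a)}"]) (use Rep_basis_index in auto)
  then show "finite (UNIV::'a basis_index set)"
    by (rule finite_imageD) (auto simp: inj_on_def Rep_basis_index_inject)
qed

lemma card_basis_index: "CARD('a::euclidean_space basis_index) = DIM('a)"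
  using type_definition.card[OF type_definition_basis_index] by simp

text \<open>Besides being isometric, the map permutes standard bases. Boxes therefore correspond to
  boxes, and preservation of Lebesgue measure needs no determinant.\<close>

definition basis_iso :: "('a::euclidean_space \<Rightarrow> 'b::euclidean_space) \<Rightarrow> ('b \<Rightarrow> 'a) \<Rightarrow> bool" where
  "basis_iso F G \<longleftrightarrow> linear F \<and> linear G \<and> (\<forall>x. G (F x) = x) \<and> (\<forall>y. F (G y) = y) \<and>
     F ` Basis = Basis \<and> (\<forall>x x'. F x \<bullet> F x' = x \<bullet> x')"

lemma basis_iso_from_bij:
  assumes h: "bij_betw h (Basis::'a::euclidean_space set) (Basis::'b::euclidean_space set)"
  shows "\<exists>F G. basis_iso F G \<and> (\<forall>i\<in>Basis. F i = h i)"
proof -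
  define F where "F x = (\<Sum>i\<in>Basis. (x \<bullet> i) *\<^sub>R h i)" for x :: 'a
  define G where "G y = (\<Sum>i\<in>Basis. (y \<bullet> h i) *\<^sub>R i)" for y :: 'b
  have hB: "h i \<in> Basis" if "i \<in> Basis" for i using h that by (auto simp: bij_betw_def)
  have hi: "h i \<bullet> h j = (if i = j then 1 else 0)" if "i \<in> Basis" "j \<in> Basis" for i j
    using h that hB by (auto simp: inner_Basis bij_betw_def inj_on_def)
  have Fi: "F x \<bullet> h j = x \<bullet> j" if "j \<in> Basis" for x j
    using that by (simp add: F_def inner_sum_left hi if_distrib cong: if_cong)
  have Gi: "G y \<bullet> j = y \<bullet> h j" if "j \<in> Basis" for y j
    using that by (simp add: G_def inner_sum_left inner_Basis if_distrib cong: if_cong)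
  have FG: "F (G y) = y" for y
  proof (rule euclidean_eqI)
    fix b :: 'b assume "b \<in> Basis"
    then obtain i where "i \<in> Basis" "b = h i" using h by (auto simp: bij_betw_def)
    then show "F (G y) \<bullet> b = y \<bullet> b" by (simp add: Fi Gi)
  qed
  have GF: "G (F x) = x" for x by (rule euclidean_eqI) (simp add: Fi Gi)
  have Fh: "F i = h i" if "i \<in> Basis" for i
    using that by (simp add: F_def inner_Basis if_distrib[of "\<lambda>c. c *\<^sub>R _"] cong: if_cong)
  have "F ` Basis = Basis" using Fh h by (auto simp: bij_betw_def)
  moreover have "linear F" "linear G"
    by (auto intro!: linearI simp: F_def G_def inner_add_left scaleR_add_left sum.distrib scaleR_sum_right)
  moreover have "F x \<bullet> F x' = x \<bullet> x'" for x x'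
  proof -
    have "F x \<bullet> F x' = (\<Sum>i\<in>Basis. (x' \<bullet> i) * (F x \<bullet> h i))" by (simp add: F_def[of x'] inner_sum_right)
    also have "\<dots> = (\<Sum>i\<in>Basis. (x \<bullet> i) * (x' \<bullet> i))" by (intro sum.cong) (auto simp: Fi)
    also have "\<dots> = x \<bullet> x'" by (rule euclidean_inner[symmetric])
    finally show ?thesis .
  qed
  ultimately show ?thesis using FG GF Fh unfolding basis_iso_def by blast
qed

lemma basis_iso_exists:
  assumes "DIM('a::euclidean_space) = DIM('b::euclidean_space)"
  shows "\<exists>(F::'a \<Rightarrow> 'b) G. basis_iso F G"
proof -
  obtain h where "bij_betw h (Basis::'a set) (Basis::'b set)"
    using finite_same_card_bij[OF finite_Basis finite_Basis assms] by blast
  then show ?thesis using basis_iso_from_bij by blast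
qed

text \<open>Used to make a coordinate in which the gradient does not vanish the last coordinate of a
  graph chart.\<close>

lemma basis_iso_exists_pointed:
  assumes d: "DIM('a::euclidean_space) = DIM('b::euclidean_space)" and a: "a \<in> (Basis::'a set)" and b: "b \<in> (Basis::'b set)"
  shows "\<exists>(F::'a \<Rightarrow> 'b) G. basis_iso F G \<and> F a = b"
proof -
  have "card (Basis - {a}) = card (Basis - {b})" using d a b by simp
  then obtain h where h: "bij_betw h (Basis - {a}) (Basis - {b})"
    using finite_same_card_bij[of "Basis - {a}" "Basis - {b}"] by auto
  have "bij_betw (h(a := b)) (insert a (Basis - {a})) (insert b (Basis - {b}))"
    using h by (auto simp: bij_betw_def inj_on_def)
  then have "bij_betw (h(a := b)) Basis Basis" using a b by (simp add: insert_absorb)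
  from basis_iso_from_bij[OF this] show ?thesis using a by auto
qed

lemma basis_iso_sym:
  assumes "basis_iso F G" shows "basis_iso G F"
proof -
  have "G y \<bullet> G y' = y \<bullet> y'" for y y'
    using assms unfolding basis_iso_def by metis
  moreover have "G ` Basis = Basis"
    using assms unfolding basis_iso_def by (metis (no_types, lifting) image_comp image_cong comp_apply image_ident)
  ultimately show ?thesis using assms unfolding basis_iso_def by blast
qed

lemma basis_iso_continuous: "basis_iso F G \<Longrightarrow> continuous_on S F"
  unfolding basis_iso_def by (simp add: linear_continuous_on linear_conv_bounded_linear)

lemma basis_iso_borel: "basis_iso F G \<Longrightarrow> F \<in> borel_measurable borel"
  by (intro borel_measurable_continuous_onI basis_iso_continuous)

lemma basis_iso_image_vimage:
  assumes "basis_iso F G" shows "F ` S = G -` S"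
  using assms unfolding basis_iso_def by (auto simp: image_iff) metis

text \<open>Boxes pull back to boxes with the same side lengths, and the volumes of boxes
  characterise Lebesgue measure.\<close>

lemma basis_iso_distr:
  fixes F :: "'a::euclidean_space \<Rightarrow> 'b::euclidean_space"
  assumes F: "basis_iso F G"
  shows "distr lborel borel F = lborel"
proof (rule lborel_eqI[symmetric])
  fix l u :: 'b assume lu: "\<And>b. b \<in> Basis \<Longrightarrow> l \<bullet> b \<le> u \<bullet> b"
  have FB: "F ` Basis = Basis" and inn: "\<And>x x'. F x \<bullet> F x' = x \<bullet> x'" using F by (auto simp: basis_iso_def)
  have FG: "F (G y) = y" for y using F by (auto simp: basis_iso_def)
  have inj: "inj_on F Basis" using F unfolding basis_iso_def by (metis inj_on_inverseI)
  have co: "F x \<bullet> F i = x \<bullet> i" "y \<bullet> F i = G y \<bullet> i" for x i y using inn FG by metis+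
  have vim: "F -` box l u = box (G l) (G u)"
  proof -
    have "F x \<in> box l u \<longleftrightarrow> (\<forall>i\<in>Basis. l \<bullet> F i < F x \<bullet> F i \<and> F x \<bullet> F i < u \<bullet> F i)" for x
      unfolding mem_box using FB by (metis (no_types, lifting) imageE imageI)
    then show ?thesis using F unfolding mem_box co by (auto simp: mem_box basis_iso_def)
  qed
  have "emeasure (distr lborel borel F) (box l u) = emeasure lborel (F -` box l u)"
    using F by (subst emeasure_distr) (auto simp: basis_iso_borel)
  also have "\<dots> = (\<Prod>b\<in>Basis. (G u - G l) \<bullet> b)"
    unfolding vim using lu FB by (subst emeasure_lborel_box) (auto simp: co(2)[symmetric])
  also have "(\<Prod>b\<in>Basis. (G u - G l) \<bullet> b) = (\<Prod>b\<in>Basis. (u - l) \<bullet> F b)"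
    by (simp add: inner_diff_left flip: co(2))
  also have "\<dots> = (\<Prod>b\<in>Basis. (u - l) \<bullet> b)"
    using prod.reindex[OF inj, of "\<lambda>b. (u - l) \<bullet> b"] FB by (simp add: o_def)
  finally show "emeasure (distr lborel borel F) (box l u) = (\<Prod>b\<in>Basis. (u - l) \<bullet> b)" .
qed simp

lemma basis_iso_dim: "basis_iso (F::'a::euclidean_space \<Rightarrow> 'b::euclidean_space) G \<Longrightarrow> DIM('a) = DIM('b)"
  unfolding basis_iso_def by (metis card_image inj_on_inverseI)

text \<open>On Borel sets this is \<open>basis_iso_distr\<close>. A Lebesgue set is an F-sigma set
  up to a null set, and the image of the null set under a differentiable map stays null.\<close>

lemma basis_iso_emeasure:
  fixes F :: "'a::euclidean_space \<Rightarrow> 'b::euclidean_space"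
  assumes F: "basis_iso F G" and S: "S \<in> sets lebesgue"
  shows "F ` S \<in> sets lebesgue" "emeasure lebesgue (F ` S) = emeasure lebesgue S"
proof -
  have G: "basis_iso G F" using F by (rule basis_iso_sym)
  have dif: "F differentiable_on T" for T
    using F unfolding basis_iso_def by (intro linear_imp_differentiable_on) auto
  have dim: "DIM('a) = DIM('b)" using F by (rule basis_iso_dim)
  show 1: "F ` S \<in> sets lebesgue"
    by (rule differentiable_image_in_sets_lebesgue[OF S]) (simp_all add: dim dif)
  have bor: "emeasure lborel (F ` A) = emeasure lborel A" if "A \<in> sets borel" for A
  proof -
    have "emeasure lborel A = emeasure (distr lborel borel G) A" using basis_iso_distr[OF G] by simp
    also have "\<dots> = emeasure lborel (G -` A)"
      using that G by (subst emeasure_distr) (auto simp: basis_iso_borel)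
    finally show ?thesis using basis_iso_image_vimage[OF F] by simp
  qed
  obtain C T where C: "fsigma C" "T \<in> null_sets lebesgue" "C \<union> T = S" "disjnt C T"
    using lebesgue_set_almost_fsigma[OF S] by blast
  have CB: "C \<in> sets borel" using C(1) by (auto elim!: fsigma.cases)
  have FCB: "F ` C \<in> sets borel"
    unfolding basis_iso_image_vimage[OF F] using measurable_sets[OF basis_iso_borel[OF G] CB] by simp
  have "negligible T" using C(2) negligible_iff_null_sets by blast
  then have "negligible (F ` T)"
    by (rule negligible_differentiable_image_negligible[rotated]) (simp_all add: dim dif)
  then have FT: "F ` T \<in> null_sets lebesgue" using negligible_iff_null_sets by blast
  have "emeasure lebesgue (F ` S) = emeasure lebesgue (F ` C \<union> F ` T)"
    using C(3) by (metis image_Un)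
  also have "\<dots> = emeasure lebesgue (F ` C)" using FT FCB by (intro emeasure_Un_null_set) auto
  also have "\<dots> = emeasure lborel C" using FCB bor[OF CB] by simp
  also have "\<dots> = emeasure lebesgue C" using CB by simp
  also have "\<dots> = emeasure lebesgue (C \<union> T)" using C(2) CB by (intro emeasure_Un_null_set[symmetric]) auto
  finally show "emeasure lebesgue (F ` S) = emeasure lebesgue S" using C(3) by simp
qed

definition cart_iso :: "'a::euclidean_space \<Rightarrow> real^('a basis_index)" where
  "cart_iso = (SOME F. \<exists>G. basis_iso F G)"

definition cart_inv :: "real^('a::euclidean_space basis_index) \<Rightarrow> 'a" where
  "cart_inv = inv cart_iso"

lemma cart_iso: "basis_iso (cart_iso :: 'a::euclidean_space \<Rightarrow> _) cart_inv"
proof -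
  have "\<exists>(F::'a \<Rightarrow> real^('a basis_index)) G. basis_iso F G"
    by (rule basis_iso_exists) (simp add: card_basis_index)
  then have "\<exists>G. basis_iso (cart_iso :: 'a \<Rightarrow> _) G"
    unfolding cart_iso_def by (rule someI_ex)
  then obtain G where G: "basis_iso (cart_iso :: 'a \<Rightarrow> _) G" by blast
  moreover have "G = cart_inv" unfolding cart_inv_def
    using G unfolding basis_iso_def by (metis ext inv_equality)
  ultimately show ?thesis by simp
qed

text \<open>The Jacobian factor of an endomorphism of an abstract Euclidean space, computed in one
  fixed system of Cartesian coordinates.\<close>

definition absdet :: "('a::euclidean_space \<Rightarrow> 'a) \<Rightarrow> real" where
  "absdet f = \<bar>det (matrix (cart_iso \<circ> f \<circ> cart_inv))\<bar>"

lemma cart_simps [simp]: "cart_inv (cart_iso x) = x" "cart_iso (cart_inv y) = y"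
  "linear cart_iso" "linear cart_inv"
  using cart_iso by (auto simp: basis_iso_def)

lemma cart_inner [simp]: "cart_iso x \<bullet> cart_iso y = x \<bullet> y" "cart_inv x' \<bullet> cart_inv y' = x' \<bullet> y'"
  using cart_iso basis_iso_sym[OF cart_iso] by (auto simp: basis_iso_def)

lemma absdet_nonneg [simp]: "absdet f \<ge> 0" by (simp add: absdet_def)

lemma linear_conj: "linear f \<Longrightarrow> linear (cart_iso \<circ> f \<circ> cart_inv)"
  by (metis cart_simps(3,4) linear_compose)

lemma absdet_compose:
  assumes "linear f" "linear g"
  shows "absdet (f \<circ> g) = absdet f * absdet g"
proof -
  have "cart_iso \<circ> (f \<circ> g) \<circ> cart_inv = (cart_iso \<circ> f \<circ> cart_inv) \<circ> (cart_iso \<circ> g \<circ> cart_inv)"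
    by (auto simp: fun_eq_iff)
  then show ?thesis
    using matrix_compose[OF linear_conj[OF assms(2)] linear_conj[OF assms(1)]]
    by (simp add: absdet_def det_mul abs_mult)
qed

lemma absdet_eigenbasis:
  fixes f :: "'a::euclidean_space \<Rightarrow> 'a"
  assumes f: "linear f" and B: "finite B" "card B = DIM('a)" "pairwise orthogonal B" "\<forall>b\<in>B. norm b = 1"
    and eig: "\<forall>b\<in>B. f b = l b *\<^sub>R b"
  shows "absdet f = \<bar>\<Prod>b\<in>B. l b\<bar>"
proof -
  have inj: "inj_on cart_iso B" by (metis cart_simps(1) inj_on_inverseI)
  have nrm: "norm (cart_iso x) = norm x" for x :: 'a by (simp add: norm_eq_sqrt_inner)
  have "det (matrix (cart_iso \<circ> f \<circ> cart_inv)) = (\<Prod>b\<in>cart_iso ` B. (l \<circ> cart_inv) b)"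
  proof (rule det_eigenbasis[OF linear_conj[OF f]])
    show "finite (cart_iso ` B)" using B(1) by simp
    show "card (cart_iso ` B) = CARD('a basis_index)" using B(2) inj by (simp add: card_image card_basis_index)
    show "pairwise orthogonal (cart_iso ` B)" using B(3) by (auto simp: pairwise_def orthogonal_def)
    show "\<forall>b\<in>cart_iso ` B. norm b = 1" using B(4) nrm by auto
    show "\<forall>b\<in>cart_iso ` B. (cart_iso \<circ> f \<circ> cart_inv) b = (l \<circ> cart_inv) b *\<^sub>R b"
      using eig by (auto simp: linear_cmul)
  qed
  then show ?thesis using inj by (simp add: absdet_def prod.reindex)
qed

text \<open>In coordinates the adjoint is the transpose, which has the same determinant. This trades
  a Jacobian for the symmetric operator \<open>adjoint f \<circ> f\<close>, whose eigenvalues can be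
  found.\<close>

lemma absdet_square:
  fixes f :: "'a::euclidean_space \<Rightarrow> 'a"
  assumes f: "linear f"
  shows "(absdet f)\<^sup>2 = absdet (adjoint f \<circ> f)"
proof -
  let ?F = "cart_iso \<circ> f \<circ> cart_inv"
  have adj: "linear (adjoint f)" using f by (rule adjoint_linear)
  have "adjoint ?F = cart_iso \<circ> adjoint f \<circ> cart_inv"
  proof (rule adjoint_unique)
    show "\<forall>x y. ?F x \<bullet> y = x \<bullet> (cart_iso \<circ> adjoint f \<circ> cart_inv) y"
      by (metis (no_types, lifting) adjoint_works cart_inner(1) cart_simps(2) comp_apply f)
  qed
  then have "matrix (cart_iso \<circ> adjoint f \<circ> cart_inv) = transpose (matrix ?F)"
    using matrix_adjoint[OF linear_conj[OF f]] by simp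
  then have "absdet (adjoint f) = absdet f" by (simp add: absdet_def)
  then show ?thesis using absdet_compose[OF adj f] by (simp add: power2_eq_square)
qed

text \<open>For operators of a Cartesian space both sides are the root of the product of the eigenvalues of
  \<open>f\<^sup>* f\<close>, which does not depend on the indexing of the coordinates.\<close>

lemma absdet_cart:
  fixes f :: "real^'n \<Rightarrow> real^'n"
  assumes f: "linear f"
  shows "absdet f = \<bar>det (matrix f)\<bar>"
proof -
  let ?h = "adjoint f \<circ> f"
  have h: "linear ?h" using f adjoint_linear linear_compose by blast
  have "\<exists>B l. B \<subseteq> UNIV \<and> pairwise orthogonal B \<and> (\<forall>b\<in>B. norm b = 1) \<and> span B = UNIV \<and>
      finite B \<and> card B = dim (UNIV::(real^'n) set) \<and> (\<forall>b\<in>B. ?h b = l b *\<^sub>R b)"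
    by (rule selfadjoint_eigenbasis[OF h]) (auto simp: adjoint_works[OF f] adjoint_clauses[OF f])
  then obtain B l where B: "pairwise orthogonal B" "\<forall>b\<in>B. norm b = 1" "finite B"
      "card B = CARD('n)" "\<forall>b\<in>B. ?h b = l b *\<^sub>R b" by auto
  have 1: "det (matrix ?h) = (\<Prod>b\<in>B. l b)" by (rule det_eigenbasis[OF h B(3,4,1,2,5)])
  have 2: "absdet ?h = \<bar>\<Prod>b\<in>B. l b\<bar>" by (rule absdet_eigenbasis[OF h B(3) _ B(1,2,5)]) (simp add: B)
  have "det (matrix ?h) = (det (matrix f))\<^sup>2"
    using matrix_compose[OF f adjoint_linear[OF f]] matrix_adjoint[OF f] by (simp add: det_mul power2_eq_square)
  then have "(absdet f)\<^sup>2 = \<bar>det (matrix f)\<bar>\<^sup>2" using 1 2 absdet_square[OF f] by simp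
  then show ?thesis by (metis abs_ge_zero absdet_nonneg power2_eq_iff_nonneg)
qed

lemma conj_has_derivative:
  assumes "(f has_derivative f') (at x)"
  shows "((cart_iso \<circ> f \<circ> cart_inv) has_derivative (cart_iso \<circ> f' \<circ> cart_inv)) (at (cart_iso x))"
proof -
  have 1: "(cart_inv has_derivative cart_inv) (at y within T)" for y :: "real^('a basis_index)" and T
    by (simp add: linear_imp_has_derivative)
  have 2: "(cart_iso has_derivative cart_iso) (at y within T)" for y :: "'a" and T
    by (simp add: linear_imp_has_derivative)
  have "(f has_derivative f') (at (cart_inv (cart_iso x)))" using assms by simp
  then have "((f \<circ> cart_inv) has_derivative (f' \<circ> cart_inv)) (at (cart_iso x))"
    using 1 diff_chain_at by blast
  then have "((cart_iso \<circ> (f \<circ> cart_inv)) has_derivative (cart_iso \<circ> (f' \<circ> cart_inv))) (at (cart_iso x))"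
    by (rule diff_chain_at) (simp add: linear_imp_has_derivative)
  then show ?thesis by (simp add: comp_assoc)
qed

section \<open>Area formula for images of Borel sets\<close>

text \<open>A nonintegrable Jacobian is matched by an image of infinite measure.\<close>

lemma emeasure_image_le_cart:
  fixes f :: "real^'n::{finite,wellorder} \<Rightarrow> real^'n::_"
  assumes S: "S \<in> sets borel"
    and der: "\<And>x. x \<in> S \<Longrightarrow> (f has_derivative f' x) (at x)"
    and meas: "(\<lambda>x. indicator S x * \<bar>det (matrix (f' x))\<bar>) \<in> borel_measurable borel"
  shows "f ` S \<in> sets lebesgue"
    "emeasure lebesgue (f ` S) \<le> (\<integral>\<^sup>+x. ennreal (indicator S x * \<bar>det (matrix (f' x))\<bar>) \<partial>lborel)"
    "inj_on f S \<Longrightarrow> emeasure lebesgue (f ` S) = (\<integral>\<^sup>+x. ennreal (indicator S x * \<bar>det (matrix (f' x))\<bar>) \<partial>lborel)"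
proof -
  let ?J = "\<lambda>x. \<bar>det (matrix (f' x))\<bar>"
  have Sl: "S \<in> sets lebesgue" using S by simp
  have derw: "(f has_derivative f' x) (at x within S)" if "x \<in> S" for x
    using der[OF that] has_derivative_at_withinI by blast
  have dif: "f differentiable_on S"
    using derw unfolding differentiable_on_def differentiable_def by blast
  show img: "f ` S \<in> sets lebesgue" by (rule differentiable_image_in_sets_lebesgue[OF Sl _ dif]) simp
  let ?I = "(\<integral>\<^sup>+x. ennreal (indicator S x * ?J x) \<partial>lborel)"
  \<comment> \<open>Translation between the nonnegative integral over the whole space and the gauge
    integral over \<open>S\<close>, available once the former is finite.\<close>
  have int: "integral S ?J = enn2real ?I \<and> ?J integrable_on S" if "?I < \<infinity>"
  proof -
    have "integrable lborel (\<lambda>x. indicator S x * ?J x)"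
      using meas that by (intro integrableI_nonneg) auto
    then have "((\<lambda>x. indicator S x * ?J x) has_integral integral\<^sup>L lborel (\<lambda>x. indicator S x * ?J x)) UNIV"
      by (rule has_integral_integral_lborel)
    moreover have "(\<lambda>x. indicator S x * ?J x) = (\<lambda>x. if x \<in> S then ?J x else 0)" by (auto simp: fun_eq_iff)
    ultimately have "(?J has_integral integral\<^sup>L lborel (\<lambda>x. indicator S x * ?J x)) S"
      by (simp add: has_integral_restrict_UNIV)
    moreover have "integral\<^sup>L lborel (\<lambda>x. indicator S x * ?J x) = enn2real ?I"
      using meas by (intro integral_eq_nn_integral) auto
    ultimately show ?thesis by (auto simp: has_integral_iff)
  qed
  show "emeasure lebesgue (f ` S) \<le> ?I"
  proof (cases "?I < \<infinity>")
    case True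
    note i = int[OF True]
    have "f ` S \<in> lmeasurable" "measure lebesgue (f ` S) \<le> enn2real ?I"
      using measurable_differentiable_image[OF Sl derw] measure_differentiable_image[OF Sl derw] i by auto
    then have "emeasure lebesgue (f ` S) \<le> ennreal (enn2real ?I)"
      by (simp add: emeasure_eq_measure2 ennreal_leI)
    then show ?thesis using True by (simp add: ennreal_enn2real)
  qed (simp add: less_top[symmetric])
  assume inj: "inj_on f S"
  show "emeasure lebesgue (f ` S) = ?I"
  proof (cases "?I < \<infinity>")
    case True
    note i = int[OF True]
    have "f ` S \<in> lmeasurable" "measure lebesgue (f ` S) = enn2real ?I"
      using measurable_differentiable_image_eq[OF Sl derw inj] measure_differentiable_image_eq[OF Sl derw inj] i by auto
    then have "emeasure lebesgue (f ` S) = ennreal (enn2real ?I)"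
      by (simp add: emeasure_eq_measure2)
    then show ?thesis using True by (simp add: ennreal_enn2real)
  next
    case False
    have "\<not> f ` S \<in> lmeasurable"
    proof
      assume "f ` S \<in> lmeasurable"
      then have "?J absolutely_integrable_on S"
        using measurable_differentiable_image_alt[OF Sl derw inj] by blast
      then have "integrable lebesgue (\<lambda>x. indicator S x *\<^sub>R ?J x)"
        by (simp add: set_integrable_def)
      then have "integrable lborel (\<lambda>x. indicator S x * ?J x)"
        using meas by (simp add: integrable_completion)
      then have "(\<integral>\<^sup>+x. ennreal (norm (indicator S x * ?J x)) \<partial>lborel) < \<infinity>"
        by (simp add: integrable_iff_bounded)
      then show False using False by simp
    qed
    then have "emeasure lebesgue (f ` S) = \<infinity>"
      using fmeasurableI[OF img] by (metis infinity_ennreal_def top.not_eq_extremum)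
    then show ?thesis using False by (metis infinity_ennreal_def top.not_eq_extremum)
  qed
qed

text \<open>Conjugation with \<open>cart_iso\<close> reduces this to Cartesian coordinates; it
  preserves the measures of the sets on both sides and turns \<open>absdet\<close> into a
  determinant.\<close>

lemma emeasure_image:
  fixes f :: "'a::euclidean_space \<Rightarrow> 'a"
  assumes S: "S \<in> sets borel"
    and der: "\<And>x. x \<in> S \<Longrightarrow> (f has_derivative f' x) (at x)"
    and meas: "(\<lambda>x. indicator S x * absdet (f' x)) \<in> borel_measurable borel"
  shows "f ` S \<in> sets lebesgue"
    "emeasure lebesgue (f ` S) \<le> (\<integral>\<^sup>+x. ennreal (indicator S x * absdet (f' x)) \<partial>lborel)"
    "inj_on f S \<Longrightarrow> emeasure lebesgue (f ` S) = (\<integral>\<^sup>+x. ennreal (indicator S x * absdet (f' x)) \<partial>lborel)"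
proof -
  let ?f = "cart_iso \<circ> f \<circ> cart_inv" and ?S = "cart_iso ` S"
  let ?f' = "\<lambda>y. cart_iso \<circ> f' (cart_inv y) \<circ> cart_inv"
  have ci: "basis_iso (cart_inv::_ \<Rightarrow> 'a) cart_iso" using basis_iso_sym[OF cart_iso] .
  have mi: "(cart_inv::_ \<Rightarrow> 'a) \<in> borel_measurable borel" using ci by (rule basis_iso_borel)
  have SB: "?S \<in> sets borel"
    unfolding basis_iso_image_vimage[OF cart_iso] using measurable_sets[OF mi S] by simp
  have der': "(?f has_derivative ?f' y) (at y)" if "y \<in> ?S" for y
    using that conj_has_derivative[OF der] by auto
  have indS: "indicator ?S y = (indicator S (cart_inv y) :: real)" for y
    unfolding basis_iso_image_vimage[OF cart_iso] by (simp add: indicator_def)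
  have J: "indicator ?S y * \<bar>det (matrix (?f' y))\<bar> = indicator S (cart_inv y) * absdet (f' (cart_inv y))" for y
    by (simp add: absdet_def indS)
  have meas': "(\<lambda>y. indicator ?S y * \<bar>det (matrix (?f' y))\<bar>) \<in> borel_measurable borel"
    unfolding J by (rule measurable_compose[OF mi meas])
  have int: "(\<integral>\<^sup>+y. ennreal (indicator ?S y * \<bar>det (matrix (?f' y))\<bar>) \<partial>lborel)
     = (\<integral>\<^sup>+x. ennreal (indicator S x * absdet (f' x)) \<partial>lborel)"
  proof -
    have "(\<integral>\<^sup>+x. ennreal (indicator S x * absdet (f' x)) \<partial>lborel)
       = (\<integral>\<^sup>+x. ennreal (indicator S x * absdet (f' x)) \<partial>distr lborel borel cart_inv)"
      using basis_iso_distr[OF ci] by simp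
    also have "\<dots> = (\<integral>\<^sup>+y. ennreal (indicator S (cart_inv y) * absdet (f' (cart_inv y))) \<partial>lborel)"
      using meas mi by (subst nn_integral_distr) auto
    finally show ?thesis unfolding J by simp
  qed
  have im: "?f ` ?S = cart_iso ` (f ` S)" by (auto simp: image_iff)
  have im2: "f ` S = cart_inv ` (?f ` ?S)" unfolding im by (auto simp: image_iff)
  note * = emeasure_image_le_cart[OF SB der' meas']
  show sl: "f ` S \<in> sets lebesgue" unfolding im2 using basis_iso_emeasure(1)[OF ci] *(1) by blast
  have em: "emeasure lebesgue (f ` S) = emeasure lebesgue (?f ` ?S)"
    unfolding im using basis_iso_emeasure(2)[OF cart_iso sl] by simp
  show "emeasure lebesgue (f ` S) \<le> (\<integral>\<^sup>+x. ennreal (indicator S x * absdet (f' x)) \<partial>lborel)"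
    using *(2) em int by simp
  show "emeasure lebesgue (f ` S) = (\<integral>\<^sup>+x. ennreal (indicator S x * absdet (f' x)) \<partial>lborel)" if "inj_on f S"
  proof -
    have "inj_on ?f ?S" using that by (auto simp: inj_on_def) (metis cart_simps(1))
    then show ?thesis using *(3) em int by simp
  qed
qed

text \<open>An open set is a countable union of compact sets. On each of these \<open>f\<close> is a
  homeomorphism onto a compact image, so the image of a Borel subset is a preimage under a
  continuous inverse.\<close>

lemma borel_injective_image:
  fixes f :: "'a::euclidean_space \<Rightarrow> 'b::euclidean_space"
  assumes V: "open V" and c: "continuous_on V f" and inj: "inj_on f V" and B: "B \<in> sets borel" "B \<subseteq> V"
  shows "f ` B \<in> sets borel"
proof -
  obtain C :: "nat \<Rightarrow> 'a set" where C: "\<And>n. compact (C n)" "V = (\<Union>n. C n)"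
    using open_Union_compact_subsets[OF V] by metis
  have "f ` (B \<inter> C n) \<in> sets borel" for n
  proof -
    have CV: "C n \<subseteq> V" using C(2) by auto
    obtain g where h: "homeomorphism (C n) (f ` C n) f g"
      using homeomorphism_compact[OF C(1) continuous_on_subset[OF c CV] refl inj_on_subset[OF inj CV]] by blast
    have cp: "compact (f ` C n)" by (intro compact_continuous_image continuous_on_subset[OF c CV] C)
    have "g \<in> borel_measurable (restrict_space borel (f ` C n))"
      using h by (intro borel_measurable_continuous_on_restrict) (auto simp: homeomorphism_def)
    then have "g -` B \<inter> space (restrict_space borel (f ` C n)) \<in> sets (restrict_space borel (f ` C n))"
      using B(1) by (rule measurable_sets)
    then have "g -` B \<inter> f ` C n \<in> sets borel"
      using cp by (auto simp: space_restrict_space sets_restrict_space_iff borel_compact)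
    moreover have "f ` (B \<inter> C n) = g -` B \<inter> f ` C n"
      using h by (force simp: homeomorphism_def)
    ultimately show ?thesis by simp
  qed
  then have "(\<Union>n. f ` (B \<inter> C n)) \<in> sets borel" by blast
  moreover have "f ` B = (\<Union>n. f ` (B \<inter> C n))" using B(2) C(2) by blast
  ultimately show ?thesis by simp
qed

lemma nn_integral_image:
  fixes T :: "'a::euclidean_space \<Rightarrow> 'a"
  assumes S: "S \<in> sets borel" and TS: "T ` S \<in> sets borel"
    and der: "\<And>x. x \<in> S \<Longrightarrow> (T has_derivative T' x) (at x)"
    and meas: "(\<lambda>x. indicator S x * absdet (T' x)) \<in> borel_measurable borel"
    and inj: "inj_on T S" and Tm: "(\<lambda>x. indicator S x *\<^sub>R T x) \<in> borel_measurable borel"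
    and h: "h \<in> borel_measurable borel"
  shows "(\<integral>\<^sup>+y. h y * indicator (T ` S) y \<partial>lborel)
       = (\<integral>\<^sup>+x. h (T x) * ennreal (indicator S x * absdet (T' x)) \<partial>lborel)"
proof -
  let ?J = "\<lambda>x. ennreal (indicator S x * absdet (T' x))"
  \<comment> \<open>Nothing is known about \<open>T\<close> off \<open>S\<close>. Extending it by 0
    gives a Borel map, and the density vanishes where the two differ.\<close>
  define T0 where "T0 x = indicator S x *\<^sub>R T x" for x
  have T0: "T0 \<in> borel_measurable borel" using Tm unfolding T0_def by simp
  have T0S: "T0 x = T x" if "x \<in> S" for x using that by (simp add: T0_def)
  have Jm: "?J \<in> borel_measurable lborel" using meas by simp
  let ?L = "density lborel (indicator (T ` S))" and ?R = "distr (density lborel ?J) borel T0"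
  have eq: "?L = ?R"
  proof (rule measure_eqI)
    fix A assume "A \<in> sets ?L"
    then have A: "A \<in> sets borel" by simp
    define S' where "S' = S \<inter> T0 -` A"
    have S': "S' \<in> sets borel" unfolding S'_def using S measurable_sets[OF T0 A] by auto
    have "emeasure ?L A = emeasure lborel (A \<inter> T ` S)"
    proof -
      have "emeasure ?L A = (\<integral>\<^sup>+x. indicator (T ` S) x * indicator A x \<partial>lborel)"
        using A TS by (subst emeasure_density) auto
      also have "\<dots> = (\<integral>\<^sup>+x. indicator (A \<inter> T ` S) x \<partial>lborel)"
        by (intro nn_integral_cong) (auto simp: indicator_def)
      finally show ?thesis using A TS by simp
    qed
    also have "A \<inter> T ` S = T ` S'" unfolding S'_def using T0S by auto
    also have "emeasure lborel (T ` S') = emeasure lebesgue (T ` S')"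
    proof -
      have "T ` S' \<in> sets borel" using A TS \<open>A \<inter> T ` S = T ` S'\<close> by (metis sets.Int)
      then show ?thesis by simp
    qed
    also have "\<dots> = (\<integral>\<^sup>+x. ennreal (indicator S' x * absdet (T' x)) \<partial>lborel)"
    proof (rule emeasure_image(3)[OF S'])
      show "(T has_derivative T' x) (at x)" if "x \<in> S'" for x using der that by (simp add: S'_def)
      have "(\<lambda>x. indicator S' x * absdet (T' x)) = (\<lambda>x. indicator S' x * (indicator S x * absdet (T' x)))"
        by (auto simp: fun_eq_iff indicator_def S'_def)
      then show "(\<lambda>x. indicator S' x * absdet (T' x)) \<in> borel_measurable borel"
        using S' meas by simp
      show "inj_on T S'" using inj unfolding S'_def by (rule inj_on_subset) auto
    qed
    also have "\<dots> = (\<integral>\<^sup>+x. ?J x * indicator (T0 -` A) x \<partial>lborel)"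
      by (intro nn_integral_cong) (auto simp: S'_def indicator_def)
    also have "\<dots> = emeasure (density lborel ?J) (T0 -` A)"
      using Jm measurable_sets[OF T0 A] by (subst emeasure_density) auto
    also have "\<dots> = emeasure ?R A"
      using A T0 by (subst emeasure_distr) auto
    finally show "emeasure ?L A = emeasure ?R A" .
  qed simp
  have "(\<integral>\<^sup>+y. h y * indicator (T ` S) y \<partial>lborel) = integral\<^sup>N ?L h"
    using TS h by (subst nn_integral_density) (auto simp: mult.commute)
  also have "\<dots> = (\<integral>\<^sup>+x. h (T0 x) \<partial>density lborel ?J)"
    unfolding eq using T0 h by (subst nn_integral_distr) auto
  also have "\<dots> = (\<integral>\<^sup>+x. ?J x * h (T0 x) \<partial>lborel)"
    using Jm measurable_compose[OF T0 h] by (subst nn_integral_density) auto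
  also have "\<dots> = (\<integral>\<^sup>+x. h (T x) * ?J x \<partial>lborel)"
    by (intro nn_integral_cong) (auto simp: T0_def indicator_def mult.commute)
  finally show ?thesis .
qed

section \<open>Calculus of class one and two: gradients, symmetric second derivatives, unit
  gradients\<close>

lemma Ck1D:
  assumes "Ck_on 1 f U" "x \<in> U"
  shows "(f has_derivative frechet_derivative f (at x)) (at x)"
  using assms frechet_derivative_works by (auto simp: One_nat_def)

lemma Ck1_continuous:
  assumes "Ck_on 1 f U"
  shows "continuous_on U (\<lambda>x. frechet_derivative f (at x) v)"
  using assms by (auto simp: One_nat_def)

lemma Ck1I:
  assumes U: "open U" and der: "\<And>x. x \<in> U \<Longrightarrow> (f has_derivative f' x) (at x)"
    and cont: "\<And>v. continuous_on U (\<lambda>x. f' x v)"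
  shows "Ck_on 1 f U"
proof -
  have "f' x = frechet_derivative f (at x)" if "x \<in> U" for x
    using der[OF that] by (rule frechet_derivative_at)
  then have "continuous_on U (\<lambda>x. frechet_derivative f (at x) v)" for v
    by (intro continuous_on_eq[OF cont[of v]]) simp
  then show ?thesis using der unfolding One_nat_def by (auto simp: differentiable_def)
qed

lemma Ck1_subset: "Ck_on 1 f U \<Longrightarrow> V \<subseteq> U \<Longrightarrow> Ck_on 1 f V"
  unfolding One_nat_def by (auto intro: continuous_on_subset)

lemma Ck1_imp_continuous_on: "Ck_on 1 f U \<Longrightarrow> continuous_on U f"
  by (meson Ck1D continuous_at_imp_continuous_on has_derivative_continuous)

lemma linear_basis_expansion:
  fixes f :: "'a::euclidean_space \<Rightarrow> 'b::real_vector"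
  assumes "linear f" shows "f w = (\<Sum>b\<in>Basis. (w \<bullet> b) *\<^sub>R f b)"
proof -
  have "f w = f (\<Sum>b\<in>Basis. (w \<bullet> b) *\<^sub>R b)" by (simp add: euclidean_representation)
  then show ?thesis using assms by (simp add: linear_sum linear_cmul)
qed

lemma Ck1_linear: "Ck_on 1 f U \<Longrightarrow> x \<in> U \<Longrightarrow> linear (frechet_derivative f (at x))"
  by (metis Ck1D has_derivative_linear)

lemma Ck1_continuous_on_apply:
  assumes f: "Ck_on 1 f U" and p: "continuous_on S p" "p ` S \<subseteq> U" and w: "continuous_on S w"
  shows "continuous_on S (\<lambda>x. frechet_derivative f (at (p x)) (w x))"
proof -
  have "continuous_on S (\<lambda>x. frechet_derivative f (at (p x)) b)" for b
    using continuous_on_compose2[OF Ck1_continuous[OF f] p] .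
  then have "continuous_on S (\<lambda>x. \<Sum>b\<in>Basis. (w x \<bullet> b) *\<^sub>R frechet_derivative f (at (p x)) b)"
    by (intro continuous_intros w)
  moreover have "(\<Sum>b\<in>Basis. (w x \<bullet> b) *\<^sub>R frechet_derivative f (at (p x)) b) = frechet_derivative f (at (p x)) (w x)"
    if "x \<in> S" for x
    using p(2) that by (intro linear_basis_expansion[symmetric] Ck1_linear[OF f]) auto
  ultimately show ?thesis by (metis (no_types, lifting) continuous_on_cong)
qed

lemma gradient_works:
  assumes "g differentiable (at x)"
  shows "frechet_derivative g (at x) v = gradient g x \<bullet> v"
    "gradient g x = (\<Sum>b\<in>Basis. frechet_derivative g (at x) b *\<^sub>R b)"
    "(g has_derivative (\<lambda>v. gradient g x \<bullet> v)) (at x)"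
proof -
  let ?g' = "frechet_derivative g (at x)" and ?D = "\<Sum>b\<in>Basis. frechet_derivative g (at x) b *\<^sub>R b"
  have d: "(g has_derivative ?g') (at x)" using assms frechet_derivative_works by blast
  have lin: "linear ?g'" using d has_derivative_linear by blast
  have eq: "?g' = (\<lambda>h. h \<bullet> ?D)"
    by (rule ext) (subst linear_basis_expansion[OF lin], simp add: inner_sum_right mult.commute)
  have "GDERIV g x :> ?D" unfolding gderiv_def using d eq by metis
  moreover have "D = ?D" if "GDERIV g x :> D" for D
  proof (rule euclidean_eqI)
    fix b :: 'a
    have "(\<lambda>h. h \<bullet> D) = ?g'" using that has_derivative_unique[OF _ d] unfolding gderiv_def by blast
    then show "D \<bullet> b = ?D \<bullet> b" using eq by (metis inner_commute)
  qed
  ultimately show 2: "gradient g x = ?D" unfolding gradient_def by (rule the_equality)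
  show 1: "?g' v = gradient g x \<bullet> v" for v using eq 2 by (metis inner_commute)
  show "(g has_derivative (\<lambda>v. gradient g x \<bullet> v)) (at x)" using d 1 by (metis ext)
qed

text \<open>The mean value theorem is applied to the increment of \<open>g\<close> in direction
  \<open>w\<close>, as a function of the position along \<open>v\<close>. Its derivative is a
  difference of two gradients, which \<open>A\<close> evaluates up to the error
  \<open>e\<close>.\<close>

lemma second_difference_estimate:
  fixes g :: "'a::euclidean_space \<Rightarrow> real"
  assumes g: "\<And>y. y \<in> ball x d \<Longrightarrow> (g has_derivative (\<lambda>v. G y \<bullet> v)) (at y)"
    and A: "linear A" and est: "\<And>y. y \<in> ball x d \<Longrightarrow> norm (G y - G x - A (y - x)) \<le> e * norm (y - x)"
    and t: "t > 0" "t * (norm v + norm w) < d" and e: "e \<ge> 0"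
  shows "\<bar>g (x + t *\<^sub>R v + t *\<^sub>R w) - g (x + t *\<^sub>R v) - g (x + t *\<^sub>R w) + g x - t\<^sup>2 * (A w \<bullet> v)\<bar>
     \<le> 2 * e * t\<^sup>2 * (norm v + norm w) * norm v"
proof -
  define q where "q s = g (x + s *\<^sub>R v + t *\<^sub>R w) - g (x + s *\<^sub>R v)" for s
  have b: "x + s *\<^sub>R v + r *\<^sub>R w \<in> ball x d \<and> norm (s *\<^sub>R v + r *\<^sub>R w) \<le> t * (norm v + norm w)"
    if "0 \<le> s" "s \<le> t" "0 \<le> r" "r \<le> t" for s r
  proof -
    have "norm (s *\<^sub>R v + r *\<^sub>R w) \<le> s * norm v + r * norm w"
      by (rule order_trans[OF norm_triangle_ineq]) (use that in simp)
    also have "\<dots> \<le> t * norm v + t * norm w" by (intro add_mono mult_right_mono) (use that in auto)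
    finally have *: "norm (s *\<^sub>R v + r *\<^sub>R w) \<le> t * (norm v + norm w)" by (simp add: algebra_simps)
    then have "dist x (x + s *\<^sub>R v + r *\<^sub>R w) < d" using t
      by (metis add.assoc add_diff_cancel_left' dist_commute dist_norm le_less_trans)
    then show ?thesis using * by simp
  qed
  have b0: "x + s *\<^sub>R v \<in> ball x d \<and> norm (s *\<^sub>R v) \<le> t * (norm v + norm w)" if "0 \<le> s" "s \<le> t" for s
    using b[OF that, of 0] t by simp
  have der: "(q has_derivative (\<lambda>h. h * ((G (x + s *\<^sub>R v + t *\<^sub>R w) - G (x + s *\<^sub>R v)) \<bullet> v))) (at s within {0..t})"
    if "0 \<le> s" "s \<le> t" for s
  proof -
    have 1: "((\<lambda>s. g (x + s *\<^sub>R v + t *\<^sub>R w)) has_derivative (\<lambda>h. G (x + s *\<^sub>R v + t *\<^sub>R w) \<bullet> (h *\<^sub>R v))) (at s within {0..t})"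
      by (rule has_derivative_compose[where g = g and f = "\<lambda>s. x + s *\<^sub>R v + t *\<^sub>R w"])
        (use b[OF that, of t] t that in \<open>auto intro!: derivative_eq_intros g\<close>)
    have 2: "((\<lambda>s. g (x + s *\<^sub>R v)) has_derivative (\<lambda>h. G (x + s *\<^sub>R v) \<bullet> (h *\<^sub>R v))) (at s within {0..t})"
      by (rule has_derivative_compose[where g = g and f = "\<lambda>s. x + s *\<^sub>R v"])
        (use b0[OF that] in \<open>auto intro!: derivative_eq_intros g\<close>)
    show ?thesis unfolding q_def
      by (rule has_derivative_eq_rhs[OF has_derivative_diff[OF 1 2]]) (auto simp: inner_diff_left algebra_simps)
  qed
  obtain s where s: "0 < s" "s < t" and "q t - q 0 = (t - 0) * ((G (x + s *\<^sub>R v + t *\<^sub>R w) - G (x + s *\<^sub>R v)) \<bullet> v)"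
    using mvt_simple[OF t(1) der] by auto
  then have eq: "q t - q 0 = t * ((G (x + s *\<^sub>R v + t *\<^sub>R w) - G (x + s *\<^sub>R v)) \<bullet> v)" by simp
  define e1 where "e1 = G (x + s *\<^sub>R v + t *\<^sub>R w) - G x - A (s *\<^sub>R v + t *\<^sub>R w)"
  define e2 where "e2 = G (x + s *\<^sub>R v) - G x - A (s *\<^sub>R v)"
  let ?N = "e * (t * (norm v + norm w))"
  have "norm e1 \<le> e * norm (s *\<^sub>R v + t *\<^sub>R w)"
    using est[of "x + s *\<^sub>R v + t *\<^sub>R w"] b[of s t] s t unfolding e1_def by (simp add: add.assoc)
  also have "\<dots> \<le> ?N" using b[of s t] s t e by (intro mult_left_mono) auto
  finally have n1: "norm e1 \<le> ?N" .
  have "norm e2 \<le> e * norm (s *\<^sub>R v)"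
    using est[of "x + s *\<^sub>R v"] b0[of s] s unfolding e2_def by simp
  also have "\<dots> \<le> ?N" using b0[of s] s e by (intro mult_left_mono) auto
  finally have n2: "norm e2 \<le> ?N" .
  have "G (x + s *\<^sub>R v + t *\<^sub>R w) - G (x + s *\<^sub>R v) = t *\<^sub>R A w + (e1 - e2)"
    unfolding e1_def e2_def using A by (simp add: linear_add linear_cmul)
  then have "q t - q 0 = t * ((t *\<^sub>R A w + (e1 - e2)) \<bullet> v)"
    using eq by simp
  then have "q t - q 0 - t\<^sup>2 * (A w \<bullet> v) = t * ((e1 - e2) \<bullet> v)"
    by (simp add: inner_add_left power2_eq_square distrib_left)
  then have "\<bar>q t - q 0 - t\<^sup>2 * (A w \<bullet> v)\<bar> = t * \<bar>(e1 - e2) \<bullet> v\<bar>" using t by (simp add: abs_mult)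
  also have "\<bar>(e1 - e2) \<bullet> v\<bar> \<le> norm (e1 - e2) * norm v" by (rule Cauchy_Schwarz_ineq2)
  also have "norm (e1 - e2) \<le> ?N + ?N" using n1 n2 norm_triangle_ineq4[of e1 e2] by linarith
  finally have "\<bar>q t - q 0 - t\<^sup>2 * (A w \<bullet> v)\<bar> \<le> t * ((?N + ?N) * norm v)"
    using t by (simp add: mult_left_mono mult_right_mono)
  then show ?thesis unfolding q_def by (simp add: power2_eq_square algebra_simps)
qed

text \<open>Differentiability of the gradient at the single point \<open>x\<close> suffices: the
  second difference is symmetric in \<open>v\<close> and \<open>w\<close>, and
  \<open>second_difference_estimate\<close> compares it with both
  \<open>t\<^sup>2 * (A w \<bullet> v)\<close> and
  \<open>t\<^sup>2 * (A v \<bullet> w)\<close>.\<close>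

lemma gradient_derivative_symmetric:
  fixes g :: "'a::euclidean_space \<Rightarrow> real"
  assumes U: "open U" "x \<in> U" and g: "\<And>y. y \<in> U \<Longrightarrow> (g has_derivative (\<lambda>v. G y \<bullet> v)) (at y)"
    and G: "(G has_derivative A) (at x)"
  shows "A v \<bullet> w = v \<bullet> A w"
proof (rule ccontr)
  assume ne: "A v \<bullet> w \<noteq> v \<bullet> A w"
  define c where "c = \<bar>A v \<bullet> w - A w \<bullet> v\<bar>"
  have c: "c > 0" using ne by (simp add: c_def inner_commute)
  \<comment> \<open>The two error terms add up to \<open>t\<^sup>2 * (m * (M - 1))\<close>, so that
    the choice of \<open>m\<close> keeps them below half of \<open>t\<^sup>2 * c\<close>.\<close>
  define M where "M = 2 * (norm v + norm w) * norm v + 2 * (norm v + norm w) * norm w + 1"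
  have M: "M > 0" unfolding M_def by (intro add_nonneg_pos add_nonneg_nonneg) auto
  define m where "m = c / (2 * M)"
  have m: "m > 0" using c M by (simp add: m_def)
  have lin: "linear A" using G has_derivative_linear by blast
  obtain d1 where d1: "d1 > 0" "ball x d1 \<subseteq> U" using U open_contains_ball by blast
  obtain d2 where d2: "d2 > 0" "\<And>y. norm (y - x) < d2 \<Longrightarrow> norm (G y - G x - A (y - x)) \<le> m * norm (y - x)"
    using G m unfolding has_derivative_at_alt by blast
  define d where "d = min d1 d2"
  have d: "d > 0" using d1 d2 by (simp add: d_def)
  define t where "t = d / (2 * (norm v + norm w + 1))"
  have np: "norm v + norm w + 1 > 0" by (intro add_nonneg_pos add_nonneg_nonneg) auto
  have t: "t > 0" using d np by (simp add: t_def)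
  have "t * (norm v + norm w) < t * (2 * (norm v + norm w + 1))" using t np by (intro mult_strict_left_mono) auto
  also have "\<dots> = d" using np unfolding t_def by (simp add: field_simps)
  finally have tb: "t * (norm v + norm w) < d" .
  have gb: "(g has_derivative (\<lambda>v. G y \<bullet> v)) (at y)" if "y \<in> ball x d" for y
    using that d1 by (intro g) (auto simp: d_def)
  have eb: "norm (G y - G x - A (y - x)) \<le> m * norm (y - x)" if "y \<in> ball x d" for y
    using that d2(2)[of y] by (simp add: d_def dist_norm norm_minus_commute)
  let ?D = "g (x + t *\<^sub>R v + t *\<^sub>R w) - g (x + t *\<^sub>R v) - g (x + t *\<^sub>R w) + g x"
  have 1: "\<bar>?D - t\<^sup>2 * (A w \<bullet> v)\<bar> \<le> 2 * m * t\<^sup>2 * (norm v + norm w) * norm v"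
    using second_difference_estimate[OF gb lin eb t tb] m by simp
  have 2: "\<bar>?D - t\<^sup>2 * (A v \<bullet> w)\<bar> \<le> 2 * m * t\<^sup>2 * (norm w + norm v) * norm w"
  proof -
    have tb': "t * (norm w + norm v) < d" using tb by (simp add: add.commute)
    have e: "x + t *\<^sub>R w + t *\<^sub>R v = x + t *\<^sub>R v + t *\<^sub>R w" by simp
    have "\<bar>g (x + t *\<^sub>R v + t *\<^sub>R w) - g (x + t *\<^sub>R w) - g (x + t *\<^sub>R v) + g x - t\<^sup>2 * (A v \<bullet> w)\<bar>
      \<le> 2 * m * t\<^sup>2 * (norm w + norm v) * norm w"
      using second_difference_estimate[OF gb lin eb t(1) tb'] m unfolding e by simp
    moreover have "g (x + t *\<^sub>R v + t *\<^sub>R w) - g (x + t *\<^sub>R w) - g (x + t *\<^sub>R v) + g x = ?D" by simp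
    ultimately show ?thesis by simp
  qed
  have "t\<^sup>2 * c = \<bar>t\<^sup>2 * (A v \<bullet> w) - t\<^sup>2 * (A w \<bullet> v)\<bar>"
    unfolding c_def by (metis abs_mult abs_power2 right_diff_distrib)
  also have "\<dots> \<le> 2 * m * t\<^sup>2 * (norm v + norm w) * norm v + 2 * m * t\<^sup>2 * (norm w + norm v) * norm w"
    using 1 2 by linarith
  also have "\<dots> = t\<^sup>2 * (m * (M - 1))" unfolding M_def by (simp add: algebra_simps)
  also have "\<dots> < t\<^sup>2 * (m * M)" using t m by simp
  also have "\<dots> = t\<^sup>2 * (c / 2)" using M by (simp add: m_def)
  finally show False using t c by simp
qed

text \<open>The unit normal extended off the hypersurface along the level sets of a defining equation.\<close>

definition unit_gradient :: "('a::euclidean_space \<Rightarrow> real) \<Rightarrow> 'a \<Rightarrow> 'a" where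
  "unit_gradient g x = sgn (gradient g x)"

text \<open>On tangent vectors of a level set this is the Weingarten map. Its value on the normal
  depends on the chosen equation, which is why \<open>focal_map\<close> projects the normal
  component away.\<close>

definition shape :: "('a::euclidean_space \<Rightarrow> real) \<Rightarrow> 'a \<Rightarrow> 'a \<Rightarrow> 'a" where
  "shape g x = frechet_derivative (unit_gradient g) (at x)"

lemma C2_equationD:
  assumes "C2_equation \<Sigma> U g"
  shows "open U" "x \<in> U \<Longrightarrow> gradient g x \<noteq> 0" "y \<in> \<Sigma> \<Longrightarrow> y \<in> U \<Longrightarrow> g y = 0"
    "x \<in> U \<Longrightarrow> (g has_derivative (\<lambda>v. gradient g x \<bullet> v)) (at x)"
    "Ck_on 1 (gradient g) U" "continuous_on U (gradient g)" "continuous_on U g"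
proof -
  have C2: "Ck_on (Suc 1) g U" using assms unfolding C2_equation_def by (simp add: numeral_2_eq_2 One_nat_def)
  show U: "open U" and "x \<in> U \<Longrightarrow> gradient g x \<noteq> 0" "y \<in> \<Sigma> \<Longrightarrow> y \<in> U \<Longrightarrow> g y = 0"
    using assms unfolding C2_equation_def by auto
  have d: "g differentiable (at x)" if "x \<in> U" for x using C2 that by simp
  have c: "Ck_on 1 (\<lambda>x. frechet_derivative g (at x) v) U" for v using C2 by simp
  show D: "(g has_derivative (\<lambda>v. gradient g x \<bullet> v)) (at x)" if "x \<in> U" for x
    using gradient_works(3)[OF d[OF that]] .
  show "continuous_on U g"
    by (meson D continuous_at_imp_continuous_on has_derivative_continuous)
  show C: "Ck_on 1 (gradient g) U"
  proof (rule Ck1I[OF U])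
    fix x assume x: "x \<in> U"
    have "((\<lambda>x. \<Sum>b\<in>Basis. frechet_derivative g (at x) b *\<^sub>R b) has_derivative
       (\<lambda>v. \<Sum>b\<in>Basis. frechet_derivative (\<lambda>x. frechet_derivative g (at x) b) (at x) v *\<^sub>R b)) (at x)"
      by (intro has_derivative_sum has_derivative_scaleR_left Ck1D[OF c x])
    then show "(gradient g has_derivative
       (\<lambda>v. \<Sum>b\<in>Basis. frechet_derivative (\<lambda>x. frechet_derivative g (at x) b) (at x) v *\<^sub>R b)) (at x)"
      by (rule has_derivative_transform_within_open[OF _ U x]) (simp add: gradient_works(2)[OF d])
  next
    fix v
    show "continuous_on U (\<lambda>x. \<Sum>b\<in>Basis. frechet_derivative (\<lambda>x. frechet_derivative g (at x) b) (at x) v *\<^sub>R b)"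
      by (intro continuous_intros Ck1_continuous[OF c])
  qed
  show "continuous_on U (gradient g)" using C by (rule Ck1_imp_continuous_on)
qed

text \<open>The quotient rule exhibits the derivative as the derivative of the gradient with its
  normal component removed, divided by the length of the gradient. Its values are thus tangent, and
  it inherits symmetry on tangent vectors from the second derivative of \<open>g\<close>.\<close>

lemma unit_gradient_C1:
  assumes E: "C2_equation \<Sigma> U g"
  shows "Ck_on 1 (unit_gradient g) U"
    "x \<in> U \<Longrightarrow> norm (unit_gradient g x) = 1"
    "x \<in> U \<Longrightarrow> unit_gradient g x \<bullet> shape g x v = 0"
    "x \<in> U \<Longrightarrow> v \<bullet> unit_gradient g x = 0 \<Longrightarrow> w \<bullet> unit_gradient g x = 0 \<Longrightarrow>
       shape g x v \<bullet> w = v \<bullet> shape g x w"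
    "x \<in> U \<Longrightarrow> (unit_gradient g has_derivative shape g x) (at x)"
    "continuous_on U (unit_gradient g)"
    "gradient g x = norm (gradient g x) *\<^sub>R unit_gradient g x"
proof -
  note E' = C2_equationD[OF E]
  let ?G = "gradient g" and ?A = "\<lambda>x. frechet_derivative (gradient g) (at x)" and ?h = "unit_gradient g"
  let ?n' = "\<lambda>x v. ?A x v \<bullet> sgn (?G x)"
  let ?S = "\<lambda>x v. inverse (norm (?G x)) *\<^sub>R (?A x v - ?n' x v *\<^sub>R ?h x)"
  show nz: "norm (?h x) = 1" if "x \<in> U" for x using E'(2)[OF that] by (simp add: unit_gradient_def norm_sgn)
  show nG: "?G x = norm (?G x) *\<^sub>R ?h x" for x
    by (cases "?G x = 0") (simp_all add: unit_gradient_def sgn_div_norm)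
  have A: "(?G has_derivative ?A x) (at x)" if "x \<in> U" for x using Ck1D[OF E'(5) that] .
  have n': "((\<lambda>x. norm (?G x)) has_derivative ?n' x) (at x)" if "x \<in> U" for x
    using has_derivative_compose[OF A[OF that] has_derivative_norm[OF E'(2)[OF that]]] by simp
  have S: "(?h has_derivative ?S x) (at x)" if x: "x \<in> U" for x
  proof -
    have 0: "norm (?G x) \<noteq> 0" using E'(2)[OF x] by simp
    have "((\<lambda>x. inverse (norm (?G x)) *\<^sub>R ?G x) has_derivative
      (\<lambda>v. inverse (norm (?G x)) *\<^sub>R ?A x v + (- (inverse (norm (?G x)) * ?n' x v * inverse (norm (?G x)))) *\<^sub>R ?G x)) (at x)"
      by (rule has_derivative_scaleR[OF Deriv.has_derivative_inverse[OF 0 n'[OF x]] A[OF x]])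
    then have "(?h has_derivative
      (\<lambda>v. inverse (norm (?G x)) *\<^sub>R ?A x v + (- (inverse (norm (?G x)) * ?n' x v * inverse (norm (?G x)))) *\<^sub>R ?G x)) (at x)"
      by (rule has_derivative_transform_within_open[OF _ E'(1) x]) (simp add: unit_gradient_def sgn_div_norm)
    then show ?thesis
    proof (rule has_derivative_eq_rhs, intro ext)
      fix v
      have "?h x = inverse (norm (?G x)) *\<^sub>R ?G x" by (simp add: unit_gradient_def sgn_div_norm)
      moreover have "i *\<^sub>R a + (- (i * m * i)) *\<^sub>R b = i *\<^sub>R (a - m *\<^sub>R (i *\<^sub>R b))" for i m :: real and a b :: 'a
        by (simp add: scaleR_diff_right mult.assoc)
      ultimately show "inverse (norm (?G x)) *\<^sub>R ?A x v + (- (inverse (norm (?G x)) * ?n' x v * inverse (norm (?G x)))) *\<^sub>R ?G x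
         = ?S x v" by (simp only:)
    qed
  qed
  have cG: "continuous_on U ?G" by fact
  have ch: "continuous_on U ?h" unfolding unit_gradient_def sgn_div_norm
    by (intro continuous_intros cG) (use E'(2) in auto)
  then show "continuous_on U ?h" .
  show C1: "Ck_on 1 ?h U"
  proof (rule Ck1I[OF E'(1)])
    fix v
    have cs: "continuous_on U (\<lambda>x. sgn (?G x))" using ch unfolding unit_gradient_def .
    show "continuous_on U (\<lambda>x. ?S x v)"
      by (intro continuous_intros Ck1_continuous[OF E'(5)] cG ch cs) (use E'(2) in auto)
  qed (rule S)
  show SS: "(?h has_derivative shape g x) (at x)" if "x \<in> U" for x
    unfolding shape_def using Ck1D[OF C1 that] .
  have sh: "shape g x = ?S x" if "x \<in> U" for x
    using has_derivative_unique[OF SS[OF that] S[OF that]] .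
  show "?h x \<bullet> shape g x v = 0" if "x \<in> U"
    using nz[OF that] unfolding sh[OF that]
    by (simp add: inner_diff_right dot_square_norm unit_gradient_def[symmetric] inner_commute)
  show "shape g x v \<bullet> w = v \<bullet> shape g x w"
    if "x \<in> U" "v \<bullet> ?h x = 0" "w \<bullet> ?h x = 0"
    using gradient_derivative_symmetric[OF E'(1) that(1) E'(4) A[OF that(1)], where v = v and w = w] that(2,3)
    unfolding sh[OF that(1)] by (simp add: inner_diff_left inner_diff_right inner_commute[of _ w])
qed

section \<open>Level sets as graphs over a coordinate hyperplane\<close>

text \<open>\<open>\<lambda>x. fst (\<kappa> x)\<close> is the projection to the coordinate
  hyperplane and inverts \<phi> on the zero set in \<open>W\<close>. The last clause makes the
  derivative of \<phi> computable: a vector orthogonal to the gradient is recovered from its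
  projection.\<close>

definition graph_chart ::
  "('a::euclidean_space \<Rightarrow> real) \<Rightarrow> 'a set \<Rightarrow> ((real^'n) \<times> real \<Rightarrow> 'a) \<Rightarrow> ('a \<Rightarrow> (real^'n) \<times> real) \<Rightarrow>
    (real^'n) set \<Rightarrow> (real^'n \<Rightarrow> 'a) \<Rightarrow> 'a set \<Rightarrow> bool" where
  "graph_chart g U \<iota> \<kappa> V \<phi> W \<longleftrightarrow>
     basis_iso \<iota> \<kappa> \<and> open V \<and> open W \<and> W \<subseteq> U \<and> Ck_on 1 \<phi> V \<and> (\<forall>p\<in>V. fst (\<kappa> (\<phi> p)) = p) \<and>
     \<phi> ` V = {x\<in>W. g x = 0} \<and>
     (\<forall>p\<in>V. \<forall>w. w \<bullet> gradient g (\<phi> p) = 0 \<longrightarrow> frechet_derivative \<phi> (at p) (fst (\<kappa> w)) = w)"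

text \<open>The linear map exchanges the \<open>b\<close>-coordinate of its argument for the product
  with \<open>G\<close>. It is the derivative of the map that straightens a level set with gradient
  \<open>G\<close>, and exchanging back requires division by \<open>G \<bullet> b\<close>.\<close>

lemma coordinate_replacement:
  fixes G b :: "'a::euclidean_space"
  assumes b: "b \<bullet> b = 1" and inj: "inj (\<lambda>v. v + (G \<bullet> v - v \<bullet> b) *\<^sub>R b)"
  shows "G \<bullet> b \<noteq> 0"
    "inv (\<lambda>v. v + (G \<bullet> v - v \<bullet> b) *\<^sub>R b) u = u + ((u \<bullet> b - G \<bullet> u) / (G \<bullet> b)) *\<^sub>R b"
proof -
  let ?F = "\<lambda>v. v + (G \<bullet> v - v \<bullet> b) *\<^sub>R b"
  show nz: "G \<bullet> b \<noteq> 0"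
  proof
    assume "G \<bullet> b = 0"
    then have "?F b = ?F 0" using b by simp
    then have "b = 0" using inj by (rule injD[rotated])
    then show False using b by simp
  qed
  have "?F (u + ((u \<bullet> b - G \<bullet> u) / (G \<bullet> b)) *\<^sub>R b) = u"
  proof -
    define c where "c = (u \<bullet> b - G \<bullet> u) / (G \<bullet> b)"
    have c: "c * (G \<bullet> b) = u \<bullet> b - G \<bullet> u" using nz by (simp add: c_def)
    have "G \<bullet> (u + c *\<^sub>R b) - (u + c *\<^sub>R b) \<bullet> b = - c"
      using c b by (simp add: inner_add_left inner_add_right)
    then show ?thesis unfolding c_def[symmetric] by simp
  qed
  then show "inv ?F u = u + ((u \<bullet> b - G \<bullet> u) / (G \<bullet> b)) *\<^sub>R b"
    using inj by (metis (no_types, lifting) inv_f_f)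
qed

text \<open>Implicit function theorem: choose a basis vector \<open>b\<close> with nonzero partial
  derivative, replace the \<open>b\<close>-coordinate by \<open>g\<close>, and invert this map
  locally. The zero set becomes a piece of the hyperplane orthogonal to \<open>b\<close>.\<close>

lemma graph_chart_exists:
  fixes g :: "'a::euclidean_space \<Rightarrow> real"
  assumes dim: "DIM('a) = CARD('n::finite) + 1" and E: "C2_equation \<Sigma> U g" and x0: "x0 \<in> U" "g x0 = 0"
  shows "\<exists>(i::(real^'n) \<times> real \<Rightarrow> 'a) k V f W. graph_chart g U i k V f W \<and> x0 \<in> W"
proof -
  note E' = C2_equationD[OF E]
  let ?G = "gradient g"
  obtain b where b: "b \<in> Basis" "?G x0 \<bullet> b \<noteq> 0"
    using E'(2)[OF x0(1)] by (metis euclidean_all_zero_iff)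
  have bb: "b \<bullet> b = 1" using b by (simp add: inner_Basis)
  have "\<exists>(i::(real^'n) \<times> real \<Rightarrow> 'a) k. basis_iso i k \<and> i (0, 1) = b"
  proof (rule basis_iso_exists_pointed[OF _ _ b(1)])
    show "DIM((real^'n) \<times> real) = DIM('a)" using dim by simp
    show "(0, 1) \<in> (Basis :: ((real^'n) \<times> real) set)" by (simp add: Basis_prod_def)
  qed
  then obtain i :: "(real^'n) \<times> real \<Rightarrow> 'a" and k where i: "basis_iso i k" "i (0, 1) = b" by blast
  have lin: "linear i" "linear k" and inv: "\<And>z. k (i z) = z" "\<And>x. i (k x) = x"
    using i(1) unfolding basis_iso_def by blast+
  have kb: "k b = (0, 1)" using inv(1)[of "(0, 1)"] i(2) by simp
  have sndk: "snd (k x) = x \<bullet> b" for x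
  proof -
    have "x \<bullet> b = k x \<bullet> k b" using basis_iso_sym[OF i(1)] by (simp add: basis_iso_def)
    then show ?thesis by (simp add: kb inner_prod_def)
  qed
  have split: "i (p, s) = i (p, 0) + s *\<^sub>R b" for p s
  proof -
    have "i ((p, 0) + s *\<^sub>R (0, 1)) = i (p, 0) + s *\<^sub>R b"
      by (simp only: linear_add[OF lin(1)] linear_cmul[OF lin(1)] i(2))
    then show ?thesis by simp
  qed
  have pr: "i (fst (k w), 0) = w - (w \<bullet> b) *\<^sub>R b" for w
    using split[of "fst (k w)" "snd (k w)"] inv(2)[of w] sndk[of w] by (metis add_diff_cancel_right' prod.collapse)
  have ip: "i (p, 0) \<bullet> b = 0" for p using sndk[of "i (p, 0)"] inv by simp
  have fkb: "fst (k (x + c *\<^sub>R b)) = fst (k x)" for x c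
    using kb lin(2) by (simp add: linear_add linear_cmul)
  define F where "F x = x + (g x - x \<bullet> b) *\<^sub>R b" for x
  define f' where "f' x = id_blinfun + (blinfun_scaleR_left b o\<^sub>L (blinfun_inner_left (?G x) - blinfun_inner_left b))" for x
  have f': "blinfun_apply (f' x) = (\<lambda>v. v + (?G x \<bullet> v - v \<bullet> b) *\<^sub>R b)" for x
    by (rule ext) (simp add: f'_def blinfun.bilinear_simps inner_commute)
  have derF: "(F has_derivative blinfun_apply (f' x)) (at x)" if "x \<in> U" for x
    unfolding F_def f' by (auto intro!: derivative_eq_intros E'(4)[OF that])
  have contf': "continuous_on U f'"
    unfolding f'_def
    by (intro continuous_intros bounded_bilinear.continuous_on[OF bounded_bilinear_blinfun_compose]
      bounded_linear.continuous_on[OF bounded_linear_blinfun_inner_left] E'(6))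
  \<comment> \<open>The explicit inverse of the derivative at \<open>x0\<close>, of the form found
    in \<open>coordinate_replacement\<close>; the inverse function theorem asks for it.\<close>
  define invf where "invf = id_blinfun + (blinfun_scaleR_left ((1 / (?G x0 \<bullet> b)) *\<^sub>R b) o\<^sub>L (blinfun_inner_left b - blinfun_inner_left (?G x0)))"
  have invf: "invf o\<^sub>L f' x0 = id_blinfun"
  proof (rule blinfun_eqI)
    fix v
    define c where "c = ?G x0 \<bullet> v - v \<bullet> b"
    have "(v + c *\<^sub>R b) \<bullet> b - ?G x0 \<bullet> (v + c *\<^sub>R b) = - c * (?G x0 \<bullet> b)"
      using bb by (simp add: c_def inner_add_left inner_add_right algebra_simps)
    then have "v + c *\<^sub>R b + (((v + c *\<^sub>R b) \<bullet> b - ?G x0 \<bullet> (v + c *\<^sub>R b)) / (?G x0 \<bullet> b)) *\<^sub>R b = v"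
      using b(2) by simp
    moreover have "blinfun_apply invf u = u + ((u \<bullet> b - ?G x0 \<bullet> u) / (?G x0 \<bullet> b)) *\<^sub>R b" for u
      by (simp add: invf_def blinfun.diff_left blinfun.add_left inner_commute)
    moreover have "blinfun_apply (f' x0) v = v + c *\<^sub>R b" by (simp add: f' c_def)
    ultimately show "blinfun_apply (invf o\<^sub>L f' x0) v = blinfun_apply id_blinfun v"
      by (simp only: blinfun_apply_blinfun_compose blinfun_apply_id_blinfun)
  qed
  obtain W V' h h' where W: "open W" "W \<subseteq> U" "x0 \<in> W" and V': "open V'" "F x0 \<in> V'"
    and hom: "homeomorphism W V' F h" and derh: "\<And>y. y \<in> V' \<Longrightarrow> (h has_derivative (h' y)) (at y)"
    and h': "\<And>y. y \<in> V' \<Longrightarrow> h' y = inv (blinfun_apply (f' (h y)))"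
    and bij: "\<And>y. y \<in> V' \<Longrightarrow> bij (blinfun_apply (f' (h y)))"
    using inverse_function_theorem[OF E'(1) derF contf' x0(1) invf] by metis
  define L where "L p = i (p, 0)" for p
  have linL: "linear L" unfolding L_def using lin(1)
    by (auto intro!: linearI simp: linear_add[symmetric] linear_cmul[symmetric])
  have cL: "continuous_on S L" for S using linL by (simp add: linear_continuous_on linear_conv_bounded_linear)
  define V where "V = L -` V'"
  define f where "f p = h (L p)" for p
  have oV: "open V" unfolding V_def using V'(1) cL[of UNIV] by (simp add: continuous_on_open_vimage)
  have hV: "h y \<in> W" "F (h y) = y" if "y \<in> V'" for y using hom that by (auto simp: homeomorphism_def)
  have hW: "F x \<in> V'" "h (F x) = x" if "x \<in> W" for x using hom that by (auto simp: homeomorphism_def)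
  have Fb: "F x \<bullet> b = g x" for x unfolding F_def using bb by (simp add: inner_add_left)
  have fF: "fst (k (F x)) = fst (k x)" for x unfolding F_def by (rule fkb)
  have nzb: "?G (h y) \<bullet> b \<noteq> 0" and
    h'e: "h' y u = u + ((u \<bullet> b - ?G (h y) \<bullet> u) / (?G (h y) \<bullet> b)) *\<^sub>R b" if "y \<in> V'" for y u
    using coordinate_replacement[OF bb, of "?G (h y)"] bij[OF that] h'[OF that] unfolding f' by (auto simp: bij_def)
  have derf: "(f has_derivative (\<lambda>q. h' (L p) (L q))) (at p)" if "p \<in> V" for p
  proof -
    have "(L has_derivative L) (at p)" using linL by (rule linear_imp_has_derivative)
    then show ?thesis unfolding f_def
      by (rule has_derivative_compose) (use that derh in \<open>simp add: V_def\<close>)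
  qed
  have cf: "continuous_on V f"
    unfolding f_def
    by (rule continuous_on_compose2[of V' h]) (use hom cL in \<open>auto simp: homeomorphism_def V_def\<close>)
  have fW: "f p \<in> W" if "p \<in> V" for p using that hV by (simp add: f_def V_def)
  have cGf: "continuous_on V (\<lambda>p. ?G (h (L p)))"
    using continuous_on_compose2[OF E'(6) cf] fW W(2) by (auto simp: f_def)
  have C1: "Ck_on 1 f V"
  proof (rule Ck1I[OF oV derf])
    fix q
    have "continuous_on V (\<lambda>p. L q + ((L q \<bullet> b - ?G (h (L p)) \<bullet> L q) / (?G (h (L p)) \<bullet> b)) *\<^sub>R b)"
      by (intro continuous_intros cGf) (auto simp: V_def nzb)
    then show "continuous_on V (\<lambda>p. h' (L p) (L q))"
      by (rule continuous_on_eq) (simp add: V_def h'e)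
  qed
  have fstf: "fst (k (f p)) = p" if "p \<in> V" for p
    using fF[of "f p"] hV(2)[of "L p"] that inv(1) by (simp add: f_def V_def L_def)
  have img: "f ` V = {x\<in>W. g x = 0}"
  proof
    show "f ` V \<subseteq> {x\<in>W. g x = 0}"
    proof clarify
      fix p assume p: "p \<in> V"
      have "g (f p) = F (f p) \<bullet> b" by (simp add: Fb)
      also have "\<dots> = L p \<bullet> b" using hV(2)[of "L p"] p by (simp add: f_def V_def)
      finally show "f p \<in> W \<and> g (f p) = 0" using fW[OF p] ip by (simp add: L_def)
    qed
    show "{x\<in>W. g x = 0} \<subseteq> f ` V"
    proof clarify
      fix x assume x: "x \<in> W" "g x = 0"
      have "F x = L (fst (k x))" unfolding L_def pr F_def using x by simp
      then have "L (fst (k x)) \<in> V'" "h (L (fst (k x))) = x" using hW[OF x(1)] by auto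
      then show "x \<in> f ` V" unfolding V_def f_def by (metis image_eqI vimageI)
    qed
  qed
  have tang: "frechet_derivative f (at p) (fst (k w)) = w" if p: "p \<in> V" and w: "w \<bullet> ?G (f p) = 0" for p w
  proof -
    have pV: "L p \<in> V'" using p by (simp add: V_def)
    have "frechet_derivative f (at p) (fst (k w)) = h' (L p) (w - (w \<bullet> b) *\<^sub>R b)"
      using frechet_derivative_at[OF derf[OF p]] by (metis L_def pr)
    also have "\<dots> = w"
      unfolding h'e[OF pV] using nzb[OF pV] bb w
      by (simp add: inner_diff_left inner_diff_right f_def inner_commute)
    finally show ?thesis .
  qed
  have "graph_chart g U i k V f W"
    unfolding graph_chart_def using i(1) oV W C1 fstf img tang by blast
  then show ?thesis using W(3) by blast
qed

lemma graph_chartD: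
  assumes C: "graph_chart g U i k V h W"
  shows "basis_iso i k" "open V" "open W" "W \<subseteq> U" "Ck_on 1 h V" "p \<in> V \<Longrightarrow> fst (k (h p)) = p"
    "p \<in> V \<Longrightarrow> h p \<in> W" "p \<in> V \<Longrightarrow> g (h p) = 0"
    "x \<in> W \<Longrightarrow> g x = 0 \<Longrightarrow> fst (k x) \<in> V \<and> h (fst (k x)) = x"
    "p \<in> V \<Longrightarrow> w \<bullet> gradient g (h p) = 0 \<Longrightarrow> frechet_derivative h (at p) (fst (k w)) = w"
    "continuous_on V h" "inj_on h V" "p \<in> V \<Longrightarrow> (h has_derivative frechet_derivative h (at p)) (at p)"
    "p \<in> V \<Longrightarrow> fst (k (frechet_derivative h (at p) q)) = q"
proof -
  have B: "basis_iso i k" using C unfolding graph_chart_def by auto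
  have f: "fst (k (h p)) = p" if "p \<in> V" for p
    using C that unfolding graph_chart_def by auto
  show "basis_iso i k" and V: "open V" "open W" "W \<subseteq> U" and C1: "Ck_on 1 h V"
    and "p \<in> V \<Longrightarrow> fst (k (h p)) = p" "p \<in> V \<Longrightarrow> h p \<in> W" "p \<in> V \<Longrightarrow> g (h p) = 0"
    "p \<in> V \<Longrightarrow> w \<bullet> gradient g (h p) = 0 \<Longrightarrow> frechet_derivative h (at p) (fst (k w)) = w"
    using C unfolding graph_chart_def by auto
  show "fst (k x) \<in> V \<and> h (fst (k x)) = x" if "x \<in> W" "g x = 0"
  proof -
    have "x \<in> h ` V" using C that unfolding graph_chart_def by auto
    then show ?thesis using f by auto
  qed
  show "continuous_on V h" using C1 by (rule Ck1_imp_continuous_on)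
  show "inj_on h V" by (rule inj_on_inverseI[of _ "\<lambda>x. fst (k x)"]) (rule f)
  show d: "(h has_derivative frechet_derivative h (at p)) (at p)" if "p \<in> V" for p
    using Ck1D[OF C1 that] .
  show "fst (k (frechet_derivative h (at p) q)) = q" if p: "p \<in> V"
  proof -
    have "linear k" using B by (simp add: basis_iso_def)
    then have "bounded_linear (\<lambda>x. fst (k x))"
      by (intro bounded_linear_compose[OF bounded_linear_fst]) (simp add: linear_conv_bounded_linear)
    then have "((\<lambda>p. fst (k (h p))) has_derivative (\<lambda>q. fst (k (frechet_derivative h (at p) q)))) (at p)"
      using d[OF p] by (rule bounded_linear.has_derivative)
    then have "((\<lambda>p. p) has_derivative (\<lambda>q. fst (k (frechet_derivative h (at p) q)))) (at p)"
      by (rule has_derivative_transform_within_open[OF _ V(1) p]) (rule f)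
    from has_derivative_unique[OF this has_derivative_ident] show ?thesis by metis
  qed
qed

lemma graph_chart_tangent:
  assumes C: "graph_chart g U i k V f W" and E: "C2_equation \<Sigma> U g" and p: "p \<in> V"
  shows "frechet_derivative f (at p) q \<bullet> gradient g (f p) = 0"
proof -
  note C' = graph_chartD[OF C] and E' = C2_equationD[OF E]
  have "f p \<in> U" using C'(4,7) p by blast
  then have "((\<lambda>p. g (f p)) has_derivative (\<lambda>q. gradient g (f p) \<bullet> frechet_derivative f (at p) q)) (at p)"
    using has_derivative_compose[OF C'(13)[OF p] E'(4)] by simp
  then have "((\<lambda>p. 0) has_derivative (\<lambda>q. gradient g (f p) \<bullet> frechet_derivative f (at p) q)) (at p)"
    by (rule has_derivative_transform_within_open[OF _ C'(2) p]) (simp add: C'(8))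
  from has_derivative_unique[OF this has_derivative_const] show ?thesis by (metis inner_commute)
qed

text \<open>Near an interior point every equation describes the whole hypersurface: the graph over a
  ball given by the special equation is open in any other graph, by invariance of domain.\<close>

lemma hs_interior_any_equation:
  fixes \<Sigma> :: "'a::euclidean_space set"
  assumes dim: "DIM('a) = CARD('n::finite) + 1" and E: "C2_equation \<Sigma> U g" and x: "x \<in> hs_interior \<Sigma>" "x \<in> U"
  shows "\<exists>W. open W \<and> x \<in> W \<and> W \<subseteq> U \<and> \<Sigma> \<inter> W = {y\<in>W. g y = 0}"
proof -
  obtain U2 g2 where E2: "x \<in> U2" "C2_equation \<Sigma> U2 g2" "\<Sigma> \<inter> U2 = {y\<in>U2. g2 y = 0}"
    using x(1) unfolding hs_interior_def by blast
  have xS: "x \<in> \<Sigma>" using x(1) by (simp add: hs_interior_def)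
  have gx: "g x = 0" "g2 x = 0" using C2_equationD(3)[OF E xS x(2)] C2_equationD(3)[OF E2(2) xS E2(1)] by auto
  obtain i :: "(real^'n) \<times> real \<Rightarrow> 'a" and k V f W where C: "graph_chart g U i k V f W" "x \<in> W"
    using graph_chart_exists[OF dim E x(2) gx(1)] by blast
  obtain i2 :: "(real^'n) \<times> real \<Rightarrow> 'a" and k2 V2 f2 W2 where C2: "graph_chart g2 U2 i2 k2 V2 f2 W2" "x \<in> W2"
    using graph_chart_exists[OF dim E2(2) E2(1) gx(2)] by blast
  note C' = graph_chartD[OF C(1)] and C2' = graph_chartD[OF C2(1)]
  define Q where "Q = V2 \<inter> f2 -` W"
  have oQ: "open Q" unfolding Q_def using C2'(2,11) C'(3) by (metis Int_commute continuous_on_open_vimage)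
  have inS: "f2 p \<in> \<Sigma> \<and> f2 p \<in> W \<and> g (f2 p) = 0" if "p \<in> Q" for p
  proof -
    have "f2 p \<in> W2" "g2 (f2 p) = 0" "f2 p \<in> W" using that C2'(7,8) by (auto simp: Q_def)
    then have "f2 p \<in> \<Sigma>" using E2(3) C2'(4) by blast
    moreover have "f2 p \<in> U" using C'(4) \<open>f2 p \<in> W\<close> by blast
    ultimately show ?thesis using C2_equationD(3)[OF E] \<open>f2 p \<in> W\<close> by blast
  qed
  define T where "T p = fst (k (f2 p))" for p
  have lk: "continuous_on S (\<lambda>x. fst (k x))" for S
    using C'(1) by (intro continuous_on_fst basis_iso_continuous[OF basis_iso_sym])
  have cT: "continuous_on Q T" unfolding T_def
    by (rule continuous_on_compose2[OF lk[of UNIV]]) (use C2'(11) in \<open>auto simp: Q_def intro: continuous_on_subset\<close>)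
  have fT: "f (T p) = f2 p \<and> T p \<in> V" if "p \<in> Q" for p
    using C'(9)[of "f2 p"] inS[OF that] by (simp add: T_def)
  have "inj_on T Q"
    by (rule inj_onI) (metis Q_def C2'(6) IntD1 fT)
  then have oTQ: "open (T ` Q)" by (rule invariance_of_domain[OF cT oQ])
  define p2 where "p2 = fst (k2 x)"
  have p2: "p2 \<in> V2" "f2 p2 = x" using C2'(9)[OF C2(2) gx(2)] by (auto simp: p2_def)
  then have p2Q: "p2 \<in> Q" using C(2) by (simp add: Q_def)
  define W' where "W' = W \<inter> (\<lambda>y. fst (k y)) -` (T ` Q)"
  have oW: "open W'" unfolding W'_def
    by (rule open_Int[OF C'(3) open_vimage[OF oTQ lk]])
  have "x \<in> W'" unfolding W'_def using C(2) p2 p2Q by (auto simp: T_def)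
  moreover have "\<Sigma> \<inter> W' = {y\<in>W'. g y = 0}"
  proof
    show "\<Sigma> \<inter> W' \<subseteq> {y\<in>W'. g y = 0}" using C2_equationD(3)[OF E] C'(4) by (auto simp: W'_def)
    show "{y\<in>W'. g y = 0} \<subseteq> \<Sigma> \<inter> W'"
    proof
      fix y assume "y \<in> {y\<in>W'. g y = 0}"
      then have y: "y \<in> W'" "g y = 0" by auto
      then obtain p where p: "p \<in> Q" "fst (k y) = T p" by (auto simp: W'_def)
      have "y = f (T p)" using C'(9)[of y] y p by (simp add: W'_def)
      then have "y = f2 p" using fT[OF p(1)] by simp
      then show "y \<in> \<Sigma> \<inter> W'" using inS[OF p(1)] y(1) by simp
    qed
  qed
  ultimately show ?thesis using oW C'(4) by (intro exI[of _ W']) (auto simp: W'_def)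
qed

section \<open>Faces of an irredundant polytope and their active inequalities\<close>

definition coef :: "('a::euclidean_space \<Rightarrow> real) \<Rightarrow> 'a" where
  "coef f = (SOME a. \<exists>b. f = (\<lambda>x. a \<bullet> x + b))"

locale irredundant_polytope =
  fixes J :: "'j set" and u :: "'j \<Rightarrow> 'a::euclidean_space \<Rightarrow> real"
  assumes polytope: "convex_polytope J u"
begin

abbreviation "P \<equiv> polytope_of J u"

definition active :: "'a \<Rightarrow> 'j set" where "active p = {k\<in>J. u k p = 0}"

lemma fin: "finite J" and intP: "interior P \<noteq> {}"
  and irr: "l \<in> J \<Longrightarrow> P \<noteq> polytope_of (J - {l}) u"
  using polytope by (auto simp: convex_polytope_def)

lemma aff: assumes "j \<in> J" shows "u j x = u j y + coef (u j) \<bullet> (x - y)"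
proof -
  have "\<exists>a b. u j = (\<lambda>x. a \<bullet> x + b)" using polytope assms by (auto simp: convex_polytope_def)
  then have "\<exists>b. u j = (\<lambda>x. coef (u j) \<bullet> x + b)" unfolding coef_def by (rule someI_ex)
  then obtain b where "u j = (\<lambda>x. coef (u j) \<bullet> x + b)" by blast
  then have "u j x = coef (u j) \<bullet> x + b" "u j y = coef (u j) \<bullet> y + b" by (metis (no_types))+
  then show ?thesis by (simp add: inner_diff_right)
qed

lemma memP: "x \<in> P \<longleftrightarrow> (\<forall>j\<in>J. u j x \<le> 0)" by (auto simp: polytope_of_def)

lemma memF: "x \<in> facet J u k \<longleftrightarrow> u k x = 0 \<and> x \<in> P" by (simp add: facet_def)

lemma aff_comb: "j \<in> J \<Longrightarrow> u j (x + s *\<^sub>R (y - x)) = (1 - s) * u j x + s * u j y"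
proof -
  assume j: "j \<in> J"
  have "u j (x + s *\<^sub>R (y - x)) = u j x + s * (coef (u j) \<bullet> (y - x))"
    using aff[OF j, of "x + s *\<^sub>R (y - x)" x] by simp
  moreover have "coef (u j) \<bullet> (y - x) = u j y - u j x" using aff[OF j, of y x] by simp
  ultimately have "u j (x + s *\<^sub>R (y - x)) = u j x + s * (u j y - u j x)" by metis
  then show ?thesis by (simp only:) (simp add: algebra_simps)
qed

lemma aff_dir: "j \<in> J \<Longrightarrow> u j (x + s *\<^sub>R v) = u j x + s * (coef (u j) \<bullet> v)"
  using aff[of j "x + s *\<^sub>R v" x] by simp

lemma cont_u: "j \<in> J \<Longrightarrow> continuous_on S (u j)"
proof -
  assume j: "j \<in> J"
  have "continuous_on S (\<lambda>x. u j 0 + coef (u j) \<bullet> (x - 0))" by (intro continuous_intros)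
  then show "continuous_on S (u j)"
    by (rule continuous_on_eq) (rule aff[OF j, symmetric])
qed

lemma closedP: "closed P"
  unfolding polytope_of_def by (intro closed_INT ballI closed_Collect_le cont_u) auto

lemma closedF: "k \<in> J \<Longrightarrow> closed (facet J u k)"
  unfolding facet_def by (intro closed_Int closed_Collect_eq cont_u closedP) auto

lemma segP: "x \<in> P \<Longrightarrow> y \<in> P \<Longrightarrow> 0 \<le> s \<Longrightarrow> s \<le> 1 \<Longrightarrow> x + s *\<^sub>R (y - x) \<in> P"
  by (simp add: memP aff_comb add_nonpos_nonpos mult_nonneg_nonpos)

lemma segF: "k \<in> J \<Longrightarrow> x \<in> facet J u k \<Longrightarrow> y \<in> facet J u k \<Longrightarrow> 0 \<le> s \<Longrightarrow> s \<le> 1 \<Longrightarrow>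
   x + s *\<^sub>R (y - x) \<in> facet J u k"
  using segP by (simp add: memF aff_comb)

lemma convexF: "k \<in> J \<Longrightarrow> convex (facet J u k)"
proof (unfold convex_alt, intro ballI allI impI)
  fix x y s assume "k \<in> J" "x \<in> facet J u k" "y \<in> facet J u k" "0 \<le> s \<and> s \<le> (1::real)"
  then have "x + s *\<^sub>R (y - x) \<in> facet J u k" using segF by blast
  then show "(1 - s) *\<^sub>R x + s *\<^sub>R y \<in> facet J u k" by (simp add: algebra_simps)
qed

lemma coef_nz: assumes j: "j \<in> J" shows "coef (u j) \<noteq> 0"
proof
  assume 0: "coef (u j) = 0"
  obtain z where "z \<in> P" using intP interior_subset by blast
  then have "u j x \<le> 0" for x using aff[OF j, of x z] 0 j by (simp add: memP)
  then have "P = polytope_of (J - {j}) u" by (auto simp: polytope_of_def)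
  then show False using irr[OF j] by simp
qed

lemma interior_neg: assumes z: "z \<in> interior P" and j: "j \<in> J" shows "u j z < 0"
proof -
  obtain e where e: "e > 0" "ball z e \<subseteq> P" using z mem_interior by blast
  define s where "s = e / (2 * norm (coef (u j)))"
  have n: "norm (coef (u j)) > 0" using coef_nz[OF j] by simp
  have s: "s > 0" using e n by (simp add: s_def)
  have "z + s *\<^sub>R coef (u j) \<in> ball z e" using e n by (simp add: s_def dist_norm)
  then have "u j (z + s *\<^sub>R coef (u j)) \<le> 0" using e(2) j memP by blast
  then have "u j z + s * (coef (u j) \<bullet> coef (u j)) \<le> 0" by (simp add: aff_dir[OF j])
  moreover have "s * (coef (u j) \<bullet> coef (u j)) > 0" using s coef_nz[OF j] by simp
  ultimately show ?thesis by linarith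
qed

lemma neg_interior: assumes "\<forall>j\<in>J. u j z < 0" shows "z \<in> interior P"
proof (rule interiorI)
  show "open (\<Inter>j\<in>J. {x. u j x < 0})"
    by (intro open_INT[OF fin] ballI open_Collect_less cont_u continuous_on_const)
  show "z \<in> (\<Inter>j\<in>J. {x. u j x < 0})" using assms by blast
  show "(\<Inter>j\<in>J. {x. u j x < 0}) \<subseteq> P" by (auto simp: polytope_of_def less_imp_le)
qed

lemma active_frontier: assumes "p \<in> P" shows "active p \<noteq> {} \<longleftrightarrow> p \<notin> interior P"
proof
  assume "active p \<noteq> {}" then show "p \<notin> interior P" using interior_neg by (force simp: active_def)
next
  assume "p \<notin> interior P"
  then obtain j where "j \<in> J" "\<not> u j p < 0" using neg_interior by blast
  then show "active p \<noteq> {}" using assms by (force simp: active_def memP)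
qed

text \<open>Irredundancy supplies a point that violates inequality \<open>k\<close> only. The
  segment to it from an interior point crosses \<open>u k = 0\<close> before its end, at a point
  where all other inequalities are still strict.\<close>

lemma facet_witness:
  assumes k: "k \<in> J"
  shows "\<exists>q\<in>facet J u k. \<forall>l\<in>J - {k}. u l q < 0"
proof -
  have "\<exists>z. z \<in> polytope_of (J - {k}) u \<and> z \<notin> P"
    using irr[OF k] by (auto simp: polytope_of_def)
  then obtain z where z: "\<forall>l\<in>J - {k}. u l z \<le> 0" "u k z > 0"
    unfolding polytope_of_def by (metis (mono_tags, lifting) Diff_iff INT_E INT_I insertE k mem_Collect_eq not_le empty_iff)
  obtain z0 where z0: "z0 \<in> interior P" using intP by blast
  have n: "u k z0 < 0" using interior_neg[OF z0 k] .
  define s where "s = u k z0 / (u k z0 - u k z)"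
  have s: "0 < s" "s < 1" using n z(2) by (auto simp: s_def divide_simps)
  define q where "q = z0 + s *\<^sub>R (z - z0)"
  have "u k q = (1 - s) * u k z0 + s * u k z" unfolding q_def by (rule aff_comb[OF k])
  also have "\<dots> = u k z0 - s * (u k z0 - u k z)" by (simp add: algebra_simps)
  also have "\<dots> = 0" using n z(2) by (simp add: s_def)
  finally have qk: "u k q = 0" .
  have ql: "u l q < 0" if "l \<in> J - {k}" for l
  proof -
    have "u l q = (1 - s) * u l z0 + s * u l z" unfolding q_def using that by (intro aff_comb) auto
    moreover have "(1 - s) * u l z0 < 0" using interior_neg[OF z0, of l] that s by (simp add: mult_pos_neg)
    moreover have "s * u l z \<le> 0" using z(1) that s by (simp add: mult_nonneg_nonpos)
    ultimately show ?thesis by linarith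
  qed
  have "q \<in> P" unfolding memP using qk ql by (metis DiffI empty_iff insert_iff less_imp_le order_refl)
  then have "q \<in> facet J u k" using qk by (simp add: memF)
  then show ?thesis using ql by blast
qed

text \<open>A segment from \<open>q\<close> to a relative interior point \<open>p\<close> can be
  prolonged beyond \<open>p\<close> inside \<open>S\<close>. If \<open>u l\<close> were negative at
  \<open>q\<close>, it would be positive on the prolongation.\<close>

lemma rel_interior_zero:
  assumes S: "convex S" and p: "p \<in> rel_interior S" and l: "l \<in> J" and le: "S \<subseteq> P"
    and p0: "u l p = 0" and q: "q \<in> S"
  shows "u l q = 0"
proof -
  obtain e where e: "e > 1" "(1 - e) *\<^sub>R q + e *\<^sub>R p \<in> S"
    using convex_rel_interior_iff[OF S, of p] p q by blast
  have "u l ((1 - e) *\<^sub>R q + e *\<^sub>R p) = u l (q + e *\<^sub>R (p - q))" by (simp add: algebra_simps)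
  also have "\<dots> = (1 - e) * u l q" using aff_comb[OF l] p0 by simp
  finally have "(1 - e) * u l q \<le> 0" using e(2) le l memP by (metis subsetD)
  moreover have "u l q \<le> 0" using q le l memP by blast
  ultimately show ?thesis using e(1) by (simp add: mult_le_0_iff)
qed

text \<open>Another active inequality would vanish on the whole facet by
  \<open>rel_interior_zero\<close>, against \<open>facet_witness\<close>.\<close>

lemma active_facet:
  assumes k: "k \<in> J" and p: "p \<in> rel_interior (facet J u k)"
  shows "p \<in> P" "active p = {k}"
proof -
  have pF: "p \<in> facet J u k" using p rel_interior_subset by blast
  then show "p \<in> P" by (simp add: memF)
  obtain q where q: "q \<in> facet J u k" "\<forall>l\<in>J - {k}. u l q < 0" using facet_witness[OF k] by blast
  have "l = k" if "l \<in> active p" for l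
  proof (rule ccontr)
    assume "l \<noteq> k"
    have "u l q = 0"
      by (rule rel_interior_zero[OF convexF[OF k] p _ _ _ q(1)]) (use that in \<open>auto simp: active_def facet_def\<close>)
    moreover have "u l q < 0" using q(2) that \<open>l \<noteq> k\<close> by (simp add: active_def)
    ultimately show False by simp
  qed
  moreover have "k \<in> active p" using pF k by (simp add: active_def memF)
  ultimately show "active p = {k}" by blast
qed

text \<open>A third active inequality \<open>l\<close> would vanish on the whole edge, hence by
  codimension 2 be a combination of inequalities \<open>i\<close> and \<open>j\<close>. Evaluation
  at the witnesses of the facets \<open>i\<close> and \<open>j\<close> shows both coefficients to be
  positive; evaluation at the witness of facet \<open>l\<close> is then contradictory.\<close>

lemma active_edge:
  assumes e: "(i, j) \<in> edge_indices J u" and p: "p \<in> rel_interior (facet J u i \<inter> facet J u j)"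
  shows "p \<in> P" "active p = {i, j}"
proof -
  have ij: "i \<in> J" "j \<in> J" "i \<noteq> j" and ad: "aff_dim (facet J u i \<inter> facet J u j) = int DIM('a) - 2"
    using e by (auto simp: edge_indices_def)
  let ?S = "facet J u i \<inter> facet J u j"
  have pS: "p \<in> ?S" using p rel_interior_subset by blast
  then show pP: "p \<in> P" by (simp add: memF)
  have cS: "convex ?S" using ij convexF by (simp add: convex_Int)
  have SP: "?S \<subseteq> P" by (auto simp: facet_def)
  have "l = i \<or> l = j" if l: "l \<in> active p" for l
  proof (rule ccontr)
    assume ne: "\<not> (l = i \<or> l = j)"
    have lJ: "l \<in> J" "u l p = 0" using l by (auto simp: active_def)
    \<comment> \<open>The directions of the edge. They are orthogonal to the three coefficient
      vectors, and their span has dimension \<open>DIM('a) - 2\<close>; this leaves room for two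
      independent coefficients only.\<close>
    define E where "E = (+) (- p) ` ?S"
    have zero: "u k q = 0" if "k \<in> {i, j, l}" "q \<in> ?S" for k q
      using that rel_interior_zero[OF cS p lJ(1) SP lJ(2)] by (auto simp: memF)
    have orth: "x \<bullet> y = 0" if x: "x \<in> E" and y: "y \<in> {coef (u l), coef (u i), coef (u j)}" for x y
    proof -
      obtain q where q: "q \<in> ?S" "x = - p + q" using x unfolding E_def by blast
      obtain k where k: "k \<in> {i, j, l}" "y = coef (u k)" using y by blast
      have "u k q = u k p + coef (u k) \<bullet> (q - p)" using k ij lJ by (intro aff) auto
      then show ?thesis using zero[OF k(1) q(1)] zero[OF k(1) pS] q k by (simp add: inner_commute)
    qed
    have "int (dim E) = int DIM('a) - 2"
      using ad aff_dim_eq_dim[OF hull_inc[OF pS]] unfolding E_def by simp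
    then have dE: "dim E + 2 = DIM('a)" by linarith
    obtain qi where qi: "qi \<in> facet J u i" "\<forall>l\<in>J - {i}. u l qi < 0" using facet_witness[OF ij(1)] by blast
    obtain qj where qj: "qj \<in> facet J u j" "\<forall>l\<in>J - {j}. u l qj < 0" using facet_witness[OF ij(2)] by blast
    obtain ql where ql: "ql \<in> facet J u l" "\<forall>k\<in>J - {l}. u k ql < 0" using facet_witness[OF lJ(1)] by blast
    have atp: "u k q = coef (u k) \<bullet> (q - p)" if "k \<in> {i, j, l}" for k q
      using aff[of k q p] that zero[OF that pS] ij lJ by auto
    have nij: "coef (u j) \<notin> span {coef (u i)}"
    proof
      assume "coef (u j) \<in> span {coef (u i)}"
      then obtain c where "coef (u j) = c *\<^sub>R coef (u i)" by (auto simp: span_singleton)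
      then have "u j qi = c * u i qi" using atp by simp
      then show False using qi ij by (force simp: memF)
    qed
    have ind2: "independent {coef (u i), coef (u j)}"
      using independent_insertI[OF nij] coef_nz[OF ij(1)] by (simp add: insert_commute)
    have "coef (u l) \<in> span {coef (u i), coef (u j)}"
    proof (rule ccontr)
      assume n: "coef (u l) \<notin> span {coef (u i), coef (u j)}"
      then have ind3: "independent {coef (u l), coef (u i), coef (u j)}"
        using ind2 by (rule independent_insertI)
      have "coef (u i) \<noteq> coef (u j)" using nij by (metis span_base singletonI)
      moreover have "coef (u l) \<noteq> coef (u i)" "coef (u l) \<noteq> coef (u j)"
        using n by (metis span_base insertI1, metis span_base insertI1 insertI2)
      ultimately have "dim {coef (u l), coef (u i), coef (u j)} = 3"
        using dim_eq_card_independent[OF ind3] by simp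
      moreover have "dim (E \<union> {coef (u l), coef (u i), coef (u j)}) = dim E + dim {coef (u l), coef (u i), coef (u j)}"
        using orth by (rule dim_orthogonal_sum)
      moreover have "dim (E \<union> {coef (u l), coef (u i), coef (u j)}) \<le> DIM('a)" by (rule dim_subset_UNIV)
      ultimately show False using dE by linarith
    qed
    then obtain b where "coef (u l) - b *\<^sub>R coef (u i) \<in> span {coef (u j)}"
      using span_breakdown_eq by blast
    then obtain \<beta> where "coef (u l) - b *\<^sub>R coef (u i) = \<beta> *\<^sub>R coef (u j)" by (auto simp: span_singleton)
    then have c: "coef (u l) = b *\<^sub>R coef (u i) + \<beta> *\<^sub>R coef (u j)" by (simp add: algebra_simps)
    have ul: "u l q = b * u i q + \<beta> * u j q" for q
      using atp[of l q] atp[of i q] atp[of j q] unfolding c by (simp add: inner_add_left)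
    have "u l qi < 0" "u j qi < 0" "u i qi = 0" using qi ne lJ ij by (auto simp: memF)
    then have \<beta>: "\<beta> > 0" using ul[of qi] by (simp add: mult_less_0_iff)
    have "u l qj < 0" "u i qj < 0" "u j qj = 0" using qj ne lJ ij by (auto simp: memF)
    then have b: "b > 0" using ul[of qj] by (simp add: mult_less_0_iff)
    have "u i ql < 0" "u j ql < 0" "u l ql = 0" using ql ne lJ ij by (auto simp: memF)
    then have "b * u i ql + \<beta> * u j ql < 0"
      using b \<beta> by (intro add_neg_neg mult_pos_neg)
    then show False using ul[of ql] \<open>u l ql = 0\<close> by simp
  qed
  moreover have "i \<in> active p" "j \<in> active p" using pS ij by (auto simp: active_def memF)
  ultimately show "active p = {i, j}" by blast
qed

end

section \<open>Normal cones of convex sets\<close>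

lemma vector_derivative_limit:
  assumes "(c has_vector_derivative v) (at (0::real) within S)"
  shows "((\<lambda>s. (c s - c 0) /\<^sub>R s) \<longlongrightarrow> v) (at 0 within S)"
proof -
  have "((\<lambda>y. (c y - c 0 - y *\<^sub>R v) /\<^sub>R norm y) \<longlongrightarrow> 0) (at 0 within S)"
    using assms unfolding has_vector_derivative_def has_derivative_within
    by (simp add: diff_diff_eq inverse_eq_divide)
  then have "((\<lambda>y. norm ((c y - c 0 - y *\<^sub>R v) /\<^sub>R norm y)) \<longlongrightarrow> 0) (at 0 within S)"
    by (rule tendsto_norm_zero)
  then have "((\<lambda>y. norm ((c y - c 0) /\<^sub>R y - v)) \<longlongrightarrow> 0) (at 0 within S)"
  proof (rule Lim_transform_eventually)
    show "\<forall>\<^sub>F y in at 0 within S. norm ((c y - c 0 - y *\<^sub>R v) /\<^sub>R norm y) = norm ((c y - c 0) /\<^sub>R y - v)"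
      unfolding eventually_at_filter
    proof (intro always_eventually allI impI)
      fix y :: real assume "y \<noteq> 0"
      then have "(c y - c 0) /\<^sub>R y - v = (c y - c 0 - y *\<^sub>R v) /\<^sub>R y" by (simp add: scaleR_diff_right)
      then show "norm ((c y - c 0 - y *\<^sub>R v) /\<^sub>R norm y) = norm ((c y - c 0) /\<^sub>R y - v)" by simp
    qed
  qed
  then have "((\<lambda>y. (c y - c 0) /\<^sub>R y - v) \<longlongrightarrow> 0) (at 0 within S)" by (rule tendsto_norm_zero_cancel)
  then show ?thesis by (rule LIM_zero_cancel)
qed

lemma directional_limit:
  assumes "(f has_derivative f') (at x)"
  shows "((\<lambda>s. (f (x + s *\<^sub>R d) - f x) /\<^sub>R s) \<longlongrightarrow> f' d) (at 0)"
proof -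
  interpret f': bounded_linear f' using assms has_derivative_bounded_linear by blast
  have "((\<lambda>s. f (x + s *\<^sub>R d)) has_derivative (\<lambda>s. f' (s *\<^sub>R d))) (at 0)"
    by (rule has_derivative_compose[where g = f and f = "\<lambda>s. x + s *\<^sub>R d"])
      (use assms in \<open>auto intro!: derivative_eq_intros\<close>)
  then have "((\<lambda>s. f (x + s *\<^sub>R d)) has_vector_derivative f' d) (at 0)"
    by (simp add: has_vector_derivative_def f'.scaleR)
  from vector_derivative_limit[OF this] show ?thesis by simp
qed

definition normal_cone :: "'a::euclidean_space set \<Rightarrow> 'a \<Rightarrow> 'a set" where
  "normal_cone K x = {w. \<forall>y\<in>K. w \<bullet> (y - x) \<le> 0}"

lemma normal_cone_closure: "w \<in> normal_cone K x \<Longrightarrow> y \<in> closure K \<Longrightarrow> w \<bullet> (y - x) \<le> 0"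
proof -
  assume w: "w \<in> normal_cone K x" and y: "y \<in> closure K"
  have "closed {y. w \<bullet> (y - x) \<le> 0}" by (intro closed_Collect_le continuous_intros)
  moreover have "K \<subseteq> {y. w \<bullet> (y - x) \<le> 0}" using w by (auto simp: normal_cone_def)
  ultimately have "closure K \<subseteq> {y. w \<bullet> (y - x) \<le> 0}" by (simp add: closure_minimal)
  then show ?thesis using y by blast
qed

lemma normal_cone_interior:
  assumes w: "w \<in> normal_cone K x" "w \<noteq> 0" and z: "z \<in> interior K"
  shows "w \<bullet> (z - x) < 0"
proof -
  obtain e where e: "e > 0" "ball z e \<subseteq> K" using z mem_interior by blast
  define s where "s = e / (2 * norm w)"
  have s: "s > 0" using e w by (simp add: s_def)
  have "z + s *\<^sub>R w \<in> ball z e" using e w by (simp add: s_def dist_norm)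
  then have "w \<bullet> (z + s *\<^sub>R w - x) \<le> 0" using e(2) w(1) unfolding normal_cone_def by blast
  moreover have "w \<bullet> (z + s *\<^sub>R w - x) = w \<bullet> (z - x) + s * (w \<bullet> w)" by (simp add: algebra_simps inner_diff_right inner_add_right)
  moreover have "s * (w \<bullet> w) > 0" using s w by simp
  ultimately show ?thesis by linarith
qed

text \<open>A direction along which a convex set is never entered is separated from it.\<close>

lemma inner_direction:
  assumes K: "convex K" "interior K \<noteq> {}" and x: "x \<in> closure K"
    and v: "\<And>w. w \<in> normal_cone K x \<Longrightarrow> w \<noteq> 0 \<Longrightarrow> w \<bullet> v < 0"
  shows "\<exists>s>0. x + s *\<^sub>R v \<in> interior K"
proof (rule ccontr)
  assume no: "\<not> ?thesis"
  \<comment> \<open>The open ray avoids the interior of \<open>K\<close>, so a hyperplane with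
    normal \<open>a\<close> separates them. Letting the ray parameter tend to 0 shows that it passes
    through \<open>x\<close>; hence \<open>a\<close> is an outer normal with
    \<open>a \<bullet> v \<ge> 0\<close>.\<close>
  define R where "R = (\<lambda>t. x + t *\<^sub>R v) ` {0<..}"
  have "convex R" unfolding R_def
    by (rule convex_translation[of "(\<lambda>t. t *\<^sub>R v) ` {0<..}" x, unfolded image_image])
      (auto intro!: convex_linear_image simp: linear_iff scaleR_add_left)
  moreover have "R \<inter> interior K = {}" using no by (auto simp: R_def)
  moreover have "R \<noteq> {}" by (auto simp: R_def)
  ultimately obtain a b where a: "a \<noteq> 0" "\<forall>y\<in>interior K. a \<bullet> y \<le> b" "\<forall>y\<in>R. a \<bullet> y \<ge> b"
    using separating_hyperplane_sets[of "interior K" R] K convex_interior by (metis Int_commute)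
  have cl: "a \<bullet> y \<le> b" if "y \<in> closure K" for y
  proof -
    have "closed {y. a \<bullet> y \<le> b}" by (rule closed_halfspace_le)
    then have "closure (interior K) \<subseteq> {y. a \<bullet> y \<le> b}" using a(2) by (intro closure_minimal) auto
    then show ?thesis using that convex_closure_interior[OF K] by blast
  qed
  have lim: "((\<lambda>t. a \<bullet> (x + t *\<^sub>R v)) \<longlongrightarrow> a \<bullet> (x + 0 *\<^sub>R v)) (at_right 0)"
    by (intro tendsto_intros)
  have "b \<le> a \<bullet> (x + 0 *\<^sub>R v)"
  proof (rule tendsto_lowerbound[OF lim])
    show "\<forall>\<^sub>F t in at_right 0. b \<le> a \<bullet> (x + t *\<^sub>R v)"
      using a(3) by (auto simp: R_def eventually_at_right_field intro!: exI[of _ 1])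
  qed simp
  then have eq: "a \<bullet> x = b" using cl[OF x] by simp
  have "a \<in> normal_cone K x" unfolding normal_cone_def
    using cl closure_subset eq by (auto simp: inner_diff_right)
  then have "a \<bullet> v < 0" using v a(1) by blast
  moreover have "x + 1 *\<^sub>R v \<in> R" unfolding R_def by (intro image_eqI[of _ _ 1]) auto
  then have "b \<le> a \<bullet> (x + 1 *\<^sub>R v)" using a(3) by blast
  ultimately show False using eq by (simp add: inner_add_right)
qed

text \<open>A competitor is orthogonal to the same hyperplane and so equals \<open>N\<close> or
  \<open>- N\<close>. The latter is excluded because every nonzero outer normal is strictly negative
  towards an interior point. This evaluates the definite description.\<close>

lemma outer_normal_eqI:
  assumes K: "interior K \<noteq> {}" and N: "norm N = 1" "N \<in> normal_cone K x"
    and T: "tangent_space F x = {v. N \<bullet> v = 0}"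
  shows "outer_normal K F x = N"
  unfolding outer_normal_def
proof (rule the_equality)
  show "norm N = 1 \<and> (\<forall>v\<in>tangent_space F x. N \<bullet> v = 0) \<and> (\<forall>y\<in>K. N \<bullet> (y - x) \<le> 0)"
    using N T by (auto simp: normal_cone_def)
next
  fix N' assume N': "norm N' = 1 \<and> (\<forall>v\<in>tangent_space F x. N' \<bullet> v = 0) \<and> (\<forall>y\<in>K. N' \<bullet> (y - x) \<le> 0)"
  define w where "w = N' - (N \<bullet> N') *\<^sub>R N"
  have "N \<bullet> w = 0" unfolding w_def using N(1) by (simp add: inner_diff_right dot_square_norm)
  then have "N' \<bullet> w = 0" using N' T by auto
  then have "w \<bullet> w = 0" using \<open>N \<bullet> w = 0\<close> unfolding w_def by (simp add: inner_diff_left inner_diff_right inner_commute)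
  then have e: "N' = (N \<bullet> N') *\<^sub>R N" unfolding w_def by simp
  then have "\<bar>N \<bullet> N'\<bar> = 1" using N' N(1) by (metis mult.right_neutral norm_scaleR)
  moreover have "N \<bullet> N' \<noteq> -1"
  proof
    assume "N \<bullet> N' = -1"
    then have e': "N' = - N" using e by simp
    obtain z where z: "z \<in> interior K" using K by blast
    have "N \<bullet> (z - x) < 0" "N' \<bullet> (z - x) < 0"
      using normal_cone_interior[OF N(2) _ z] normal_cone_interior[of N' K x z] N' N z
      unfolding normal_cone_def by force+
    then show False using e' by simp
  qed
  ultimately show "N' = N" using e by (auto simp: abs_if split: if_splits)
qed

section \<open>The piecewise smooth container and the normals of its smooth pieces\<close>

locale polytope_domain = irredundant_polytope J u
  for J :: "'j set" and u :: "'j \<Rightarrow> 'a::euclidean_space \<Rightarrow> real" +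
  fixes \<Psi> :: "'a \<Rightarrow> 'a" and K :: "'a set"
  assumes dom: "polytope_type_domain J u \<Psi> K"
begin

lemma convK: "convex K" using dom by (simp add: polytope_type_domain_def)

definition \<Phi> :: "'a \<Rightarrow> 'a" where
  "\<Phi> = (SOME \<Phi>. homeomorphism P (closure K) \<Psi> \<Phi> \<and> (\<exists>M. M-lipschitz_on (closure K) \<Phi>))"

lemma \<Phi>: "homeomorphism P (closure K) \<Psi> \<Phi>" "\<exists>M. M-lipschitz_on (closure K) \<Phi>"
proof -
  have "\<exists>\<Phi>. homeomorphism P (closure K) \<Psi> \<Phi> \<and> (\<exists>M. M-lipschitz_on (closure K) \<Phi>)"
    using dom unfolding polytope_type_domain_def by blast
  from someI_ex[OF this] show "homeomorphism P (closure K) \<Psi> \<Phi>" "\<exists>M. M-lipschitz_on (closure K) \<Phi>"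
    unfolding \<Phi>_def by blast+
qed

lemma \<Psi>K: "p \<in> P \<Longrightarrow> \<Psi> p \<in> closure K" and \<Phi>P: "x \<in> closure K \<Longrightarrow> \<Phi> x \<in> P"
  and \<Phi>\<Psi>: "p \<in> P \<Longrightarrow> \<Phi> (\<Psi> p) = p" and \<Psi>\<Phi>: "x \<in> closure K \<Longrightarrow> \<Psi> (\<Phi> x) = x"
  and cont\<Psi>: "continuous_on P \<Psi>" and cont\<Phi>: "continuous_on (closure K) \<Phi>"
  using \<Phi>(1) by (auto simp: homeomorphism_def)

text \<open>Invariance of domain, together with the fact that a convex set and its closure have the
  same interior.\<close>

lemma \<Psi>_interior: assumes "p \<in> interior P" shows "\<Psi> p \<in> interior K"
proof -
  have "inj_on \<Psi> (interior P)" by (metis \<Phi>\<Psi> inj_on_inverseI interior_subset subsetD)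
  then have "open (\<Psi> ` interior P)"
    by (intro invariance_of_domain continuous_on_subset[OF cont\<Psi>] interior_subset open_interior)
  then have "\<Psi> ` interior P \<subseteq> interior (closure K)"
    using \<Psi>K interior_subset by (intro interior_maximal) blast+
  then show ?thesis using assms convex_interior_closure[OF convK] by blast
qed

lemma \<Phi>_interior: assumes "x \<in> interior K" shows "\<Phi> x \<in> interior P"
proof -
  have i: "interior K \<subseteq> closure K" using interior_subset closure_subset by blast
  have "inj_on \<Phi> (interior K)" by (metis \<Psi>\<Phi> inj_on_inverseI i subsetD)
  then have "open (\<Phi> ` interior K)"
    by (intro invariance_of_domain continuous_on_subset[OF cont\<Phi>] i open_interior)
  then have "\<Phi> ` interior K \<subseteq> interior P"
    using \<Phi>P i by (intro interior_maximal) blast+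
  then show ?thesis using assms by blast
qed

lemma intK: "interior K \<noteq> {}" using intP \<Psi>_interior by blast

lemma frontierK: assumes "p \<in> P" shows "\<Psi> p \<in> frontier K \<longleftrightarrow> active p \<noteq> {}"
proof -
  have "\<Psi> p \<in> interior K \<longleftrightarrow> p \<in> interior P"
    using \<Psi>_interior \<Phi>_interior[of "\<Psi> p"] \<Phi>\<Psi>[OF assms] by auto
  then show ?thesis using active_frontier[OF assms] \<Psi>K[OF assms] by (simp add: frontier_def)
qed

text \<open>One extension of \<Psi> off the facet is fixed for good. Only its derivatives in
  directions of the facet are determined by \<Psi>.\<close>

definition ext :: "'j \<Rightarrow> 'a \<Rightarrow> 'a" where
  "ext j = (SOME G. \<exists>U. open U \<and> facet J u j \<subseteq> U \<and> Ck_on 1 G U \<and> (\<forall>x\<in>facet J u j. G x = \<Psi> x))"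

definition D :: "'j \<Rightarrow> 'a \<Rightarrow> 'a \<Rightarrow> 'a" where "D j p = frechet_derivative (ext j) (at p)"

lemma ext: assumes j: "j \<in> J"
  shows "\<exists>U. open U \<and> facet J u j \<subseteq> U \<and> Ck_on 1 (ext j) U \<and> (\<forall>x\<in>facet J u j. ext j x = \<Psi> x)"
proof -
  obtain U G where G: "open U" "facet J u j \<subseteq> U" "\<forall>k. Ck_on k G U" "\<forall>x\<in>facet J u j. G x = \<Psi> x"
    using dom j unfolding polytope_type_domain_def smooth_map_on_def by blast
  then have "\<exists>G U. open U \<and> facet J u j \<subseteq> U \<and> Ck_on 1 G U \<and> (\<forall>x\<in>facet J u j. G x = \<Psi> x)" by blast
  then show ?thesis unfolding ext_def by (rule someI_ex)
qed

lemma ext_eq: "j \<in> J \<Longrightarrow> x \<in> facet J u j \<Longrightarrow> ext j x = \<Psi> x" using ext by blast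

lemma D_deriv: "j \<in> J \<Longrightarrow> p \<in> facet J u j \<Longrightarrow> (ext j has_derivative D j p) (at p)"
  unfolding D_def using ext[of j] Ck1D by blast

lemma D_linear: "j \<in> J \<Longrightarrow> p \<in> facet J u j \<Longrightarrow> linear (D j p)"
  using D_deriv has_derivative_linear by blast

lemma D_cont: assumes j: "j \<in> J" shows "continuous_on (facet J u j) (\<lambda>p. D j p v)"
  unfolding D_def using ext[OF j] Ck1_continuous continuous_on_subset by blast

lemma facetP: "p \<in> facet J u j \<Longrightarrow> p \<in> P" by (simp add: memF)

lemma pieceK: "j \<in> J \<Longrightarrow> x \<in> piece J u \<Psi> j \<Longrightarrow> x \<in> frontier K"
  using frontierK by (force simp: piece_def active_def memF)

lemma frontier_param: assumes "x \<in> frontier K" shows "\<Phi> x \<in> P" "\<Psi> (\<Phi> x) = x" "active (\<Phi> x) \<noteq> {}"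
proof -
  have "x \<in> closure K" using assms by (simp add: frontier_def)
  then show *: "\<Phi> x \<in> P" "\<Psi> (\<Phi> x) = x" using \<Phi>P \<Psi>\<Phi> by auto
  then show "active (\<Phi> x) \<noteq> {}" using frontierK assms by metis
qed

text \<open>Tangency is expressed through the differential of the parametrisation instead of
  \<open>tangent_space\<close>, because this condition passes to limits along the facet. At a point
  of several facets each of them has its own normal.\<close>

definition face_normal :: "'j \<Rightarrow> 'a \<Rightarrow> 'a \<Rightarrow> bool" where
  "face_normal k p N \<longleftrightarrow> norm N = 1 \<and> N \<in> normal_cone K (\<Psi> p) \<and> (\<forall>v. coef (u k) \<bullet> v = 0 \<longrightarrow> N \<bullet> D k p v = 0)"

text \<open>All defining conditions are closed under convergence. In this way normals at corners are
  obtained from regular points.\<close>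

lemma face_normal_limit:
  assumes k: "k \<in> J" and pn: "\<And>n. pn n \<in> facet J u k" "pn \<longlonglongrightarrow> p" and N: "\<And>n. face_normal k (pn n) (N n)" "N \<longlonglongrightarrow> N0"
  shows "p \<in> facet J u k" "face_normal k p N0"
proof -
  show pF: "p \<in> facet J u k" using closedF[OF k] pn closed_sequentially by blast
  have c\<Psi>: "(\<lambda>n. \<Psi> (pn n)) \<longlonglongrightarrow> \<Psi> p"
    by (rule continuous_on_tendsto_compose[OF cont\<Psi> pn(2)]) (use pF[THEN facetP] pn(1)[THEN facetP] in auto)
  have cD: "(\<lambda>n. D k (pn n) v) \<longlonglongrightarrow> D k p v" for v
    by (rule continuous_on_tendsto_compose[OF D_cont[OF k] pn(2)]) (use pF pn(1) in auto)
  have "(\<lambda>n. norm (N n)) \<longlonglongrightarrow> norm N0" using N(2) by (rule tendsto_norm)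
  moreover have "(\<lambda>n. norm (N n)) = (\<lambda>n. 1)" using N(1) by (simp add: face_normal_def)
  ultimately have 1: "norm N0 = 1" by (simp add: LIMSEQ_const_iff)
  have 2: "N0 \<in> normal_cone K (\<Psi> p)"
    unfolding normal_cone_def
  proof clarify
    fix y assume "y \<in> K"
    then have "\<forall>n. N n \<bullet> (y - \<Psi> (pn n)) \<le> 0" using N(1) by (simp add: face_normal_def normal_cone_def)
    moreover have "(\<lambda>n. N n \<bullet> (y - \<Psi> (pn n))) \<longlonglongrightarrow> N0 \<bullet> (y - \<Psi> p)" by (intro tendsto_intros N(2) c\<Psi>)
    ultimately show "N0 \<bullet> (y - \<Psi> p) \<le> 0" using LIMSEQ_le_const2 by blast
  qed
  have 3: "N0 \<bullet> D k p v = 0" if "coef (u k) \<bullet> v = 0" for v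
  proof -
    have "(\<lambda>n. N n \<bullet> D k (pn n) v) \<longlonglongrightarrow> N0 \<bullet> D k p v" by (intro tendsto_intros N(2) cD)
    moreover have "(\<lambda>n. N n \<bullet> D k (pn n) v) = (\<lambda>n. 0)" using N(1) that by (simp add: face_normal_def)
    ultimately show ?thesis by (simp add: LIMSEQ_const_iff)
  qed
  show "face_normal k p N0" using 1 2 3 by (simp add: face_normal_def)
qed

text \<open>At a point with a single active inequality, the image of a line in the facet touches the
  supporting hyperplane from one side in both directions.\<close>

lemma regular_face_normal:
  assumes k: "k \<in> J" and p: "p \<in> facet J u k" and act: "active p = {k}"
    and N: "N \<in> normal_cone K (\<Psi> p)" and v: "coef (u k) \<bullet> v = 0"
  shows "N \<bullet> D k p v = 0"
proof -
  have neg: "u l p < 0" if "l \<in> J - {k}" for l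
    using p act that by (force simp: memF memP active_def)
  \<comment> \<open>The open set of parameters for which the line through \<open>p\<close> satisfies
    the remaining inequalities strictly and so stays in the facet. On it
    \<open>N \<bullet> ext k (p + s *\<^sub>R v)\<close> is maximal at \<open>s = 0\<close>.\<close>
  define S where "S = (\<Inter>l\<in>J - {k}. {s. u l (p + s *\<^sub>R v) < 0})"
  have oS: "open S" unfolding S_def
  proof (intro open_INT ballI open_Collect_less continuous_on_const)
    fix l assume "l \<in> J - {k}"
    then have "(\<lambda>s. u l (p + s *\<^sub>R v)) = (\<lambda>s. u l p + s * (coef (u l) \<bullet> v))" using aff_dir by auto
    then show "continuous_on UNIV (\<lambda>s. u l (p + s *\<^sub>R v))"
      by (simp only:) (intro continuous_intros)
  qed (use fin in auto)
  have S0: "0 \<in> S" using neg by (auto simp: S_def)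
  have inF: "p + s *\<^sub>R v \<in> facet J u k" if "s \<in> S" for s
  proof -
    have z: "u k (p + s *\<^sub>R v) = 0" using p v by (simp add: aff_dir[OF k] memF)
    then show ?thesis using that unfolding memF memP S_def by (metis (mono_tags, lifting) DiffI INT_D insert_iff empty_iff less_imp_le mem_Collect_eq order_refl)
  qed
  have der: "((\<lambda>s. N \<bullet> ext k (p + s *\<^sub>R v)) has_derivative (\<lambda>h. N \<bullet> D k p (h *\<^sub>R v))) (at 0)"
    by (intro has_derivative_inner_right has_derivative_compose[where g = "ext k" and f = "\<lambda>s. p + s *\<^sub>R v"])
      (auto intro!: derivative_eq_intros D_deriv k p)
  have "N \<bullet> ext k (p + s *\<^sub>R v) \<le> N \<bullet> ext k (p + 0 *\<^sub>R v)" if "s \<in> S" for s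
    using normal_cone_closure[OF N \<Psi>K[OF facetP[OF inF[OF that]]]] ext_eq[OF k inF[OF that]] ext_eq[OF k p]
    by (simp add: inner_diff_right)
  then have "(\<lambda>h. N \<bullet> D k p (h *\<^sub>R v)) = (\<lambda>h. 0)"
    using differential_zero_maxmin[OF S0 oS der] by blast
  from fun_cong[OF this, of 1] show ?thesis by simp
qed

lemma normal_exists:
  assumes "x \<in> frontier K" shows "\<exists>N. norm N = 1 \<and> N \<in> normal_cone K x"
proof -
  have "x \<in> closure K" "x \<notin> interior (closure K)"
    using assms convex_interior_closure[OF convK] by (auto simp: frontier_def)
  moreover have "rel_interior (closure K) = interior (closure K)"
    using intK convex_interior_closure[OF convK] by (intro rel_interior_nonempty_interior) simp
  ultimately obtain a where a: "a \<noteq> 0" "\<And>y. y \<in> closure K \<Longrightarrow> a \<bullet> x \<le> a \<bullet> y"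
    using supporting_hyperplane_rel_boundary[of "closure K" x] convK by (metis convex_closure)
  have "sgn (- a) \<in> normal_cone K x"
    unfolding normal_cone_def using a(2) closure_subset
    by (auto simp: sgn_div_norm inner_diff_right mult_left_mono divide_simps)
  moreover have "norm (sgn (- a)) = 1" using a(1) by (simp add: norm_sgn)
  ultimately show ?thesis by blast
qed

text \<open>Along the segment from \<open>p\<close> to a facet witness only inequality
  \<open>k\<close> is active, so any outer normal there is a face normal by
  \<open>regular_face_normal\<close>. Unit normals subconverge as the points tend to
  \<open>p\<close>.\<close>

lemma face_normal_exists:
  assumes k: "k \<in> J" and p: "p \<in> facet J u k"
  shows "\<exists>N. face_normal k p N"
proof -
  obtain q where q: "q \<in> facet J u k" "\<forall>l\<in>J - {k}. u l q < 0" using facet_witness[OF k] by blast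
  define pn where "pn n = p + (1 / real (Suc n)) *\<^sub>R (q - p)" for n
  have pF: "pn n \<in> facet J u k" for n unfolding pn_def by (rule segF[OF k p q(1)]) auto
  have act: "active (pn n) = {k}" for n
  proof -
    have "u l (pn n) < 0" if l: "l \<in> J - {k}" for l
    proof -
      define s where "s = 1 / real (Suc n)"
      have s: "0 < s" "s \<le> 1" by (auto simp: s_def)
      have "u l (pn n) = (1 - s) * u l p + s * u l q" unfolding pn_def s_def[symmetric] using l by (intro aff_comb) auto
      moreover have "(1 - s) * u l p \<le> 0" using p l s by (simp add: memF memP mult_nonneg_nonpos)
      moreover have "s * u l q < 0" using q(2) l s by (simp add: mult_pos_neg)
      ultimately show ?thesis by linarith
    qed
    then show ?thesis using pF[of n] k by (force simp: active_def memF)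
  qed
  have "\<exists>N. face_normal k (pn n) N" for n
  proof -
    have "\<Psi> (pn n) \<in> frontier K" using frontierK[OF facetP[OF pF]] act by simp
    then obtain N where "norm N = 1" "N \<in> normal_cone K (\<Psi> (pn n))" using normal_exists by blast
    then show ?thesis using regular_face_normal[OF k pF act] unfolding face_normal_def by blast
  qed
  then obtain N where N: "\<And>n. face_normal k (pn n) (N n)" by metis
  have "\<forall>n. N n \<in> sphere 0 1" using N by (simp add: face_normal_def)
  then obtain N0 r where r: "strict_mono r" "(N \<circ> r) \<longlonglongrightarrow> N0"
    using compact_sphere[of "0::'a" 1] unfolding compact_def by metis
  have "pn \<longlonglongrightarrow> p + 0 *\<^sub>R (q - p)" unfolding pn_def
    by (intro tendsto_intros LIMSEQ_Suc[OF lim_1_over_n])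
  then have "(pn \<circ> r) \<longlonglongrightarrow> p" using r(1) LIMSEQ_subseq_LIMSEQ by fastforce
  then have "face_normal k p N0"
    using face_normal_limit(2)[OF k, of "pn \<circ> r" p "N \<circ> r" N0] pF N r(2) by simp
  then show ?thesis by blast
qed

lemma facet_direction:
  assumes k: "k \<in> J" and q: "q \<in> facet J u k" "\<forall>l\<in>J - {k}. u l q < 0" and v: "coef (u k) \<bullet> v = 0"
  shows "\<exists>e>0. q + e *\<^sub>R v \<in> facet J u k"
proof -
  have "\<forall>l\<in>J - {k}. \<forall>\<^sub>F e in at_right 0. u l (q + e *\<^sub>R v) < 0"
  proof
    fix l assume l: "l \<in> J - {k}"
    have "((\<lambda>e. u l q + e * (coef (u l) \<bullet> v)) \<longlongrightarrow> u l q + 0 * (coef (u l) \<bullet> v)) (at_right 0)"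
      by (intro tendsto_intros)
    then have "\<forall>\<^sub>F e in at_right 0. u l q + e * (coef (u l) \<bullet> v) < 0"
      by (rule order_tendstoD(2)) (use q(2) l in simp)
    then show "\<forall>\<^sub>F e in at_right 0. u l (q + e *\<^sub>R v) < 0" using l by (simp add: aff_dir)
  qed
  then have "\<forall>\<^sub>F e in at_right 0. \<forall>l\<in>J - {k}. u l (q + e *\<^sub>R v) < 0"
    using fin by (simp add: eventually_ball_finite)
  moreover have "\<forall>\<^sub>F e in at_right 0. (0::real) < e" by (simp add: eventually_at_right_less)
  ultimately have "\<forall>\<^sub>F e in at_right 0. 0 < e \<and> (\<forall>l\<in>J - {k}. u l (q + e *\<^sub>R v) < 0)" by (rule eventually_conj[rotated])
  then obtain e where e: "e > 0" "\<forall>l\<in>J - {k}. u l (q + e *\<^sub>R v) < 0"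
    using eventually_happens'[OF trivial_limit_at_right_real] by blast
  have z: "u k (q + e *\<^sub>R v) = 0" using q(1) v by (simp add: aff_dir[OF k] memF)
  have "q + e *\<^sub>R v \<in> facet J u k"
    unfolding memF memP using z e(2) by (metis DiffI empty_iff insert_iff less_imp_le order_refl)
  then show ?thesis using e(1) by blast
qed

text \<open>The inverse of \<Psi> is Lipschitz, so image points cannot approach each other faster
  than their preimages. Since \<open>p\<close> may lie on the boundary of the facet, a positive
  multiple of \<open>v\<close> is written as the difference of two directions \<open>d1\<close>,
  \<open>d2\<close> pointing into the facet.\<close>

lemma D_injective:
  assumes k: "k \<in> J" and p: "p \<in> facet J u k" and v: "coef (u k) \<bullet> v = 0" and Dv: "D k p v = 0"
  shows "v = 0"
proof -
  obtain q where q: "q \<in> facet J u k" "\<forall>l\<in>J - {k}. u l q < 0" using facet_witness[OF k] by blast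
  obtain e where e: "e > 0" and q2: "q + e *\<^sub>R v \<in> facet J u k"
    using facet_direction[OF k q v] by blast
  obtain M where M: "M-lipschitz_on (closure K) \<Phi>" using \<Phi>(2) by blast
  define d1 where "d1 = q + e *\<^sub>R v - p"
  define d2 where "d2 = q - p"
  have lim: "((\<lambda>s. (ext k (p + s *\<^sub>R d) - ext k p) /\<^sub>R s) \<longlongrightarrow> D k p d) (at_right 0)" for d
    by (rule tendsto_within_subset[OF directional_limit[OF D_deriv[OF k p]]]) simp
  have "((\<lambda>s. M * norm ((ext k (p + s *\<^sub>R d1) - ext k p) /\<^sub>R s - (ext k (p + s *\<^sub>R d2) - ext k p) /\<^sub>R s))
      \<longlongrightarrow> M * norm (D k p d1 - D k p d2)) (at_right 0)"
    by (intro tendsto_intros lim)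
  moreover have "\<forall>\<^sub>F s in at_right 0. norm (e *\<^sub>R v)
      \<le> M * norm ((ext k (p + s *\<^sub>R d1) - ext k p) /\<^sub>R s - (ext k (p + s *\<^sub>R d2) - ext k p) /\<^sub>R s)"
    unfolding eventually_at_right_field
  proof (intro exI[of _ 1] conjI allI impI)
    fix s :: real assume s: "0 < s" "s < 1"
    have f1: "p + s *\<^sub>R d1 \<in> facet J u k" unfolding d1_def by (rule segF[OF k p q2]) (use s in auto)
    have f2: "p + s *\<^sub>R d2 \<in> facet J u k" unfolding d2_def by (rule segF[OF k p q(1)]) (use s in auto)
    have "dist (\<Phi> (\<Psi> (p + s *\<^sub>R d1))) (\<Phi> (\<Psi> (p + s *\<^sub>R d2))) \<le> M * dist (\<Psi> (p + s *\<^sub>R d1)) (\<Psi> (p + s *\<^sub>R d2))"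
      by (rule lipschitz_onD[OF M]) (use \<Psi>K facetP f1 f2 in auto)
    then have "norm (s *\<^sub>R d1 - s *\<^sub>R d2) \<le> M * norm (ext k (p + s *\<^sub>R d1) - ext k (p + s *\<^sub>R d2))"
      using \<Phi>\<Psi>[OF facetP[OF f1]] \<Phi>\<Psi>[OF facetP[OF f2]] ext_eq[OF k f1] ext_eq[OF k f2] by (simp add: dist_norm)
    moreover have "s *\<^sub>R d1 - s *\<^sub>R d2 = s *\<^sub>R (e *\<^sub>R v)" by (simp add: d1_def d2_def scaleR_diff_right[symmetric])
    moreover have "(ext k (p + s *\<^sub>R d1) - ext k p) /\<^sub>R s - (ext k (p + s *\<^sub>R d2) - ext k p) /\<^sub>R s
       = (ext k (p + s *\<^sub>R d1) - ext k (p + s *\<^sub>R d2)) /\<^sub>R s" by (simp add: scaleR_diff_right[symmetric])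
    ultimately show "norm (e *\<^sub>R v) \<le> M * norm ((ext k (p + s *\<^sub>R d1) - ext k p) /\<^sub>R s - (ext k (p + s *\<^sub>R d2) - ext k p) /\<^sub>R s)"
      using s by (simp add: divide_simps abs_mult mult_ac)
  qed simp
  ultimately have "norm (e *\<^sub>R v) \<le> M * norm (D k p d1 - D k p d2)"
    by (intro tendsto_lowerbound) auto
  moreover have "D k p d1 - D k p d2 = e *\<^sub>R D k p v"
    using D_linear[OF k p] by (simp add: linear_diff[symmetric] linear_cmul[symmetric] d1_def d2_def)
  ultimately have "norm (e *\<^sub>R v) \<le> 0" using Dv by simp
  then show "v = 0" using e by (simp add: mult_le_0_iff)
qed

end

lemma velocity_tangent_space:
  "c 0 = x \<Longrightarrow> c ` {0..1} \<subseteq> S \<Longrightarrow> (c has_vector_derivative v) (at 0 within {0..1::real}) \<Longrightarrow> v \<in> tangent_space S x"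
  unfolding tangent_space_def by (intro span_base) blast

lemma tangent_space_subset_hyperplane:
  assumes "\<And>c v. c 0 = x \<Longrightarrow> c ` {0..1} \<subseteq> S \<Longrightarrow> (c has_vector_derivative v) (at 0 within {0..1::real}) \<Longrightarrow> N \<bullet> v = 0"
  shows "tangent_space S x \<subseteq> {v. N \<bullet> v = 0}"
  unfolding tangent_space_def
  by (rule span_minimal) (use assms subspace_hyperplane in \<open>blast+\<close>)

lemma at_0_within_unit: "at 0 within {0..1} = at_right (0::real)"
  by (rule at_within_Icc_at_right) simp

lemma normal_cone_velocity:
  assumes w: "w \<in> normal_cone K x" and c: "c 0 = x" "c ` {0..1} \<subseteq> closure K"
    and d: "(c has_vector_derivative v) (at 0 within {0..1::real})"
  shows "w \<bullet> v \<le> 0"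
proof -
  have "((\<lambda>s. w \<bullet> ((c s - c 0) /\<^sub>R s)) \<longlongrightarrow> w \<bullet> v) (at_right 0)"
    using vector_derivative_limit[OF d] unfolding at_0_within_unit by (intro tendsto_intros)
  moreover have "\<forall>\<^sub>F s in at_right 0. w \<bullet> ((c s - c 0) /\<^sub>R s) \<le> 0"
    unfolding eventually_at_right_field
  proof (intro exI[of _ 1] conjI allI impI)
    fix s :: real assume s: "0 < s" "s < 1"
    then have "c s \<in> closure K" using c(2) by auto
    then have "w \<bullet> (c s - x) \<le> 0" by (rule normal_cone_closure[OF w])
    then show "w \<bullet> ((c s - c 0) /\<^sub>R s) \<le> 0" using s c(1) by (simp add: mult_nonneg_nonpos)
  qed simp
  ultimately show ?thesis by (rule tendsto_upperbound) simp
qed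

context polytope_domain
begin

text \<open>A dimension count: the differential is injective on one hyperplane and maps it into
  another.\<close>

lemma D_range:
  assumes k: "k \<in> J" and p: "p \<in> facet J u k" and N: "face_normal k p N"
  shows "D k p ` {v. coef (u k) \<bullet> v = 0} = {w. N \<bullet> w = 0}"
proof (rule subspace_dim_equal)
  let ?S = "{v. coef (u k) \<bullet> v = 0}"
  have S: "subspace ?S" by (rule subspace_hyperplane)
  note lin = D_linear[OF k p]
  show "subspace (D k p ` ?S)" using lin S by (rule linear_subspace_image)
  show "subspace {w. N \<bullet> w = 0}" by (rule subspace_hyperplane)
  show "D k p ` ?S \<subseteq> {w. N \<bullet> w = 0}" using N by (auto simp: face_normal_def)
  have "inj_on (D k p) ?S"
    using D_injective[OF k p] by (subst linear_injective_on_subspace_0[OF lin S]) auto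
  then have "dim (D k p ` ?S) = dim ?S" using dim_image_eq[OF lin, of ?S] S by (simp add: span_eq_iff[THEN iffD2])
  moreover have "N \<noteq> 0" using N by (auto simp: face_normal_def)
  ultimately show "dim {w. N \<bullet> w = 0} \<le> dim (D k p ` ?S)"
    using coef_nz[OF k] by (simp add: dim_hyperplane)
qed

text \<open>Segments from \<open>p\<close> inside the facet give one-sided velocities, and some
  positive multiple of \<open>v\<close> is a difference of two such directions even if
  \<open>p\<close> lies on the boundary of the facet.\<close>

lemma D_tangent:
  assumes k: "k \<in> J" and p: "p \<in> facet J u k" and v: "coef (u k) \<bullet> v = 0"
  shows "D k p v \<in> tangent_space (piece J u \<Psi> k) (\<Psi> p)"
proof -
  let ?T = "tangent_space (piece J u \<Psi> k) (\<Psi> p)"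
  have sub: "subspace ?T" unfolding tangent_space_def by simp
  have base: "D k p (q - p) \<in> ?T" if q: "q \<in> facet J u k" for q
  proof (rule velocity_tangent_space)
    let ?c = "\<lambda>s. \<Psi> (p + s *\<^sub>R (q - p))"
    have F: "p + s *\<^sub>R (q - p) \<in> facet J u k" if "s \<in> {0..1}" for s using segF[OF k p q] that by simp
    show "?c 0 = \<Psi> p" by simp
    show "?c ` {0..1} \<subseteq> piece J u \<Psi> k" using F by (auto simp: piece_def)
    have "((\<lambda>s. ext k (p + s *\<^sub>R (q - p))) has_derivative (\<lambda>h. D k p (h *\<^sub>R (q - p)))) (at 0 within {0..1})"
      by (rule has_derivative_compose[where g = "ext k" and f = "\<lambda>s. p + s *\<^sub>R (q - p)"])
        (auto intro!: derivative_eq_intros D_deriv k p)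
    then have "((\<lambda>s. ext k (p + s *\<^sub>R (q - p))) has_vector_derivative D k p (q - p)) (at 0 within {0..1})"
      unfolding has_vector_derivative_def using D_linear[OF k p] by (simp add: linear_cmul)
    then show "(?c has_vector_derivative D k p (q - p)) (at 0 within {0..1})"
      by (rule has_vector_derivative_transform[rotated 2]) (use F ext_eq[OF k] in auto)
  qed
  obtain q where q: "q \<in> facet J u k" "\<forall>l\<in>J - {k}. u l q < 0" using facet_witness[OF k] by blast
  obtain e where e: "e > 0" "q + e *\<^sub>R v \<in> facet J u k"
    using facet_direction[OF k q v] by blast
  have "D k p (q + e *\<^sub>R v - p) - D k p (q - p) \<in> ?T" by (intro subspace_diff[OF sub] base q e)
  moreover have "D k p (q + e *\<^sub>R v - p) - D k p (q - p) = e *\<^sub>R D k p v"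
    using D_linear[OF k p] by (simp add: linear_diff[symmetric] linear_cmul[symmetric])
  ultimately have "(1 / e) *\<^sub>R (e *\<^sub>R D k p v) \<in> ?T" using sub by (metis subspace_mul)
  then show ?thesis using e(1) by simp
qed

text \<open>A point of the curve is \<open>\<Psi> y\<close> with \<open>y\<close> in the facet, and
  \<open>y - p\<close> is controlled by the Lipschitz inverse. As \<open>N\<close> annihilates
  \<open>D k p (y - p)\<close>, the product of \<open>N\<close> with the increment of the curve is
  of smaller order than the parameter.\<close>

lemma piece_velocity:
  assumes k: "k \<in> J" and p: "p \<in> facet J u k" and N: "face_normal k p N"
    and w: "w 0 = \<Psi> p" "w ` {0..1} \<subseteq> piece J u \<Psi> k"
    and d: "(w has_vector_derivative v) (at 0 within {0..1::real})"
  shows "N \<bullet> v = 0"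
proof -
  obtain M where M: "M-lipschitz_on (closure K) \<Phi>" using \<Phi>(2) by blast
  have M0: "M \<ge> 0" using M lipschitz_on_nonneg by blast
  have lim: "((\<lambda>s. (w s - w 0) /\<^sub>R s) \<longlongrightarrow> v) (at_right 0)"
    using vector_derivative_limit[OF d] unfolding at_0_within_unit .
  have "continuous (at 0 within {0..1}) w" using d has_vector_derivative_continuous by blast
  then have cw: "(w \<longlongrightarrow> w 0) (at_right 0)" unfolding continuous_within at_0_within_unit .
  have key: "\<bar>N \<bullet> v\<bar> \<le> e * (M * norm v)" if e: "e > 0" for e
  proof -
    obtain r where r: "r > 0" "\<And>y. norm (y - p) < r \<Longrightarrow> norm (ext k y - ext k p - D k p (y - p)) \<le> e * norm (y - p)"
      using D_deriv[OF k p] e unfolding has_derivative_at_alt by blast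
    have "\<forall>\<^sub>F s in at_right 0. dist (w s) (w 0) < r / (M + 1)"
      using cw r(1) M0 by (intro tendstoD) auto
    moreover have "\<forall>\<^sub>F s in at_right 0. 0 < s \<and> s < (1::real)"
      unfolding eventually_at_right_field by (intro exI[of _ 1]) auto
    ultimately have "\<forall>\<^sub>F s in at_right 0. \<bar>N \<bullet> ((w s - w 0) /\<^sub>R s)\<bar> \<le> e * (M * norm ((w s - w 0) /\<^sub>R s))"
    proof eventually_elim
      case (elim s)
      then have "w s \<in> piece J u \<Psi> k" using w(2) by auto
      then obtain y where y: "y \<in> facet J u k" "w s = \<Psi> y" by (auto simp: piece_def)
      have "dist (\<Phi> (\<Psi> y)) (\<Phi> (\<Psi> p)) \<le> M * dist (\<Psi> y) (\<Psi> p)"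
        by (rule lipschitz_onD[OF M]) (use \<Psi>K facetP y p in auto)
      then have yl: "norm (y - p) \<le> M * norm (w s - w 0)"
        using \<Phi>\<Psi>[OF facetP[OF y(1)]] \<Phi>\<Psi>[OF facetP[OF p]] y(2) w(1) by (simp add: dist_norm)
      have "M * norm (w s - w 0) \<le> M * (r / (M + 1))" using elim M0 by (intro mult_left_mono) (auto simp: dist_norm)
      also have "\<dots> < r" using r(1) M0 by (simp add: field_simps)
      finally have "norm (y - p) < r" using yl by linarith
      from r(2)[OF this] have e1: "norm (w s - w 0 - D k p (y - p)) \<le> e * norm (y - p)"
        using ext_eq[OF k] y p w(1) by simp
      have "coef (u k) \<bullet> (y - p) = 0" using aff[OF k, of y p] y(1) p by (simp add: memF)
      then have "N \<bullet> D k p (y - p) = 0" using N by (simp add: face_normal_def)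
      then have "\<bar>N \<bullet> (w s - w 0)\<bar> = \<bar>N \<bullet> (w s - w 0 - D k p (y - p))\<bar>" by (simp add: inner_diff_right)
      also have "\<dots> \<le> norm N * norm (w s - w 0 - D k p (y - p))" by (rule Cauchy_Schwarz_ineq2)
      also have "\<dots> \<le> e * norm (y - p)" using e1 N by (simp add: face_normal_def)
      also have "\<dots> \<le> e * (M * norm (w s - w 0))" using yl e by (intro mult_left_mono) auto
      finally show ?case using elim by (simp add: abs_mult divide_simps mult_ac)
    qed
    moreover have "((\<lambda>s. \<bar>N \<bullet> ((w s - w 0) /\<^sub>R s)\<bar>) \<longlongrightarrow> \<bar>N \<bullet> v\<bar>) (at_right 0)" by (intro tendsto_intros lim)
    moreover have "((\<lambda>s. e * (M * norm ((w s - w 0) /\<^sub>R s))) \<longlongrightarrow> e * (M * norm v)) (at_right 0)" by (intro tendsto_intros lim)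
    ultimately show ?thesis by (intro tendsto_le[OF trivial_limit_at_right_real])
  qed
  have "\<bar>N \<bullet> v\<bar> \<le> 0"
  proof (rule field_le_epsilon)
    fix e :: real assume e: "e > 0"
    define c where "c = M * norm v"
    have c: "c \<ge> 0" using M0 by (simp add: c_def)
    have "\<bar>N \<bullet> v\<bar> \<le> (e / (c + 1)) * c" unfolding c_def by (rule key[unfolded mult.assoc]) (use e c in \<open>simp add: c_def\<close>)
    also have "\<dots> \<le> e" using e c by (simp add: field_simps)
    finally show "\<bar>N \<bullet> v\<bar> \<le> 0 + e" by simp
  qed
  then show ?thesis by simp
qed

lemma tangent_space_piece:
  assumes k: "k \<in> J" and p: "p \<in> facet J u k" and N: "face_normal k p N"
  shows "tangent_space (piece J u \<Psi> k) (\<Psi> p) = {v. N \<bullet> v = 0}"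
proof
  show "tangent_space (piece J u \<Psi> k) (\<Psi> p) \<subseteq> {v. N \<bullet> v = 0}"
    by (rule tangent_space_subset_hyperplane) (rule piece_velocity[OF k p N])
  show "{v. N \<bullet> v = 0} \<subseteq> tangent_space (piece J u \<Psi> k) (\<Psi> p)"
    unfolding D_range[OF k p N, symmetric] using D_tangent[OF k p] by blast
qed

lemma outer_normal_piece:
  assumes "k \<in> J" "p \<in> facet J u k" "face_normal k p N"
  shows "outer_normal K (piece J u \<Psi> k) (\<Psi> p) = N"
  using outer_normal_eqI[OF intK _ _ tangent_space_piece[OF assms]] assms(3) by (simp add: face_normal_def)

lemma face_normal_unique:
  "k \<in> J \<Longrightarrow> p \<in> facet J u k \<Longrightarrow> face_normal k p N \<Longrightarrow> face_normal k p N' \<Longrightarrow> N = N'"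
  by (metis outer_normal_piece)

definition nrm :: "'j \<Rightarrow> 'a \<Rightarrow> 'a" where "nrm k p = outer_normal K (piece J u \<Psi> k) (\<Psi> p)"

lemma activeD: "p \<in> P \<Longrightarrow> k \<in> active p \<Longrightarrow> k \<in> J \<and> p \<in> facet J u k" by (simp add: active_def memF)

lemma nrm: "p \<in> P \<Longrightarrow> k \<in> active p \<Longrightarrow> face_normal k p (nrm k p)"
  unfolding nrm_def using face_normal_exists outer_normal_piece activeD by metis

lemma nrmD: assumes "p \<in> P" "k \<in> active p"
  shows "norm (nrm k p) = 1" "nrm k p \<in> normal_cone K (\<Psi> p)" "nrm k p \<noteq> 0"
  using nrm[OF assms] by (auto simp: face_normal_def)

text \<open>Every normal at a boundary point is generated by the normals of the adjacent pieces: a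
  direction which is strictly inward for all of these would otherwise leave \<open>K\<close>, and the normals at
  nearby boundary points reached from it would accumulate at an adjacent piece normal.\<close>

lemma normal_cone_generated:
  assumes p: "p \<in> P" "active p \<noteq> {}" and v: "\<And>k. k \<in> active p \<Longrightarrow> v \<bullet> nrm k p < 0"
    and w: "w \<in> normal_cone K (\<Psi> p)"
  shows "v \<bullet> w \<le> 0"
proof (rule ccontr)
  assume "\<not> v \<bullet> w \<le> 0"
  then have vw: "w \<bullet> v > 0" by (simp add: inner_commute)
  let ?x = "\<Psi> p"
  have xK: "?x \<in> closure K" using \<Psi>K p by blast
  obtain z where z: "z \<in> interior K" using intK by blast
  obtain m where m: "m > 0" "ball z m \<subseteq> interior K" using z open_contains_ball open_interior by blast
  define d where "d = z - ?x"
  \<comment> \<open>Large enough for \<open>z + v /\<^sub>R C\<close> to stay in the ball about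
    \<open>z\<close>, so that \<open>v + C *\<^sub>R d\<close> points from \<open>?x\<close> into
    the interior of \<open>K\<close>.\<close>
  define C where "C = (norm v + 1) / m"
  have C: "C > 0" unfolding C_def using m by (intro divide_pos_pos add_nonneg_pos) auto
  have "norm v < C * m" using m by (simp add: C_def)
  then have z': "z + v /\<^sub>R C \<in> interior K" using m C by (intro subsetD[OF m(2)]) (simp add: dist_norm field_simps)
  have ex: "\<exists>b. 0 \<le> b \<and> b \<le> C \<and> ?x + s *\<^sub>R (v + b *\<^sub>R d) \<in> frontier K" if s: "0 < s" "s * C \<le> 1" for s
  proof -
    \<comment> \<open>Tilting \<open>v\<close> towards the interior: for parameter 0 the point is
      outside \<open>K\<close> because \<open>w \<bullet> v\<close> is positive, for parameter
      \<open>C\<close> it is inside. In between, the segment meets the frontier.\<close>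
    let ?L = "(\<lambda>b. ?x + s *\<^sub>R (v + b *\<^sub>R d)) ` {0..C}"
    have cL: "connected ?L" by (intro connected_continuous_image continuous_intros connected_Icc)
    have "?x + s *\<^sub>R (v + C *\<^sub>R d) \<in> K"
    proof -
      have "?x - (s * C) *\<^sub>R (?x - (z + v /\<^sub>R C)) \<in> interior K"
        by (rule mem_interior_closure_convex_shrink[OF convK z' xK]) (use s C in auto)
      moreover have "?x - (s * C) *\<^sub>R (?x - (z + v /\<^sub>R C)) = ?x + s *\<^sub>R (v + C *\<^sub>R d)"
      proof -
        have "(s * C) *\<^sub>R (v /\<^sub>R C) = s *\<^sub>R v" using C by simp
        moreover have "?x - (s * C) *\<^sub>R (?x - (z + v /\<^sub>R C)) = ?x + (s * C) *\<^sub>R d + (s * C) *\<^sub>R (v /\<^sub>R C)"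
          unfolding d_def by (simp add: scaleR_diff_right scaleR_add_right)
        ultimately show ?thesis by (simp add: scaleR_add_right)
      qed
      ultimately show ?thesis using interior_subset by auto
    qed
    moreover have "?x + s *\<^sub>R (v + C *\<^sub>R d) \<in> ?L" by (rule image_eqI[OF refl]) (use C in auto)
    ultimately have "?L \<inter> K \<noteq> {}" by blast
    have "?x + s *\<^sub>R (v + 0 *\<^sub>R d) \<notin> K"
    proof
      assume "?x + s *\<^sub>R (v + 0 *\<^sub>R d) \<in> K"
      then have "w \<bullet> (s *\<^sub>R v) \<le> 0" using w by (force simp: normal_cone_def)
      then show False using vw s by (simp add: mult_le_0_iff)
    qed
    moreover have "?x + s *\<^sub>R (v + 0 *\<^sub>R d) \<in> ?L" by (rule image_eqI[OF refl]) (use C in auto)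
    ultimately have "?L - K \<noteq> {}" by blast
    with cL \<open>?L \<inter> K \<noteq> {}\<close> have "?L \<inter> frontier K \<noteq> {}" by (rule connected_Int_frontier)
    then show ?thesis by auto
  qed
  define m0 where "m0 = nat \<lceil>C\<rceil>"
  define sq where "sq n = 1 / real (Suc (n + m0))" for n
  have sq: "0 < sq n" "sq n * C \<le> 1" for n
  proof -
    have "C \<le> real (Suc (n + m0))" unfolding m0_def by linarith
    then show "0 < sq n" "sq n * C \<le> 1" by (auto simp: sq_def divide_simps)
  qed
  obtain b where b: "\<And>n. 0 \<le> b n \<and> b n \<le> C \<and> ?x + sq n *\<^sub>R (v + b n *\<^sub>R d) \<in> frontier K"
    using ex[OF sq] by metis
  define xn where "xn n = ?x + sq n *\<^sub>R (v + b n *\<^sub>R d)" for n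
  have xF: "xn n \<in> frontier K" for n using b by (simp add: xn_def)
  define pn where "pn n = \<Phi> (xn n)" for n
  have pn: "pn n \<in> P" "\<Psi> (pn n) = xn n" "active (pn n) \<noteq> {}" for n
    using frontier_param[OF xF] by (auto simp: pn_def)
  have "\<forall>n. \<exists>k. k \<in> active (pn n)" using pn(3) by blast
  then obtain kn where kn: "\<And>n. kn n \<in> active (pn n)" by metis
  have sq0: "sq \<longlonglongrightarrow> 0" unfolding sq_def
    using LIMSEQ_ignore_initial_segment[OF LIMSEQ_Suc[OF lim_1_over_n], of m0] by simp
  have xlim: "xn \<longlonglongrightarrow> ?x"
  proof -
    have "(\<lambda>n. sq n *\<^sub>R (v + b n *\<^sub>R d)) \<longlonglongrightarrow> 0"
    proof (rule Lim_null_comparison)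
      have "norm (v + b n *\<^sub>R d) \<le> norm v + C * norm d" for n
        by (rule order_trans[OF norm_triangle_ineq]) (use b[of n] in \<open>simp add: mult_right_mono\<close>)
      then show "\<forall>\<^sub>F n in sequentially. norm (sq n *\<^sub>R (v + b n *\<^sub>R d)) \<le> sq n * (norm v + C * norm d)"
        using sq(1) by (simp add: less_imp_le mult_left_mono abs_of_pos)
      show "(\<lambda>n. sq n * (norm v + C * norm d)) \<longlonglongrightarrow> 0" using tendsto_mult_left_zero[OF sq0] by simp
    qed
    then have "(\<lambda>n. ?x + sq n *\<^sub>R (v + b n *\<^sub>R d)) \<longlonglongrightarrow> ?x + 0" by (intro tendsto_intros)
    then show ?thesis by (simp add: xn_def[abs_def])
  qed
  have plim: "pn \<longlonglongrightarrow> p"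
  proof -
    have "(\<lambda>n. \<Phi> (xn n)) \<longlonglongrightarrow> \<Phi> ?x"
      by (rule continuous_on_tendsto_compose[OF cont\<Phi> xlim xK]) (use xF in \<open>auto simp: frontier_def\<close>)
    then show ?thesis using \<Phi>\<Psi>[OF p(1)] by (simp add: pn_def[abs_def])
  qed
  \<comment> \<open>There are finitely many facets, so along a subsequence the frontier points
    belong to one and the same piece.\<close>
  have "range kn \<subseteq> J" using kn by (auto simp: active_def)
  then have "finite (range kn)" using fin finite_subset by blast
  then obtain k where kinf: "infinite {n. kn n = k}"
    using pigeonhole_infinite[of "UNIV::nat set" kn] by auto
  obtain r0 :: "nat \<Rightarrow> nat" where r0: "strict_mono r0" "\<And>n. kn (r0 n) = k"
    using infinite_enumerate[OF kinf] by blast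
  define Nn where "Nn n = nrm k (pn (r0 n))" for n
  have kJ: "k \<in> J" using kn[of "r0 0"] r0(2) by (metis active_def mem_Collect_eq)
  have pF: "pn (r0 n) \<in> facet J u k" and NF: "face_normal k (pn (r0 n)) (Nn n)" for n
    using activeD[OF pn(1) kn[of "r0 n"]] nrm[OF pn(1) kn[of "r0 n"]] r0(2) by (auto simp: Nn_def)
  have cp: "compact (sphere (0::'a) 1 \<times> {0..C})" by (intro compact_Times compact_sphere compact_Icc)
  have all: "\<forall>n. (Nn n, b (r0 n)) \<in> sphere (0::'a) 1 \<times> {0..C}" using NF b by (simp add: face_normal_def)
  obtain l r where l: "l \<in> sphere (0::'a) 1 \<times> {0..C}" "strict_mono r" "((\<lambda>n. (Nn n, b (r0 n))) \<circ> r) \<longlonglongrightarrow> l"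
    using cp[unfolded compact_def, THEN spec, of "\<lambda>n. (Nn n, b (r0 n))", THEN mp, OF all] by blast
  obtain N0 b0 where l0: "l = (N0, b0)" by fastforce
  have lN: "(\<lambda>n. Nn (r n)) \<longlonglongrightarrow> N0" and lb: "(\<lambda>n. b (r0 (r n))) \<longlonglongrightarrow> b0"
    using tendsto_fst[OF l(3)] tendsto_snd[OF l(3)] by (auto simp: o_def l0)
  have "(\<lambda>n. pn (r0 (r n))) \<longlonglongrightarrow> p"
    using LIMSEQ_subseq_LIMSEQ[OF plim strict_mono_o[OF r0(1) l(2)]] by (simp add: o_def)
  from face_normal_limit[OF kJ pF this NF lN] have fn: "p \<in> facet J u k" "face_normal k p N0" .
  then have kA: "k \<in> active p" using kJ by (simp add: active_def memF)
  have N0: "N0 = nrm k p" using face_normal_unique[OF kJ fn(1,2) nrm[OF p(1) kA]] .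
  \<comment> \<open>\<open>?x\<close> lies on the inner side of the supporting hyperplane at the
    frontier point, which is reached from \<open>?x\<close> in the direction
    \<open>v + b (r0 n) *\<^sub>R d\<close>. In the limit this contradicts that \<open>N0\<close> is
    negative on both \<open>v\<close> and \<open>d\<close>.\<close>
  have "0 \<le> Nn n \<bullet> (v + b (r0 n) *\<^sub>R d)" for n
  proof -
    have "Nn n \<bullet> (?x - xn (r0 n)) \<le> 0"
      using normal_cone_closure[of "Nn n" K "xn (r0 n)" ?x] NF[of n] pn(2) xK by (simp add: face_normal_def)
    then have "sq (r0 n) * (Nn n \<bullet> (v + b (r0 n) *\<^sub>R d)) \<ge> 0" by (simp add: xn_def)
    then show ?thesis using sq(1)[of "r0 n"] by (simp add: zero_le_mult_iff)
  qed
  moreover have "(\<lambda>n. Nn (r n) \<bullet> (v + b (r0 (r n)) *\<^sub>R d)) \<longlonglongrightarrow> N0 \<bullet> (v + b0 *\<^sub>R d)"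
    by (intro tendsto_intros lN lb)
  ultimately have "0 \<le> N0 \<bullet> (v + b0 *\<^sub>R d)" using LIMSEQ_le_const by blast
  moreover have "N0 \<bullet> v < 0" using v[OF kA] N0 by (simp add: inner_commute)
  moreover have "N0 \<bullet> d < 0" unfolding d_def N0
    by (rule normal_cone_interior[OF nrmD(2)[OF p(1) kA] nrmD(3)[OF p(1) kA] z])
  moreover have "b0 \<ge> 0" using l(1) by (simp add: l0)
  ultimately show False by (simp add: inner_add_right) (smt (verit) mult_nonneg_nonpos)
qed

text \<open>Adding a small multiple of a direction to an interior point makes the inequalities
  strict, so that \<open>normal_cone_generated\<close> applies; the multiple then tends to
  0.\<close>

lemma normal_cone_generated_le:
  assumes p: "p \<in> P" "active p \<noteq> {}" and v: "\<And>k. k \<in> active p \<Longrightarrow> v \<bullet> nrm k p \<le> 0"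
    and w: "w \<in> normal_cone K (\<Psi> p)"
  shows "v \<bullet> w \<le> 0"
proof -
  obtain z where z: "z \<in> interior K" using intK by blast
  have "(v + e *\<^sub>R (z - \<Psi> p)) \<bullet> w \<le> 0" if e: "e > 0" for e
  proof (rule normal_cone_generated[OF p _ w])
    fix k assume k: "k \<in> active p"
    have "nrm k p \<bullet> (z - \<Psi> p) < 0" by (rule normal_cone_interior[OF nrmD(2,3)[OF p(1) k] z])
    then have "e * ((z - \<Psi> p) \<bullet> nrm k p) < 0" using e by (simp add: mult_pos_neg inner_commute)
    then show "(v + e *\<^sub>R (z - \<Psi> p)) \<bullet> nrm k p < 0" using v[OF k] by (simp add: inner_add_left)
  qed
  then have "\<forall>\<^sub>F e in at_right 0. (v + e *\<^sub>R (z - \<Psi> p)) \<bullet> w \<le> 0"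
    unfolding eventually_at_right_field by (intro exI[of _ 1]) auto
  moreover have "((\<lambda>e. (v + e *\<^sub>R (z - \<Psi> p)) \<bullet> w) \<longlongrightarrow> (v + 0 *\<^sub>R (z - \<Psi> p)) \<bullet> w) (at_right 0)"
    by (intro tendsto_intros)
  ultimately have "(v + 0 *\<^sub>R (z - \<Psi> p)) \<bullet> w \<le> 0" by (intro tendsto_upperbound) auto
  then show ?thesis by simp
qed

text \<open>To obtain a strict sign against an arbitrary outer normal,
  \<open>normal_cone_generated\<close> is applied to \<open>v - e *\<^sub>R d\<close>, where
  \<open>d\<close> leads to an interior point. The strictly negative product with \<open>d\<close>
  supplies the missing margin.\<close>

lemma inner_direction_active:
  assumes p: "p \<in> P" "active p \<noteq> {}" and v: "\<And>k. k \<in> active p \<Longrightarrow> v \<bullet> nrm k p < 0"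
  shows "\<exists>t>0. \<Psi> p + t *\<^sub>R v \<in> interior K"
proof (rule inner_direction[OF convK intK \<Psi>K[OF p(1)]])
  fix w assume w: "w \<in> normal_cone K (\<Psi> p)" "w \<noteq> 0"
  obtain z where z: "z \<in> interior K" using intK by blast
  define d where "d = z - \<Psi> p"
  have "\<forall>k\<in>active p. \<forall>\<^sub>F e in at_right 0. (v - e *\<^sub>R d) \<bullet> nrm k p < 0"
  proof
    fix k assume k: "k \<in> active p"
    have "((\<lambda>e. (v - e *\<^sub>R d) \<bullet> nrm k p) \<longlongrightarrow> (v - 0 *\<^sub>R d) \<bullet> nrm k p) (at_right 0)" by (intro tendsto_intros)
    then show "\<forall>\<^sub>F e in at_right 0. (v - e *\<^sub>R d) \<bullet> nrm k p < 0"
      by (rule order_tendstoD(2)) (use v[OF k] in simp)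
  qed
  moreover have "finite (active p)" using fin by (simp add: active_def)
  ultimately have "\<forall>\<^sub>F e in at_right 0. \<forall>k\<in>active p. (v - e *\<^sub>R d) \<bullet> nrm k p < 0"
    by (simp add: eventually_ball_finite)
  moreover have "\<forall>\<^sub>F e in at_right 0. (0::real) < e" by (simp add: eventually_at_right_less)
  ultimately have "\<forall>\<^sub>F e in at_right 0. (0::real) < e \<and> (\<forall>k\<in>active p. (v - e *\<^sub>R d) \<bullet> nrm k p < 0)"
    by (rule eventually_conj[rotated])
  then obtain e where e: "e > 0" "\<And>k. k \<in> active p \<Longrightarrow> (v - e *\<^sub>R d) \<bullet> nrm k p < 0"
    using eventually_happens'[OF trivial_limit_at_right_real] by blast
  have "(v - e *\<^sub>R d) \<bullet> w \<le> 0" using normal_cone_generated[OF p e(2) w(1)] .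
  moreover have "w \<bullet> d < 0" unfolding d_def using normal_cone_interior[OF w z] .
  then have "e * (d \<bullet> w) < 0" using e(1) by (simp add: mult_pos_neg inner_commute)
  ultimately have "v \<bullet> w < 0" by (simp add: inner_diff_left)
  then show "w \<bullet> v < 0" by (simp add: inner_commute)
qed

text \<open>A velocity of a curve in the whole frontier has nonpositive product with the piece
  normal. If the product were negative, \<open>inner_direction_active\<close> would make the curve
  enter the interior of \<open>K\<close>. So frontier and piece have the same tangent space
  here.\<close>

lemma outer_normal_regular:
  assumes p: "p \<in> P" and a: "active p = {k}"
  shows "outer_normal K (frontier K) (\<Psi> p) = nrm k p"
proof (rule outer_normal_eqI[OF intK])
  have k: "k \<in> active p" using a by simp
  note kJ = activeD[OF p k]
  show "norm (nrm k p) = 1" "nrm k p \<in> normal_cone K (\<Psi> p)" using nrmD[OF p k] by auto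
  show "tangent_space (frontier K) (\<Psi> p) = {v. nrm k p \<bullet> v = 0}"
  proof
    have "piece J u \<Psi> k \<subseteq> frontier K" using pieceK kJ by blast
    then have "tangent_space (piece J u \<Psi> k) (\<Psi> p) \<subseteq> tangent_space (frontier K) (\<Psi> p)"
      unfolding tangent_space_def by (intro span_mono) blast
    then show "{v. nrm k p \<bullet> v = 0} \<subseteq> tangent_space (frontier K) (\<Psi> p)"
      using tangent_space_piece[OF _ _ nrm[OF p k]] kJ by simp
    show "tangent_space (frontier K) (\<Psi> p) \<subseteq> {v. nrm k p \<bullet> v = 0}"
    proof (rule tangent_space_subset_hyperplane)
      fix c v assume c: "c 0 = \<Psi> p" "c ` {0..1} \<subseteq> frontier K" and d: "(c has_vector_derivative v) (at 0 within {0..1::real})"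
      have "nrm k p \<bullet> v \<le> 0"
        by (rule normal_cone_velocity[OF nrmD(2)[OF p k] c(1) _ d]) (use c(2) in \<open>auto simp: frontier_def\<close>)
      moreover have "\<not> nrm k p \<bullet> v < 0"
      proof
        assume neg: "nrm k p \<bullet> v < 0"
        obtain t where t: "t > 0" "\<Psi> p + t *\<^sub>R v \<in> interior K"
          using inner_direction_active[OF p, of v] a neg by (auto simp: inner_commute)
        have "((\<lambda>s. \<Psi> p + t *\<^sub>R ((c s - c 0) /\<^sub>R s)) \<longlongrightarrow> \<Psi> p + t *\<^sub>R v) (at_right 0)"
          using vector_derivative_limit[OF d] unfolding at_0_within_unit by (intro tendsto_intros)
        then have "\<forall>\<^sub>F s in at_right 0. \<Psi> p + t *\<^sub>R ((c s - c 0) /\<^sub>R s) \<in> interior K"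
          using t(2) by (rule topological_tendstoD[OF _ open_interior])
        moreover have "\<forall>\<^sub>F s in at_right 0. 0 < s \<and> s < min 1 t"
          unfolding eventually_at_right_field using t(1) by (intro exI[of _ "min 1 t"]) auto
        ultimately have "\<forall>\<^sub>F s in at_right 0. 0 < s \<and> s < min 1 t \<and> \<Psi> p + t *\<^sub>R ((c s - c 0) /\<^sub>R s) \<in> interior K"
          by eventually_elim auto
        then obtain s where s: "0 < s" "s < 1" "s < t" "\<Psi> p + t *\<^sub>R ((c s - c 0) /\<^sub>R s) \<in> interior K"
          using eventually_happens'[OF trivial_limit_at_right_real] by force
        have "\<Psi> p - (s / t) *\<^sub>R (\<Psi> p - (\<Psi> p + t *\<^sub>R ((c s - c 0) /\<^sub>R s))) \<in> interior K"
          by (rule mem_interior_closure_convex_shrink[OF convK s(4) \<Psi>K[OF p]]) (use s t in auto)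
        moreover have "\<Psi> p - (s / t) *\<^sub>R (\<Psi> p - (\<Psi> p + t *\<^sub>R ((c s - c 0) /\<^sub>R s))) = c s"
          using s t(1) c(1) by simp
        ultimately have "c s \<in> interior K" by simp
        moreover have "c s \<in> frontier K" using c(2) s by auto
        ultimately show False by (simp add: frontier_def)
      qed
      ultimately show "nrm k p \<bullet> v = 0" by linarith
    qed
  qed
qed

text \<open>Brings conditions stated separately on the regular part and on the edges into one form,
  a condition on all active normals.\<close>

lemma boundary_point:
  assumes x: "x \<in> Reg J u \<Psi> \<union> Sing0 J u \<Psi>"
    and reg: "x \<in> Reg J u \<Psi> \<Longrightarrow> P1 (outer_normal K (frontier K) x)"
    and sing: "\<And>i j. (i, j) \<in> edge_indices J u \<Longrightarrow> x \<in> edge_interior J u \<Psi> i j \<Longrightarrow>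
        P1 (outer_normal K (piece J u \<Psi> i) x) \<and> P1 (outer_normal K (piece J u \<Psi> j) x)"
  shows "\<exists>p\<in>P. x = \<Psi> p \<and> active p \<noteq> {} \<and> (\<forall>k\<in>active p. P1 (nrm k p))"
  using x
proof
  assume x: "x \<in> Reg J u \<Psi>"
  then obtain k p where k: "k \<in> J" "p \<in> rel_interior (facet J u k)" "x = \<Psi> p" by (auto simp: Reg_def)
  note a = active_facet[OF k(1,2)]
  have "P1 (nrm k p)" using reg[OF x] outer_normal_regular[OF a] k(3) by simp
  then show ?thesis using a k(3) by auto
next
  assume "x \<in> Sing0 J u \<Psi>"
  then obtain i j where ij: "(i, j) \<in> edge_indices J u" "x \<in> edge_interior J u \<Psi> i j" by (auto simp: Sing0_def)
  then obtain p where p: "p \<in> rel_interior (facet J u i \<inter> facet J u j)" "x = \<Psi> p" by (auto simp: edge_interior_def)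
  note a = active_edge[OF ij(1) p(1)]
  show ?thesis using sing[OF ij] a p(2) by (auto simp: nrm_def)
qed

text \<open>The two normals in the free boundary condition are normals of \<open>K\<close>.\<close>

lemma boundary_normals_in_normal_cone:
  shows "x \<in> Reg J u \<Psi> \<Longrightarrow> outer_normal K (frontier K) x \<in> normal_cone K x"
    "(i, j) \<in> edge_indices J u \<Longrightarrow> x \<in> edge_interior J u \<Psi> i j \<Longrightarrow>
       outer_normal K (piece J u \<Psi> i) x \<in> normal_cone K x \<and> outer_normal K (piece J u \<Psi> j) x \<in> normal_cone K x"
proof -
  assume "x \<in> Reg J u \<Psi>"
  then obtain k p where k: "k \<in> J" "p \<in> rel_interior (facet J u k)" "x = \<Psi> p" by (auto simp: Reg_def)
  note a = active_facet[OF k(1,2)]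
  show "outer_normal K (frontier K) x \<in> normal_cone K x"
    using outer_normal_regular[OF a] nrmD(2)[OF a(1), of k] a(2) k(3) by simp
next
  assume ij: "(i, j) \<in> edge_indices J u" "x \<in> edge_interior J u \<Psi> i j"
  then obtain p where p: "p \<in> rel_interior (facet J u i \<inter> facet J u j)" "x = \<Psi> p" by (auto simp: edge_interior_def)
  note a = active_edge[OF ij(1) p(1)]
  show "outer_normal K (piece J u \<Psi> i) x \<in> normal_cone K x \<and> outer_normal K (piece J u \<Psi> j) x \<in> normal_cone K x"
    using nrmD(2)[OF a(1), of i] nrmD(2)[OF a(1), of j] a(2) p(2) by (simp add: nrm_def)
qed

end

section \<open>Divergence of unit fields, principal curvatures and the focal map\<close>

lemma orthonormal_insert_normal:
  fixes N :: "'a::euclidean_space"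
  assumes N: "norm N = 1" and E: "E \<subseteq> {v. v \<bullet> N = 0}" "finite E" "pairwise orthogonal E" "\<forall>e\<in>E. norm e = 1"
    "span E = {v. v \<bullet> N = 0}" "card E = dim {v. v \<bullet> N = 0}"
  shows "N \<notin> E" "finite (insert N E)" "card (insert N E) = DIM('a)" "pairwise orthogonal (insert N E)"
    "\<forall>e\<in>insert N E. norm e = 1" "span (insert N E) = UNIV" "card E = DIM('a) - 1"
proof -
  have NN: "N \<bullet> N = 1" using N by (simp add: dot_square_norm)
  show NE: "N \<notin> E" using E(1) NN by auto
  show f: "finite (insert N E)" using E(2) by simp
  show pw: "pairwise orthogonal (insert N E)"
    using E(1,3) by (auto simp: pairwise_insert orthogonal_def inner_commute)
  show nm: "\<forall>e\<in>insert N E. norm e = 1" using E(4) N by auto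
  have "N \<noteq> 0" using N by auto
  then have "dim {v. N \<bullet> v = 0} = DIM('a) - 1" by (rule dim_hyperplane)
  then show c: "card E = DIM('a) - 1" using E(6) by (simp add: inner_commute)
  then show c2: "card (insert N E) = DIM('a)" using NE E(2) by (simp add: Suc_leI)
  show "span (insert N E) = UNIV"
  proof -
    have "v \<in> span (insert N E)" for v
    proof -
      have "v - (v \<bullet> N) *\<^sub>R N \<in> span E" unfolding E(5) using NN by (simp add: inner_diff_left)
      then show ?thesis by (auto simp: span_insert)
    qed
    then show ?thesis by blast
  qed
qed

lemma orthonormal_basis_with_normal:
  fixes N :: "'a::euclidean_space"
  assumes N: "norm N = 1"
  shows "\<exists>E. E \<subseteq> {v. v \<bullet> N = 0} \<and> finite E \<and> pairwise orthogonal E \<and> (\<forall>e\<in>E. norm e = 1) \<and>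
     span E = {v. v \<bullet> N = 0} \<and> card E = dim {v. v \<bullet> N = 0}"
proof -
  have "subspace {v. v \<bullet> N = 0}" using subspace_hyperplane[of N] by (simp add: inner_commute)
  from orthonormal_basis_subspace[OF this] show ?thesis by (metis independent_imp_finite)
qed

text \<open>A unit field does not turn in its own direction, so its divergence is its tangential trace.\<close>

lemma trace_unit_field:
  fixes f :: "'a::euclidean_space \<Rightarrow> 'a"
  assumes f: "linear f" and N: "norm N = 1" and orth: "\<And>v. N \<bullet> f v = 0"
    and E: "E \<subseteq> {v. v \<bullet> N = 0}" "finite E" "pairwise orthogonal E" "\<forall>e\<in>E. norm e = 1"
    "span E = {v. v \<bullet> N = 0}" "card E = dim {v. v \<bullet> N = 0}"
  shows "(\<Sum>b\<in>Basis. f b \<bullet> b) = (\<Sum>e\<in>E. f e \<bullet> e)"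
proof -
  note I = orthonormal_insert_normal[OF N E]
  have "(\<Sum>b\<in>Basis. f b \<bullet> b) = (\<Sum>e\<in>insert N E. f e \<bullet> e)"
    by (rule trace_orthonormal_basis[OF f I(2,4,5,6)])
  then show ?thesis using I(1) E(2) orth[of N] by (simp add: inner_commute)
qed

lemma unit_field_derivative_orthogonal:
  assumes "open U" "x \<in> U" "\<And>y. y \<in> U \<Longrightarrow> norm (h y) = 1" "(h has_derivative h') (at x)"
  shows "h x \<bullet> h' v = 0"
proof -
  have "((\<lambda>y. h y \<bullet> h y) has_derivative (\<lambda>v. h x \<bullet> h' v + h' v \<bullet> h x)) (at x)"
    by (intro has_derivative_inner assms)
  then have "((\<lambda>y. 1) has_derivative (\<lambda>v. h x \<bullet> h' v + h' v \<bullet> h x)) (at x)"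
    by (rule has_derivative_transform_within_open[OF _ assms(1,2)]) (simp add: assms(3) dot_square_norm)
  from has_derivative_unique[OF this has_derivative_const] have "h x \<bullet> h' v + h' v \<bullet> h x = 0" by metis
  then show ?thesis by (simp add: inner_commute)
qed

definition shape_trace :: "('a::euclidean_space \<Rightarrow> real) \<Rightarrow> 'a \<Rightarrow> real" where
  "shape_trace g x = (\<Sum>b\<in>Basis. shape g x b \<bullet> b)"

text \<open>The derivative of \<open>x \<mapsto> x - t \<nu>(x)\<close> on the tangent space, completed by the identity on the
  normal line.\<close>

definition focal_map :: "('a::euclidean_space \<Rightarrow> real) \<Rightarrow> 'a \<Rightarrow> real \<Rightarrow> 'a \<Rightarrow> 'a" where
  "focal_map g x t w = w - t *\<^sub>R shape g x (w - (w \<bullet> unit_gradient g x) *\<^sub>R unit_gradient g x)"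

lemma Ck_on_subset: "Ck_on k f U \<Longrightarrow> V \<subseteq> U \<Longrightarrow> Ck_on k f V"
  by (induction k arbitrary: f) (auto intro: continuous_on_subset)

lemma C2_equation_subset: "C2_equation \<Sigma> U g \<Longrightarrow> open V \<Longrightarrow> V \<subseteq> U \<Longrightarrow> C2_equation \<Sigma> V g"
  unfolding C2_equation_def using Ck_on_subset by blast

lemma shape_linear: "C2_equation \<Sigma> U g \<Longrightarrow> x \<in> U \<Longrightarrow> linear (shape g x)"
  using unit_gradient_C1(5) has_derivative_linear by blast

lemma focal_map_linear:
  assumes "C2_equation \<Sigma> U g" "x \<in> U" shows "linear (focal_map g x t)"
proof -
  interpret A: linear "shape g x" using shape_linear[OF assms] .
  show ?thesis unfolding focal_map_def
    by (rule linearI) (simp_all add: A.diff A.add A.scaleR inner_add_left scaleR_add_left scaleR_add_right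
      scaleR_diff_right mult.left_commute)
qed

text \<open>An eigenbasis of the shape operator on the tangent hyperplane, completed by the unit
  normal, diagonalises every \<open>focal_map g x t\<close>: the eigenvalue is 1 on the normal and
  \<open>1 - t * l e\<close> on a principal direction.\<close>

lemma principal_curvatures:
  fixes g :: "'a::euclidean_space \<Rightarrow> real"
  assumes E: "C2_equation \<Sigma> U g" and x: "x \<in> U"
  shows "\<exists>E l. finite E \<and> card E = DIM('a) - 1 \<and> (\<forall>e\<in>E. e \<bullet> unit_gradient g x = 0 \<and> norm e = 1 \<and> shape g x e = l e *\<^sub>R e) \<and>
    (\<Sum>e\<in>E. l e) = shape_trace g x \<and> (\<forall>t. absdet (focal_map g x t) = \<bar>\<Prod>e\<in>E. (1 - t * l e)\<bar>)"
proof -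
  let ?N = "unit_gradient g x" and ?A = "shape g x"
  let ?S = "{v. v \<bullet> ?N = 0}"
  note G = unit_gradient_C1[OF E]
  have N: "norm ?N = 1" using G(2)[OF x] .
  have S: "subspace ?S" using subspace_hyperplane[of ?N] by (simp add: inner_commute)
  have lin: "linear ?A" using shape_linear[OF E x] .
  have "\<exists>B l. B \<subseteq> ?S \<and> pairwise orthogonal B \<and> (\<forall>b\<in>B. norm b = 1) \<and> span B = ?S \<and>
      finite B \<and> card B = dim ?S \<and> (\<forall>b\<in>B. ?A b = l b *\<^sub>R b)"
    by (rule selfadjoint_eigenbasis[OF lin S]) (use G(3,4) x in \<open>auto simp: inner_commute\<close>)
  then obtain B l where B: "B \<subseteq> ?S" "pairwise orthogonal B" "\<forall>b\<in>B. norm b = 1" "span B = ?S"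
      "finite B" "card B = dim ?S" "\<forall>b\<in>B. ?A b = l b *\<^sub>R b" by blast
  note I = orthonormal_insert_normal[OF N B(1,5,2,3,4,6)]
  have tr: "(\<Sum>e\<in>B. l e) = shape_trace g x"
  proof -
    have "shape_trace g x = (\<Sum>e\<in>B. ?A e \<bullet> e)"
      unfolding shape_trace_def by (rule trace_unit_field[OF lin N _ B(1,5,2,3,4,6)]) (rule G(3)[OF x])
    also have "\<dots> = (\<Sum>e\<in>B. l e)" using B(3,7) by (intro sum.cong) (auto simp: dot_square_norm)
    finally show ?thesis by simp
  qed
  have det: "absdet (focal_map g x t) = \<bar>\<Prod>e\<in>B. (1 - t * l e)\<bar>" for t
  proof -
    define m where "m e = (if e = ?N then 1 else 1 - t * l e)" for e
    have "absdet (focal_map g x t) = \<bar>\<Prod>e\<in>insert ?N B. m e\<bar>"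
    proof (rule absdet_eigenbasis[OF focal_map_linear[OF E x] I(2,3,4,5)])
      show "\<forall>e\<in>insert ?N B. focal_map g x t e = m e *\<^sub>R e"
      proof
        fix e assume "e \<in> insert ?N B"
        then consider "e = ?N" | "e \<in> B" "e \<noteq> ?N" by blast
        then show "focal_map g x t e = m e *\<^sub>R e"
        proof cases
          case 1
          then show ?thesis using N lin by (simp add: focal_map_def m_def dot_square_norm linear_0)
        next
          case 2
          then show ?thesis using B(1,7) by (auto simp: focal_map_def m_def scaleR_diff_left)
        qed
      qed
    qed
    also have "(\<Prod>e\<in>insert ?N B. m e) = (\<Prod>e\<in>B. m e)" using I(1) B(5) by (simp add: m_def)
    also have "\<dots> = (\<Prod>e\<in>B. (1 - t * l e))" using I(1) by (intro prod.cong) (auto simp: m_def)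
    finally show ?thesis .
  qed
  show ?thesis using B I(7) tr det by (intro exI[of _ B] exI[of _ l]) auto
qed

lemma prod_le_mean_power:
  fixes f :: "'b \<Rightarrow> real"
  assumes "finite E" "\<And>e. e \<in> E \<Longrightarrow> f e \<ge> 0" "E \<noteq> {}"
  shows "(\<Prod>e\<in>E. f e) \<le> ((\<Sum>e\<in>E. f e) / card E) ^ card E"
proof -
  let ?P = "\<Prod>e\<in>E. f e" and ?c = "card E"
  have c: "?c > 0" using assms by (simp add: card_gt_0_iff)
  have P0: "?P \<ge> 0" using assms by (intro prod_nonneg) auto
  have "?P powr (1 / ?c) \<le> (\<Sum>e\<in>E. f e / ?c)" using assms by (intro arith_geom_mean) auto
  then have le: "?P powr (1 / ?c) \<le> (\<Sum>e\<in>E. f e) / ?c" by (simp add: sum_divide_distrib)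
  have "?P = (?P powr (1 / ?c)) ^ ?c"
  proof (cases "?P = 0")
    case True then show ?thesis using c by (simp add: power_0_left)
  next
    case False
    then have "(?P powr (1 / ?c)) ^ ?c = ?P powr ((1 / ?c) * ?c)" using P0 by (simp add: powr_realpow[symmetric] powr_powr)
    then show ?thesis using c P0 False by simp
  qed
  also have "\<dots> \<le> ((\<Sum>e\<in>E. f e) / ?c) ^ ?c" using le by (intro power_mono) auto
  finally show ?thesis .
qed

section \<open>The oriented hypersurface: mean curvature and conditions at nearest points\<close>

locale oriented_hypersurface =
  fixes T :: "'n::finite itself" and \<Sigma> :: "'a::euclidean_space set" and \<nu> :: "'a \<Rightarrow> 'a"
  assumes dim: "DIM('a) = CARD('n) + 1"
    and hyp: "compact_C2_hypersurface \<Sigma>"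
    and local_normal: "\<forall>x\<in>\<Sigma>. \<exists>U g. x \<in> U \<and> C2_equation \<Sigma> U g \<and> (\<forall>y\<in>\<Sigma> \<inter> U. \<nu> y = sgn (gradient g y))"
begin

definition eqn :: "'a set \<Rightarrow> ('a \<Rightarrow> real) \<Rightarrow> bool" where
  "eqn U g \<longleftrightarrow> C2_equation \<Sigma> U g \<and> (\<forall>y\<in>\<Sigma> \<inter> U. \<nu> y = unit_gradient g y)"

lemma eqn_exists: "x \<in> \<Sigma> \<Longrightarrow> \<exists>U g. eqn U g \<and> x \<in> U"
  using local_normal unfolding eqn_def unit_gradient_def by blast

lemma eqn_subset: "eqn U g \<Longrightarrow> open V \<Longrightarrow> V \<subseteq> U \<Longrightarrow> eqn V g"
  unfolding eqn_def using C2_equation_subset by blast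

lemma eqnD: "eqn U g \<Longrightarrow> C2_equation \<Sigma> U g" "eqn U g \<Longrightarrow> x \<in> \<Sigma> \<Longrightarrow> x \<in> U \<Longrightarrow> \<nu> x = unit_gradient g x"
  by (auto simp: eqn_def)

lemma compact\<Sigma>: "compact \<Sigma>" and ne\<Sigma>: "\<Sigma> \<noteq> {}" and closed\<Sigma>: "closed \<Sigma>"
  and dense: "\<Sigma> \<subseteq> closure (hs_interior \<Sigma>)"
  using hyp compact_imp_closed by (auto simp: compact_C2_hypersurface_def)

lemma hs_interior_subset: "x \<in> hs_interior \<Sigma> \<Longrightarrow> x \<in> \<Sigma>" by (simp add: hs_interior_def)

lemma norm\<nu>: "x \<in> \<Sigma> \<Longrightarrow> norm (\<nu> x) = 1"
  using eqn_exists unit_gradient_C1(2) eqnD by metis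

lemma locally_continuous:
  assumes "\<And>x. x \<in> \<Sigma> \<Longrightarrow> \<exists>U. open U \<and> x \<in> U \<and> continuous_on (\<Sigma> \<inter> U) f"
  shows "continuous_on \<Sigma> f"
  unfolding continuous_on_eq_continuous_within
proof
  fix x assume x: "x \<in> \<Sigma>"
  then obtain U where U: "open U" "x \<in> U" "continuous_on (\<Sigma> \<inter> U) f" using assms by blast
  then have "continuous (at x within \<Sigma> \<inter> U) f" using x by (simp add: continuous_on_eq_continuous_within)
  then show "continuous (at x within \<Sigma>) f"
    using at_within_nhd[OF U(2,1), of "\<Sigma> \<inter> U" \<Sigma>] by (simp add: Int_ac)
qed

lemma cont\<nu>: "continuous_on \<Sigma> \<nu>"
proof (rule locally_continuous)
  fix x assume "x \<in> \<Sigma>"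
  then obtain U g where U: "eqn U g" "x \<in> U" using eqn_exists by blast
  note E = eqnD(1)[OF U(1)]
  have "continuous_on (\<Sigma> \<inter> U) (unit_gradient g)"
    using unit_gradient_C1(6)[OF E] by (rule continuous_on_subset) auto
  then have "continuous_on (\<Sigma> \<inter> U) \<nu>" by (rule continuous_on_eq) (use eqnD(2)[OF U(1)] in auto)
  then show "\<exists>U. open U \<and> x \<in> U \<and> continuous_on (\<Sigma> \<inter> U) \<nu>" using U C2_equationD(1)[OF E] by blast
qed

lemma interior_chart:
  assumes x: "x \<in> hs_interior \<Sigma>" and g: "eqn U g" "x \<in> U"
  shows "\<exists>(i::(real^'n) \<times> real \<Rightarrow> 'a) k V f W. graph_chart g U i k V f W \<and> x \<in> W \<and> f ` V \<subseteq> \<Sigma>"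
proof -
  obtain W where W: "open W" "x \<in> W" "W \<subseteq> U" "\<Sigma> \<inter> W = {y\<in>W. g y = 0}"
    using hs_interior_any_equation[OF dim eqnD(1)[OF g(1)] x g(2)] by blast
  have gx: "g x = 0" using W hs_interior_subset[OF x] by blast
  obtain i :: "(real^'n) \<times> real \<Rightarrow> 'a" and k V f W' where C: "graph_chart g W i k V f W'" "x \<in> W'"
    using graph_chart_exists[OF dim eqnD(1)[OF eqn_subset[OF g(1) W(1,3)]] W(2) gx] by blast
  have "f ` V \<subseteq> \<Sigma>" using graph_chartD(4,7,8)[OF C(1)] W(4) by blast
  moreover have "graph_chart g U i k V f W'" using C(1) W(3) unfolding graph_chart_def by blast
  ultimately show ?thesis using C(2) by blast
qed

lemma open_hs_interior: "openin (top_of_set \<Sigma>) (hs_interior \<Sigma>)"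
proof (subst openin_subopen, intro ballI)
  fix x assume "x \<in> hs_interior \<Sigma>"
  then obtain U g where U: "x \<in> \<Sigma>" "x \<in> U" "C2_equation \<Sigma> U g" "\<Sigma> \<inter> U = {y\<in>U. g y = 0}" by (auto simp: hs_interior_def)
  have "\<Sigma> \<inter> U \<subseteq> hs_interior \<Sigma>" using U by (auto simp: hs_interior_def)
  moreover have "openin (top_of_set \<Sigma>) (\<Sigma> \<inter> U)" using C2_equationD(1)[OF U(3)] by blast
  ultimately show "\<exists>T. openin (top_of_set \<Sigma>) T \<and> x \<in> T \<and> T \<subseteq> hs_interior \<Sigma>" using U by blast
qed

text \<open>Two extensions of \<nu> coincide along a chart, and derivatives of the chart reach every
  tangent vector.\<close>

lemma tangential_derivative_unique:
  assumes x: "x \<in> hs_interior \<Sigma>" and g: "eqn U g" "x \<in> U"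
    and h: "open U'" "x \<in> U'" "(h has_derivative h') (at x)" "\<And>y. y \<in> \<Sigma> \<inter> U' \<Longrightarrow> h y = \<nu> y"
    and v: "v \<bullet> \<nu> x = 0"
  shows "h' v = shape g x v"
proof -
  have xS: "x \<in> \<Sigma>" using hs_interior_subset[OF x] .
  note E = eqnD(1)[OF g(1)]
  obtain i :: "(real^'n) \<times> real \<Rightarrow> 'a" and k V f W where C: "graph_chart g U i k V f W" "x \<in> W" "f ` V \<subseteq> \<Sigma>"
    using interior_chart[OF x g] by blast
  note C' = graph_chartD[OF C(1)]
  define p where "p = fst (k x)"
  have gx: "g x = 0" using C2_equationD(3)[OF E xS g(2)] .
  have p: "p \<in> V" "f p = x" using C'(9)[OF C(2) gx] by (auto simp: p_def)
  define q where "q = fst (k v)"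
  have "gradient g x = norm (gradient g x) *\<^sub>R \<nu> x" using unit_gradient_C1(7)[OF E] eqnD(2)[OF g(1) xS g(2)] by simp
  then have "v \<bullet> gradient g (f p) = 0" using v p(2) by (metis inner_scaleR_right mult_zero_right)
  then have q: "frechet_derivative f (at p) q = v" unfolding q_def using C'(10)[OF p(1)] by blast
  have d1: "((\<lambda>p. h (f p)) has_derivative (\<lambda>q. h' (frechet_derivative f (at p) q))) (at p)"
    by (rule has_derivative_compose[OF C'(13)[OF p(1)]]) (simp add: p h)
  have d2: "((\<lambda>p. unit_gradient g (f p)) has_derivative (\<lambda>q. shape g x (frechet_derivative f (at p) q))) (at p)"
    by (rule has_derivative_compose[OF C'(13)[OF p(1)]]) (use p unit_gradient_C1(5)[OF E g(2)] in simp)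
  define V' where "V' = V \<inter> f -` U'"
  have "open V'" unfolding V'_def using C'(2,11) h(1) by (metis Int_commute continuous_on_open_vimage)
  moreover have "p \<in> V'" using p h(2) by (simp add: V'_def)
  moreover have "h (f y) = unit_gradient g (f y)" if "y \<in> V'" for y
  proof -
    have y: "y \<in> V" "f y \<in> U'" using that by (auto simp: V'_def)
    then have "f y \<in> \<Sigma>" "f y \<in> U" using C(3) C'(4) C'(7)[OF y(1)] by auto
    then show ?thesis using h(4)[of "f y"] eqnD(2)[OF g(1), of "f y"] y(2) by simp
  qed
  ultimately have "((\<lambda>p. unit_gradient g (f p)) has_derivative (\<lambda>q. h' (frechet_derivative f (at p) q))) (at p)"
    by (intro has_derivative_transform_within_open[OF d1])
  from fun_cong[OF has_derivative_unique[OF this d2], of q] show ?thesis using q by simp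
qed

text \<open>At interior points any two unit extensions have the same tangential derivatives, and the
  normal direction contributes nothing to the trace. At the remaining points the difference of the
  traces vanishes by continuity, as interior points are dense. This evaluates the definite
  description.\<close>

lemma mean_curvature_eq:
  assumes x: "x \<in> \<Sigma>" and g: "eqn U g" "x \<in> U"
  shows "mean_curvature \<Sigma> \<nu> x = shape_trace g x"
proof -
  note E = eqnD(1)[OF g(1)] and U = C2_equationD(1)[OF eqnD(1)[OF g(1)]]
  let ?m = "unit_gradient g"
  show ?thesis unfolding mean_curvature_def
  proof (rule the_equality)
    show "\<exists>U m. open U \<and> x \<in> U \<and> Ck_on 1 m U \<and> (\<forall>y\<in>U. norm (m y) = 1) \<and>
        (\<forall>y\<in>\<Sigma> \<inter> U. m y = \<nu> y) \<and> shape_trace g x = (\<Sum>b\<in>Basis. frechet_derivative m (at x) b \<bullet> b)"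
    proof (intro exI[of _ U] exI[of _ ?m] conjI ballI)
      show "open U" "x \<in> U" "Ck_on 1 ?m U" by (rule U g(2) unit_gradient_C1(1)[OF E])+
      show "norm (?m y) = 1" if "y \<in> U" for y using unit_gradient_C1(2)[OF E that] .
      show "?m y = \<nu> y" if "y \<in> \<Sigma> \<inter> U" for y using eqnD(2)[OF g(1)] that by simp
    qed (simp add: shape_trace_def shape_def)
  next
    fix h assume "\<exists>U m. open U \<and> x \<in> U \<and> Ck_on 1 m U \<and> (\<forall>y\<in>U. norm (m y) = 1) \<and>
        (\<forall>y\<in>\<Sigma> \<inter> U. m y = \<nu> y) \<and> h = (\<Sum>b\<in>Basis. frechet_derivative m (at x) b \<bullet> b)"
    then obtain U' m where U': "open U'" "x \<in> U'" "Ck_on 1 m U'" "\<forall>y\<in>U'. norm (m y) = 1"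
      "\<forall>y\<in>\<Sigma> \<inter> U'. m y = \<nu> y" "h = (\<Sum>b\<in>Basis. frechet_derivative m (at x) b \<bullet> b)" by blast
    define W where "W = U \<inter> U'"
    have W: "open W" "x \<in> W" using U U' g(2) by (auto simp: W_def)
    define f where "f y = (\<Sum>b\<in>Basis. frechet_derivative m (at y) b \<bullet> b) - shape_trace g y" for y
    have eq: "f y = 0" if y: "y \<in> hs_interior \<Sigma>" "y \<in> W" for y
    proof -
      have yS: "y \<in> \<Sigma>" using hs_interior_subset[OF y(1)] .
      have yU: "y \<in> U" "y \<in> U'" using y(2) by (auto simp: W_def)
      have N: "norm (\<nu> y) = 1" using norm\<nu>[OF yS] .
      obtain B where B: "B \<subseteq> {v. v \<bullet> \<nu> y = 0}" "finite B" "pairwise orthogonal B" "\<forall>e\<in>B. norm e = 1"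
        "span B = {v. v \<bullet> \<nu> y = 0}" "card B = Real_Vector_Spaces.dim {v. v \<bullet> \<nu> y = 0}"
        using orthonormal_basis_with_normal[OF N] by blast
      have d: "(m has_derivative frechet_derivative m (at y)) (at y)" using Ck1D[OF U'(3) yU(2)] .
      have "\<nu> y \<bullet> frechet_derivative m (at y) v = 0" for v
        using unit_field_derivative_orthogonal[OF U'(1) yU(2) _ d] U'(4,5) yS yU by auto
      then have 1: "(\<Sum>b\<in>Basis. frechet_derivative m (at y) b \<bullet> b) = (\<Sum>e\<in>B. frechet_derivative m (at y) e \<bullet> e)"
        by (intro trace_unit_field[OF _ N _ B]) (use d has_derivative_linear in auto)
      have 2: "shape_trace g y = (\<Sum>e\<in>B. shape g y e \<bullet> e)"
        unfolding shape_trace_def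
        by (intro trace_unit_field[OF shape_linear[OF E yU(1)] N _ B]) (simp add: eqnD(2)[OF g(1) yS yU(1)] unit_gradient_C1(3)[OF E yU(1)])
      have "frechet_derivative m (at y) e = shape g y e" if "e \<in> B" for e
        by (rule tangential_derivative_unique[OF y(1) g(1) yU(1) U'(1) yU(2) d]) (use U'(5) B(1) that in auto)
      then show ?thesis unfolding f_def 1 2 by simp
    qed
    have "continuous_on W f"
      unfolding f_def shape_trace_def shape_def
      by (intro continuous_intros Ck1_continuous[OF Ck1_subset[OF U'(3)]] Ck1_continuous[OF Ck1_subset[OF unit_gradient_C1(1)[OF E]]])
        (auto simp: W_def)
    then have "closedin (top_of_set W) {y\<in>W. f y = 0}" by (rule continuous_closedin_preimage_constant)
    then obtain Z where Z: "closed Z" "{y\<in>W. f y = 0} = W \<inter> Z" by (auto simp: closedin_closed)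
    have "W \<inter> closure (hs_interior \<Sigma>) \<subseteq> closure (W \<inter> hs_interior \<Sigma>)" using W(1) by (rule open_Int_closure_subset)
    moreover have "W \<inter> hs_interior \<Sigma> \<subseteq> Z" using eq Z(2) by blast
    then have "closure (W \<inter> hs_interior \<Sigma>) \<subseteq> Z" using Z(1) by (rule closure_minimal)
    ultimately have "x \<in> Z" using W(2) dense x by blast
    then show "h = shape_trace g x" using Z(2) W(2) U'(6) by (auto simp: f_def)
  qed
qed

lemma cont_mean_curvature: "continuous_on \<Sigma> (mean_curvature \<Sigma> \<nu>)"
proof (rule locally_continuous)
  fix x assume "x \<in> \<Sigma>"
  then obtain U g where U: "eqn U g" "x \<in> U" using eqn_exists by blast
  note E = eqnD(1)[OF U(1)]
  have "continuous_on (\<Sigma> \<inter> U) (shape_trace g)"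
    unfolding shape_trace_def shape_def
    by (intro continuous_intros Ck1_continuous[OF Ck1_subset[OF unit_gradient_C1(1)[OF E]]]) auto
  then have "continuous_on (\<Sigma> \<inter> U) (mean_curvature \<Sigma> \<nu>)"
    by (rule continuous_on_eq) (use mean_curvature_eq[OF _ U(1)] in auto)
  then show "\<exists>U. open U \<and> x \<in> U \<and> continuous_on (\<Sigma> \<inter> U) (mean_curvature \<Sigma> \<nu>)" using U C2_equationD(1)[OF E] by blast
qed

text \<open>First order condition: a nearest point in the interior lies straight below.\<close>

lemma nearest_point_normal:
  assumes x: "x \<in> hs_interior \<Sigma>" and near: "\<And>z. z \<in> \<Sigma> \<Longrightarrow> dist y x \<le> dist y z"
  shows "y - x = ((y - x) \<bullet> \<nu> x) *\<^sub>R \<nu> x"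
proof -
  have xS: "x \<in> \<Sigma>" using hs_interior_subset[OF x] .
  obtain U g where g: "eqn U g" "x \<in> U" using eqn_exists[OF xS] by blast
  note E = eqnD(1)[OF g(1)]
  obtain i :: "(real^'n) \<times> real \<Rightarrow> 'a" and k V h W where C: "graph_chart g U i k V h W" "x \<in> W" "h ` V \<subseteq> \<Sigma>"
    using interior_chart[OF x g] by blast
  note C' = graph_chartD[OF C(1)]
  define p where "p = fst (k x)"
  have gx: "g x = 0" using C2_equationD(3)[OF E xS g(2)] .
  have p: "p \<in> V" "h p = x" using C'(9)[OF C(2) gx] by (auto simp: p_def)
  have G: "gradient g x = norm (gradient g x) *\<^sub>R \<nu> x" using unit_gradient_C1(7)[OF E] eqnD(2)[OF g(1) xS g(2)] by simp
  define v where "v = (y - x) - ((y - x) \<bullet> \<nu> x) *\<^sub>R \<nu> x"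
  have v\<nu>: "v \<bullet> \<nu> x = 0" unfolding v_def using norm\<nu>[OF xS] by (simp add: inner_diff_left dot_square_norm)
  then have "v \<bullet> gradient g (h p) = 0" using G p(2) by (metis inner_scaleR_right mult_zero_right)
  then have q: "frechet_derivative h (at p) (fst (k v)) = v" using C'(10)[OF p(1)] by blast
  let ?f = "\<lambda>p. (h p - y) \<bullet> (h p - y)"
  have d: "(?f has_derivative (\<lambda>q. (h p - y) \<bullet> frechet_derivative h (at p) q + frechet_derivative h (at p) q \<bullet> (h p - y))) (at p)"
    by (auto intro!: derivative_eq_intros C'(13)[OF p(1)] simp: inner_commute)
  have "?f p \<le> ?f p'" if "p' \<in> V" for p'
  proof -
    have "h p' \<in> \<Sigma>" using C(3) that by blast
    then have "norm (h p - y) \<le> norm (h p' - y)" using near[of "h p'"] p(2) by (simp add: dist_norm norm_minus_commute)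
    then show ?thesis by (simp add: norm_le)
  qed
  then have "(\<lambda>q. (h p - y) \<bullet> frechet_derivative h (at p) q + frechet_derivative h (at p) q \<bullet> (h p - y)) = (\<lambda>q. 0)"
    by (intro differential_zero_maxmin[OF p(1) C'(2) d]) auto
  from fun_cong[OF this, of "fst (k v)"] have "(x - y) \<bullet> v + v \<bullet> (x - y) = 0" using q p(2) by simp
  then have "v \<bullet> (y - x) = 0" by (simp add: inner_commute inner_diff_left inner_diff_right)
  then have "v \<bullet> v = 0" using v\<nu> unfolding v_def by (metis (no_types, lifting) diff_0_right inner_diff_right inner_scaleR_right mult_zero_right v_def)
  then show ?thesis unfolding v_def by simp
qed

text \<open>Second order condition: a ball touching from inside bounds the shape operator. Only the
  derivative of the squared distance along a curve is used, since charts are merely \<open>C\<^sup>1\<close>.\<close>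

lemma touching_ball_shape:
  assumes x: "x \<in> hs_interior \<Sigma>" and g: "eqn U g" "x \<in> U"
    and t: "t \<ge> 0" and touch: "\<And>z. z \<in> \<Sigma> \<Longrightarrow> t \<le> dist (x - t *\<^sub>R \<nu> x) z" and v: "v \<bullet> \<nu> x = 0"
  shows "t * (shape g x v \<bullet> v) \<le> v \<bullet> v"
proof (rule ccontr)
  assume neg: "\<not> ?thesis"
  have xS: "x \<in> \<Sigma>" using hs_interior_subset[OF x] .
  note E = eqnD(1)[OF g(1)]
  obtain i :: "(real^'n) \<times> real \<Rightarrow> 'a" and k V m W where C: "graph_chart g U i k V m W" "x \<in> W" "m ` V \<subseteq> \<Sigma>"
    using interior_chart[OF x g] by blast
  note C' = graph_chartD[OF C(1)]
  define p where "p = fst (k x)"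
  have gx: "g x = 0" using C2_equationD(3)[OF E xS g(2)] .
  have p: "p \<in> V" "m p = x" using C'(9)[OF C(2) gx] by (auto simp: p_def)
  have G: "gradient g x = norm (gradient g x) *\<^sub>R \<nu> x" using unit_gradient_C1(7)[OF E] eqnD(2)[OF g(1) xS g(2)] by simp
  define q where "q = fst (k v)"
  have "v \<bullet> gradient g (m p) = 0" using v G p(2) by (metis inner_scaleR_right mult_zero_right)
  then have q: "frechet_derivative m (at p) q = v" using C'(10)[OF p(1)] by (simp add: q_def)
  let ?\<eta> = "unit_gradient g"
  define y where "y = x - t *\<^sub>R \<nu> x"
  \<comment> \<open>Against a tangent vector, \<open>m (c s) - y\<close> may be replaced by
    \<open>\<zeta> (m (c s)) - y\<close>, which differs from it by a normal vector. The new factor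
    vanishes at \<open>s = 0\<close> with derivative \<open>v - t *\<^sub>R shape g x v\<close>, so
    its quotient by \<open>s\<close> reveals the second-order behaviour of \<open>f\<close>.\<close>
  define \<zeta> where "\<zeta> z = z - t *\<^sub>R ?\<eta> z" for z
  have \<nu>x: "\<nu> x = ?\<eta> x" using eqnD(2)[OF g(1) xS g(2)] .
  have \<zeta>x: "\<zeta> x = y" by (simp add: \<zeta>_def y_def \<nu>x)
  define c where "c s = p + s *\<^sub>R q" for s
  define m' where "m' s = frechet_derivative m (at (c s)) q" for s
  have cc: "continuous_on S c" for S unfolding c_def by (intro continuous_intros)
  have "open (c -` V)" using C'(2) cc[of UNIV] by (simp add: continuous_on_open_vimage)
  moreover have "0 \<in> c -` V" using p by (simp add: c_def)
  ultimately obtain r where r: "r > 0" "\<And>s. \<bar>s\<bar> < r \<Longrightarrow> c s \<in> V"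
    unfolding open_contains_ball by (metis (no_types, lifting) dist_0_norm mem_ball real_norm_def subsetD vimageE)
  define f where "f s = (m (c s) - y) \<bullet> (m (c s) - y)" for s
  have df: "(f has_real_derivative 2 * ((\<zeta> (m (c s)) - y) \<bullet> m' s)) (at s)" if s: "\<bar>s\<bar> < r" for s
  proof -
    have cV: "c s \<in> V" using r(2)[OF s] .
    have "((\<lambda>s. m (c s)) has_derivative (\<lambda>h. frechet_derivative m (at (c s)) (h *\<^sub>R q))) (at s)"
    proof (rule has_derivative_compose[where f = c and g = m, OF _ C'(13)[OF cV]])
      show "(c has_derivative (\<lambda>h. h *\<^sub>R q)) (at s)" unfolding c_def by (auto intro!: derivative_eq_intros)
    qed
    then have d: "((\<lambda>s. m (c s)) has_vector_derivative m' s) (at s)"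
      using Ck1_linear[OF C'(5) cV] by (simp add: has_vector_derivative_def linear_cmul m'_def)
    then have d2: "(f has_real_derivative 2 * ((m (c s) - y) \<bullet> m' s)) (at s)"
      unfolding f_def has_field_derivative_def has_vector_derivative_def
      by (auto intro!: derivative_eq_intros simp: inner_commute)
    have "m' s \<bullet> gradient g (m (c s)) = 0" unfolding m'_def by (rule graph_chart_tangent[OF C(1) E cV])
    then have "?\<eta> (m (c s)) \<bullet> m' s = 0" by (simp add: unit_gradient_def sgn_div_norm inner_commute)
    then have "(m (c s) - y) \<bullet> m' s = (\<zeta> (m (c s)) - y) \<bullet> m' s"
      unfolding \<zeta>_def by (simp add: inner_diff_left)
    then show ?thesis using d2 by simp
  qed
  have lim1: "((\<lambda>s. (\<zeta> (m (c s)) - y) /\<^sub>R s) \<longlongrightarrow> v - t *\<^sub>R shape g x v) (at_right 0)"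
  proof -
    have "(\<zeta> has_derivative (\<lambda>w. w - t *\<^sub>R shape g x w)) (at (m p))"
      unfolding \<zeta>_def p(2) by (auto intro!: derivative_eq_intros unit_gradient_C1(5)[OF E g(2)])
    from has_derivative_compose[OF C'(13)[OF p(1)] this]
    have "((\<lambda>p. \<zeta> (m p)) has_derivative (\<lambda>q. frechet_derivative m (at p) q - t *\<^sub>R shape g x (frechet_derivative m (at p) q))) (at p)" .
    from directional_limit[OF this, of q] show ?thesis
      unfolding q c_def p(2) \<zeta>x by (rule tendsto_within_subset) simp
  qed
  have lim2: "(m' \<longlongrightarrow> v) (at_right 0)"
  proof -
    have "continuous_on {-r<..<r} m'" unfolding m'_def
      by (rule continuous_on_compose2[OF Ck1_continuous[OF C'(5)] cc]) (use r(2) in auto)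
    then have "isCont m' 0" using r(1) by (simp add: continuous_on_eq_continuous_at)
    then have "(m' \<longlongrightarrow> m' 0) (at 0)" by (simp add: isCont_def)
    moreover have "m' 0 = v" using q by (simp add: m'_def c_def)
    ultimately show ?thesis by (metis tendsto_within_subset subset_UNIV)
  qed
  have "((\<lambda>s. ((\<zeta> (m (c s)) - y) /\<^sub>R s) \<bullet> m' s) \<longlongrightarrow> (v - t *\<^sub>R shape g x v) \<bullet> v) (at_right 0)"
    by (intro tendsto_intros lim1 lim2)
  moreover have "(v - t *\<^sub>R shape g x v) \<bullet> v < 0" using neg by (simp add: inner_diff_left)
  ultimately have "\<forall>\<^sub>F s in at_right 0. ((\<zeta> (m (c s)) - y) /\<^sub>R s) \<bullet> m' s < 0" by (rule order_tendstoD(2))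
  then obtain b where b: "b > 0" "\<And>s. 0 < s \<Longrightarrow> s < b \<Longrightarrow> ((\<zeta> (m (c s)) - y) /\<^sub>R s) \<bullet> m' s < 0"
    unfolding eventually_at_right_field by blast
  define s1 where "s1 = min b r / 2"
  have s1: "0 < s1" "s1 < b" "s1 < r" using b r by (auto simp: s1_def)
  have "f s1 < f 0"
  proof (rule DERIV_neg_imp_decreasing_open[OF s1(1)])
    fix s assume s: "0 < s" "s < s1"
    have "(1 / s) * ((\<zeta> (m (c s)) - y) \<bullet> m' s) < 0" using b(2)[of s] s s1 by (simp add: divide_inverse)
    then have "(\<zeta> (m (c s)) - y) \<bullet> m' s < 0" using s by (simp add: mult_less_0_iff divide_less_0_iff)
    then show "\<exists>y. DERIV f s :> y \<and> y < 0" using df[of s] s s1 by force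
  next
    show "continuous_on {0..s1} f"
      by (rule DERIV_continuous_on, rule has_field_derivative_at_within, rule df) (use s1 in auto)
  qed
  moreover have "f 0 \<le> f s1"
  proof -
    have "f 0 = t\<^sup>2" using norm\<nu>[OF xS] p(2) by (simp add: f_def c_def y_def dot_square_norm power2_eq_square)
    moreover have "\<bar>t\<bar> \<le> dist y (m (c s1))"
    proof -
      have "t \<le> dist y (m (c s1))" using touch[of "m (c s1)"] C(3) r(2)[of s1] s1 unfolding y_def by auto
      then show ?thesis using t by simp
    qed
    ultimately show ?thesis by (simp add: f_def dist_norm norm_minus_commute dot_square_norm power2_le_iff_abs_le)
  qed
  ultimately show False by simp
qed

end

section \<open>Null sets, area densities and change of charts\<close>

text \<open>Infinitely many disjoint translates of equal measure fit into a bounded set only if the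
  measure vanishes.\<close>

lemma negligible_disjoint_translates:
  fixes Q :: "'a::euclidean_space set"
  assumes Q: "compact Q" and r: "r > 0" and sep: "\<And>p s. p \<in> Q \<Longrightarrow> 0 < s \<Longrightarrow> s < r \<Longrightarrow> p + s *\<^sub>R v \<notin> Q"
  shows "negligible Q"
proof -
  have Qm: "Q \<in> lmeasurable" using Q by (rule lmeasurable_compact)
  obtain R where R: "R > 0" "Q \<subseteq> ball 0 R" using Q compact_imp_bounded bounded_subset_ballD by blast
  define s where "s k = r / real (k + 2)" for k
  have s: "0 < s k" "s k < r" for k using r by (auto simp: s_def divide_simps)
  have inc: "s k < s j" if "j < k" for j k using r that by (auto simp: s_def divide_simps)
  define A where "A k = (+) (s k *\<^sub>R v) ` Q" for k
  have Am: "A k \<in> lmeasurable" "measure lebesgue (A k) = measure lebesgue Q" for k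
    unfolding A_def using measurable_translation[OF Qm] measure_translation by auto
  have disj: "disjoint_family_on A {..<n}" for n
  proof -
    have "A j \<inter> A k = {}" if "j < k" for j k
    proof -
      have False if pq: "p \<in> Q" "q \<in> Q" "s j *\<^sub>R v + p = s k *\<^sub>R v + q" for p q
      proof -
        have "q = p + (s j - s k) *\<^sub>R v" using pq(3) by (simp add: algebra_simps)
        moreover have "0 < s j - s k" "s j - s k < r" using inc[OF \<open>j < k\<close>] s(1)[of k] s(2)[of j] by linarith+
        ultimately show False using sep[OF pq(1)] pq(2) by blast
      qed
      then show ?thesis unfolding A_def by blast
    qed
    then show ?thesis unfolding disjoint_family_on_def by (metis Int_commute nat_neq_iff)
  qed
  have sub: "A k \<subseteq> ball 0 (R + r * norm v)" for k
  proof
    fix x assume "x \<in> A k"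
    then obtain p where p: "p \<in> Q" "x = s k *\<^sub>R v + p" by (auto simp: A_def)
    have "norm x \<le> s k * norm v + norm p" unfolding p(2) using s[of k] by (metis abs_of_pos norm_scaleR norm_triangle_ineq)
    moreover have "s k * norm v \<le> r * norm v" using s[of k] by (simp add: mult_right_mono)
    moreover have "norm p < R" using p(1) R by auto
    ultimately show "x \<in> ball 0 (R + r * norm v)" by simp
  qed
  have "real n * measure lebesgue Q \<le> measure lebesgue (ball (0::'a) (R + r * norm v))" for n
  proof -
    have "real n * measure lebesgue Q = (\<Sum>k<n. measure lebesgue (A k))" by (simp add: Am)
    also have "\<dots> = measure lebesgue (\<Union>k<n. A k)"
      by (rule measure_finite_Union[symmetric]) (use fmeasurableD[OF Am(1)] fmeasurableD2[OF Am(1)] disj in auto)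
    also have "\<dots> \<le> measure lebesgue (ball (0::'a) (R + r * norm v))"
      by (rule measure_mono_fmeasurable) (use sub Am in \<open>auto intro!: fmeasurableD\<close>)
    finally show ?thesis .
  qed
  then have "measure lebesgue Q = 0"
    by (metis (no_types, opaque_lifting) measure_nonneg mult.commute not_le order_antisym_conv reals_Archimedean3)
  then show ?thesis using Qm negligible_iff_measure by blast
qed

text \<open>Near a point where the derivative along \<open>e\<close> is nonzero, \<open>f\<close> is
  strictly monotone along \<open>e\<close>. Short translates of its zero set along \<open>e\<close>
  are therefore disjoint from it.\<close>

lemma negligible_zero_set_partial:
  fixes f :: "'a::euclidean_space \<Rightarrow> real"
  assumes V: "open V" and f: "\<And>p. p \<in> V \<Longrightarrow> (f has_derivative f' p) (at p)"
    and c: "continuous_on V (\<lambda>p. f' p e)"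
  shows "negligible {p\<in>V. f p = 0 \<and> f' p e \<noteq> 0}"
proof (subst locally_negligible_alt, intro ballI)
  let ?Z = "{p\<in>V. f p = 0 \<and> f' p e \<noteq> 0}"
  fix p0 assume p0: "p0 \<in> ?Z"
  \<comment> \<open>The factor \<open>f' p0 e\<close> normalises the sign, so that one positivity
    condition covers both cases.\<close>
  define g where "g p = f' p e * f' p0 e" for p
  have "continuous_on V g" unfolding g_def by (intro continuous_intros c)
  then have "open (g -` {0<..} \<inter> V)" using continuous_on_open_vimage[OF V, THEN iffD1, rule_format, OF _ open_greaterThan] by simp
  moreover have "g -` {0<..} \<inter> V = {p\<in>V. g p > 0}" by auto
  ultimately have "open {p\<in>V. g p > 0}" by simp
  moreover have "p0 \<in> {p\<in>V. g p > 0}" using p0 by (auto simp: g_def zero_less_mult_iff linorder_neq_iff)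
  ultimately obtain r where r: "r > 0" "cball p0 r \<subseteq> {p\<in>V. g p > 0}" by (metis open_contains_cball)
  define Q where "Q = {p \<in> cball p0 r. f p = 0}"
  have cf: "continuous_on (cball p0 r) f"
    by (intro continuous_at_imp_continuous_on ballI has_derivative_continuous[OF f]) (use r(2) in auto)
  then have "closed Q" unfolding Q_def
    using continuous_closed_preimage_constant[OF cf closed_cball] by simp
  moreover have "bounded Q" unfolding Q_def using bounded_cball by (rule bounded_subset) auto
  ultimately have cQ: "compact Q" by (simp add: compact_eq_bounded_closed)
  have "negligible Q"
  proof (rule negligible_disjoint_translates[OF cQ zero_less_one])
    fix p and s :: real assume p: "p \<in> Q" and s: "0 < s" "s < 1"
    show "p + s *\<^sub>R e \<notin> Q"
    proof
      assume q: "p + s *\<^sub>R e \<in> Q"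
      define h where "h t = f (p + t *\<^sub>R e) * f' p0 e" for t
      have inB: "p + t *\<^sub>R e \<in> cball p0 r" if "0 \<le> t" "t \<le> s" for t
      proof -
        have "(1 - t / s) *\<^sub>R p + (t / s) *\<^sub>R (p + s *\<^sub>R e) \<in> cball p0 r"
          by (rule convexD[OF convex_cball]) (use p q that s in \<open>auto simp: Q_def\<close>)
        moreover have "(1 - t / s) *\<^sub>R p + (t / s) *\<^sub>R (p + s *\<^sub>R e) = p + t *\<^sub>R e"
          using s by (simp add: scaleR_add_right scaleR_diff_left)
        ultimately show ?thesis by simp
      qed
      have dh: "(h has_real_derivative g (p + t *\<^sub>R e)) (at t)" if "0 \<le> t" "t \<le> s" for t
      proof -
        have V': "p + t *\<^sub>R e \<in> V" using inB[OF that] r(2) by blast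
        have "((\<lambda>t. f (p + t *\<^sub>R e)) has_derivative (\<lambda>h. f' (p + t *\<^sub>R e) (h *\<^sub>R e))) (at t)"
          by (rule has_derivative_compose[where g = f and f = "\<lambda>t. p + t *\<^sub>R e"])
            (auto intro!: derivative_eq_intros f V')
        then have "((\<lambda>t. f (p + t *\<^sub>R e)) has_real_derivative f' (p + t *\<^sub>R e) e) (at t)"
          using has_derivative_linear[OF f[OF V']] by (simp add: has_field_derivative_def linear_cmul mult.commute[of _ "f' _ _"])
        then show ?thesis unfolding h_def g_def by (rule DERIV_cmult_right)
      qed
      have "h 0 < h s"
        by (rule DERIV_pos_imp_increasing[OF s(1)]) (use dh inB r(2) in blast)
      then show False using p q by (simp add: h_def Q_def)
    qed
  qed
  moreover have "ball p0 r \<inter> ?Z \<subseteq> Q" by (auto simp: Q_def)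
  ultimately have "negligible (ball p0 r \<inter> ?Z)" using negligible_subset by blast
  moreover have "openin (top_of_set ?Z) (ball p0 r \<inter> ?Z)" using openin_open_Int[OF open_ball, of ?Z p0 r] by (simp add: Int_commute)
  ultimately show "\<exists>U. openin (top_of_set ?Z) U \<and> p0 \<in> U \<and> negligible U"
    using p0 r(1) centre_in_ball by blast
qed

text \<open>A nonzero derivative has a nonzero entry, which reduces this to scalar functions.
  Applied to the difference of two maps, it says that maps agreeing on a set agree to first order at
  almost every point of that set.\<close>

lemma negligible_zero_set_derivative:
  fixes F :: "'a::euclidean_space \<Rightarrow> 'b::euclidean_space"
  assumes V: "open V" and F: "\<And>p. p \<in> V \<Longrightarrow> (F has_derivative F' p) (at p)"
    and c: "\<And>e. continuous_on V (\<lambda>p. F' p e)"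
  shows "negligible {p\<in>V. F p = 0 \<and> F' p \<noteq> (\<lambda>_. 0)}"
proof -
  have "negligible {p\<in>V. F p \<bullet> b = 0 \<and> F' p e \<bullet> b \<noteq> 0}" for e b
    by (rule negligible_zero_set_partial[OF V, of "\<lambda>p. F p \<bullet> b" "\<lambda>p v. F' p v \<bullet> b"])
      (auto intro!: derivative_eq_intros F continuous_intros c)
  then have "negligible (\<Union>e\<in>Basis. \<Union>b\<in>Basis. {p\<in>V. F p \<bullet> b = 0 \<and> F' p e \<bullet> b \<noteq> 0})"
    by (intro negligible_Union) auto
  moreover have "{p\<in>V. F p = 0 \<and> F' p \<noteq> (\<lambda>_. 0)} \<subseteq> (\<Union>e\<in>Basis. \<Union>b\<in>Basis. {p\<in>V. F p \<bullet> b = 0 \<and> F' p e \<bullet> b \<noteq> 0})"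
  proof clarify
    fix p assume p: "p \<in> V" "F p = 0" "F' p \<noteq> (\<lambda>_. 0)"
    have lin: "linear (F' p)" using F[OF p(1)] has_derivative_linear by blast
    have "\<exists>e\<in>Basis. F' p e \<noteq> 0"
    proof (rule ccontr)
      assume "\<not> (\<exists>e\<in>Basis. F' p e \<noteq> 0)"
      then have "F' p v = 0" for v using linear_basis_expansion[OF lin, of v] by simp
      then show False using p(3) by auto
    qed
    then obtain e where e: "e \<in> Basis" "F' p e \<noteq> 0" by blast
    then obtain b where "b \<in> Basis" "F' p e \<bullet> b \<noteq> 0" using euclidean_all_zero_iff by blast
    then show "p \<in> (\<Union>e\<in>Basis. \<Union>b\<in>Basis. {p\<in>V. F p \<bullet> b = 0 \<and> F' p e \<bullet> b \<noteq> 0})"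
      using e p by force
  qed
  ultimately show ?thesis by (rule negligible_subset)
qed

lemma continuous_on_det:
  fixes A :: "'a::topological_space \<Rightarrow> real^'n^'n"
  assumes "\<And>i j. continuous_on S (\<lambda>x. A x $ i $ j)"
  shows "continuous_on S (\<lambda>x. det (A x))"
  unfolding det_def by (intro continuous_intros assms)

lemma continuous_on_absdet:
  fixes L :: "'b::topological_space \<Rightarrow> 'a::euclidean_space \<Rightarrow> 'a"
  assumes "\<And>v. continuous_on S (\<lambda>x. L x v)"
  shows "continuous_on S (\<lambda>x. absdet (L x))"
proof -
  have *: "continuous_on S (\<lambda>x. cart_iso (L x v) $ i)" for v i
    by (intro continuous_on_component continuous_on_compose2[OF basis_iso_continuous[OF cart_iso] assms]) auto
  show ?thesis unfolding absdet_def matrix_def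
    by (intro continuous_on_rabs continuous_on_det) (simp only: vec_lambda_beta o_def *)
qed

lemma area_density_adjoint:
  fixes h :: "real^'n \<Rightarrow> 'a::euclidean_space"
  assumes lin: "linear (frechet_derivative h (at p))"
  shows "area_density h p = sqrt (det (matrix (adjoint (frechet_derivative h (at p)) \<circ> frechet_derivative h (at p))))"
proof -
  let ?f = "frechet_derivative h (at p)"
  have "matrix (adjoint ?f \<circ> ?f) = (\<chi> i j. ?f (axis i 1) \<bullet> ?f (axis j 1))"
    by (simp add: matrix_def vec_eq_iff cart_eq_inner_axis adjoint_clauses[OF lin] inner_commute)
  then show ?thesis by (simp add: area_density_def)
qed

lemma area_density_compose:
  fixes m :: "real^'n \<Rightarrow> 'a::euclidean_space" and h :: "real^'n \<Rightarrow> 'a"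
  assumes l1: "linear (frechet_derivative h (at q))" and l2: "linear S"
    and eq: "frechet_derivative m (at p) = frechet_derivative h (at q) \<circ> S"
  shows "area_density m p = area_density h q * absdet S"
proof -
  let ?f = "frechet_derivative h (at q)"
  have lf: "linear (frechet_derivative m (at p))" unfolding eq using l2 l1 by (rule linear_compose)
  have lh: "linear (adjoint ?f \<circ> ?f)" using l1 adjoint_linear linear_compose by blast
  have "adjoint (?f \<circ> S) = adjoint S \<circ> adjoint ?f"
    by (rule adjoint_unique) (simp add: adjoint_clauses[OF l1] adjoint_clauses[OF l2])
  then have "adjoint (?f \<circ> S) \<circ> (?f \<circ> S) = adjoint S \<circ> ((adjoint ?f \<circ> ?f) \<circ> S)" by (simp add: comp_assoc)
  then have "matrix (adjoint (?f \<circ> S) \<circ> (?f \<circ> S)) = transpose (matrix S) ** (matrix (adjoint ?f \<circ> ?f) ** matrix S)"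
    using matrix_compose[OF linear_compose[OF l2 lh] adjoint_linear[OF l2]] matrix_compose[OF l2 lh] matrix_adjoint[OF l2] by simp
  then have "det (matrix (adjoint (?f \<circ> S) \<circ> (?f \<circ> S))) = det (matrix (adjoint ?f \<circ> ?f)) * (det (matrix S))\<^sup>2"
    by (simp add: det_mul power2_eq_square)
  then show ?thesis
    unfolding area_density_adjoint[OF lf] area_density_adjoint[OF l1] eq
    by (simp add: real_sqrt_mult absdet_cart[OF l2])
qed

lemma continuous_on_area_density:
  fixes f :: "real^'n \<Rightarrow> 'a::euclidean_space"
  assumes "Ck_on 1 f V" shows "continuous_on V (area_density f)"
  unfolding area_density_def
  by (intro continuous_on_real_sqrt continuous_on_det) (auto intro!: continuous_intros Ck1_continuous[OF assms])

text \<open>Completing a parametrisation by the unit normal turns its area density into a Jacobian.\<close>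

lemma area_density_absdet:
  fixes f :: "real^'n \<Rightarrow> 'a::euclidean_space"
  assumes i: "basis_iso (i :: (real^'n) \<times> real \<Rightarrow> 'a) k" and f: "linear f" and N: "norm N = 1" "\<And>q. f q \<bullet> N = 0"
  shows "absdet (\<lambda>w. f (fst (k w)) - snd (k w) *\<^sub>R N) = sqrt (det (matrix (adjoint f \<circ> f)))"
proof -
  let ?m = "adjoint f \<circ> f" and ?D = "\<lambda>w. f (fst (k w)) - snd (k w) *\<^sub>R N"
  have lin: "linear i" "linear k" and inv: "\<And>z. k (i z) = z" "\<And>x. i (k x) = x"
    and inn: "\<And>x y. i x \<bullet> i y = x \<bullet> y" using i unfolding basis_iso_def by blast+
  have lm: "linear ?m" using f adjoint_linear linear_compose by blast
  have ka: "k (x + y) = k x + k y" "k (c *\<^sub>R x) = c *\<^sub>R k x" for x y c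
    using lin(2) by (simp_all add: linear_add linear_cmul)
  have lD: "linear ?D"
    by (rule linearI) (simp_all add: ka linear_add[OF f] linear_cmul[OF f] scaleR_add_left scaleR_diff_right)
  have "\<exists>B l. B \<subseteq> UNIV \<and> pairwise orthogonal B \<and> (\<forall>b\<in>B. norm b = 1) \<and> span B = UNIV \<and>
      finite B \<and> card B = dim (UNIV::(real^'n) set) \<and> (\<forall>b\<in>B. ?m b = l b *\<^sub>R b)"
    by (rule selfadjoint_eigenbasis[OF lm]) (auto simp: adjoint_clauses[OF f])
  then obtain B l where B: "pairwise orthogonal B" "\<forall>b\<in>B. norm b = 1" "finite B"
      "card B = CARD('n)" "\<forall>b\<in>B. ?m b = l b *\<^sub>R b" by auto
  have det: "det (matrix ?m) = (\<Prod>b\<in>B. l b)" by (rule det_eigenbasis[OF lm B(3,4,1,2,5)])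
  have l0: "l b \<ge> 0" if "b \<in> B" for b
  proof -
    have "?m b \<bullet> b = l b" using B(2,5) that by (simp add: dot_square_norm)
    moreover have "?m b \<bullet> b = f b \<bullet> f b" by (simp add: adjoint_clauses[OF f])
    ultimately show ?thesis by (metis inner_ge_zero)
  qed
  \<comment> \<open>Since the range of \<open>f\<close> is orthogonal to the unit vector
    \<open>N\<close>, this operator acts as \<open>adjoint f \<circ> f\<close> on the first factor
    and as the identity on the last coordinate.\<close>
  have adj: "adjoint ?D (?D w) = i (?m (fst (k w)), snd (k w))" for w
  proof (rule vector_eq_ldot[THEN iffD1], intro allI)
    fix z
    have "z \<bullet> adjoint ?D (?D w) = ?D z \<bullet> ?D w" by (rule adjoint_clauses(1)[OF lD])
    also have "\<dots> = f (fst (k z)) \<bullet> f (fst (k w)) + snd (k z) * snd (k w)"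
      using N by (simp add: inner_diff_left inner_diff_right dot_square_norm inner_commute)
    also have "\<dots> = k z \<bullet> (?m (fst (k w)), snd (k w))"
      by (simp add: inner_prod_def adjoint_clauses[OF f])
    also have "\<dots> = z \<bullet> i (?m (fst (k w)), snd (k w))" by (metis inn inv(2))
    finally show "z \<bullet> adjoint ?D (?D w) = z \<bullet> i (?m (fst (k w)), snd (k w))" .
  qed
  let ?j = "\<lambda>b. i (b, 0)" and ?e = "i (0, 1)"
  have injj: "inj_on ?j B" by (rule inj_on_inverseI[of _ "\<lambda>x. fst (k x)"]) (simp add: inv)
  have ej: "?e \<noteq> ?j b" for b by (metis inv(1) prod.inject zero_neq_one)
  define m where "m w = (if w = ?e then 1 else l (fst (k w)))" for w
  have "absdet (adjoint ?D \<circ> ?D) = \<bar>\<Prod>w\<in>insert ?e (?j ` B). m w\<bar>"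
  proof (rule absdet_eigenbasis)
    show "linear (adjoint ?D \<circ> ?D)" using lD adjoint_linear linear_compose by blast
    show "finite (insert ?e (?j ` B))" using B(3) by simp
    show "card (insert ?e (?j ` B)) = DIM('a)"
      using B(3,4) injj ej basis_iso_dim[OF i] by (auto simp: card_image image_iff)
    show "pairwise orthogonal (insert ?e (?j ` B))"
      using B(1) by (auto simp: pairwise_insert pairwise_image orthogonal_def inn pairwise_def)
    show "\<forall>b\<in>insert ?e (?j ` B). norm b = 1"
      using B(2) by (auto simp: norm_eq_1 inn)
    show "\<forall>b\<in>insert ?e (?j ` B). (adjoint ?D \<circ> ?D) b = m b *\<^sub>R b"
    proof
      fix b assume "b \<in> insert ?e (?j ` B)"
      then consider "b = ?e" | c where "c \<in> B" "b = ?j c" by blast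
      moreover have "(adjoint ?D \<circ> ?D) b = i (?m (fst (k b)), snd (k b))"
        by (simp only: comp_apply[of "adjoint ?D"] adj)
      ultimately show "(adjoint ?D \<circ> ?D) b = m b *\<^sub>R b"
      proof cases
        case 1
        have "?m 0 = 0" using linear_0[OF lm] .
        then show ?thesis using 1 \<open>(adjoint ?D \<circ> ?D) b = _\<close> by (simp only: inv fst_conv snd_conv m_def if_True scaleR_one refl)
      next
        case 2
        have "?m c = l c *\<^sub>R c" using B(5) 2(1) by blast
        moreover have "l c *\<^sub>R ?j c = i (l c *\<^sub>R c, 0)" using linear_cmul[OF lin(1), of "l c" "(c, 0)"] by simp
        ultimately show ?thesis using 2(2) \<open>(adjoint ?D \<circ> ?D) b = _\<close> ej[of c]
          by (auto simp only: inv fst_conv snd_conv m_def split: if_splits)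
      qed
    qed
  qed
  also have "(\<Prod>w\<in>insert ?e (?j ` B). m w) = (\<Prod>w\<in>?j ` B. m w)"
    using B(3) ej by (subst prod.insert) (auto simp: m_def)
  also have "\<dots> = (\<Prod>b\<in>B. l b)"
    unfolding prod.reindex[OF injj] o_def using ej by (intro prod.cong refl) (metis m_def inv(1) fst_conv)
  finally have "absdet (adjoint ?D \<circ> ?D) = \<bar>det (matrix ?m)\<bar>" unfolding det .
  moreover have "det (matrix ?m) \<ge> 0" unfolding det using l0 by (simp add: prod_nonneg)
  ultimately have "(absdet ?D)\<^sup>2 = det (matrix ?m)" unfolding absdet_square[OF lD] by linarith
  from real_sqrt_unique[OF this absdet_nonneg] show ?thesis by simp
qed

lemma AE_not_negligible: "negligible N \<Longrightarrow> AE x in lborel. x \<notin> N"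
  using AE_not_in[of N lebesgue] by (simp add: negligible_iff_null_sets AE_completion_iff)

lemma borel_vimage_continuous_on:
  assumes "open V" "continuous_on V f" "A \<in> sets borel"
  shows "{p\<in>V. f p \<in> A} \<in> sets borel"
proof -
  have "f \<in> borel_measurable (restrict_space borel V)" using assms(2) by (rule borel_measurable_continuous_on_restrict)
  then have "f -` A \<inter> space (restrict_space borel V) \<in> sets (restrict_space borel V)" using assms(3) by (rule measurable_sets)
  moreover have "f -` A \<inter> space (restrict_space borel V) = {p\<in>V. f p \<in> A}" by (auto simp: space_restrict_space)
  ultimately show ?thesis using assms(1) by (simp add: sets_restrict_space_iff)
qed

lemma continuous_on_fst_basis_iso: "basis_iso i k \<Longrightarrow> continuous_on S (\<lambda>x. fst (k x))"
  by (intro continuous_on_fst basis_iso_continuous[OF basis_iso_sym])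

lemma graph_chart_parametrisation:
  assumes "graph_chart g U i k V f W" shows "parametrisation V f"
proof -
  note C = graph_chartD[OF assms]
  have "inj (frechet_derivative f (at p))" if "p \<in> V" for p
    by (rule inj_on_inverseI[of _ "\<lambda>x. fst (k x)"]) (rule C(14)[OF that])
  then show ?thesis using C unfolding parametrisation_def by blast
qed

text \<open>As \<open>B\<close> is merely Borel, \<open>f\<close> and \<open>f1 \<circ> T\<close>
  need not agree on an open set, and the chain rule cannot be read off directly. By
  \<open>negligible_zero_set_derivative\<close> their derivatives agree almost everywhere on
  \<open>B\<close>; there the area densities differ by the Jacobian of \<open>T\<close>, and the
  change of variables formula applies.\<close>

lemma chart_change:
  fixes f :: "real^'n \<Rightarrow> 'a::euclidean_space" and k :: "'a \<Rightarrow> (real^'n) \<times> real"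
  assumes C: "graph_chart g U i k V1 f1 W" and par: "parametrisation V f"
    and B: "B \<in> sets borel" "B \<subseteq> V" "f ` B \<subseteq> {x\<in>W. g x = 0}"
  shows "{p\<in>V1. f1 p \<in> f ` B} \<in> sets borel"
    "(\<integral>\<^sup>+p. ennreal (area_density f1 p) * indicator {p\<in>V1. f1 p \<in> f ` B} p \<partial>lborel)
       = (\<integral>\<^sup>+p\<in>B. ennreal (area_density f p) \<partial>lborel)"
proof -
  note C' = graph_chartD[OF C]
  have V: "open V" "Ck_on 1 f V" "inj_on f V" using par by (auto simp: parametrisation_def)
  have cf: "continuous_on V f" using V(2) by (rule Ck1_imp_continuous_on)
  have linV: "linear (frechet_derivative f (at p))" if "p \<in> V" for p using Ck1_linear[OF V(2) that] .
  have k: "linear (\<lambda>x. fst (k x))"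
    using C'(1) linear_compose[of k fst] by (simp add: basis_iso_def linear_fst o_def)
  have bk: "bounded_linear (\<lambda>x. fst (k x))" using k linear_conv_bounded_linear by blast
  define T where "T p = fst (k (f p))" for p
  define T' where "T' p q = fst (k (frechet_derivative f (at p) q))" for p q
  have dT: "(T has_derivative T' p) (at p)" if "p \<in> V" for p
    unfolding T_def T'_def using bounded_linear.has_derivative[OF bk Ck1D[OF V(2) that]] .
  have linT: "linear (T' p)" if "p \<in> V" for p using dT[OF that] has_derivative_linear by blast
  have fT: "T p \<in> V1" "f1 (T p) = f p" if "p \<in> B" for p
    using C'(9)[of "f p"] B(3) that by (auto simp: T_def)
  have im: "T ` B = {p\<in>V1. f1 p \<in> f ` B}"
  proof
    show "T ` B \<subseteq> {p\<in>V1. f1 p \<in> f ` B}" using fT by auto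
    show "{p\<in>V1. f1 p \<in> f ` B} \<subseteq> T ` B"
    proof clarify
      fix p b assume "p \<in> V1" "f1 p = f b" "b \<in> B"
      then have "T b = p" unfolding T_def using C'(6) by metis
      then show "p \<in> T ` B" using \<open>b \<in> B\<close> by blast
    qed
  qed
  have fB: "f ` B \<in> sets borel" by (rule borel_injective_image[OF V(1) cf V(3) B(1,2)])
  show TB: "{p\<in>V1. f1 p \<in> f ` B} \<in> sets borel" by (rule borel_vimage_continuous_on[OF C'(2,11) fB])
  define h where "h p = ennreal (indicator V1 p *\<^sub>R area_density f1 p)" for p
  have h: "h \<in> borel_measurable borel" unfolding h_def
    using borel_measurable_continuous_on_indicator[OF _ continuous_on_area_density[OF C'(5)]] C'(2) by simp
  have injT: "inj_on T B"
  proof (rule inj_onI)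
    fix p q assume "p \<in> B" "q \<in> B" "T p = T q"
    then have "f p = f q" using fT(2) by metis
    then show "p = q" using V(3) B(2) \<open>p \<in> B\<close> \<open>q \<in> B\<close> by (auto dest: inj_onD)
  qed
  have cT': "continuous_on V (\<lambda>p. T' p v)" for v
    unfolding T'_def
    by (rule continuous_on_compose2[OF continuous_on_fst_basis_iso[OF C'(1)] Ck1_continuous[OF V(2)]]) auto
  have mJ: "(\<lambda>x. indicator B x * absdet (T' x)) \<in> borel_measurable borel"
    using borel_measurable_continuous_on_indicator[OF B(1) continuous_on_subset[OF continuous_on_absdet[OF cT'] B(2)]] by simp
  have mT: "(\<lambda>x. indicator B x *\<^sub>R T x) \<in> borel_measurable borel"
    unfolding T_def
    by (intro borel_measurable_continuous_on_indicator B(1)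
      continuous_on_compose2[OF continuous_on_fst_basis_iso[OF C'(1), of UNIV] continuous_on_subset[OF cf B(2)]]) auto
  have "(\<integral>\<^sup>+p. ennreal (area_density f1 p) * indicator {p\<in>V1. f1 p \<in> f ` B} p \<partial>lborel)
      = (\<integral>\<^sup>+y. h y * indicator (T ` B) y \<partial>lborel)"
    unfolding im by (intro nn_integral_cong) (auto simp: h_def indicator_def)
  also have "\<dots> = (\<integral>\<^sup>+x. h (T x) * ennreal (indicator B x * absdet (T' x)) \<partial>lborel)"
    by (rule nn_integral_image[OF B(1) _ dT mJ injT mT h]) (use TB im B(2) in auto)
  also have "\<dots> = (\<integral>\<^sup>+p\<in>B. ennreal (area_density f p) \<partial>lborel)"
  proof (rule nn_integral_cong_AE)
    define V0 where "V0 = V \<inter> T -` V1"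
    have cT: "continuous_on V T" unfolding T_def
      by (rule continuous_on_compose2[OF continuous_on_fst_basis_iso[OF C'(1), of UNIV] cf]) auto
    have V0: "open V0" unfolding V0_def
      using continuous_on_open_vimage[OF V(1), THEN iffD1, rule_format, OF cT C'(2)] by (simp add: Int_commute)
    \<comment> \<open>Vanishes on \<open>B\<close>; almost everywhere on its zero set the derivative
      \<open>F'\<close> vanishes as well.\<close>
    define F where "F p = f p - f1 (T p)" for p
    define F' where "F' p q = frechet_derivative f (at p) q - frechet_derivative f1 (at (T p)) (T' p q)" for p q
    have dF: "(F has_derivative F' p) (at p)" if p: "p \<in> V0" for p
    proof -
      have pV: "p \<in> V" "T p \<in> V1" using p by (auto simp: V0_def)
      show ?thesis unfolding F_def F'_def
        by (intro has_derivative_diff Ck1D[OF V(2) pV(1)] has_derivative_compose[OF dT[OF pV(1)] C'(13)[OF pV(2)]])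
    qed
    have cF': "continuous_on V0 (\<lambda>p. F' p e)" for e
      unfolding F'_def
      by (intro continuous_on_diff Ck1_continuous_on_apply[OF C'(5)] continuous_on_subset[OF Ck1_continuous[OF V(2)]]
        continuous_on_subset[OF cT] continuous_on_subset[OF cT']) (auto simp: V0_def)
    have "AE p in lborel. p \<notin> {p\<in>V0. F p = 0 \<and> F' p \<noteq> (\<lambda>_. 0)}"
      by (rule AE_not_negligible[OF negligible_zero_set_derivative[OF V0 dF cF']])
    then show "AE x in lborel. h (T x) * ennreal (indicator B x * absdet (T' x)) = ennreal (area_density f x) * indicator B x"
    proof (rule AE_mp, intro AE_I2 impI)
      fix p assume n: "p \<notin> {p\<in>V0. F p = 0 \<and> F' p \<noteq> (\<lambda>_. 0)}"
      show "h (T p) * ennreal (indicator B p * absdet (T' p)) = ennreal (area_density f p) * indicator B p"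
      proof (cases "p \<in> B")
        case True
        have pV: "p \<in> V" "T p \<in> V1" using B(2) fT(1)[OF True] True by auto
        have "p \<in> V0" "F p = 0" using pV fT(2)[OF True] by (auto simp: V0_def F_def)
        then have "F' p = (\<lambda>_. 0)" using n by blast
        then have "frechet_derivative f (at p) = frechet_derivative f1 (at (T p)) \<circ> T' p"
          unfolding F'_def by (auto simp: fun_eq_iff)
        then have "area_density f p = area_density f1 (T p) * absdet (T' p)"
          by (rule area_density_compose[OF Ck1_linear[OF C'(5) pV(2)] linT[OF pV(1)]])
        then show ?thesis using True pV by (simp add: h_def ennreal_mult'')
      qed simp
    qed
  qed
  finally show "(\<integral>\<^sup>+p. ennreal (area_density f1 p) * indicator {p\<in>V1. f1 p \<in> f ` B} p \<partial>lborel)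
       = (\<integral>\<^sup>+p\<in>B. ennreal (area_density f p) \<partial>lborel)" .
qed

section \<open>Existence and uniqueness of the area measure\<close>

context oriented_hypersurface
begin

abbreviation "area \<equiv> area_measure T \<Sigma>"

text \<open>A finite Borel partition of \<Sigma> subordinate to graph charts. The charts may extend
  beyond \<Sigma>, hence the restriction to \<open>E k\<close>; compact parameter sets keep the
  densities bounded and the area finite.\<close>

definition patches ::
  "nat \<Rightarrow> (nat \<Rightarrow> 'a set) \<Rightarrow> (nat \<Rightarrow> 'a \<Rightarrow> real) \<Rightarrow> (nat \<Rightarrow> (real^'n) \<times> real \<Rightarrow> 'a) \<Rightarrow> (nat \<Rightarrow> 'a \<Rightarrow> (real^'n) \<times> real) \<Rightarrow>
    (nat \<Rightarrow> (real^'n) set) \<Rightarrow> (nat \<Rightarrow> real^'n \<Rightarrow> 'a) \<Rightarrow> (nat \<Rightarrow> 'a set) \<Rightarrow> (nat \<Rightarrow> 'a set) \<Rightarrow> bool" where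
  "patches m U g \<iota> \<kappa> V \<phi> W E \<longleftrightarrow>
     (\<forall>k<m. eqn (U k) (g k) \<and> graph_chart (g k) (U k) (\<iota> k) (\<kappa> k) (V k) (\<phi> k) (W k) \<and> E k \<in> sets borel \<and> E k \<subseteq> \<Sigma> \<inter> W k \<and>
       (\<exists>C. compact C \<and> C \<subseteq> V k \<and> {p\<in>V k. \<phi> k p \<in> E k} \<subseteq> C)) \<and>
     disjoint_family_on E {..<m} \<and> (\<Union>k<m. E k) = \<Sigma>"

text \<open>Compactness selects finitely many balls inside chart domains, and
  \<open>disjointed\<close> turns them into a partition. Using closed balls of the same radius
  inside the chart domains gives the compact parameter sets.\<close>

lemma patches_exist: "\<exists>m U g (i :: nat \<Rightarrow> (real^'n) \<times> real \<Rightarrow> 'a) l V f W E. patches m U g i l V f W E"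
proof -
  have ex: "\<forall>x\<in>\<Sigma>. \<exists>U g (i :: (real^'n) \<times> real \<Rightarrow> 'a) l V f W r. eqn U g \<and> graph_chart g U i l V f W \<and> r > 0 \<and> cball x r \<subseteq> W"
  proof
    fix x assume x: "x \<in> \<Sigma>"
    obtain U g where g: "eqn U g" "x \<in> U" using eqn_exists[OF x] by blast
    have "g x = 0" using C2_equationD(3)[OF eqnD(1)[OF g(1)] x g(2)] .
    then obtain i :: "(real^'n) \<times> real \<Rightarrow> 'a" and l V f W where C: "graph_chart g U i l V f W" "x \<in> W"
      using graph_chart_exists[OF dim eqnD(1)[OF g(1)] g(2)] by blast
    obtain r where "r > 0" "cball x r \<subseteq> W" using graph_chartD(3)[OF C(1)] C(2) open_contains_cball by blast
    then show "\<exists>U g (i :: (real^'n) \<times> real \<Rightarrow> 'a) l V f W r. eqn U g \<and> graph_chart g U i l V f W \<and> r > 0 \<and> cball x r \<subseteq> W"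
      using g(1) C(1) by blast
  qed
  from bchoice[OF ex] obtain U where "\<forall>x\<in>\<Sigma>. \<exists>g (i :: (real^'n) \<times> real \<Rightarrow> 'a) l V f W r. eqn (U x) g \<and> graph_chart g (U x) i l V f W \<and> r > 0 \<and> cball x r \<subseteq> W" by blast
  from bchoice[OF this] obtain g where "\<forall>x\<in>\<Sigma>. \<exists>(i :: (real^'n) \<times> real \<Rightarrow> 'a) l V f W r. eqn (U x) (g x) \<and> graph_chart (g x) (U x) i l V f W \<and> r > 0 \<and> cball x r \<subseteq> W" by blast
  from bchoice[OF this] obtain i where "\<forall>x\<in>\<Sigma>. \<exists>l V f W r. eqn (U x) (g x) \<and> graph_chart (g x) (U x) (i x :: (real^'n) \<times> real \<Rightarrow> 'a) l V f W \<and> r > 0 \<and> cball x r \<subseteq> W" by blast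
  from bchoice[OF this] obtain l where "\<forall>x\<in>\<Sigma>. \<exists>V f W r. eqn (U x) (g x) \<and> graph_chart (g x) (U x) (i x) (l x) V f W \<and> r > 0 \<and> cball x r \<subseteq> W" by blast
  from bchoice[OF this] obtain V where "\<forall>x\<in>\<Sigma>. \<exists>f W r. eqn (U x) (g x) \<and> graph_chart (g x) (U x) (i x) (l x) (V x) f W \<and> r > 0 \<and> cball x r \<subseteq> W" by blast
  from bchoice[OF this] obtain f where "\<forall>x\<in>\<Sigma>. \<exists>W r. eqn (U x) (g x) \<and> graph_chart (g x) (U x) (i x) (l x) (V x) (f x) W \<and> r > 0 \<and> cball x r \<subseteq> W" by blast
  from bchoice[OF this] obtain W where "\<forall>x\<in>\<Sigma>. \<exists>r. eqn (U x) (g x) \<and> graph_chart (g x) (U x) (i x) (l x) (V x) (f x) (W x) \<and> r > 0 \<and> cball x r \<subseteq> W x" by blast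
  from bchoice[OF this] obtain r where d: "\<forall>x\<in>\<Sigma>. eqn (U x) (g x) \<and> graph_chart (g x) (U x) (i x) (l x) (V x) (f x) (W x) \<and> r x > 0 \<and> cball x (r x) \<subseteq> W x" by blast
  obtain C' where C': "C' \<subseteq> \<Sigma>" "finite C'" "\<Sigma> \<subseteq> (\<Union>c\<in>C'. ball c (r c))"
    by (rule compactE_image[OF compact\<Sigma>, of \<Sigma> "\<lambda>x. ball x (r x)"]) (use d in auto)
  obtain xs where xs: "set xs = C'" using finite_list[OF C'(2)] by blast
  define m where "m = length xs"
  define A where "A k = ball (xs ! k) (r (xs ! k))" for k
  define E where "E k = \<Sigma> \<inter> disjointed A k" for k
  have xk: "xs ! k \<in> \<Sigma>" if "k < m" for k using that xs C'(1) by (auto simp: m_def)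
  have UE: "(\<Union>k<m. E k) = \<Sigma>"
  proof -
    have "(\<Union>k\<in>{0..<m}. A k) = (\<Union>c\<in>C'. ball c (r c))" unfolding A_def xs[symmetric] m_def
      by (force simp: set_conv_nth)
    then have "\<Sigma> \<subseteq> (\<Union>k\<in>{0..<m}. disjointed A k)" using C'(3) finite_UN_disjointed_eq[of A m] by simp
    then show ?thesis unfolding E_def by (auto simp: atLeast0LessThan)
  qed
  have disj: "disjoint_family_on E {..<m}"
    using disjoint_family_disjointed[of A] unfolding disjoint_family_on_def E_def by blast
  have EA: "E k \<subseteq> \<Sigma> \<inter> A k" for k unfolding E_def using disjointed_subset[of A k] by blast
  have EB: "E k \<in> sets borel" for k unfolding E_def disjointed_def A_def using closed\<Sigma>
    by (intro sets.Int sets.Diff sets.finite_UN) auto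
  have "patches m (\<lambda>k. U (xs ! k)) (\<lambda>k. g (xs ! k)) (\<lambda>k. i (xs ! k)) (\<lambda>k. l (xs ! k)) (\<lambda>k. V (xs ! k)) (\<lambda>k. f (xs ! k)) (\<lambda>k. W (xs ! k)) E"
    unfolding patches_def
  proof (intro conjI allI impI)
    fix k assume k: "k < m"
    let ?x = "xs ! k"
    have dk: "eqn (U ?x) (g ?x)" "graph_chart (g ?x) (U ?x) (i ?x) (l ?x) (V ?x) (f ?x) (W ?x)" "cball ?x (r ?x) \<subseteq> W ?x"
      using d xk[OF k] by auto
    show "eqn (U ?x) (g ?x)" "graph_chart (g ?x) (U ?x) (i ?x) (l ?x) (V ?x) (f ?x) (W ?x)" "E k \<in> sets borel"
      using dk EB by auto
    have AW: "A k \<subseteq> cball ?x (r ?x)" by (simp add: A_def ball_subset_cball)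
    show "E k \<subseteq> \<Sigma> \<inter> W ?x" using EA[of k] AW dk(3) by blast
    note G = graph_chartD[OF dk(2)]
    let ?C = "(\<lambda>x. fst (l ?x x)) ` (\<Sigma> \<inter> cball ?x (r ?x))"
    have "compact ?C"
      by (intro compact_continuous_image continuous_on_fst_basis_iso[OF G(1)] compact_Int_closed compact\<Sigma>) auto
    moreover have "?C \<subseteq> V ?x"
    proof clarify
      fix y assume y: "y \<in> \<Sigma>" "y \<in> cball ?x (r ?x)"
      then have "y \<in> W ?x" using dk(3) by blast
      moreover have "g ?x y = 0" using C2_equationD(3)[OF eqnD(1)[OF dk(1)] y(1)] G(4) \<open>y \<in> W ?x\<close> by blast
      ultimately show "fst (l ?x y) \<in> V ?x" using G(9) by blast
    qed
    moreover have "{p\<in>V ?x. f ?x p \<in> E k} \<subseteq> ?C"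
    proof clarify
      fix p assume p: "p \<in> V ?x" "f ?x p \<in> E k"
      then have "f ?x p \<in> \<Sigma> \<inter> cball ?x (r ?x)" using EA[of k] AW by blast
      then show "p \<in> ?C" using G(6)[OF p(1)] by (metis image_eqI)
    qed
    ultimately show "\<exists>C. compact C \<and> C \<subseteq> V ?x \<and> {p\<in>V ?x. f ?x p \<in> E k} \<subseteq> C" by blast
  qed (rule disj UE)+
  then show ?thesis by blast
qed

lemma patchesD:
  assumes P: "patches m U g i c V f W E" and k: "k < m"
  shows "eqn (U k) (g k)" "graph_chart (g k) (U k) (i k) (c k) (V k) (f k) (W k)" "E k \<in> sets borel" "E k \<subseteq> \<Sigma>" "E k \<subseteq> W k"
    "\<exists>C. compact C \<and> C \<subseteq> V k \<and> {p\<in>V k. f k p \<in> E k} \<subseteq> C"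
    "{p\<in>V k. f k p \<in> E k} \<in> sets borel" "A \<subseteq> E k \<Longrightarrow> f k ` {p\<in>V k. f k p \<in> A} = A"
proof -
  show e: "eqn (U k) (g k)" and C: "graph_chart (g k) (U k) (i k) (c k) (V k) (f k) (W k)" and EB: "E k \<in> sets borel"
    and ES: "E k \<subseteq> \<Sigma>" and EW: "E k \<subseteq> W k" "\<exists>C. compact C \<and> C \<subseteq> V k \<and> {p\<in>V k. f k p \<in> E k} \<subseteq> C"
    using P k unfolding patches_def by auto
  show "{p\<in>V k. f k p \<in> E k} \<in> sets borel"
    by (rule borel_vimage_continuous_on[OF graph_chartD(2,11)[OF C] EB])
  assume A: "A \<subseteq> E k"
  show "f k ` {p\<in>V k. f k p \<in> A} = A"
  proof
    show "A \<subseteq> f k ` {p\<in>V k. f k p \<in> A}"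
    proof
      fix x assume x: "x \<in> A"
      then have "x \<in> W k" "x \<in> \<Sigma>" using A ES EW by auto
      then have "g k x = 0" using C2_equationD(3)[OF eqnD(1)[OF e]] graph_chartD(4)[OF C] by blast
      then have "fst (c k x) \<in> V k" "f k (fst (c k x)) = x" using graph_chartD(9)[OF C \<open>x \<in> W k\<close>] by auto
      then show "x \<in> f k ` {p\<in>V k. f k p \<in> A}" using x by (metis (mono_tags, lifting) image_eqI mem_Collect_eq)
    qed
  qed auto
qed

text \<open>The parameter domains are put side by side as \<open>count_space\<close> times Lebesgue
  measure, weighted by the area densities, and pushed forward to \<Sigma>.\<close>

lemma patch_measure_exists:
  assumes P: "patches m U g (i :: nat \<Rightarrow> (real^'n) \<times> real \<Rightarrow> 'a) \<kappa> V F W E"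
  shows "\<exists>l. sets l = sets (restrict_space borel \<Sigma>) \<and>
    (\<forall>f\<in>borel_measurable (restrict_space borel \<Sigma>). integral\<^sup>N l f =
      (\<Sum>k<m. \<integral>\<^sup>+p. f (F k p) * (ennreal (area_density (F k) p) * indicator {p\<in>V k. F k p \<in> E k} p) \<partial>lborel))"
proof -
  obtain x0 where x0: "x0 \<in> \<Sigma>" using ne\<Sigma> by blast
  define B where "B k = {p\<in>V k. F k p \<in> E k}" for k
  \<comment> \<open>The default value \<open>x0\<close> keeps the map inside \<Sigma> where the
    density is zero.\<close>
  define h where "h k p = (if p \<in> B k then F k p else x0)" for k p
  define b where "b k p = ennreal (area_density (F k) p) * indicator (B k) p" for k p
  let ?M = "count_space {..<m} \<Otimes>\<^sub>M (lborel :: (real^'n) measure)"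
  let ?d = "\<lambda>(k, p). b k p" and ?h = "\<lambda>(k, p). h k p"
  define l where "l = distr (density ?M ?d) (restrict_space borel \<Sigma>) ?h"
  have BB: "B k \<in> sets borel" "B k \<subseteq> V k" if "k < m" for k using patchesD(7)[OF P that] by (auto simp: B_def)
  have hm: "h k \<in> measurable borel (restrict_space borel \<Sigma>)" if k: "k < m" for k
  proof -
    note C = graph_chartD[OF patchesD(2)[OF P k]]
    have c: "continuous_on (B k) (F k)" using C(11) BB(2)[OF k] by (rule continuous_on_subset)
    have "h k \<in> borel_measurable borel" unfolding h_def
      by (rule measurable_If_restrict_space_iff[THEN iffD2])
        (use BB[OF k] c in \<open>auto intro!: borel_measurable_continuous_on_restrict\<close>)
    moreover have "h k p \<in> \<Sigma>" for p using x0 patchesD(4)[OF P k] by (auto simp: h_def B_def)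
    ultimately show ?thesis by (intro measurable_restrict_space2) auto
  qed
  have bm: "b k \<in> borel_measurable borel" if k: "k < m" for k
  proof -
    note C = graph_chartD[OF patchesD(2)[OF P k]]
    have "(\<lambda>p. indicator (B k) p *\<^sub>R area_density (F k) p) \<in> borel_measurable borel"
      by (intro borel_measurable_continuous_on_indicator BB[OF k] continuous_on_subset[OF continuous_on_area_density[OF C(5)]])
    then have "(\<lambda>p. ennreal (indicator (B k) p *\<^sub>R area_density (F k) p)) \<in> borel_measurable borel" by simp
    moreover have "(\<lambda>p. ennreal (indicator (B k) p *\<^sub>R area_density (F k) p)) = b k"
      by (auto simp: b_def fun_eq_iff indicator_def)
    ultimately show ?thesis by simp
  qed
  have mh: "?h \<in> measurable ?M (restrict_space borel \<Sigma>)"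
    by (rule measurable_pair_measure_countable1) (use hm in auto)
  have md: "?d \<in> borel_measurable ?M"
    by (rule measurable_pair_measure_countable1) (use bm in auto)
  have "integral\<^sup>N l f = (\<Sum>k<m. \<integral>\<^sup>+p. f (F k p) * b k p \<partial>lborel)" if f: "f \<in> borel_measurable (restrict_space borel \<Sigma>)" for f
  proof -
    have mf: "(\<lambda>z. f (?h z)) \<in> borel_measurable ?M" using measurable_compose[OF mh f] .
    have "integral\<^sup>N l f = (\<integral>\<^sup>+z. f (?h z) \<partial>density ?M ?d)"
      unfolding l_def by (rule nn_integral_distr) (use mh f in auto)
    also have "\<dots> = (\<integral>\<^sup>+z. ?d z * f (?h z) \<partial>?M)" by (rule nn_integral_density[OF md mf])
    also have "\<dots> = (\<integral>\<^sup>+k. \<integral>\<^sup>+p. ?d (k, p) * f (?h (k, p)) \<partial>lborel \<partial>count_space {..<m})"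
      by (rule lborel.nn_integral_fst[symmetric]) (intro borel_measurable_times_ennreal md mf)
    also have "\<dots> = (\<Sum>k<m. \<integral>\<^sup>+p. ?d (k, p) * f (?h (k, p)) \<partial>lborel)"
      by (rule nn_integral_count_space_finite) simp
    also have "\<dots> = (\<Sum>k<m. \<integral>\<^sup>+p. f (F k p) * b k p \<partial>lborel)"
      by (intro sum.cong refl nn_integral_cong) (auto simp: h_def b_def mult.commute)
    finally show ?thesis .
  qed
  moreover have "sets l = sets (restrict_space borel \<Sigma>)" by (simp add: l_def)
  ultimately show ?thesis unfolding b_def B_def by blast
qed

lemma sets_area_Borel: "A \<in> sets (restrict_space borel \<Sigma>) \<longleftrightarrow> A \<in> sets borel \<and> A \<subseteq> \<Sigma>"
  using closed\<Sigma> by (auto simp: sets_restrict_space_iff)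

text \<open>The measure glued from patches satisfies the defining property in every parametrisation
  by \<open>chart_change\<close>. It is the only one: a Borel subset of a single patch is the image
  of a Borel set of parameters, so its measure is prescribed. Hence the definite description
  \<open>area_measure\<close> denotes it.\<close>

lemma area_measure_patches:
  assumes P: "patches m U g (j :: nat \<Rightarrow> (real^'n) \<times> real \<Rightarrow> 'a) c V h W E"
  shows "sets area = sets (restrict_space borel \<Sigma>)"
    "f \<in> borel_measurable (restrict_space borel \<Sigma>) \<Longrightarrow> integral\<^sup>N area f =
      (\<Sum>k<m. \<integral>\<^sup>+p. f (h k p) * (ennreal (area_density (h k) p) * indicator {p\<in>V k. h k p \<in> E k} p) \<partial>lborel)"
    "parametrisation V' h' \<Longrightarrow> B \<in> sets borel \<Longrightarrow> B \<subseteq> V' \<Longrightarrow> h' ` B \<subseteq> \<Sigma> \<Longrightarrow>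
       emeasure area (h' ` B) = (\<integral>\<^sup>+p\<in>B. ennreal (area_density (h' :: real^'n \<Rightarrow> 'a) p) \<partial>lborel)"
proof -
  let ?prop = "\<lambda>\<mu>. \<forall>V (h :: real^'n \<Rightarrow> 'a) B. parametrisation V h \<and> B \<in> sets borel \<and> B \<subseteq> V \<and> h ` B \<subseteq> \<Sigma> \<longrightarrow>
           emeasure \<mu> (h ` B) = (\<integral>\<^sup>+p\<in>B. ennreal (area_density h p) \<partial>lborel)"
  obtain \<mu> where \<mu>: "sets \<mu> = sets (restrict_space borel \<Sigma>)"
    and int: "\<And>f. f \<in> borel_measurable (restrict_space borel \<Sigma>) \<Longrightarrow> integral\<^sup>N \<mu> f =
      (\<Sum>k<m. \<integral>\<^sup>+p. f (h k p) * (ennreal (area_density (h k) p) * indicator {p\<in>V k. h k p \<in> E k} p) \<partial>lborel)"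
    using patch_measure_exists[OF P] by blast
  have em: "emeasure \<mu> A = (\<Sum>k<m. \<integral>\<^sup>+p. ennreal (area_density (h k) p) * indicator {p\<in>V k. h k p \<in> A \<inter> E k} p \<partial>lborel)"
    if A: "A \<in> sets (restrict_space borel \<Sigma>)" for A
  proof -
    have "emeasure \<mu> A = integral\<^sup>N \<mu> (indicator A)" using A \<mu> by simp
    also have "\<dots> = (\<Sum>k<m. \<integral>\<^sup>+p. indicator A (h k p) * (ennreal (area_density (h k) p) * indicator {p\<in>V k. h k p \<in> E k} p) \<partial>lborel)"
      by (rule int) (use A in simp)
    also have "\<dots> = (\<Sum>k<m. \<integral>\<^sup>+p. ennreal (area_density (h k) p) * indicator {p\<in>V k. h k p \<in> A \<inter> E k} p \<partial>lborel)"
      by (intro sum.cong refl nn_integral_cong) (auto simp: indicator_def)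
    finally show ?thesis .
  qed
  have prp: "?prop \<mu>"
  proof (intro allI impI, elim conjE)
    fix V' :: "(real^'n) set" and h' :: "real^'n \<Rightarrow> 'a" and B
    assume par: "parametrisation V' h'" and B: "B \<in> sets borel" "B \<subseteq> V'" "h' ` B \<subseteq> \<Sigma>"
    have V': "open V'" "continuous_on V' h'" "inj_on h' V'"
      using par Ck1_imp_continuous_on by (auto simp: parametrisation_def)
    have img: "h' ` B \<in> sets (restrict_space borel \<Sigma>)"
      unfolding sets_area_Borel using borel_injective_image[OF V' B(1,2)] B(3) by simp
    define Bk where "Bk k = {p\<in>V'. h' p \<in> E k} \<inter> B" for k
    have BkB: "Bk k \<in> sets borel" if "k < m" for k
      unfolding Bk_def using borel_vimage_continuous_on[OF V'(1,2) patchesD(3)[OF P that]] B(1) by blast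
    have "emeasure \<mu> (h' ` B) = (\<Sum>k<m. \<integral>\<^sup>+p\<in>Bk k. ennreal (area_density h' p) \<partial>lborel)"
      unfolding em[OF img]
    proof (rule sum.cong[OF refl])
      fix k assume "k \<in> {..<m}"
      then have k: "k < m" by simp
      have i: "h' ` B \<inter> E k = h' ` Bk k" using B(2) by (auto simp: Bk_def)
      have "h' ` Bk k \<subseteq> {x\<in>W k. g k x = 0}"
      proof clarify
        fix p assume "p \<in> Bk k"
        then have "h' p \<in> E k" by (simp add: Bk_def)
        then have "h' p \<in> \<Sigma>" "h' p \<in> W k" using patchesD(4,5)[OF P k] by auto
        then show "h' p \<in> W k \<and> g k (h' p) = 0"
          using C2_equationD(3)[OF eqnD(1)[OF patchesD(1)[OF P k]]] graph_chartD(4)[OF patchesD(2)[OF P k]] by blast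
      qed
      from chart_change(2)[OF patchesD(2)[OF P k] par BkB[OF k] _ this]
      show "(\<integral>\<^sup>+p. ennreal (area_density (h k) p) * indicator {p\<in>V k. h k p \<in> h' ` B \<inter> E k} p \<partial>lborel)
          = (\<integral>\<^sup>+p\<in>Bk k. ennreal (area_density h' p) \<partial>lborel)"
        unfolding i by (auto simp: Bk_def)
    qed
    also have "\<dots> = (\<integral>\<^sup>+p. (\<Sum>k<m. ennreal (area_density h' p) * indicator (Bk k) p) \<partial>lborel)"
    proof (rule nn_integral_sum[symmetric])
      fix k assume "k \<in> {..<m}"
      then have k: "k < m" by simp
      have "(\<lambda>p. indicator (Bk k) p *\<^sub>R area_density h' p) \<in> borel_measurable borel"
        using par by (intro borel_measurable_continuous_on_indicator BkB[OF k] continuous_on_subset[OF continuous_on_area_density[of h' V']])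
          (auto simp: parametrisation_def Bk_def)
      then have "(\<lambda>p. ennreal (indicator (Bk k) p *\<^sub>R area_density h' p)) \<in> borel_measurable borel" by simp
      moreover have "(\<lambda>p. ennreal (indicator (Bk k) p *\<^sub>R area_density h' p)) = (\<lambda>p. ennreal (area_density h' p) * indicator (Bk k) p)"
        by (auto simp: fun_eq_iff indicator_def)
      ultimately show "(\<lambda>p. ennreal (area_density h' p) * indicator (Bk k) p) \<in> borel_measurable lborel" by simp
    qed
    also have "\<dots> = (\<integral>\<^sup>+p\<in>B. ennreal (area_density h' p) \<partial>lborel)"
    proof (rule nn_integral_cong)
      fix p
      have "(\<Sum>k<m. indicator (Bk k) p) = (indicator B p :: ennreal)"
      proof (cases "p \<in> B")
        case True
        then have "h' p \<in> (\<Union>k<m. E k)" using B(3) P by (auto simp: patches_def)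
        then obtain k where k: "k < m" "h' p \<in> E k" by blast
        have dj: "disjoint_family_on E {..<m}" using P by (simp add: patches_def)
        have "indicator (Bk l) p = (if l = k then 1 else 0 :: ennreal)" if "l \<in> {..<m}" for l
          using True B(2) k that disjoint_family_onD[OF dj, of l k] by (auto simp: Bk_def indicator_def)
        then have "(\<Sum>l<m. indicator (Bk l) p) = (\<Sum>l<m. if l = k then 1 else 0 :: ennreal)" by (rule sum.cong[OF refl])
        then show ?thesis using k(1) True by simp
      next
        case False then show ?thesis by (simp add: Bk_def)
      qed
      then show "(\<Sum>k<m. ennreal (area_density h' p) * indicator (Bk k) p) = ennreal (area_density h' p) * indicator B p"
        by (simp add: sum_distrib_left[symmetric])
    qed
    finally show "emeasure \<mu> (h' ` B) = (\<integral>\<^sup>+p\<in>B. ennreal (area_density h' p) \<partial>lborel)" .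
  qed
  have uniq: "\<mu>' = \<mu>" if \<mu>': "sets \<mu>' = sets (restrict_space borel \<Sigma>)" "?prop \<mu>'" for \<mu>'
  proof (rule measure_eqI)
    show "sets \<mu>' = sets \<mu>" using \<mu> \<mu>' by simp
    fix A assume "A \<in> sets \<mu>'"
    then have A: "A \<in> sets (restrict_space borel \<Sigma>)" "A \<in> sets borel" "A \<subseteq> \<Sigma>" using \<mu>' sets_area_Borel by auto
    have AE: "A \<inter> E k \<in> sets (restrict_space borel \<Sigma>)" if "k < m" for k
      unfolding sets_area_Borel using A patchesD(3)[OF P that] by auto
    have dec: "emeasure M A = (\<Sum>k<m. \<integral>\<^sup>+p\<in>{p\<in>V k. h k p \<in> A \<inter> E k}. ennreal (area_density (h k) p) \<partial>lborel)"
      if M: "sets M = sets (restrict_space borel \<Sigma>)" "?prop M" for M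
    proof -
      have "A = (\<Union>k<m. A \<inter> E k)" using A(3) P by (auto simp: patches_def)
      then have "emeasure M A = emeasure M (\<Union>k<m. A \<inter> E k)" by simp
      also have "\<dots> = (\<Sum>k<m. emeasure M (A \<inter> E k))"
      proof (rule sum_emeasure[symmetric])
        show "(\<lambda>k. A \<inter> E k) ` {..<m} \<subseteq> sets M" using AE M(1) by auto
        have "disjoint_family_on E {..<m}" using P by (simp add: patches_def)
        then show "disjoint_family_on (\<lambda>k. A \<inter> E k) {..<m}" unfolding disjoint_family_on_def by blast
      qed simp
      also have "\<dots> = (\<Sum>k<m. \<integral>\<^sup>+p\<in>{p\<in>V k. h k p \<in> A \<inter> E k}. ennreal (area_density (h k) p) \<partial>lborel)"
      proof (rule sum.cong[OF refl])
        fix k assume "k \<in> {..<m}"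
        then have k: "k < m" by simp
        note C = patchesD(2)[OF P k]
        have i: "h k ` {p\<in>V k. h k p \<in> A \<inter> E k} = A \<inter> E k" by (rule patchesD(8)[OF P k]) blast
        have bor: "{p\<in>V k. h k p \<in> A \<inter> E k} \<in> sets borel"
          by (rule borel_vimage_continuous_on[OF graph_chartD(2,11)[OF C]]) (use A patchesD(3)[OF P k] in auto)
        have "emeasure M (h k ` {p\<in>V k. h k p \<in> A \<inter> E k}) = (\<integral>\<^sup>+p\<in>{p\<in>V k. h k p \<in> A \<inter> E k}. ennreal (area_density (h k) p) \<partial>lborel)"
          by (rule M(2)[rule_format, of "V k"]) (use bor graph_chart_parametrisation[OF C] A(3) in auto)
        then show "emeasure M (A \<inter> E k) = (\<integral>\<^sup>+p\<in>{p\<in>V k. h k p \<in> A \<inter> E k}. ennreal (area_density (h k) p) \<partial>lborel)"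
          unfolding i .
      qed
      finally show ?thesis .
    qed
    show "emeasure \<mu>' A = emeasure \<mu> A" using dec[OF \<mu>'] dec[OF \<mu> prp] by simp
  qed
  have "area = \<mu>" unfolding area_measure_def
    by (rule the_equality) (use \<mu> prp uniq in blast)+
  then show "sets area = sets (restrict_space borel \<Sigma>)"
    "f \<in> borel_measurable (restrict_space borel \<Sigma>) \<Longrightarrow> integral\<^sup>N area f =
      (\<Sum>k<m. \<integral>\<^sup>+p. f (h k p) * (ennreal (area_density (h k) p) * indicator {p\<in>V k. h k p \<in> E k} p) \<partial>lborel)"
    "parametrisation V' h' \<Longrightarrow> B \<in> sets borel \<Longrightarrow> B \<subseteq> V' \<Longrightarrow> h' ` B \<subseteq> \<Sigma> \<Longrightarrow>
       emeasure area (h' ` B) = (\<integral>\<^sup>+p\<in>B. ennreal (area_density h' p) \<partial>lborel)"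
    using \<mu> int prp by blast+
qed

end

section \<open>The tube formula for the normal map\<close>

lemma basis_isoD:
  assumes "basis_iso F G"
  shows "linear F" "linear G" "G (F x) = x" "F (G y) = y" "F x \<bullet> F x' = x \<bullet> x'"
  using assms unfolding basis_iso_def by blast+

lemma area_density_pos:
  fixes h :: "real^'n \<Rightarrow> 'a::euclidean_space" and k :: "'a \<Rightarrow> (real^'n) \<times> real"
  assumes C: "graph_chart g U i k V h W" and E: "C2_equation \<Sigma> U g" and p: "p \<in> V"
  shows "area_density h p > 0"
    "area_density h p = absdet (\<lambda>w. frechet_derivative h (at p) (fst (k w)) - snd (k w) *\<^sub>R unit_gradient g (h p))"
proof -
  note C' = graph_chartD[OF C]
  let ?f = "frechet_derivative h (at p)"
  have lin: "linear ?f" using Ck1_linear[OF C'(5) p] .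
  have pU: "h p \<in> U" using C'(4,7) p by blast
  have "?f q \<bullet> unit_gradient g (h p) = 0" for q
    using graph_chart_tangent[OF C E p, of q] by (simp add: unit_gradient_def sgn_div_norm)
  from area_density_absdet[OF C'(1) lin unit_gradient_C1(2)[OF E pU] this]
  show eq: "area_density h p = absdet (\<lambda>w. ?f (fst (k w)) - snd (k w) *\<^sub>R unit_gradient g (h p))"
    unfolding area_density_adjoint[OF lin] by simp
  have "inj (adjoint ?f \<circ> ?f)"
  proof (subst linear_injective_0)
    show "linear (adjoint ?f \<circ> ?f)" using lin adjoint_linear linear_compose by blast
    show "\<forall>q. (adjoint ?f \<circ> ?f) q = 0 \<longrightarrow> q = 0"
    proof (intro allI impI)
      fix q assume "(adjoint ?f \<circ> ?f) q = 0"
      then have "q \<bullet> adjoint ?f (?f q) = 0" by simp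
      then have "?f q = 0" by (simp add: adjoint_clauses[OF lin])
      then show "q = 0" using C'(14)[OF p, of q] C'(1) by (simp add: basis_iso_def linear_0)
    qed
  qed
  moreover have "linear (adjoint ?f \<circ> ?f)" using lin adjoint_linear linear_compose by blast
  ultimately have "det (matrix (adjoint ?f \<circ> ?f)) \<noteq> 0" using det_nz_iff_inj by blast
  then have "area_density h p \<noteq> 0" unfolding area_density_adjoint[OF lin] by simp
  moreover have "area_density h p \<ge> 0" unfolding eq by (rule absdet_nonneg)
  ultimately show "area_density h p > 0" by linarith
qed

lemma nn_integral_basis_iso:
  fixes i :: "'c::euclidean_space \<times> real \<Rightarrow> 'a::euclidean_space"
  assumes i: "basis_iso i k" and f: "f \<in> borel_measurable borel"
  shows "(\<integral>\<^sup>+w. f w \<partial>lborel) = (\<integral>\<^sup>+p. \<integral>\<^sup>+t. f (i (p, t)) \<partial>lborel \<partial>lborel)"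
proof -
  have m: "i \<in> borel_measurable borel" using i by (rule basis_iso_borel)
  have "(\<integral>\<^sup>+w. f w \<partial>lborel) = (\<integral>\<^sup>+w. f w \<partial>distr lborel borel i)" using basis_iso_distr[OF i] by simp
  also have "\<dots> = (\<integral>\<^sup>+z. f (i z) \<partial>lborel)" using m f by (subst nn_integral_distr) auto
  also have "\<dots> = (\<integral>\<^sup>+z. f (i z) \<partial>(lborel \<Otimes>\<^sub>M lborel))" by (simp add: lborel_prod)
  also have "\<dots> = (\<integral>\<^sup>+p. \<integral>\<^sup>+t. f (i (p, t)) \<partial>lborel \<partial>lborel)"
    using measurable_compose[OF m f] by (intro lborel.nn_integral_fst[symmetric]) (simp add: lborel_prod)
  finally show ?thesis .
qed

text \<open>In the coordinates \<open>(p, t)\<close> the derivative of the normal map is the focal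
  map composed with the chart derivative completed by the normal. Its Jacobian is therefore the
  product of \<open>absdet (focal_map g (m p) t)\<close> and the area density, and the area formula
  is integrated first over \<open>t\<close>.\<close>

lemma patch_tube:
  fixes m :: "real^'n \<Rightarrow> 'a::euclidean_space" and k :: "'a \<Rightarrow> (real^'n) \<times> real"
  assumes C: "graph_chart g U i k V m W" and E: "C2_equation \<Sigma> U g"
    and B: "B \<in> sets borel" "B \<subseteq> V" and Q: "Q \<in> sets borel"
  defines "S \<equiv> {w. fst (k w) \<in> B \<and> (m (fst (k w)), snd (k w)) \<in> Q}"
    and "Z \<equiv> \<lambda>w. m (fst (k w)) - snd (k w) *\<^sub>R unit_gradient g (m (fst (k w)))"
    and "I \<equiv> (\<integral>\<^sup>+p. (\<integral>\<^sup>+t. ennreal (absdet (focal_map g (m p) t)) * indicator Q (m p, t) \<partial>lborel) *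
      (ennreal (area_density m p) * indicator B p) \<partial>lborel)"
  shows "Z ` S \<in> sets lebesgue" "emeasure lebesgue (Z ` S) \<le> I" "inj_on Z S \<Longrightarrow> emeasure lebesgue (Z ` S) = I"
proof -
  note C' = graph_chartD[OF C] and G = unit_gradient_C1[OF E]
  have link: "linear k" and inv: "k (i z) = z" for z using basis_isoD[OF C'(1)] by blast+
  have ck: "continuous_on A k" for A using basis_iso_continuous[OF basis_iso_sym[OF C'(1)]] .
  define V' where "V' = {w. fst (k w) \<in> V}"
  have cf: "continuous_on A (\<lambda>w. fst (k w))" "continuous_on A (\<lambda>w. snd (k w))" for A
    by (intro continuous_intros ck)+
  have oV': "open V'" unfolding V'_def
    using open_vimage[OF C'(2) cf(1)[of UNIV]] by (simp add: vimage_def)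
  have U: "m p \<in> U" if "p \<in> V" for p using C'(4,7) that by blast
  have cm: "continuous_on V' (\<lambda>w. m (fst (k w)))"
    by (rule continuous_on_compose2[OF C'(11) cf(1)]) (auto simp: V'_def)
  have SV: "S \<subseteq> V'" using B(2) by (auto simp: S_def V'_def)
  have S: "S \<in> sets borel"
  proof -
    have "{w\<in>V'. (m (fst (k w)), snd (k w)) \<in> Q} \<in> sets borel"
      by (rule borel_vimage_continuous_on[OF oV' _ Q]) (intro continuous_intros cm ck)
    moreover have "{w\<in>V'. fst (k w) \<in> B} \<in> sets borel"
      by (rule borel_vimage_continuous_on[OF oV' cf(1) B(1)])
    moreover have "S = {w\<in>V'. (m (fst (k w)), snd (k w)) \<in> Q} \<inter> {w\<in>V'. fst (k w) \<in> B}"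
      using SV by (auto simp: S_def)
    ultimately show ?thesis by simp
  qed
  let ?m' = "\<lambda>p. frechet_derivative m (at p)"
  define Z' where "Z' w h = ?m' (fst (k w)) (fst (k h)) - (snd (k w) *\<^sub>R shape g (m (fst (k w))) (?m' (fst (k w)) (fst (k h)))
     + snd (k h) *\<^sub>R unit_gradient g (m (fst (k w))))" for w h
  have dfst: "((\<lambda>w. fst (k w)) has_derivative (\<lambda>w. fst (k w))) (at w)"
    and dsnd: "((\<lambda>w. snd (k w)) has_derivative (\<lambda>w. snd (k w))) (at w)" for w
    by (intro has_derivative_fst has_derivative_snd linear_imp_has_derivative link)+
  have dZ: "(Z has_derivative Z' w) (at w)" if w: "w \<in> V'" for w
  proof -
    have wV: "fst (k w) \<in> V" using w by (simp add: V'_def)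
    have 1: "((\<lambda>w. m (fst (k w))) has_derivative (\<lambda>h. ?m' (fst (k w)) (fst (k h)))) (at w)"
      by (rule has_derivative_compose[OF dfst C'(13)[OF wV]])
    have 2: "((\<lambda>w. unit_gradient g (m (fst (k w)))) has_derivative
        (\<lambda>h. shape g (m (fst (k w))) (?m' (fst (k w)) (fst (k h))))) (at w)"
      by (rule has_derivative_compose[OF 1 G(5)[OF U[OF wV]]])
    show ?thesis unfolding Z_def Z'_def[abs_def]
      by (intro has_derivative_diff 1 has_derivative_scaleR dsnd 2)
  qed
  define D where "D p h = ?m' p (fst (k h)) - snd (k h) *\<^sub>R unit_gradient g (m p)" for p h
  have Z'eq: "Z' w = focal_map g (m (fst (k w))) (snd (k w)) \<circ> D (fst (k w))" if w: "w \<in> V'" for w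
  proof (rule ext)
    fix h
    define p where "p = fst (k w)"
    have p: "p \<in> V" using w by (simp add: V'_def p_def)
    have 0: "?m' p q \<bullet> unit_gradient g (m p) = 0" for q
      using graph_chart_tangent[OF C E p, of q] by (simp add: unit_gradient_def sgn_div_norm)
    have 1: "unit_gradient g (m p) \<bullet> unit_gradient g (m p) = 1" using G(2)[OF U[OF p]] by (simp add: dot_square_norm)
    have "D p h \<bullet> unit_gradient g (m p) = - snd (k h)" unfolding D_def by (simp add: inner_diff_left 0 1)
    then have e: "D p h - (D p h \<bullet> unit_gradient g (m p)) *\<^sub>R unit_gradient g (m p) = ?m' p (fst (k h))"
      by (simp add: D_def)
    have "(focal_map g (m p) (snd (k w)) \<circ> D p) h = D p h - snd (k w) *\<^sub>R shape g (m p) (?m' p (fst (k h)))"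
      by (simp only: focal_map_def comp_apply e)
    then show "Z' w h = (focal_map g (m (fst (k w))) (snd (k w)) \<circ> D (fst (k w))) h"
      unfolding p_def[symmetric] Z'_def by (simp add: D_def)
  qed
  have linD: "linear (D p)" if p: "p \<in> V" for p
    using Ck1_linear[OF C'(5) p] link unfolding D_def
    by (intro linearI) (simp_all add: linear_add linear_cmul scaleR_add_left scaleR_diff_right)
  have det: "absdet (Z' w) = absdet (focal_map g (m (fst (k w))) (snd (k w))) * area_density m (fst (k w))"
    if w: "w \<in> V'" for w
  proof -
    have p: "fst (k w) \<in> V" using w by (simp add: V'_def)
    have "area_density m (fst (k w)) = absdet (D (fst (k w)))"
      unfolding D_def[abs_def] by (rule area_density_pos(2)[OF C E p])
    then show ?thesis
      unfolding Z'eq[OF w] using absdet_compose[OF focal_map_linear[OF E U[OF p]] linD[OF p]] by simp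
  qed
  have cZ': "continuous_on V' (\<lambda>w. Z' w h)" for h
  proof -
    have 1: "continuous_on V' (\<lambda>w. ?m' (fst (k w)) (fst (k h)))"
      by (rule continuous_on_compose2[OF Ck1_continuous[OF C'(5)] cf(1)]) (auto simp: V'_def)
    have 2: "continuous_on V' (\<lambda>w. shape g (m (fst (k w))) (?m' (fst (k w)) (fst (k h))))"
      unfolding shape_def by (rule Ck1_continuous_on_apply[OF G(1) cm _ 1]) (use U in \<open>auto simp: V'_def\<close>)
    have 3: "continuous_on V' (\<lambda>w. unit_gradient g (m (fst (k w))))"
      by (rule continuous_on_compose2[OF G(6) cm]) (use U in \<open>auto simp: V'_def\<close>)
    show ?thesis unfolding Z'_def by (intro continuous_intros 1 2 3 ck)
  qed
  have mJ: "(\<lambda>w. indicator S w * absdet (Z' w)) \<in> borel_measurable borel"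
    using borel_measurable_continuous_on_indicator[OF S continuous_on_subset[OF continuous_on_absdet[OF cZ'] SV]] by simp
  have "(\<integral>\<^sup>+w. ennreal (indicator S w * absdet (Z' w)) \<partial>lborel)
      = (\<integral>\<^sup>+p. \<integral>\<^sup>+t. ennreal (indicator S (i (p, t)) * absdet (Z' (i (p, t)))) \<partial>lborel \<partial>lborel)"
    using mJ by (intro nn_integral_basis_iso[OF C'(1)]) simp
  also have "\<dots> = I" unfolding I_def
  proof (rule nn_integral_cong)
    fix p
    show "(\<integral>\<^sup>+t. ennreal (indicator S (i (p, t)) * absdet (Z' (i (p, t)))) \<partial>lborel)
      = (\<integral>\<^sup>+t. ennreal (absdet (focal_map g (m p) t)) * indicator Q (m p, t) \<partial>lborel) * (ennreal (area_density m p) * indicator B p)"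
    proof (cases "p \<in> B")
      case False
      then have "indicator S (i (p, t)) = (0::real)" for t by (simp add: S_def inv)
      then show ?thesis using False by simp
    next
      case True
      then have pV: "p \<in> V" using B(2) by blast
      have "continuous_on UNIV (\<lambda>t. absdet (focal_map g (m p) t))"
        by (rule continuous_on_absdet) (auto simp: focal_map_def intro!: continuous_intros)
      then have m1: "(\<lambda>t. absdet (focal_map g (m p) t)) \<in> borel_measurable borel" by (rule borel_measurable_continuous_onI)
      have "(\<lambda>t. (m p, t)) \<in> borel_measurable (borel :: real measure)"
        by (intro borel_measurable_continuous_onI continuous_intros)
      then have m2: "(\<lambda>t. indicator Q (m p, t) :: ennreal) \<in> borel_measurable borel"
        using borel_measurable_indicator[OF Q] by (rule measurable_compose)
      have "ennreal (indicator S (i (p, t)) * absdet (Z' (i (p, t))))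
        = (ennreal (absdet (focal_map g (m p) t)) * indicator Q (m p, t)) * ennreal (area_density m p)" for t
      proof -
        have "i (p, t) \<in> V'" using pV by (simp add: V'_def inv)
        then have "absdet (Z' (i (p, t))) = absdet (focal_map g (m p) t) * area_density m p" using det by (simp add: inv)
        then show ?thesis using True area_density_pos(1)[OF C E pV]
          by (auto simp: S_def inv indicator_def ennreal_mult)
      qed
      then show ?thesis using True m1 m2 by (simp add: nn_integral_multc)
    qed
  qed
  finally have int: "(\<integral>\<^sup>+w. ennreal (indicator S w * absdet (Z' w)) \<partial>lborel) = I" .
  have dS: "(Z has_derivative Z' w) (at w)" if "w \<in> S" for w using dZ SV that by blast
  note im = emeasure_image[OF S dS mJ]
  show "Z ` S \<in> sets lebesgue" "emeasure lebesgue (Z ` S) \<le> I" "inj_on Z S \<Longrightarrow> emeasure lebesgue (Z ` S) = I"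
    using im unfolding int by auto
qed

context oriented_hypersurface
begin

lemma sets_area: "sets area = sets (restrict_space borel \<Sigma>)" and space_area: "space area = \<Sigma>"
proof -
  obtain m U g and i :: "nat \<Rightarrow> (real^'n) \<times> real \<Rightarrow> 'a" and k V f W E where P: "patches m U g i k V f W E"
    using patches_exist by blast
  show *: "sets area = sets (restrict_space borel \<Sigma>)" using area_measure_patches(1)[OF P] .
  show "space area = \<Sigma>" using sets_eq_imp_space_eq[OF *] by (simp add: space_restrict_space)
qed

lemma in_sets_area: "A \<in> sets area \<longleftrightarrow> A \<in> sets borel \<and> A \<subseteq> \<Sigma>"
  unfolding sets_area by (rule sets_area_Borel)

lemma emeasure_area_parametrisation:
  "parametrisation V f \<Longrightarrow> B \<in> sets borel \<Longrightarrow> B \<subseteq> V \<Longrightarrow> f ` B \<subseteq> \<Sigma> \<Longrightarrow>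
   emeasure area (f ` B) = (\<integral>\<^sup>+p\<in>B. ennreal (area_density (f :: real^'n \<Rightarrow> 'a) p) \<partial>lborel)"
proof -
  assume "parametrisation V f" "B \<in> sets borel" "B \<subseteq> V" "f ` B \<subseteq> \<Sigma>"
  moreover obtain m U g and i :: "nat \<Rightarrow> (real^'n) \<times> real \<Rightarrow> 'a" and k V f W E where P: "patches m U g i k V f W E"
    using patches_exist by blast
  ultimately show ?thesis by (intro area_measure_patches(3)[OF P])
qed

lemma finite_area: "finite_measure area"
proof
  obtain m U g and i :: "nat \<Rightarrow> (real^'n) \<times> real \<Rightarrow> 'a" and c V f W E where P: "patches m U g i c V f W E"
    using patches_exist by blast
  have "emeasure area (space area) = integral\<^sup>N area (\<lambda>_. 1)" by simp
  also have "\<dots> = (\<Sum>k<m. \<integral>\<^sup>+p. 1 * (ennreal (area_density (f k) p) * indicator {p\<in>V k. f k p \<in> E k} p) \<partial>lborel)"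
    by (rule area_measure_patches(2)[OF P]) simp
  also have "\<dots> < \<infinity>"
  proof (subst infinity_ennreal_def, subst ennreal_sum_less_top, simp, intro ballI)
    fix k assume "k \<in> {..<m}"
    then have k: "k < m" by simp
    note G = graph_chartD[OF patchesD(2)[OF P k]]
    obtain C where C: "compact C" "C \<subseteq> V k" "{p\<in>V k. f k p \<in> E k} \<subseteq> C" using patchesD(6)[OF P k] by blast
    have "continuous_on C (area_density (f k))" using continuous_on_area_density[OF G(5)] C(2) by (rule continuous_on_subset)
    then have "bounded (area_density (f k) ` C)" using C(1) compact_continuous_image compact_imp_bounded by blast
    then obtain M where M: "\<And>p. p \<in> C \<Longrightarrow> \<bar>area_density (f k) p\<bar> \<le> M" by (auto simp: bounded_iff)
    have "(\<integral>\<^sup>+p. 1 * (ennreal (area_density (f k) p) * indicator {p\<in>V k. f k p \<in> E k} p) \<partial>lborel)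
      \<le> (\<integral>\<^sup>+p. ennreal M * indicator C p \<partial>lborel)"
    proof (rule nn_integral_mono)
      fix p
      show "1 * (ennreal (area_density (f k) p) * indicator {p\<in>V k. f k p \<in> E k} p) \<le> ennreal M * indicator C p"
      proof (cases "p \<in> V k \<and> f k p \<in> E k")
        case True
        then have "p \<in> C" using C(3) by blast
        then show ?thesis using M[of p] True by (auto intro!: ennreal_leI)
      qed (auto simp: indicator_def)
    qed
    also have "\<dots> = ennreal M * emeasure lborel C" using C(1) by (subst nn_integral_cmult_indicator) (auto intro: borel_compact)
    also have "\<dots> < top" using emeasure_compact_finite[OF C(1)] by (simp add: ennreal_mult_less_top)
    finally show "(\<integral>\<^sup>+p. 1 * (ennreal (area_density (f k) p) * indicator {p\<in>V k. f k p \<in> E k} p) \<partial>lborel) < top" .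
  qed
  finally show "emeasure area (space area) \<noteq> \<infinity>" by simp
qed

text \<open>By density the neighbourhood contains an interior point of \<Sigma>, hence the image of
  a nonempty open set of parameters, on which the density is positive. Needed to exclude loss of
  volume in the equality case.\<close>

lemma area_full_support:
  assumes x: "x \<in> \<Sigma>" and N: "open N" "x \<in> N"
  shows "emeasure area (\<Sigma> \<inter> N) > 0"
proof -
  have "x \<in> closure (hs_interior \<Sigma>)" using dense x by blast
  then obtain y where y: "y \<in> hs_interior \<Sigma>" "y \<in> N" using N by (metis closure_iff_nhds_not_empty disjoint_iff Int_iff subset_refl)
  have yS: "y \<in> \<Sigma>" using hs_interior_subset[OF y(1)] .
  obtain U g where g: "eqn U g" "y \<in> U" using eqn_exists[OF yS] by blast
  note E = eqnD(1)[OF g(1)]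
  obtain i :: "(real^'n) \<times> real \<Rightarrow> 'a" and k V f W where C: "graph_chart g U i k V f W" "y \<in> W" "f ` V \<subseteq> \<Sigma>"
    using interior_chart[OF y(1) g] by blast
  note C' = graph_chartD[OF C(1)]
  have gy: "g y = 0" using C2_equationD(3)[OF E yS g(2)] .
  define B where "B = V \<inter> f -` N"
  have oB: "open B" unfolding B_def
    using continuous_on_open_vimage[OF C'(2), THEN iffD1, rule_format, OF C'(11) N(1)] by (simp add: Int_commute)
  have neB: "B \<noteq> {}" using C'(9)[OF C(2) gy] y(2) by (auto simp: B_def)
  have eq: "emeasure area (f ` B) = (\<integral>\<^sup>+p\<in>B. ennreal (area_density f p) \<partial>lborel)"
    by (rule emeasure_area_parametrisation[OF graph_chart_parametrisation[OF C(1)]]) (use oB C(3) in \<open>auto simp: B_def\<close>)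
  have "(\<integral>\<^sup>+p\<in>B. ennreal (area_density f p) \<partial>lborel) \<noteq> 0"
  proof
    assume z: "(\<integral>\<^sup>+p\<in>B. ennreal (area_density f p) \<partial>lborel) = 0"
    have "(\<lambda>p. indicator B p *\<^sub>R area_density f p) \<in> borel_measurable borel"
      using oB by (intro borel_measurable_continuous_on_indicator continuous_on_subset[OF continuous_on_area_density[OF C'(5)]]) (auto simp: B_def)
    then have "(\<lambda>p. ennreal (indicator B p *\<^sub>R area_density f p)) \<in> borel_measurable borel" by simp
    moreover have "(\<lambda>p. ennreal (indicator B p *\<^sub>R area_density f p)) = (\<lambda>p. ennreal (area_density f p) * indicator B p)"
      by (auto simp: fun_eq_iff indicator_def)
    ultimately have "AE p in lborel. ennreal (area_density f p) * indicator B p = 0"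
      using z by (simp add: nn_integral_0_iff_AE)
    then have "AE p in lborel. p \<notin> B"
    proof (rule AE_mp, intro AE_I2 impI notI)
      fix p assume p: "ennreal (area_density f p) * indicator B p = 0" "p \<in> B"
      then have "p \<in> V" by (simp add: B_def)
      then show False using p area_density_pos(1)[OF C(1) E \<open>p \<in> V\<close>] by (simp add: ennreal_eq_0_iff)
    qed
    then have "B \<in> null_sets lborel" using oB AE_iff_null_sets[of B lborel] by simp
    then have "negligible B" by (simp add: negligible_iff_null_sets null_sets_completionI)
    then show False using oB neB open_not_negligible by blast
  qed
  then have "emeasure area (f ` B) > 0" unfolding eq by (simp add: zero_less_iff_neq_zero)
  also have "emeasure area (f ` B) \<le> emeasure area (\<Sigma> \<inter> N)"
    by (rule emeasure_mono) (use C(3) in_sets_area closed\<Sigma> N(1) in \<open>auto simp: B_def\<close>)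
  finally show ?thesis .
qed

text \<open>The normal map into the enclosed domain: the minus sign is due to \<nu> pointing
  outward.\<close>

definition \<zeta> :: "'a \<times> real \<Rightarrow> 'a" where "\<zeta> = (\<lambda>(x, t). x - t *\<^sub>R \<nu> x)"

text \<open>Sum of \<open>patch_tube\<close> over the patches. Images may overlap, so in general
  only an upper bound holds; injectivity of \<zeta> and the exact Jacobian give equality.\<close>

lemma tube:
  assumes Q: "Q \<in> sets borel" "Q \<subseteq> \<Sigma> \<times> UNIV"
    and F: "F \<in> borel_measurable borel"
  shows "\<zeta> ` Q \<in> sets lebesgue"
    "(\<And>x t U g. (x, t) \<in> Q \<Longrightarrow> eqn U g \<Longrightarrow> x \<in> U \<Longrightarrow> absdet (focal_map g x t) \<le> F (x, t)) \<Longrightarrow>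
       emeasure lebesgue (\<zeta> ` Q) \<le> (\<integral>\<^sup>+x. \<integral>\<^sup>+t. ennreal (F (x, t)) * indicator Q (x, t) \<partial>lborel \<partial>area)"
    "(\<And>x t U g. (x, t) \<in> Q \<Longrightarrow> eqn U g \<Longrightarrow> x \<in> U \<Longrightarrow> absdet (focal_map g x t) = F (x, t)) \<Longrightarrow> inj_on \<zeta> Q \<Longrightarrow>
       emeasure lebesgue (\<zeta> ` Q) = (\<integral>\<^sup>+x. \<integral>\<^sup>+t. ennreal (F (x, t)) * indicator Q (x, t) \<partial>lborel \<partial>area)"
proof -
  obtain m U g and i :: "nat \<Rightarrow> (real^'n) \<times> real \<Rightarrow> 'a" and c V h W E where P: "patches m U g i c V h W E"
    using patches_exist by blast
  define B where "B k = {p\<in>V k. h k p \<in> E k}" for k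
  define S where "S k = {w. fst (c k w) \<in> B k \<and> (h k (fst (c k w)), snd (c k w)) \<in> Q}" for k
  define Z where "Z k w = h k (fst (c k w)) - snd (c k w) *\<^sub>R unit_gradient (g k) (h k (fst (c k w)))" for k w
  define I where "I k = (\<integral>\<^sup>+p. (\<integral>\<^sup>+t. ennreal (absdet (focal_map (g k) (h k p) t)) * indicator Q (h k p, t) \<partial>lborel) *
      (ennreal (area_density (h k) p) * indicator (B k) p) \<partial>lborel)" for k
  define f where "f x = (\<integral>\<^sup>+t. ennreal (F (x, t)) * indicator Q (x, t) \<partial>lborel)" for x
  have BB: "B k \<in> sets borel" "B k \<subseteq> V k" if "k < m" for k using patchesD(7)[OF P that] by (auto simp: B_def)
  have pt: "Z k ` S k \<in> sets lebesgue" "emeasure lebesgue (Z k ` S k) \<le> I k" "inj_on (Z k) (S k) \<Longrightarrow> emeasure lebesgue (Z k ` S k) = I k"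
    if k: "k < m" for k
    using patch_tube[OF patchesD(2)[OF P k] eqnD(1)[OF patchesD(1)[OF P k]] BB[OF k] Q(1)]
    unfolding Z_def S_def I_def by auto
  have Zk: "Z k w = \<zeta> (h k (fst (c k w)), snd (c k w))" if k: "k < m" and w: "w \<in> S k" for k w
  proof -
    have "h k (fst (c k w)) \<in> \<Sigma>" "h k (fst (c k w)) \<in> U k"
      using w patchesD(4,5)[OF P k] graph_chartD(4)[OF patchesD(2)[OF P k]] by (auto simp: S_def B_def)
    then show ?thesis using eqnD(2)[OF patchesD(1)[OF P k]] by (simp add: Z_def \<zeta>_def)
  qed
  have img: "Z k ` S k = \<zeta> ` (Q \<inter> E k \<times> UNIV)" if k: "k < m" for k
  proof
    show "Z k ` S k \<subseteq> \<zeta> ` (Q \<inter> E k \<times> UNIV)" using Zk[OF k] by (auto simp: S_def B_def)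
    show "\<zeta> ` (Q \<inter> E k \<times> UNIV) \<subseteq> Z k ` S k"
    proof clarify
      fix x t assume x: "(x, t) \<in> Q" "x \<in> E k"
      note G = graph_chartD[OF patchesD(2)[OF P k]]
      have inv: "c k (i k z) = z" for z using basis_isoD(3)[OF G(1)] .
      have xW: "x \<in> W k" "x \<in> \<Sigma>" using x patchesD(4,5)[OF P k] by auto
      then have "g k x = 0" using C2_equationD(3)[OF eqnD(1)[OF patchesD(1)[OF P k]]] G(4) by blast
      then have p: "fst (c k x) \<in> V k" "h k (fst (c k x)) = x" using G(9)[OF xW(1)] by auto
      define w where "w = i k (fst (c k x), t)"
      have w: "w \<in> S k" using p x by (simp add: S_def B_def w_def inv)
      have "\<zeta> (x, t) = Z k w" using Zk[OF k w] p by (simp add: w_def inv)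
      then show "\<zeta> (x, t) \<in> Z k ` S k" using w by blast
    qed
  qed
  have UQ: "Q = (\<Union>k<m. Q \<inter> E k \<times> UNIV)" using Q(2) P by (auto simp: patches_def)
  have im: "\<zeta> ` Q = (\<Union>k<m. Z k ` S k)" by (subst UQ) (auto simp: img image_UN)
  show "\<zeta> ` Q \<in> sets lebesgue" unfolding im using pt(1) by (intro sets.finite_UN) auto
  have mf: "f \<in> borel_measurable borel"
    unfolding f_def
  proof (rule lborel.borel_measurable_nn_integral)
    have s: "sets (borel \<Otimes>\<^sub>M (lborel :: real measure)) = sets (borel :: ('a \<times> real) measure)"
      by (metis borel_prod sets_lborel sets_pair_measure_cong)
    have "(\<lambda>z. ennreal (F z) * indicator Q z) \<in> borel_measurable borel" using F Q(1) by simp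
    then show "(\<lambda>(x, t). ennreal (F (x, t)) * indicator Q (x, t)) \<in> borel_measurable (borel \<Otimes>\<^sub>M lborel)"
      by (simp add: measurable_cong_sets[OF s refl] case_prod_beta')
  qed
  have area_f: "integral\<^sup>N area f = (\<Sum>k<m. \<integral>\<^sup>+p. f (h k p) * (ennreal (area_density (h k) p) * indicator (B k) p) \<partial>lborel)"
    unfolding B_def by (rule area_measure_patches(2)[OF P measurable_restrict_space1[OF mf]])
  have pB: "h k p \<in> U k" if "k < m" "p \<in> B k" for k p
    using that graph_chartD(4,7)[OF patchesD(2)[OF P that(1)]] by (auto simp: B_def)
  {
    assume le: "\<And>x t U g. (x, t) \<in> Q \<Longrightarrow> eqn U g \<Longrightarrow> x \<in> U \<Longrightarrow> absdet (focal_map g x t) \<le> F (x, t)"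
    have "emeasure lebesgue (\<zeta> ` Q) \<le> (\<Sum>k<m. emeasure lebesgue (Z k ` S k))"
      unfolding im by (rule emeasure_subadditive_finite) (use pt(1) in auto)
    also have "\<dots> \<le> (\<Sum>k<m. I k)" using pt(2) by (intro sum_mono) auto
    also have "\<dots> \<le> integral\<^sup>N area f"
      unfolding area_f
    proof (rule sum_mono)
      fix k assume "k \<in> {..<m}"
      then have k: "k < m" by simp
      show "I k \<le> (\<integral>\<^sup>+p. f (h k p) * (ennreal (area_density (h k) p) * indicator (B k) p) \<partial>lborel)"
        unfolding I_def
      proof (rule nn_integral_mono)
        fix p
        show "(\<integral>\<^sup>+t. ennreal (absdet (focal_map (g k) (h k p) t)) * indicator Q (h k p, t) \<partial>lborel) *
          (ennreal (area_density (h k) p) * indicator (B k) p) \<le> f (h k p) * (ennreal (area_density (h k) p) * indicator (B k) p)"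
        proof (cases "p \<in> B k")
          case True
          have "(\<integral>\<^sup>+t. ennreal (absdet (focal_map (g k) (h k p) t)) * indicator Q (h k p, t) \<partial>lborel) \<le> f (h k p)"
            unfolding f_def
            by (intro nn_integral_mono) (auto simp: indicator_def intro!: ennreal_leI le[OF _ patchesD(1)[OF P k] pB[OF k True]])
          then show ?thesis by (intro mult_right_mono) auto
        qed simp
      qed
    qed
    finally show "emeasure lebesgue (\<zeta> ` Q) \<le> (\<integral>\<^sup>+x. \<integral>\<^sup>+t. ennreal (F (x, t)) * indicator Q (x, t) \<partial>lborel \<partial>area)"
      unfolding f_def .
  }
  {
    assume eq: "\<And>x t U g. (x, t) \<in> Q \<Longrightarrow> eqn U g \<Longrightarrow> x \<in> U \<Longrightarrow> absdet (focal_map g x t) = F (x, t)"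
      and inj: "inj_on \<zeta> Q"
    have injZ: "inj_on (Z k) (S k)" if k: "k < m" for k
    proof (rule inj_onI)
      fix w w' assume w: "w \<in> S k" "w' \<in> S k" "Z k w = Z k w'"
      note G = graph_chartD[OF patchesD(2)[OF P k]]
      have "(h k (fst (c k w)), snd (c k w)) = (h k (fst (c k w')), snd (c k w'))"
        using w Zk[OF k] by (intro inj_onD[OF inj]) (auto simp: S_def)
      moreover have "fst (c k w) \<in> V k" "fst (c k w') \<in> V k" using w by (auto simp: S_def B_def)
      ultimately have "c k w = c k w'" using G(12) by (intro prod_eqI) (auto dest: inj_onD)
      then show "w = w'" using G(1) unfolding basis_iso_def by metis
    qed
    have dj: "disjoint_family_on E {..<m}" using P by (simp add: patches_def)
    have "emeasure lebesgue (\<zeta> ` Q) = (\<Sum>k<m. emeasure lebesgue (Z k ` S k))"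
      unfolding im
    proof (rule sum_emeasure[symmetric])
      show "disjoint_family_on (\<lambda>k. Z k ` S k) {..<m}"
        unfolding disjoint_family_on_def
      proof (intro ballI impI)
        fix k l assume kl: "k \<in> {..<m}" "l \<in> {..<m}" "k \<noteq> l"
        have "E k \<inter> E l = {}" using disjoint_family_onD[OF dj kl] .
        then have "(Q \<inter> E k \<times> UNIV) \<inter> (Q \<inter> E l \<times> UNIV) = {}" by blast
        then show "Z k ` S k \<inter> Z l ` S l = {}"
          using kl inj_on_image_Int[OF inj, of "Q \<inter> E k \<times> UNIV" "Q \<inter> E l \<times> UNIV"] by (simp add: img)
      qed
    qed (use pt(1) in auto)
    also have "\<dots> = (\<Sum>k<m. I k)" using pt(3) injZ by (intro sum.cong) auto
    also have "\<dots> = integral\<^sup>N area f"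
      unfolding area_f
    proof (rule sum.cong[OF refl])
      fix k assume "k \<in> {..<m}"
      then have k: "k < m" by simp
      show "I k = (\<integral>\<^sup>+p. f (h k p) * (ennreal (area_density (h k) p) * indicator (B k) p) \<partial>lborel)"
        unfolding I_def
      proof (rule nn_integral_cong)
        fix p
        show "(\<integral>\<^sup>+t. ennreal (absdet (focal_map (g k) (h k p) t)) * indicator Q (h k p, t) \<partial>lborel) *
          (ennreal (area_density (h k) p) * indicator (B k) p) = f (h k p) * (ennreal (area_density (h k) p) * indicator (B k) p)"
        proof (cases "p \<in> B k")
          case True
          have "(\<integral>\<^sup>+t. ennreal (absdet (focal_map (g k) (h k p) t)) * indicator Q (h k p, t) \<partial>lborel) = f (h k p)"
            unfolding f_def
            by (intro nn_integral_cong) (auto simp: indicator_def eq[OF _ patchesD(1)[OF P k] pB[OF k True]])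
          then show ?thesis by simp
        qed simp
      qed
    qed
    finally show "emeasure lebesgue (\<zeta> ` Q) = (\<integral>\<^sup>+x. \<integral>\<^sup>+t. ennreal (F (x, t)) * indicator Q (x, t) \<partial>lborel \<partial>area)"
      unfolding f_def .
  }
qed

end

section \<open>Velocities of curves in the hypersurface\<close>

lemma increasing_along_segment:
  fixes g :: "'a::euclidean_space \<Rightarrow> real"
  assumes B: "convex B" "x \<in> B" "x + d \<in> B"
    and g: "\<And>z. z \<in> B \<Longrightarrow> (g has_derivative (\<lambda>v. G z \<bullet> v)) (at z)" and pos: "\<And>z. z \<in> B \<Longrightarrow> G z \<bullet> d > 0"
  shows "g x < g (x + d)"
proof -
  define h where "h s = g (x + s *\<^sub>R d)" for s
  have inB: "x + s *\<^sub>R d \<in> B" if "0 \<le> s" "s \<le> 1" for s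
  proof -
    have "(1 - s) *\<^sub>R x + s *\<^sub>R (x + d) \<in> B" by (rule convexD[OF B(1)]) (use B that in auto)
    moreover have "(1 - s) *\<^sub>R x + s *\<^sub>R (x + d) = x + s *\<^sub>R d" by (simp add: algebra_simps)
    ultimately show ?thesis by simp
  qed
  have "h 0 < h 1"
  proof (rule DERIV_pos_imp_increasing[of 0 1 h])
    fix s :: real assume s: "0 \<le> s" "s \<le> 1"
    have "(h has_derivative (\<lambda>k. G (x + s *\<^sub>R d) \<bullet> (k *\<^sub>R d))) (at s)"
      unfolding h_def
      by (rule has_derivative_compose[where g = g and f = "\<lambda>s. x + s *\<^sub>R d"])
        (auto intro!: derivative_eq_intros g inB s)
    then have "(h has_derivative (\<lambda>k. k *\<^sub>R (G (x + s *\<^sub>R d) \<bullet> d))) (at s)" by simp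
    then have "DERIV h s :> G (x + s *\<^sub>R d) \<bullet> d"
      by (simp add: has_real_derivative_iff_has_vector_derivative has_vector_derivative_def)
    then show "\<exists>y. DERIV h s :> y \<and> y > 0" using pos[OF inB[OF s]] by blast
  qed simp
  then show ?thesis by (simp add: h_def)
qed

lemma nearest_velocity:
  assumes near: "\<And>z. z \<in> S \<Longrightarrow> dist y x \<le> dist y z" and c: "c 0 = x" "c ` {0..1} \<subseteq> S"
    and d: "(c has_vector_derivative v) (at 0 within {0..1::real})"
  shows "(y - x) \<bullet> v \<le> 0"
proof -
  have lim: "((\<lambda>s. (c s - c 0) /\<^sub>R s) \<longlongrightarrow> v) (at_right 0)"
    using vector_derivative_limit[OF d] unfolding at_0_within_unit .
  have "continuous (at 0 within {0..1}) c" using d has_vector_derivative_continuous by blast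
  then have cc: "(c \<longlongrightarrow> c 0) (at_right 0)" unfolding continuous_within at_0_within_unit .
  \<comment> \<open>With \<open>a = y - x\<close> and \<open>b = c s - x\<close>, the product
    \<open>(2 *\<^sub>R a - b) \<bullet> b\<close> is the squared distance from \<open>y\<close> to
    \<open>x\<close> minus that to \<open>c s\<close>, which is nonpositive.\<close>
  have "((\<lambda>s. (2 *\<^sub>R (y - x) - (c s - x)) \<bullet> ((c s - c 0) /\<^sub>R s)) \<longlongrightarrow> (2 *\<^sub>R (y - x) - (c 0 - x)) \<bullet> v) (at_right 0)"
    by (intro tendsto_intros lim cc)
  moreover have "\<forall>\<^sub>F s in at_right 0. (2 *\<^sub>R (y - x) - (c s - x)) \<bullet> ((c s - c 0) /\<^sub>R s) \<le> 0"
    unfolding eventually_at_right_field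
  proof (intro exI[of _ 1] conjI allI impI)
    fix s :: real assume s: "0 < s" "s < 1"
    then have "c s \<in> S" using c(2) by auto
    then have "norm (y - x) \<le> norm (y - c s)" using near by (simp add: dist_norm)
    then have "(y - x) \<bullet> (y - x) \<le> (y - c s) \<bullet> (y - c s)" by (simp add: norm_le)
    moreover have "(2 *\<^sub>R a - b) \<bullet> b = a \<bullet> a - (a - b) \<bullet> (a - b)" for a b :: 'a
      by (simp add: inner_diff_left inner_diff_right inner_commute)
    from this[of "y - x" "c s - x"] have "(2 *\<^sub>R (y - x) - (c s - x)) \<bullet> (c s - x) =
        (y - x) \<bullet> (y - x) - (y - c s) \<bullet> (y - c s)" by simp
    ultimately have "(2 *\<^sub>R (y - x) - (c s - x)) \<bullet> (c s - x) \<le> 0" by linarith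
    then show "(2 *\<^sub>R (y - x) - (c s - x)) \<bullet> ((c s - c 0) /\<^sub>R s) \<le> 0"
      using s c(1) by (simp add: mult_nonneg_nonpos)
  qed simp
  ultimately have "(2 *\<^sub>R (y - x) - (c 0 - x)) \<bullet> v \<le> 0" by (intro tendsto_upperbound) auto
  then show ?thesis using c(1) by simp
qed

context oriented_hypersurface
begin

lemma tangent_space_subset:
  assumes x: "x \<in> \<Sigma>"
  shows "tangent_space \<Sigma> x \<subseteq> {v. \<nu> x \<bullet> v = 0}"
proof (rule tangent_space_subset_hyperplane)
  fix c v assume c: "c 0 = x" "c ` {0..1} \<subseteq> \<Sigma>" and d: "(c has_vector_derivative v) (at 0 within {0..1::real})"
  obtain U g where g: "eqn U g" "x \<in> U" using eqn_exists[OF x] by blast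
  note E = eqnD(1)[OF g(1)]
  have "((\<lambda>s. g (c s)) has_derivative (\<lambda>h. gradient g x \<bullet> (h *\<^sub>R v))) (at 0 within {0..1})"
    using has_derivative_compose[OF d[unfolded has_vector_derivative_def], of g "\<lambda>v. gradient g x \<bullet> v"]
      C2_equationD(4)[OF E g(2)] c(1) by simp
  then have "((\<lambda>s. g (c s)) has_vector_derivative gradient g x \<bullet> v) (at 0 within {0..1})"
    by (simp add: has_vector_derivative_def)
  from vector_derivative_limit[OF this]
  have lim: "((\<lambda>s. (g (c s) - g (c 0)) /\<^sub>R s) \<longlongrightarrow> gradient g x \<bullet> v) (at_right 0)" unfolding at_0_within_unit .
  have "continuous (at 0 within {0..1}) c" using d has_vector_derivative_continuous by blast
  then have cc: "(c \<longlongrightarrow> x) (at_right 0)" using c(1) unfolding continuous_within at_0_within_unit by simp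
  have "\<forall>\<^sub>F s in at_right 0. c s \<in> U" using topological_tendstoD[OF cc C2_equationD(1)[OF E] g(2)] .
  moreover have "\<forall>\<^sub>F s in at_right 0. 0 < s \<and> s < (1::real)" unfolding eventually_at_right_field by (intro exI[of _ 1]) auto
  ultimately have "\<forall>\<^sub>F s in at_right 0. (g (c s) - g (c 0)) /\<^sub>R s = 0"
  proof eventually_elim
    case (elim s)
    then have "c s \<in> \<Sigma>" using c(2) by auto
    then have "g (c s) = 0" using C2_equationD(3)[OF E] elim by blast
    moreover have "g (c 0) = 0" using C2_equationD(3)[OF E x g(2)] c(1) by simp
    ultimately show ?case by simp
  qed
  then have "((\<lambda>s. (g (c s) - g (c 0)) /\<^sub>R s) \<longlongrightarrow> 0) (at_right 0)" by (rule tendsto_eventually)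
  from tendsto_unique[OF trivial_limit_at_right_real lim this]
  show "\<nu> x \<bullet> v = 0" using eqnD(2)[OF g(1) x g(2)] by (simp add: unit_gradient_def sgn_div_norm)
qed

lemma chart_velocity:
  assumes C: "graph_chart g U i k V m W" and p: "p \<in> V" and q: "frechet_derivative m (at p) q = v" and r: "r > 0"
    and S: "\<And>s. 0 \<le> s \<Longrightarrow> s \<le> r \<Longrightarrow> m (p + s *\<^sub>R q) \<in> \<Sigma>"
  shows "\<exists>c. c 0 = m p \<and> c ` {0..1} \<subseteq> \<Sigma> \<and> (c has_vector_derivative r *\<^sub>R v) (at 0 within {0..1::real})"
proof (intro exI conjI)
  note C' = graph_chartD[OF C]
  let ?c = "\<lambda>s. m (p + s *\<^sub>R (r *\<^sub>R q))"
  show "?c 0 = m p" by simp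
  show "?c ` {0..1} \<subseteq> \<Sigma>"
  proof clarify
    fix s :: real assume "s \<in> {0..1}"
    then have "0 \<le> s * r" "s * r \<le> r" using r by (auto simp: mult_left_le_one_le)
    then show "?c s \<in> \<Sigma>" using S[of "s * r"] by simp
  qed
  have "(?c has_derivative (\<lambda>h. frechet_derivative m (at p) (h *\<^sub>R (r *\<^sub>R q)))) (at 0 within {0..1})"
    by (rule has_derivative_compose[where g = m and f = "\<lambda>s. p + s *\<^sub>R (r *\<^sub>R q)"])
      (use C'(13)[OF p] in \<open>auto intro!: derivative_eq_intros\<close>)
  then show "(?c has_vector_derivative r *\<^sub>R v) (at 0 within {0..1})"
    using Ck1_linear[OF C'(5) p] q by (simp add: has_vector_derivative_def linear_cmul)
qed

lemma interior_velocity: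
  assumes x: "x \<in> hs_interior \<Sigma>" and v: "v \<bullet> \<nu> x = 0"
  shows "\<exists>r>0. \<exists>c. c 0 = x \<and> c ` {0..1} \<subseteq> \<Sigma> \<and> (c has_vector_derivative r *\<^sub>R v) (at 0 within {0..1::real})"
proof -
  have xS: "x \<in> \<Sigma>" using hs_interior_subset[OF x] .
  obtain U g where g: "eqn U g" "x \<in> U" using eqn_exists[OF xS] by blast
  note E = eqnD(1)[OF g(1)]
  obtain i :: "(real^'n) \<times> real \<Rightarrow> 'a" and k V f W where C: "graph_chart g U i k V f W" "x \<in> W" "f ` V \<subseteq> \<Sigma>"
    using interior_chart[OF x g] by blast
  note C' = graph_chartD[OF C(1)]
  have p: "fst (k x) \<in> V" "f (fst (k x)) = x" using C'(9)[OF C(2) C2_equationD(3)[OF E xS g(2)]] by auto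
  have "gradient g x = norm (gradient g x) *\<^sub>R \<nu> x" using unit_gradient_C1(7)[OF E] eqnD(2)[OF g(1) xS g(2)] by simp
  then have "v \<bullet> gradient g (f (fst (k x))) = 0" using v p(2) by (metis inner_scaleR_right mult_zero_right)
  then have q: "frechet_derivative f (at (fst (k x))) (fst (k v)) = v" using C'(10)[OF p(1)] by blast
  obtain e where e: "e > 0" "ball (fst (k x)) e \<subseteq> V" using C'(2) p(1) open_contains_ball by blast
  define r where "r = e / (2 * (norm (fst (k v)) + 1))"
  have nn: "norm (fst (k v)) + 1 > 0" by (intro add_nonneg_pos) auto
  have r: "r > 0" using e nn by (simp add: r_def)
  have "f (fst (k x) + s *\<^sub>R fst (k v)) \<in> \<Sigma>" if s: "0 \<le> s" "s \<le> r" for s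
  proof -
    have "s * norm (fst (k v)) \<le> r * (norm (fst (k v)) + 1)" using s r by (intro mult_mono) auto
    also have "\<dots> = e / 2" using nn by (simp add: r_def field_simps)
    finally have "fst (k x) + s *\<^sub>R fst (k v) \<in> ball (fst (k x)) e" using e s by (simp add: dist_norm)
    then show ?thesis using e(2) C(3) by blast
  qed
  from chart_velocity[OF C(1) p(1) q r this] p(2) r show ?thesis by auto
qed

end

section \<open>The hypersurface inside the container: transversality and the side of nearest
  points\<close>

locale heintze_karcher = oriented_hypersurface T \<Sigma> \<nu> + polytope_domain J u \<Psi> K
  for T :: "'n::finite itself" and \<Sigma> :: "'a::euclidean_space set" and \<nu> :: "'a \<Rightarrow> 'a"
    and J :: "'j set" and u :: "'j \<Rightarrow> 'a \<Rightarrow> real" and \<Psi> :: "'a \<Rightarrow> 'a" and K :: "'a set" +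
  fixes \<Omega> :: "'a set"
  assumes subset: "\<Sigma> \<subseteq> closure K"
    and enclosed: "enclosed_domain K \<Sigma> \<Omega>"
    and outward: "outward_unit_normal_field \<Sigma> \<Omega> \<nu>"
    and mean_convex: "\<forall>x\<in>\<Sigma>. mean_curvature \<Sigma> \<nu> x > 0"
    and boundary: "hs_boundary \<Sigma> \<subseteq> Reg J u \<Psi> \<union> Sing0 J u \<Psi>"
    and transversal: "transversal_to_boundary J u \<Psi> \<Sigma>"
    and regular: "\<forall>x\<in>hs_boundary \<Sigma> \<inter> Reg J u \<Psi>. \<nu> x \<bullet> outer_normal K (frontier K) x \<le> 0"
    and singular: "\<forall>(i, j)\<in>edge_indices J u. \<forall>x\<in>hs_boundary \<Sigma> \<inter> edge_interior J u \<Psi> i j.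
        \<nu> x \<bullet> outer_normal K (piece J u \<Psi> i) x \<le> 0 \<and>
        \<nu> x \<bullet> outer_normal K (piece J u \<Psi> j) x \<le> 0"
begin

lemma \<Omega>: "\<Omega> \<in> components (interior K - \<Sigma>)" "bounded \<Omega>" "\<Sigma> \<subseteq> frontier \<Omega>"
  using enclosed by (auto simp: enclosed_domain_def)

lemma \<Omega>_sub: "\<Omega> \<subseteq> interior K - \<Sigma>" "connected \<Omega>" "\<Omega> \<noteq> {}" "open \<Omega>"
  using in_components_subset[OF \<Omega>(1)] in_components_connected[OF \<Omega>(1)] in_components_nonempty[OF \<Omega>(1)]
    open_components[OF open_Diff[OF open_interior closed\<Sigma>] \<Omega>(1)] by auto

lemma \<Omega>_maximal: "connected C \<Longrightarrow> C \<subseteq> interior K - \<Sigma> \<Longrightarrow> C \<inter> \<Omega> \<noteq> {} \<Longrightarrow> C \<subseteq> \<Omega>"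
  using components_maximal[OF \<Omega>(1)] by (metis Int_commute)

text \<open>The intersection is convex, avoids \<Sigma> and meets \<Omega>, so it lies in the same
  component.\<close>

lemma ball_subset_\<Omega>:
  assumes y: "y \<in> closure \<Omega>" and r: "ball y r \<inter> \<Sigma> = {}" "r > 0"
  shows "ball y r \<inter> interior K \<subseteq> \<Omega>"
proof (rule \<Omega>_maximal)
  show "connected (ball y r \<inter> interior K)"
    by (intro convex_connected convex_Int convex_ball convex_interior convK)
  show "ball y r \<inter> interior K \<subseteq> interior K - \<Sigma>" using r(1) by blast
  have "ball y r \<inter> \<Omega> \<noteq> {}" using y r(2) by (metis centre_in_ball closure_iff_nhds_not_empty disjoint_iff open_ball subset_refl Int_commute)
  then show "ball y r \<inter> interior K \<inter> \<Omega> \<noteq> {}" using \<Omega>_sub(1) by blast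
qed

text \<open>Otherwise both tangent spaces would lie in the hyperplane orthogonal to the piece normal
  and could not span the space.\<close>

lemma piece_transversal:
  assumes p: "p \<in> P" "k \<in> active p" and x: "\<Psi> p \<in> \<Sigma>"
  shows "\<not> tangent_space \<Sigma> (\<Psi> p) \<subseteq> {v. nrm k p \<bullet> v = 0}"
proof
  assume sub: "tangent_space \<Sigma> (\<Psi> p) \<subseteq> {v. nrm k p \<bullet> v = 0}"
  note k = activeD[OF p]
  have "\<Psi> p \<in> piece J u \<Psi> k" using k by (auto simp: piece_def)
  then have "{v + w |v w. v \<in> tangent_space \<Sigma> (\<Psi> p) \<and> w \<in> tangent_space (piece J u \<Psi> k) (\<Psi> p)} = UNIV"
    using transversal k x unfolding transversal_to_boundary_def by blast
  then have "nrm k p \<in> {v + w |v w. v \<in> tangent_space \<Sigma> (\<Psi> p) \<and> w \<in> tangent_space (piece J u \<Psi> k) (\<Psi> p)}" by simp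
  then obtain v w where vw: "v \<in> tangent_space \<Sigma> (\<Psi> p)" "w \<in> tangent_space (piece J u \<Psi> k) (\<Psi> p)" "nrm k p = v + w"
    by blast
  have "nrm k p \<bullet> w = 0" using vw(2) tangent_space_piece[OF _ _ nrm[OF p]] k by blast
  moreover have "nrm k p \<bullet> v = 0" using sub vw(1) by blast
  ultimately have "nrm k p \<bullet> nrm k p = 0" using vw(3) by (metis add.right_neutral inner_add_right)
  then show False using nrmD(3)[OF p] by simp
qed

text \<open>At an interior point of \<Sigma> curves run in both directions of every tangent line. If
  the point were on the frontier of \<open>K\<close>, all of them would have to be tangent to an
  active piece, contrary to transversality.\<close>

lemma hs_interior_in_K: assumes x: "x \<in> hs_interior \<Sigma>" shows "x \<in> interior K"
proof (rule ccontr)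
  assume n: "x \<notin> interior K"
  have xS: "x \<in> \<Sigma>" using hs_interior_subset[OF x] .
  then have "x \<in> frontier K" using subset n by (auto simp: frontier_def)
  note p = frontier_param[OF this]
  then obtain k where k: "k \<in> active (\<Phi> x)" by blast
  let ?N = "nrm k (\<Phi> x)"
  have N: "?N \<in> normal_cone K x" using nrmD(2)[OF p(1) k] p(2) by simp
  have le: "?N \<bullet> v \<le> 0" if v: "v \<bullet> \<nu> x = 0" for v
  proof -
    obtain r c where r: "r > 0" and c: "c 0 = x" "c ` {0..1} \<subseteq> \<Sigma>"
      and d: "(c has_vector_derivative r *\<^sub>R v) (at 0 within {0..1::real})"
      using interior_velocity[OF x v] by blast
    have "?N \<bullet> (r *\<^sub>R v) \<le> 0" by (rule normal_cone_velocity[OF N c(1) _ d]) (use c(2) subset in blast)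
    then show ?thesis using r by (simp add: mult_le_0_iff)
  qed
  have "tangent_space \<Sigma> x \<subseteq> {v. ?N \<bullet> v = 0}"
  proof
    fix v assume "v \<in> tangent_space \<Sigma> x"
    then have "v \<bullet> \<nu> x = 0" using tangent_space_subset[OF xS] by (auto simp: inner_commute)
    then have "?N \<bullet> v \<le> 0" "?N \<bullet> (- v) \<le> 0" using le[of v] le[of "- v"] by simp_all
    then show "v \<in> {v. ?N \<bullet> v = 0}" by simp
  qed
  then show False using piece_transversal[OF p(1) k] p(2) xS by simp
qed

text \<open>The sign conditions extend from the active normals to all outer normals by
  \<open>normal_cone_generated_le\<close>. For the last claim, transversality yields for each active
  piece a tangent vector of \<Sigma> strictly inward for that piece and not outward for the others;
  the sum of these vectors is strictly inward for all.\<close>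

lemma boundary_facts:
  assumes x: "x \<in> hs_boundary \<Sigma>"
  shows "x \<in> \<Sigma>" "x \<in> frontier K" "w \<in> normal_cone K x \<Longrightarrow> \<nu> x \<bullet> w \<le> 0"
    "\<exists>v. v \<bullet> \<nu> x = 0 \<and> x + v \<in> interior K"
proof -
  show xS: "x \<in> \<Sigma>" using x by (simp add: hs_boundary_def)
  have "\<exists>p\<in>P. x = \<Psi> p \<and> active p \<noteq> {} \<and> (\<forall>k\<in>active p. \<nu> x \<bullet> nrm k p \<le> 0)"
  proof (rule boundary_point)
    show "x \<in> Reg J u \<Psi> \<union> Sing0 J u \<Psi>" using x boundary by blast
    show "x \<in> Reg J u \<Psi> \<Longrightarrow> \<nu> x \<bullet> outer_normal K (frontier K) x \<le> 0" using regular x by blast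
    show "\<nu> x \<bullet> outer_normal K (piece J u \<Psi> i) x \<le> 0 \<and> \<nu> x \<bullet> outer_normal K (piece J u \<Psi> j) x \<le> 0"
      if "(i, j) \<in> edge_indices J u" "x \<in> edge_interior J u \<Psi> i j" for i j using singular x that by blast
  qed
  then obtain p where p: "p \<in> P" "x = \<Psi> p" "active p \<noteq> {}" "\<forall>k\<in>active p. \<nu> x \<bullet> nrm k p \<le> 0" by blast
  show "x \<in> frontier K" using frontierK p by blast
  show "\<nu> x \<bullet> w \<le> 0" if "w \<in> normal_cone K x"
    by (rule normal_cone_generated_le[OF p(1,3)]) (use p that in auto)
  have "\<exists>v. \<nu> x \<bullet> v = 0 \<and> nrm k p \<bullet> v < 0 \<and> (\<forall>l\<in>active p. nrm l p \<bullet> v \<le> 0)" if k: "k \<in> active p" for k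
  proof (rule ccontr)
    assume no: "\<not> ?thesis"
    have "tangent_space \<Sigma> x \<subseteq> {v. nrm k p \<bullet> v = 0}"
    proof (rule tangent_space_subset_hyperplane)
      fix c v assume c: "c 0 = x" "c ` {0..1} \<subseteq> \<Sigma>" and d: "(c has_vector_derivative v) (at 0 within {0..1::real})"
      have le: "nrm l p \<bullet> v \<le> 0" if "l \<in> active p" for l
        by (rule normal_cone_velocity[OF _ c(1) _ d]) (use nrmD(2)[OF p(1) that] p(2) c(2) subset in auto)
      have "\<nu> x \<bullet> v = 0" using velocity_tangent_space[OF c d] tangent_space_subset[OF xS] by blast
      then have "\<not> nrm k p \<bullet> v < 0" using no le by blast
      then show "nrm k p \<bullet> v = 0" using le[OF k] by linarith
    qed
    then show False using piece_transversal[OF p(1) k] xS p(2) by simp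
  qed
  then obtain vv where vv: "\<And>k. k \<in> active p \<Longrightarrow> \<nu> x \<bullet> vv k = 0 \<and> nrm k p \<bullet> vv k < 0 \<and> (\<forall>l\<in>active p. nrm l p \<bullet> vv k \<le> 0)"
    by metis
  define v where "v = (\<Sum>k\<in>active p. vv k)"
  have fa: "finite (active p)" using fin by (simp add: active_def)
  have "v \<bullet> nrm k p < 0" if k: "k \<in> active p" for k
  proof -
    have "(\<Sum>l\<in>active p. - (nrm k p \<bullet> vv l)) > 0"
      by (rule sum_pos2[OF fa k]) (use vv k in auto)
    then have "(\<Sum>l\<in>active p. nrm k p \<bullet> vv l) < 0" by (simp add: sum_negf)
    then show ?thesis by (simp add: v_def inner_sum_left inner_commute[of "nrm k p"])
  qed
  then obtain t where t: "t > 0" "\<Psi> p + t *\<^sub>R v \<in> interior K"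
    using inner_direction_active[OF p(1,3)] by blast
  have "(\<Sum>k\<in>active p. \<nu> x \<bullet> vv k) = 0" using vv by (intro sum.neutral) blast
  then have "v \<bullet> \<nu> x = 0" by (simp add: v_def inner_sum_right inner_commute[of _ "\<nu> x"])
  then show "\<exists>v. v \<bullet> \<nu> x = 0 \<and> x + v \<in> interior K" using t p(2) by (intro exI[of _ "t *\<^sub>R v"]) simp
qed

lemma interior_point: "x \<in> \<Sigma> \<Longrightarrow> x \<in> interior K \<Longrightarrow> x \<in> hs_interior \<Sigma>"
  using boundary_facts(2)[of x] by (auto simp: hs_boundary_def frontier_def)

text \<open>A nearest point of \<open>y \<in> \<Omega>\<close> lies on the outer side: otherwise the ball about \<open>y\<close> would
  connect \<open>\<Omega>\<close> with the outside of a nearby interior point of the hypersurface.\<close>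

lemma nearest_point_outward:
  assumes x: "x \<in> \<Sigma>" and y: "y \<in> \<Omega>" and near: "\<And>z. z \<in> \<Sigma> \<Longrightarrow> dist y x \<le> dist y z"
  shows "(y - x) \<bullet> \<nu> x \<le> 0"
proof (rule ccontr)
  assume neg: "\<not> (y - x) \<bullet> \<nu> x \<le> 0"
  define w where "w = y - x"
  have pos: "\<nu> x \<bullet> w > 0" using neg by (simp add: w_def inner_commute)
  have w0: "norm w > 0" using pos by auto
  obtain U g where g: "eqn U g" "x \<in> U" using eqn_exists[OF x] by blast
  note E = eqnD(1)[OF g(1)]
  note E' = C2_equationD[OF E]
  let ?G = "gradient g"
  have G: "?G z = norm (?G z) *\<^sub>R \<nu> z" if "z \<in> \<Sigma>" "z \<in> U" for z
    using unit_gradient_C1(7)[OF E] eqnD(2)[OF g(1) that] by simp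
  have nG: "norm (?G z) > 0" if "z \<in> U" for z using E'(2)[OF that] by simp
  have "?G x \<bullet> w = norm (?G x) * (\<nu> x \<bullet> w)" using G[OF x g(2)] by (metis inner_scaleR_left)
  then have Gx: "?G x \<bullet> w > 0" using pos nG[OF g(2)] by simp
  have "open ((\<lambda>z. ?G z \<bullet> w) -` {0<..} \<inter> U)"
    by (rule continuous_on_open_vimage[OF E'(1), THEN iffD1, rule_format]) (intro continuous_intros E'(6), simp)
  then obtain \<delta> where \<delta>: "\<delta> > 0" "ball x \<delta> \<subseteq> (\<lambda>z. ?G z \<bullet> w) -` {0<..} \<inter> U"
    using Gx g(2) open_contains_ball by (metis IntI greaterThan_iff vimageI)
  have \<delta>U: "z \<in> U" "?G z \<bullet> w > 0" if "z \<in> ball x \<delta>" for z using \<delta>(2) that by auto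
  have yK: "y \<in> interior K" using y \<Omega>_sub(1) by blast
  obtain e where e: "e > 0" "ball y e \<subseteq> interior K" using yK open_contains_ball open_interior by blast
  \<comment> \<open>Keeps the points \<open>x' + s *\<^sub>R w\<close> in
    \<open>ball x \<delta>\<close>, where \<open>g\<close> increases along \<open>w\<close>.\<close>
  define t where "t = min (1/2) (\<delta> / (4 * norm w))"
  have t: "0 < t" "t < 1" "t * norm w \<le> \<delta> / 4" using \<delta>(1) w0 by (auto simp: t_def min_def field_simps)
  \<comment> \<open>Outwardness is known at interior points only, so \<open>x\<close> is replaced by
    a nearby \<open>x'\<close>. The three bounds keep \<open>x'\<close> in the region where
    \<open>g\<close> is controlled, put \<open>x' + t *\<^sub>R w\<close> into the ball about
    \<open>y\<close> that avoids \<Sigma>, and keep \<open>x' + w\<close> in the interior of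
    \<open>K\<close>.\<close>
  define m where "m = min (min (\<delta> / 4) (t * norm w)) e"
  have m: "m > 0" using \<delta>(1) t(1) w0 e(1) by (simp add: m_def)
  have "x \<in> closure (hs_interior \<Sigma>)" using dense x by blast
  then obtain x' where x': "x' \<in> hs_interior \<Sigma>" "dist x' x < m"
    using m closure_approachable by blast
  have x'S: "x' \<in> \<Sigma>" using hs_interior_subset[OF x'(1)] .
  have x'K: "x' \<in> interior K" using hs_interior_in_K[OF x'(1)] .
  have x'b: "norm (x' - x) < \<delta> / 4" "norm (x' - x) < t * norm w" "norm (x' - x) < e"
    using x'(2) by (auto simp: m_def dist_norm)
  have "dist y (y + (x' - x)) < e" using x'b(3) by (simp add: dist_norm norm_minus_commute)
  then have yK': "x' + w \<in> interior K" using e(2) by (auto simp: w_def algebra_simps)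
  have segK: "x' + s *\<^sub>R w \<in> interior K" if "0 \<le> s" "s \<le> 1" for s
  proof -
    have "(1 - s) *\<^sub>R x' + s *\<^sub>R (x' + w) \<in> interior K"
      by (rule convexD[OF convex_interior[OF convK] x'K yK']) (use that in auto)
    moreover have "(1 - s) *\<^sub>R x' + s *\<^sub>R (x' + w) = x' + s *\<^sub>R w" by (simp add: algebra_simps)
    ultimately show ?thesis by simp
  qed
  have inb: "x' + s *\<^sub>R w \<in> ball x \<delta>" if "0 \<le> s" "s \<le> t" for s
  proof -
    have "norm (x' + s *\<^sub>R w - x) \<le> norm (x' - x) + norm (s *\<^sub>R w)"
      using norm_triangle_ineq[of "x' - x" "s *\<^sub>R w"] by (simp add: algebra_simps)
    also have "norm (s *\<^sub>R w) \<le> t * norm w" using that by (simp add: mult_right_mono)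
    finally show ?thesis using x'b(1) t(3) \<delta>(1) by (simp add: dist_norm norm_minus_commute)
  qed
  have x'U: "x' \<in> ball x \<delta>" using inb[of 0] t by simp
  have gx': "g x' = 0" using E'(3)[OF x'S] \<delta>U(1)[OF x'U] .
  have notS: "x' + s *\<^sub>R w \<notin> \<Sigma>" if s: "0 < s" "s \<le> t" for s
  proof
    assume "x' + s *\<^sub>R w \<in> \<Sigma>"
    then have "g (x' + s *\<^sub>R w) = 0" using E'(3) \<delta>U(1)[OF inb] s by simp
    moreover have "g x' < g (x' + s *\<^sub>R w)"
      by (rule increasing_along_segment[OF convex_ball x'U, where G = ?G])
        (use inb s \<delta>U E'(4) in \<open>auto simp: mult_pos_pos\<close>)
    ultimately show False using gx' by simp
  qed
  have nb: "ball y (norm w) \<inter> \<Sigma> = {}" using near by (auto simp: w_def dist_norm not_less[symmetric])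
  have z\<Omega>: "x' + t *\<^sub>R w \<in> \<Omega>"
  proof -
    have "x' + t *\<^sub>R w - y = (x' - x) - (1 - t) *\<^sub>R w" by (simp add: w_def algebra_simps)
    then have "norm (x' + t *\<^sub>R w - y) \<le> norm (x' - x) + norm ((1 - t) *\<^sub>R w)"
      using norm_triangle_ineq4 by metis
    also have "\<dots> < t * norm w + (1 - t) * norm w" using x'b(2) t by simp
    also have "\<dots> = norm w" by (simp add: algebra_simps)
    finally have "x' + t *\<^sub>R w \<in> ball y (norm w)" by (simp add: dist_norm norm_minus_commute)
    moreover have "y \<in> closure \<Omega>" using y closure_subset by blast
    ultimately show ?thesis using ball_subset_\<Omega>[OF _ nb w0] segK[of t] t by auto
  qed
  have L\<Omega>: "x' + s *\<^sub>R w \<in> \<Omega>" if s: "0 < s" "s \<le> t" for s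
  proof -
    let ?L = "(\<lambda>s. x' + s *\<^sub>R w) ` {s..t}"
    have "?L \<subseteq> \<Omega>"
    proof (rule \<Omega>_maximal)
      show "connected ?L" by (intro connected_continuous_image continuous_intros connected_Icc)
      show "?L \<subseteq> interior K - \<Sigma>" using segK notS s t by auto
      have "x' + t *\<^sub>R w \<in> ?L" using s by (intro image_eqI[OF refl]) simp
      then show "?L \<inter> \<Omega> \<noteq> {}" using z\<Omega> by blast
    qed
    moreover have "x' + s *\<^sub>R w \<in> ?L" using s by (intro image_eqI[OF refl]) simp
    ultimately show ?thesis by blast
  qed
  let ?\<nu> = "\<nu> x'"
  have nx': "?\<nu> \<bullet> ?\<nu> = 1" using norm\<nu>[OF x'S] by (simp add: dot_square_norm)
  have "?G x' \<bullet> ?\<nu> = norm (?G x')" using G[OF x'S \<delta>U(1)[OF x'U]] nx' by (metis inner_scaleR_left mult.right_neutral)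
  then have Gx': "?G x' \<bullet> ?\<nu> > 0" using nG[OF \<delta>U(1)[OF x'U]] by simp
  have "open ((\<lambda>z. ?G z \<bullet> ?\<nu>) -` {0<..} \<inter> U)"
    by (rule continuous_on_open_vimage[OF E'(1), THEN iffD1, rule_format]) (intro continuous_intros E'(6), simp)
  then have "open (((\<lambda>z. ?G z \<bullet> ?\<nu>) -` {0<..} \<inter> U) \<inter> ball x \<delta> \<inter> interior K)" by (rule open_Int[OF open_Int[OF _ open_ball] open_interior])
  moreover have "x' \<in> ((\<lambda>z. ?G z \<bullet> ?\<nu>) -` {0<..} \<inter> U) \<inter> ball x \<delta> \<inter> interior K" using Gx' \<delta>U(1)[OF x'U] x'U x'K by simp
  ultimately obtain r where r: "r > 0" "ball x' r \<subseteq> ((\<lambda>z. ?G z \<bullet> ?\<nu>) -` {0<..} \<inter> U) \<inter> ball x \<delta> \<inter> interior K"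
    using open_contains_ball by blast
  have "\<forall>\<^sub>F s in at_right 0. x' + s *\<^sub>R ?\<nu> \<notin> \<Omega>"
    using outward x'(1) unfolding outward_unit_normal_field_def by (auto elim: eventually_mono)
  then obtain b where b: "b > 0" "\<And>s. 0 < s \<Longrightarrow> s < b \<Longrightarrow> x' + s *\<^sub>R ?\<nu> \<notin> \<Omega>"
    unfolding eventually_at_right_field by blast
  define c where "c = norm w + norm ?\<nu> + 1"
  have c: "c > 0" unfolding c_def by (intro add_nonneg_pos) auto
  define s where "s = min (min (b / 2) t) (r / (2 * c))"
  have s: "0 < s" "s < b" "s \<le> t" "s * c < r"
  proof -
    show "0 < s" "s < b" "s \<le> t" using b(1) t(1) r(1) c by (auto simp: s_def)
    have "s * c \<le> (r / (2 * c)) * c" using c by (intro mult_right_mono) (auto simp: s_def)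
    also have "\<dots> < r" using c r(1) by simp
    finally show "s * c < r" .
  qed
  \<comment> \<open>The direction is turned from \<open>w\<close> to \<open>\<nu> x'\<close>. The
    gradient of \<open>g\<close> has positive product with both, so the moving point stays where
    \<open>g > 0\<close>, off \<Sigma> and thus in \<Omega>. It ends at an outer point.\<close>
  let ?d = "\<lambda>a. (1 - a) *\<^sub>R w + a *\<^sub>R ?\<nu>"
  have db: "x' + s *\<^sub>R ?d a \<in> ball x' r" if "0 \<le> a" "a \<le> 1" for a
  proof -
    have "norm (?d a) \<le> (1 - a) * norm w + a * norm ?\<nu>"
      by (rule order_trans[OF norm_triangle_ineq]) (use that in simp)
    also have "\<dots> \<le> 1 * norm w + 1 * norm ?\<nu>" using that by (intro add_mono mult_right_mono) auto
    also have "\<dots> \<le> c" by (simp add: c_def)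
    finally have "s * norm (?d a) \<le> s * c" using s(1) by (simp add: mult_left_mono)
    then have "s * norm (?d a) < r" using s(4) by (rule le_less_trans)
    then show ?thesis using s(1) by (simp add: dist_norm)
  qed
  let ?M = "(\<lambda>a. x' + s *\<^sub>R ?d a) ` {0..1}"
  have "?M \<subseteq> \<Omega>"
  proof (rule \<Omega>_maximal)
    show "connected ?M" by (intro connected_continuous_image continuous_intros connected_Icc)
    show "?M \<inter> \<Omega> \<noteq> {}"
    proof -
      have "x' + s *\<^sub>R ?d 0 \<in> ?M" by (rule image_eqI[OF refl]) simp
      moreover have "x' + s *\<^sub>R ?d 0 \<in> \<Omega>" using L\<Omega>[OF s(1,3)] by simp
      ultimately show ?thesis by blast
    qed
    show "?M \<subseteq> interior K - \<Sigma>"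
    proof clarify
      fix a :: real assume "a \<in> {0..1}"
      then have a: "0 \<le> a" "a \<le> 1" by auto
      have pz: "?G z \<bullet> (s *\<^sub>R ?d a) > 0" if z: "z \<in> ball x' r" for z
      proof -
        have "?G z \<bullet> w > 0" "?G z \<bullet> ?\<nu> > 0" using z r(2) \<delta>U(2) by auto
        then have "(1 - a) * (?G z \<bullet> w) + a * (?G z \<bullet> ?\<nu>) > 0"
          using a by (cases "a = 0") (auto intro!: add_nonneg_pos)
        then show ?thesis using s(1) by (simp add: inner_add_right)
      qed
      have "g x' < g (x' + s *\<^sub>R ?d a)"
        by (rule increasing_along_segment[OF convex_ball _ db[OF a], where G = ?G])
          (use r pz E'(4) in auto)
      moreover have "x' + s *\<^sub>R ?d a \<in> U" "x' + s *\<^sub>R ?d a \<in> interior K" using db[OF a] r(2) by auto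
      ultimately show "x' + s *\<^sub>R ?d a \<in> interior K - \<Sigma>" using gx' E'(3)[of "x' + s *\<^sub>R ?d a"] by auto
    qed
  qed
  moreover have "x' + s *\<^sub>R ?d 1 \<in> ?M" by (rule image_eqI[OF refl]) simp
  ultimately have "x' + s *\<^sub>R ?\<nu> \<in> \<Omega>" by auto
  then show False using b(2)[OF s(1,2)] by blast
qed

end

section \<open>Boundary points: inward curves, null sets and nearest points\<close>

context heintze_karcher
begin

text \<open>Along a direction tangent to the hypersurface and pointing into the container, the chart enters the
  interior of the container at once.\<close>

lemma inward_chart:
  assumes x: "x \<in> hs_boundary \<Sigma>" and v: "v \<bullet> \<nu> x = 0" "x + v \<in> interior K" and g: "eqn U g" "x \<in> U"
  obtains i :: "(real^'n) \<times> real \<Rightarrow> 'a" and k V m W \<rho> s0 where "graph_chart g U i k V m W" "x \<in> W" "\<rho> > 0" "s0 > 0"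
    "cball (fst (k x)) (2 * \<rho>) \<subseteq> V" "frechet_derivative m (at (fst (k x))) (fst (k v)) = v"
    "\<And>p s. p \<in> cball (fst (k x)) \<rho> \<Longrightarrow> 0 \<le> s \<Longrightarrow> s \<le> s0 \<Longrightarrow> p + s *\<^sub>R fst (k v) \<in> ball (fst (k x)) (2 * \<rho>)"
    "\<And>p s. p \<in> cball (fst (k x)) \<rho> \<Longrightarrow> 0 < s \<Longrightarrow> s \<le> s0 \<Longrightarrow> m p \<in> closure K \<Longrightarrow> m (p + s *\<^sub>R fst (k v)) \<in> interior K"
proof -
  have xS: "x \<in> \<Sigma>" using boundary_facts(1)[OF x] .
  note E = eqnD(1)[OF g(1)]
  obtain i :: "(real^'n) \<times> real \<Rightarrow> 'a" and k V m W where C: "graph_chart g U i k V m W" "x \<in> W"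
    using graph_chart_exists[OF dim E g(2) C2_equationD(3)[OF E xS g(2)]] by blast
  note C' = graph_chartD[OF C(1)]
  define p0 q where "p0 = fst (k x)" and "q = fst (k v)"
  have p0: "p0 \<in> V" "m p0 = x" using C'(9)[OF C(2) C2_equationD(3)[OF E xS g(2)]] by (auto simp: p0_def)
  have "gradient g x = norm (gradient g x) *\<^sub>R \<nu> x" using unit_gradient_C1(7)[OF E] eqnD(2)[OF g(1) xS g(2)] by simp
  then have "v \<bullet> gradient g (m p0) = 0" using v p0(2) by (metis inner_scaleR_right mult_zero_right)
  then have dq: "frechet_derivative m (at p0) q = v" using C'(10)[OF p0(1)] by (simp add: q_def)
  obtain e where e: "e > 0" "ball (x + v) e \<subseteq> interior K" using v(2) open_contains_ball open_interior by blast
  have c1: "continuous_on V (\<lambda>p. frechet_derivative m (at p) q - v)"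
    by (intro continuous_intros Ck1_continuous_on_apply[OF C'(5)]) auto
  have "open (V \<inter> (\<lambda>p. frechet_derivative m (at p) q - v) -` ball 0 (e / 2) \<inter> (V \<inter> m -` ball x (e / 2)))"
    by (intro open_Int continuous_open_preimage c1 C'(2,11) open_ball)
  moreover have "p0 \<in> V \<inter> (\<lambda>p. frechet_derivative m (at p) q - v) -` ball 0 (e / 2) \<inter> (V \<inter> m -` ball x (e / 2))"
    using p0 dq e(1) by simp
  ultimately obtain r where r: "r > 0" "ball p0 r \<subseteq> V \<inter> (\<lambda>p. frechet_derivative m (at p) q - v) -` ball 0 (e / 2) \<inter> (V \<inter> m -` ball x (e / 2))"
    using open_contains_ball by blast
  have rV: "p \<in> V" and rd: "norm (frechet_derivative m (at p) q - v) \<le> e / 2" and rx: "norm (m p - x) < e / 2" if "p \<in> ball p0 r" for p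
    using r(2) that by (auto simp: dist_norm norm_minus_commute)
  define \<rho> where "\<rho> = r / 4"
  define s0 where "s0 = min 1 (\<rho> / (2 * (norm q + 1)))"
  have nq: "norm q + 1 > 0" by (intro add_nonneg_pos) auto
  have \<rho>: "\<rho> > 0" and s0: "s0 > 0" "s0 \<le> 1" using r(1) nq by (auto simp: \<rho>_def s0_def)
  have s0q: "s * norm q < \<rho>" if "0 \<le> s" "s \<le> s0" for s
  proof -
    have "s * norm q \<le> (\<rho> / (2 * (norm q + 1))) * (norm q + 1)" using that \<rho> nq by (intro mult_mono) (auto simp: s0_def)
    also have "\<dots> < \<rho>" using \<rho> nq by (simp add: divide_simps)
    finally show ?thesis .
  qed
  have mv: "p + s *\<^sub>R q \<in> ball p0 (2 * \<rho>)" if "p \<in> cball p0 \<rho>" "0 \<le> s" "s \<le> s0" for p s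
  proof -
    have "dist p0 (p + s *\<^sub>R q) \<le> dist p0 p + dist p (p + s *\<^sub>R q)" by (rule dist_triangle)
    also have "\<dots> < \<rho> + \<rho>" using that s0q[of s] by (simp add: dist_norm)
    finally show ?thesis by simp
  qed
  have inr: "p + s *\<^sub>R q \<in> ball p0 r" if "p \<in> cball p0 \<rho>" "0 \<le> s" "s \<le> s0" for p s
    using mv[OF that] \<rho> by (auto simp: \<rho>_def)
  show thesis
  proof (rule that[OF C \<rho> s0(1)])
    show "cball (fst (k x)) (2 * \<rho>) \<subseteq> V" using rV \<rho> by (auto simp: \<rho>_def p0_def[symmetric] subset_iff)
    show "frechet_derivative m (at (fst (k x))) (fst (k v)) = v" using dq by (simp add: p0_def q_def)
    fix p s assume p: "p \<in> cball (fst (k x)) \<rho>" and s: "0 \<le> s" "s \<le> s0"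
    show "p + s *\<^sub>R fst (k v) \<in> ball (fst (k x)) (2 * \<rho>)" using mv[of p s] p s by (simp add: p0_def q_def)
  next
    fix p s assume p': "p \<in> cball (fst (k x)) \<rho>" and s: "0 < s" "s \<le> s0" and K: "m p \<in> closure K"
    have p: "p \<in> cball p0 \<rho>" using p' by (simp add: p0_def)
    \<comment> \<open>Mean value inequality: over the parameter length \<open>s\<close> the chart
      moves by \<open>s *\<^sub>R v\<close> up to an error \<open>e / 2 * s\<close>.\<close>
    have "norm ((m (p + s *\<^sub>R q) - s *\<^sub>R v) - (m (p + 0 *\<^sub>R q) - 0 *\<^sub>R v)) \<le> e / 2 * norm (s - 0)"
    proof (rule differentiable_bound[where S = "{0..s}" and f = "\<lambda>t. m (p + t *\<^sub>R q) - t *\<^sub>R v"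
          and f' = "\<lambda>t h. frechet_derivative m (at (p + t *\<^sub>R q)) (h *\<^sub>R q) - h *\<^sub>R v"])
      fix t assume "t \<in> {0..s}"
      then have t: "p + t *\<^sub>R q \<in> ball p0 r" using inr[OF p] s by simp
      have "((\<lambda>t. m (p + t *\<^sub>R q)) has_derivative (\<lambda>h. frechet_derivative m (at (p + t *\<^sub>R q)) (h *\<^sub>R q))) (at t within {0..s})"
        by (rule has_derivative_compose[where g = m and f = "\<lambda>t. p + t *\<^sub>R q"])
          (use C'(13)[OF rV[OF t]] in \<open>auto intro!: derivative_eq_intros\<close>)
      then show "((\<lambda>t. m (p + t *\<^sub>R q) - t *\<^sub>R v) has_derivative
          (\<lambda>h. frechet_derivative m (at (p + t *\<^sub>R q)) (h *\<^sub>R q) - h *\<^sub>R v)) (at t within {0..s})"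
        by (intro derivative_intros)
      have "frechet_derivative m (at (p + t *\<^sub>R q)) (h *\<^sub>R q) - h *\<^sub>R v = h *\<^sub>R (frechet_derivative m (at (p + t *\<^sub>R q)) q - v)" for h
        using linear_cmul[OF Ck1_linear[OF C'(5) rV[OF t]]] by (simp add: scaleR_diff_right)
      then show "onorm (\<lambda>h. frechet_derivative m (at (p + t *\<^sub>R q)) (h *\<^sub>R q) - h *\<^sub>R v) \<le> e / 2"
        using mult_right_mono[OF rd[OF t] abs_ge_zero] by (intro onorm_le) (simp add: mult.commute)
    qed (use s in auto)
    then have b: "norm (m (p + s *\<^sub>R q) - s *\<^sub>R v - m p) \<le> e / 2 * s" using s by simp
    \<comment> \<open>The point reached from \<open>m p\<close> by stretching the increment by
      \<open>1 / s\<close>. It is within \<open>e\<close> of \<open>x + v\<close>, hence interior to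
      \<open>K\<close>, and \<open>m (p + s *\<^sub>R q)\<close> lies between \<open>m p\<close> and
      it.\<close>
    define c where "c = m p + (1 / s) *\<^sub>R (m (p + s *\<^sub>R q) - m p)"
    have eq: "c - (x + v) = (m p - x) + (1 / s) *\<^sub>R (m (p + s *\<^sub>R q) - s *\<^sub>R v - m p)"
      using s by (simp add: c_def algebra_simps)
    have "norm ((1 / s) *\<^sub>R (m (p + s *\<^sub>R q) - s *\<^sub>R v - m p)) \<le> e / 2"
      using b s by (simp only: norm_scaleR) (simp add: divide_simps)
    then have "norm (c - (x + v)) < e / 2 + e / 2" unfolding eq
      by (intro le_less_trans[OF norm_triangle_ineq] add_less_le_mono rx) (use inr[OF p, of 0] s in auto)
    then have c: "c \<in> interior K" using e(2) by (auto simp: dist_norm norm_minus_commute)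
    have "m p - s *\<^sub>R (m p - c) \<in> interior K"
      by (rule mem_interior_closure_convex_shrink[OF convK c K]) (use s s0 in auto)
    moreover have "m p - s *\<^sub>R (m p - c) = m (p + s *\<^sub>R q)" using s by (simp add: c_def)
    ultimately show "m (p + s *\<^sub>R fst (k v)) \<in> interior K" by (simp add: q_def)
  qed
qed

text \<open>A chart at a boundary point extends beyond \<Sigma>, so it must be shown that the part
  over the interior of \<open>K\<close> in the inward direction belongs to \<Sigma>. Over the
  interior of \<open>K\<close>, membership in \<Sigma> is both open and closed, so it propagates
  along connected sets of parameters.\<close>

lemma boundary_velocity:
  assumes x: "x \<in> hs_boundary \<Sigma>" and v: "v \<bullet> \<nu> x = 0" "x + v \<in> interior K"
  shows "\<exists>r>0. \<exists>c. c 0 = x \<and> c ` {0..1} \<subseteq> \<Sigma> \<and> (c has_vector_derivative r *\<^sub>R v) (at 0 within {0..1::real})"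
proof -
  have xS: "x \<in> \<Sigma>" using boundary_facts(1)[OF x] .
  obtain U g where g: "eqn U g" "x \<in> U" using eqn_exists[OF xS] by blast
  note E = eqnD(1)[OF g(1)]
  obtain i :: "(real^'n) \<times> real \<Rightarrow> 'a" and k V f W b s0 where C: "graph_chart g U i k V f W" "x \<in> W"
    and b: "b > 0" and s0: "s0 > 0" and cb: "cball (fst (k x)) (2 * b) \<subseteq> V"
    and dq: "frechet_derivative f (at (fst (k x))) (fst (k v)) = v"
    and mv: "\<And>p s. p \<in> cball (fst (k x)) b \<Longrightarrow> 0 \<le> s \<Longrightarrow> s \<le> s0 \<Longrightarrow> p + s *\<^sub>R fst (k v) \<in> ball (fst (k x)) (2 * b)"
    and int: "\<And>p s. p \<in> cball (fst (k x)) b \<Longrightarrow> 0 < s \<Longrightarrow> s \<le> s0 \<Longrightarrow> f p \<in> closure K \<Longrightarrow> f (p + s *\<^sub>R fst (k v)) \<in> interior K"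
    using inward_chart[OF x v g] by metis
  note C' = graph_chartD[OF C(1)]
  define p0 q B where "p0 = fst (k x)" and "q = fst (k v)" and "B = ball p0 (2 * b)"
  note mv = mv[folded p0_def q_def, folded B_def] and int = int[folded p0_def q_def]
  have BV: "B \<subseteq> V" using cb ball_subset_cball by (auto simp: B_def p0_def)
  have p0: "p0 \<in> V" "f p0 = x" using C'(9)[OF C(2) C2_equationD(3)[OF E xS g(2)]] by (auto simp: p0_def)
  have cB: "continuous_on B f" using continuous_on_subset[OF C'(11) BV] .
  have oB: "open B" by (simp add: B_def)
  have pre: "open (B \<inter> f -` Y)" if "open Y" for Y by (rule continuous_open_preimage[OF cB oB that])
  \<comment> \<open>\<open>D1\<close> is open because near an interior point \<Sigma> is the entire
    zero set; \<open>D2\<close> is open because \<Sigma> is closed.\<close>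
  define D1 D2 where "D1 = B \<inter> f -` interior K \<inter> f -` \<Sigma>" and "D2 = B \<inter> f -` (interior K - \<Sigma>)"
  have oD1: "open D1"
  proof (subst open_subopen, intro ballI)
    fix p assume p: "p \<in> D1"
    then have y: "f p \<in> hs_interior \<Sigma>" by (intro interior_point) (auto simp: D1_def)
    have pV: "p \<in> V" using p BV by (auto simp: D1_def)
    have yU: "f p \<in> U" using C'(4) C'(7)[OF pV] by blast
    obtain W' where W': "open W'" "f p \<in> W'" "W' \<subseteq> U" "\<Sigma> \<inter> W' = {y\<in>W'. g y = 0}"
      using hs_interior_any_equation[OF dim E y yU] by blast
    have "B \<inter> f -` (interior K \<inter> W') \<subseteq> D1"
    proof
      fix p' assume p': "p' \<in> B \<inter> f -` (interior K \<inter> W')"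
      then have "g (f p') = 0" using C'(8) BV by blast
      then have "f p' \<in> \<Sigma>" using p' W'(4) by blast
      then show "p' \<in> D1" using p' by (auto simp: D1_def)
    qed
    moreover have "open (B \<inter> f -` (interior K \<inter> W'))" by (intro pre open_Int W'(1) open_interior)
    moreover have "p \<in> B \<inter> f -` (interior K \<inter> W')" using p W'(2) by (auto simp: D1_def)
    ultimately show "\<exists>T. open T \<and> p \<in> T \<and> T \<subseteq> D1" by blast
  qed
  have oD2: "open D2" unfolding D2_def by (intro pre open_Diff open_interior closed\<Sigma>)
  have sep: "A \<subseteq> D1" if A: "connected A" "A \<subseteq> B \<inter> f -` interior K" "A \<inter> D1 \<noteq> {}" for A
  proof -
    have "D1 \<inter> A = {} \<or> D2 \<inter> A = {}"
      by (rule connectedD[OF A(1) oD1 oD2]) (use A(2) in \<open>auto simp: D1_def D2_def\<close>)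
    moreover have "A \<subseteq> D1 \<union> D2" using A(2) by (auto simp: D1_def D2_def)
    ultimately show ?thesis using A(3) by blast
  qed
  \<comment> \<open>Membership is carried from an interior point of \<Sigma> near \<open>x\<close>
    along \<open>q\<close> into a ball about \<open>p1\<close>, spread over that ball, and carried
    back along \<open>q\<close> towards \<open>p0\<close>.\<close>
  define p1 where "p1 = p0 + s0 *\<^sub>R q"
  have p0c: "p0 \<in> cball p0 b" using b by simp
  have "x \<in> closure K" using xS subset by blast
  then have p1: "p1 \<in> B \<inter> f -` interior K" using mv[OF p0c, of s0] int[OF p0c s0 order_refl] s0 p0 by (simp add: p1_def)
  obtain r2 where r2: "r2 > 0" "ball p1 r2 \<subseteq> B \<inter> f -` interior K"
    using p1 pre[OF open_interior, of K] open_contains_ball by blast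
  have "open (W \<inter> (\<lambda>z. fst (k z)) -` ball p0 (min b r2))"
    by (intro continuous_open_preimage C'(3) continuous_on_fst_basis_iso[OF C'(1)] open_ball)
  moreover have "x \<in> W \<inter> (\<lambda>z. fst (k z)) -` ball p0 (min b r2)" using C(2) b r2(1) by (simp add: p0_def)
  moreover have "x \<in> closure (hs_interior \<Sigma>)" using dense xS by blast
  ultimately have "W \<inter> (\<lambda>z. fst (k z)) -` ball p0 (min b r2) \<inter> hs_interior \<Sigma> \<noteq> {}"
    using open_Int_closure_eq_empty by blast
  then obtain x' where x': "x' \<in> hs_interior \<Sigma>" "x' \<in> W" "fst (k x') \<in> ball p0 (min b r2)"
    by blast
  define p' where "p' = fst (k x')"
  have x'S: "x' \<in> \<Sigma>" using hs_interior_subset[OF x'(1)] .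
  have x'K: "x' \<in> interior K" using hs_interior_in_K[OF x'(1)] .
  have "g x' = 0" using C2_equationD(3)[OF E x'S] x'(2) C'(4) by blast
  then have p': "p' \<in> V" "f p' = x'" using C'(9)[OF x'(2)] by (auto simp: p'_def)
  have p'b: "p' \<in> cball p0 b" "p' \<in> ball p0 r2" using x'(3) by (auto simp: p'_def)
  let ?L = "\<lambda>p. (\<lambda>s. p + s *\<^sub>R q) ` {0..s0}"
  have "?L p' \<subseteq> D1"
  proof (rule sep)
    show "connected (?L p')" by (intro connected_continuous_image continuous_intros connected_Icc)
    show "?L p' \<subseteq> B \<inter> f -` interior K"
    proof (rule subsetI)
      fix z assume "z \<in> ?L p'"
      then obtain s where s: "z = p' + s *\<^sub>R q" "0 \<le> s" "s \<le> s0" by (auto simp only: atLeastAtMost_iff)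
      have "f z \<in> interior K"
      proof (cases "s = 0")
        case True then show ?thesis using s p'(2) x'K by simp
      next
        case False
        have "f p' \<in> closure K" using p'(2) x'S subset by blast
        then show ?thesis using int[OF p'b(1), of s] s False by simp
      qed
      then show "z \<in> B \<inter> f -` interior K" using mv[OF p'b(1) s(2,3)] s(1) by simp
    qed
    have "p' \<in> ?L p'" using s0 by (intro image_eqI[of _ _ 0]) auto
    moreover have "p' \<in> B" using mv[OF p'b(1), of 0] s0 by simp
    then have "p' \<in> D1" using p'(2) x'S x'K by (simp add: D1_def)
    ultimately show "?L p' \<inter> D1 \<noteq> {}" by blast
  qed
  moreover have "p' + s0 *\<^sub>R q \<in> ?L p'" using s0 by (intro image_eqI[OF refl]) simp
  ultimately have "p' + s0 *\<^sub>R q \<in> D1" by blast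
  moreover have "p' + s0 *\<^sub>R q \<in> ball p1 r2" using p'b(2) by (simp add: p1_def dist_norm)
  ultimately have "ball p1 r2 \<subseteq> D1" by (intro sep r2(2)) auto
  then have p1D: "p1 \<in> D1" using r2(1) by auto
  have S: "f (p0 + s *\<^sub>R q) \<in> \<Sigma>" if s: "0 \<le> s" "s \<le> s0" for s
  proof (cases "s = 0")
    case True then show ?thesis using p0(2) xS by simp
  next
    case False
    let ?M = "(\<lambda>s. p0 + s *\<^sub>R q) ` {s..s0}"
    have "?M \<subseteq> D1"
    proof (rule sep)
      show "connected ?M" by (intro connected_continuous_image continuous_intros connected_Icc)
      show "?M \<subseteq> B \<inter> f -` interior K"
        using mv[OF p0c] int[OF p0c] s False p0(2) \<open>x \<in> closure K\<close> by auto
      have "p1 \<in> ?M" using s by (auto simp: p1_def)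
      then show "?M \<inter> D1 \<noteq> {}" using p1D by blast
    qed
    moreover have "p0 + s *\<^sub>R q \<in> ?M" using s by (intro image_eqI[OF refl]) simp
    ultimately show ?thesis by (auto simp: D1_def)
  qed
  have "frechet_derivative f (at p0) q = v" using dq by (simp add: p0_def q_def)
  from chart_velocity[OF C(1) p0(1) this s0 S] s0 p0(2) show ?thesis by auto
qed

lemma hs_boundary_closed: "closed (hs_boundary \<Sigma>)" "compact (hs_boundary \<Sigma>)"
proof -
  have "closedin (top_of_set \<Sigma>) (hs_boundary \<Sigma>)" unfolding hs_boundary_def
    by (rule closedin_diff[OF _ open_hs_interior]) simp
  then show "compact (hs_boundary \<Sigma>)" using closedin_compact[OF compact\<Sigma>] by blast
  then show "closed (hs_boundary \<Sigma>)" by (rule compact_imp_closed)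
qed

text \<open>By \<open>inward_chart\<close>, parameters of frontier points move to parameters of
  interior points of \<open>K\<close> under small translations along the inward direction. Their set
  therefore has disjoint translates and is null. The area and the tube formula transfer this to
  \<Sigma> and to the normal lines.\<close>

lemma boundary_locally_null:
  assumes x: "x \<in> hs_boundary \<Sigma>"
  shows "\<exists>Y. open Y \<and> x \<in> Y \<and> emeasure area (hs_boundary \<Sigma> \<inter> Y) = 0 \<and>
    negligible (\<zeta> ` ((hs_boundary \<Sigma> \<inter> Y) \<times> UNIV))"
proof -
  have xS: "x \<in> \<Sigma>" using boundary_facts(1)[OF x] .
  obtain v where v: "v \<bullet> \<nu> x = 0" "x + v \<in> interior K" using boundary_facts(4)[OF x] by blast
  obtain U g where g: "eqn U g" "x \<in> U" using eqn_exists[OF xS] by blast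
  note E = eqnD(1)[OF g(1)]
  obtain i :: "(real^'n) \<times> real \<Rightarrow> 'a" and k V m W r s0 where C: "graph_chart g U i k V m W" "x \<in> W"
    and r: "r > 0" and s0: "s0 > 0" and cb: "cball (fst (k x)) (2 * r) \<subseteq> V"
    and int: "\<And>p s. p \<in> cball (fst (k x)) r \<Longrightarrow> 0 < s \<Longrightarrow> s \<le> s0 \<Longrightarrow> m p \<in> closure K \<Longrightarrow> m (p + s *\<^sub>R fst (k v)) \<in> interior K"
    using inward_chart[OF x v g] by metis
  note C' = graph_chartD[OF C(1)]
  define Q where "Q = {p\<in>cball (fst (k x)) r. m p \<in> frontier K \<inter> \<Sigma>}"
  have cV: "cball (fst (k x)) r \<subseteq> V" using cb r by (rule_tac order_trans[OF _ cb]) (auto intro: subset_cball)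
  have "closed Q"
    using continuous_closed_preimage[OF continuous_on_subset[OF C'(11) cV] closed_cball closed_Int[OF frontier_closed[of K] closed\<Sigma>]]
    by (simp add: Q_def Int_def vimage_def)
  then have cQ: "compact Q" by (intro compact_eq_bounded_closed[THEN iffD2] conjI bounded_subset[OF bounded_cball]) (auto simp: Q_def)
  have QV: "Q \<subseteq> V" using cV by (auto simp: Q_def)
  have "negligible Q"
  proof (rule negligible_disjoint_translates[OF cQ s0])
    fix p s assume "p \<in> Q" "0 < s" "s < s0"
    then have "m (p + s *\<^sub>R fst (k v)) \<in> interior K" using int[of p s] by (auto simp: Q_def frontier_def)
    then show "p + s *\<^sub>R fst (k v) \<notin> Q" by (auto simp: Q_def frontier_def)
  qed
  moreover have Qb: "Q \<in> sets borel" using cQ by (rule borel_compact)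
  ultimately have Q0: "emeasure lborel Q = 0" by (simp add: negligible_iff_null_sets null_sets_def)
  have null: "(\<integral>\<^sup>+p. f p * (h p * indicator Q p) \<partial>lborel) = 0" for f h :: "real^'n \<Rightarrow> ennreal"
  proof -
    have "AE p in lborel. p \<notin> Q" using Q0 Qb by (intro AE_not_in) (simp add: null_sets_def)
    then have "(\<integral>\<^sup>+p. f p * (h p * indicator Q p) \<partial>lborel) = (\<integral>\<^sup>+p. 0 \<partial>(lborel :: (real^'n) measure))"
      by (intro nn_integral_cong_AE) (auto elim!: eventually_mono)
    then show ?thesis by simp
  qed
  define Y where "Y = W \<inter> (\<lambda>z. fst (k z)) -` ball (fst (k x)) r"
  have oO: "open Y" unfolding Y_def
    by (intro continuous_open_preimage C'(3) continuous_on_fst_basis_iso[OF C'(1)] open_ball)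
  have sub: "hs_boundary \<Sigma> \<inter> Y \<subseteq> m ` Q"
  proof
    fix z assume z: "z \<in> hs_boundary \<Sigma> \<inter> Y"
    then have zS: "z \<in> \<Sigma>" "z \<in> frontier K" "z \<in> W" using boundary_facts(1,2)[of z] by (auto simp: Y_def)
    have "g z = 0" using C2_equationD(3)[OF E zS(1)] zS(3) C'(4) by blast
    then have "m (fst (k z)) = z" using C'(9)[OF zS(3)] by blast
    moreover have "fst (k z) \<in> Q" using calculation zS z by (auto simp: Q_def Y_def)
    ultimately show "z \<in> m ` Q" by force
  qed
  have par: "parametrisation V m" using C(1) by (rule graph_chart_parametrisation)
  have QS: "m ` Q \<subseteq> \<Sigma>" by (auto simp: Q_def)
  have "emeasure area (m ` Q) = 0"
    using emeasure_area_parametrisation[OF par Qb QV QS] null[of "\<lambda>p. ennreal (area_density m p)" "\<lambda>_. 1"] by simp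
  moreover have "compact (m ` Q)" by (rule compact_continuous_image[OF continuous_on_subset[OF C'(11) QV] cQ])
  then have "m ` Q \<in> sets area" using QS by (simp add: in_sets_area borel_compact)
  ultimately have 1: "emeasure area (hs_boundary \<Sigma> \<inter> Y) = 0"
    using emeasure_mono[OF sub, of area] by simp
  let ?Z = "\<lambda>w. m (fst (k w)) - snd (k w) *\<^sub>R unit_gradient g (m (fst (k w)))"
  let ?S = "{w. fst (k w) \<in> Q \<and> (m (fst (k w)), snd (k w)) \<in> (UNIV :: ('a \<times> real) set)}"
  have "(UNIV :: ('a \<times> real) set) \<in> sets borel" by simp
  note T = patch_tube[OF C(1) E Qb QV this]
  have "emeasure lebesgue (?Z ` ?S) = 0" using T(2) unfolding null by simp
  then have "negligible (?Z ` ?S)" using T(1) by (simp add: negligible_iff_null_sets null_sets_def)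
  moreover have "\<zeta> ` ((hs_boundary \<Sigma> \<inter> Y) \<times> UNIV) \<subseteq> ?Z ` ?S"
  proof
    fix y assume "y \<in> \<zeta> ` ((hs_boundary \<Sigma> \<inter> Y) \<times> UNIV)"
    then obtain z t where z: "z \<in> hs_boundary \<Sigma> \<inter> Y" "y = z - t *\<^sub>R \<nu> z" by (auto simp: \<zeta>_def)
    obtain p where p: "p \<in> Q" "z = m p" using sub z(1) by blast
    have pV: "p \<in> V" using p QV by blast
    have zU: "z \<in> U" "z \<in> \<Sigma>" using C'(4) C'(7)[OF pV] p(2) boundary_facts(1)[of z] z(1) by auto
    have i: "k (i (p, t)) = (p, t)" using basis_isoD[OF C'(1)] by blast
    have "y = ?Z (i (p, t))" using z(2) p(2) eqnD(2)[OF g(1) zU(2,1)] by (simp add: i)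
    moreover have "i (p, t) \<in> ?S" using p by (simp add: i)
    ultimately show "y \<in> ?Z ` ?S" by blast
  qed
  ultimately have "negligible (\<zeta> ` ((hs_boundary \<Sigma> \<inter> Y) \<times> UNIV))" by (rule negligible_subset)
  moreover have "x \<in> Y" using C(2) r by (simp add: Y_def)
  ultimately show ?thesis using oO 1 by blast
qed

lemma boundary_null:
  "hs_boundary \<Sigma> \<in> null_sets area" "negligible (\<zeta> ` (hs_boundary \<Sigma> \<times> UNIV))"
proof -
  obtain Y where Y: "\<And>x. x \<in> hs_boundary \<Sigma> \<Longrightarrow> open (Y x) \<and> x \<in> Y x \<and>
      emeasure area (hs_boundary \<Sigma> \<inter> Y x) = 0 \<and> negligible (\<zeta> ` ((hs_boundary \<Sigma> \<inter> Y x) \<times> UNIV))"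
    using boundary_locally_null by metis
  obtain D where D: "D \<subseteq> hs_boundary \<Sigma>" "finite D" "hs_boundary \<Sigma> \<subseteq> (\<Union>x\<in>D. Y x)"
    by (rule compactE_image[OF hs_boundary_closed(2), of "hs_boundary \<Sigma>" Y]) (use Y in auto)
  have eq: "hs_boundary \<Sigma> = (\<Union>x\<in>D. hs_boundary \<Sigma> \<inter> Y x)" using D by blast
  have "hs_boundary \<Sigma> \<inter> Y x \<in> null_sets area" if "x \<in> D" for x
  proof -
    have "x \<in> hs_boundary \<Sigma>" using that D by blast
    then have "open (Y x)" "emeasure area (hs_boundary \<Sigma> \<inter> Y x) = 0" using Y by blast+
    moreover have "hs_boundary \<Sigma> \<subseteq> \<Sigma>" by (auto simp: hs_boundary_def)
    ultimately show ?thesis using hs_boundary_closed(1) by (auto simp: null_sets_def in_sets_area)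
  qed
  then have "(\<Union>x\<in>D. hs_boundary \<Sigma> \<inter> Y x) \<in> null_sets area" using D(2) by (intro null_sets.finite_UN) auto
  then show "hs_boundary \<Sigma> \<in> null_sets area" using eq by simp
  have "negligible (\<Union>x\<in>D. \<zeta> ` ((hs_boundary \<Sigma> \<inter> Y x) \<times> UNIV))"
    using Y D(1,2) by (intro negligible_Union) auto
  moreover have "\<zeta> ` (hs_boundary \<Sigma> \<times> UNIV) \<subseteq> (\<Union>x\<in>D. \<zeta> ` ((hs_boundary \<Sigma> \<inter> Y x) \<times> UNIV))"
    using eq by (auto simp: image_iff) blast
  ultimately show "negligible (\<zeta> ` (hs_boundary \<Sigma> \<times> UNIV))" by (rule negligible_subset)
qed

text \<open>If the gradient direction of the distance to a boundary point were not normal to the hypersurface, then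
  separating the inward tangent directions in the plane would split off an outer normal of the container,
  which makes an obtuse angle with \<open>\<nu>\<close>.\<close>

lemma nearest_boundary_point:
  assumes x: "x \<in> hs_boundary \<Sigma>" and y: "y \<in> \<Omega>" and near: "\<And>z. z \<in> \<Sigma> \<Longrightarrow> dist y x \<le> dist y z"
  shows "y - x = ((y - x) \<bullet> \<nu> x) *\<^sub>R \<nu> x"
proof -
  define \<xi> N where "\<xi> = y - x" and "N = \<nu> x"
  have xS: "x \<in> \<Sigma>" using boundary_facts(1)[OF x] .
  have N1: "N \<bullet> N = 1" using norm\<nu>[OF xS] by (simp add: N_def dot_square_norm)
  have yK: "y \<in> interior K" using y \<Omega>_sub(1) by blast
  have xiN: "\<xi> \<bullet> N \<le> 0" using nearest_point_outward[OF xS y near] by (simp add: \<xi>_def N_def)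
  have neg: "\<xi> \<bullet> v \<le> 0" if v: "v \<bullet> N = 0" "x + v \<in> interior K" for v
  proof -
    obtain r f where r: "r > 0" and f: "f 0 = x" "f ` {0..1} \<subseteq> \<Sigma>"
      and d: "(f has_vector_derivative r *\<^sub>R v) (at 0 within {0..1::real})"
      using boundary_velocity[OF x] v unfolding N_def by blast
    have "\<xi> \<bullet> (r *\<^sub>R v) \<le> 0" unfolding \<xi>_def by (rule nearest_velocity[OF near f d])
    then show ?thesis using r by (simp add: mult_le_0_iff)
  qed
  \<comment> \<open>The plane records the normal component of \<open>v\<close> and the product
    \<open>\<xi> \<bullet> v\<close> lowered by a positive slack. The origin is missed exactly
    because inward tangent directions satisfy \<open>neg\<close>; a separating line
    \<open>(a, b)\<close> then exists.\<close>
  define A where "A = (\<lambda>(v, c). (v \<bullet> N, \<xi> \<bullet> v - c)) ` ({v. x + v \<in> interior K} \<times> {0<..})"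
  have "{v. x + v \<in> interior K} = (\<lambda>z. - x + z) ` interior K" by (force simp: image_iff)
  then have cK: "convex {v. x + v \<in> interior K}" using convex_interior[OF convK] by (simp add: convex_translation)
  have "linear (\<lambda>(v, c). (v \<bullet> N, \<xi> \<bullet> v - c))"
    by (rule linearI) (auto simp: inner_add_left inner_add_right algebra_simps)
  then have cA: "convex A" unfolding A_def by (intro convex_linear_image convex_Times cK) auto
  have "0 \<notin> A"
  proof
    assume "0 \<in> A"
    then obtain v c where vb: "x + v \<in> interior K" "c > 0" "v \<bullet> N = 0" "\<xi> \<bullet> v = c" by (auto simp: A_def zero_prod_def)
    then show False using neg[of v] by simp
  qed
  then obtain ab where ab: "ab \<noteq> 0" "\<forall>z\<in>A. 0 \<le> ab \<bullet> z" using separating_hyperplane_set_0[OF cA] by blast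
  obtain a b where ab': "ab = (a, b)" by force
  have ineq: "a * (v \<bullet> N) + b * (\<xi> \<bullet> v) \<ge> b * c" if "x + v \<in> interior K" "c > 0" for v c
  proof -
    have "(v \<bullet> N, \<xi> \<bullet> v - c) \<in> A" using that by (force simp: A_def)
    then have "0 \<le> ab \<bullet> (v \<bullet> N, \<xi> \<bullet> v - c)" using ab(2) by blast
    then show ?thesis by (simp add: ab' algebra_simps)
  qed
  obtain v0 where v0: "v0 \<bullet> N = 0" "x + v0 \<in> interior K" using boundary_facts(4)[OF x] by (auto simp: N_def)
  have b0: "b \<le> 0"
  proof (rule ccontr)
    assume b: "\<not> b \<le> 0"
    define c where "c = \<bar>\<xi> \<bullet> v0\<bar> + 1"
    have "b * (\<xi> \<bullet> v0) \<ge> b * c" using ineq[OF v0(2), of c] v0(1) by (simp add: c_def)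
    then have "\<xi> \<bullet> v0 \<ge> c" using b by simp
    then show False by (simp add: c_def)
  qed
  \<comment> \<open>A line with \<open>b = 0\<close> would force a sign on the normal component
    throughout a neighbourhood of the tangent direction \<open>v0\<close>, where this component
    takes both signs.\<close>
  have bneg: "b < 0"
  proof (rule ccontr)
    assume "\<not> b < 0"
    then have b: "b = 0" using b0 by simp
    then have a: "a \<noteq> 0" using ab(1) ab' by (auto simp: zero_prod_def)
    obtain e where e: "e > 0" "ball (x + v0) e \<subseteq> interior K" using v0(2) open_contains_ball open_interior by blast
    have "a * ((v0 + s *\<^sub>R N) \<bullet> N) \<ge> 0" if "\<bar>s\<bar> < e" for s
    proof -
      have "x + (v0 + s *\<^sub>R N) \<in> interior K"
        using e(2) that norm\<nu>[OF xS] by (auto simp: dist_norm N_def algebra_simps)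
      from ineq[OF this, of 1] show ?thesis using b by simp
    qed
    then have "a * s \<ge> 0" if "\<bar>s\<bar> < e" for s using that v0(1) N1 by (simp add: inner_add_left)
    from this[of "e / 2"] this[of "- (e / 2)"] e(1) have "a * e = 0" by simp
    then show False using a e(1) by simp
  qed
  define \<alpha> where "\<alpha> = a / (- b)"
  have le: "\<xi> \<bullet> v \<le> \<alpha> * (v \<bullet> N)" if v: "x + v \<in> interior K" for v
  proof -
    have "(\<xi> \<bullet> v) \<le> \<alpha> * (v \<bullet> N) + c" if "c > 0" for c
      using ineq[OF v that] bneg by (simp add: \<alpha>_def field_simps)
    then show ?thesis by (rule field_le_epsilon)
  qed
  \<comment> \<open>The separation inequality says that this remainder is an outer normal of
    \<open>K\<close>. With \<open>N \<bullet> w \<le> 0\<close>, \<alpha> nonpositive and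
    \<open>w \<bullet> \<xi> \<le> 0\<close>, its square is nonpositive, so it vanishes.\<close>
  define w where "w = \<xi> - \<alpha> *\<^sub>R N"
  have wle: "w \<bullet> (z - x) \<le> 0" if "z \<in> interior K" for z
    using le[of "z - x"] that by (simp add: w_def inner_diff_left inner_commute[of N])
  have w: "w \<in> normal_cone K x"
  proof -
    have "closure K \<subseteq> {z. w \<bullet> (z - x) \<le> 0}"
      unfolding convex_closure_interior[OF convK intK, symmetric]
      by (rule closure_minimal) (use wle in \<open>auto intro!: closed_Collect_le continuous_intros\<close>)
    then show ?thesis using closure_subset by (auto simp: normal_cone_def)
  qed
  have Nw: "N \<bullet> w \<le> 0" using boundary_facts(3)[OF x w] by (simp add: N_def)
  have "\<alpha> \<le> 0"
  proof (rule ccontr)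
    assume \<alpha>: "\<not> \<alpha> \<le> 0"
    have "\<xi> \<bullet> \<xi> \<le> \<alpha> * (\<xi> \<bullet> N)" using le[of \<xi>] yK by (simp add: \<xi>_def)
    also have "\<dots> \<le> 0" using \<alpha> xiN by (simp add: mult_nonneg_nonpos)
    finally have "\<xi> \<bullet> \<xi> = 0" using inner_ge_zero[of \<xi>] by linarith
    then have "y = x" by (simp add: \<xi>_def)
    then show False using y xS \<Omega>_sub(1) by blast
  qed
  then have "\<alpha> * (N \<bullet> w) \<ge> 0" using Nw by (simp add: mult_nonpos_nonpos)
  moreover have "w \<bullet> \<xi> \<le> 0" using wle[OF yK] by (simp add: \<xi>_def)
  moreover have "w \<bullet> w = w \<bullet> (\<xi> - \<alpha> *\<^sub>R N)" by (simp only: w_def)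
  then have "w \<bullet> w = w \<bullet> \<xi> - \<alpha> * (N \<bullet> w)" by (simp add: inner_diff_right inner_commute[of w N])
  ultimately have "w \<bullet> w \<le> 0" by linarith
  then have "w = 0" using inner_ge_zero[of w] by (metis inner_eq_zero_iff order_antisym)
  then have "\<xi> = \<alpha> *\<^sub>R N" by (simp add: w_def)
  then show ?thesis using N1 by (simp add: \<xi>_def[symmetric] N_def[symmetric])
qed

end

section \<open>The inequality\<close>

lemma fibre_integral_borel:
  fixes f :: "'a::euclidean_space \<times> real \<Rightarrow> ennreal"
  assumes "f \<in> borel_measurable borel"
  shows "(\<lambda>x. \<integral>\<^sup>+t. f (x, t) \<partial>lborel) \<in> borel_measurable borel"
proof (rule lborel.borel_measurable_nn_integral)
  have s: "sets (borel \<Otimes>\<^sub>M (lborel :: real measure)) = sets (borel :: ('a \<times> real) measure)"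
    by (metis borel_prod sets_lborel sets_pair_measure_cong)
  show "(\<lambda>(x, t). f (x, t)) \<in> borel_measurable (borel \<Otimes>\<^sub>M lborel)"
    using assms by (simp add: measurable_cong_sets[OF s refl])
qed

lemma le_infdist_iff:
  fixes S :: "'a::heine_borel set"
  assumes "closed S" "S \<noteq> {}" shows "t \<le> infdist y S \<longleftrightarrow> (\<forall>z\<in>S. t \<le> dist y z)"
proof -
  obtain x where x: "x \<in> S" "infdist y S = dist y x" by (rule infdist_attains_inf[OF assms])
  then show ?thesis using infdist_le[of _ S y] by (auto intro: order_trans)
qed

context oriented_hypersurface
begin

lemma measurable_area: "f \<in> measurable borel M \<Longrightarrow> f \<in> measurable area M"
  using measurable_restrict_space1[of f borel M \<Sigma>] measurable_cong_sets[OF sets_area refl] by blast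

lemma cont_\<zeta>: "continuous_on (\<Sigma> \<times> UNIV) \<zeta>"
proof -
  have "continuous_on (\<Sigma> \<times> UNIV) (\<lambda>z::'a \<times> real. \<nu> (fst z))"
    by (rule continuous_on_compose2[OF cont\<nu>]) (auto intro: continuous_intros)
  then show ?thesis unfolding \<zeta>_def case_prod_beta' by (intro continuous_intros)
qed

lemma hs_interior_eq: obtains Y where "open Y" "hs_interior \<Sigma> = \<Sigma> \<inter> Y"
  using open_hs_interior unfolding openin_open by blast

lemma cont_infdist_\<zeta>: "continuous_on (\<Sigma> \<times> UNIV) (\<lambda>z. infdist (\<zeta> z) \<Sigma>)"
  by (intro continuous_on_infdist cont_\<zeta>)

lemma closed_\<Sigma>UNIV: "closed (\<Sigma> \<times> (UNIV :: real set))" by (intro closed_Times closed\<Sigma> closed_UNIV)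

end

context heintze_karcher
begin

text \<open>\<open>rad x\<close> is the radius of the sphere with the mean curvature of \<open>\<Sigma>\<close> at \<open>x\<close>.\<close>

definition rad :: "'a \<Rightarrow> real" where "rad x = (DIM('a) - Suc 0) / mean_curvature \<Sigma> \<nu> x"

text \<open>The bound (1 - t H / n)^n for the Jacobian, since \<open>1 / rad\<close> is H / n.
  Truncation at 0 and the value 1 off \<Sigma> make it a nonnegative Borel function on the whole
  product.\<close>

definition weight :: "'a \<times> real \<Rightarrow> real" where
  "weight z = (max 0 (1 - snd z * (if fst z \<in> \<Sigma> then 1 / rad (fst z) else 0))) ^ (DIM('a) - Suc 0)"

text \<open>Since \<open>\<zeta> (x, t)\<close> has distance \<open>t\<close> from \<open>x\<close>,
  the last condition says that \<open>x\<close> is a nearest point of \<Sigma>.\<close>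

definition touch :: "('a \<times> real) set" where
  "touch = {z. fst z \<in> hs_interior \<Sigma> \<and> 0 < snd z \<and> \<zeta> z \<in> \<Omega> \<and> snd z \<le> infdist (\<zeta> z) \<Sigma>}"

lemma rad_eq: "rad x = CARD('n) / mean_curvature \<Sigma> \<nu> x"
  and weight_alt: "weight z = (max 0 (1 - snd z * (if fst z \<in> \<Sigma> then 1 / rad (fst z) else 0))) ^ CARD('n)"
  using dim by (simp_all add: rad_def weight_def)

lemma npos: "real CARD('n) > 0" by simp

lemma rad_pos: "x \<in> \<Sigma> \<Longrightarrow> rad x > 0" using mean_convex npos by (auto simp: rad_eq)

lemma inv_rad: "1 / rad x = mean_curvature \<Sigma> \<nu> x / CARD('n)" using npos by (simp add: rad_eq)

lemma cont_rad: "continuous_on \<Sigma> rad"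
proof -
  have "\<forall>x\<in>\<Sigma>. mean_curvature \<Sigma> \<nu> x \<noteq> 0" using mean_convex by force
  then show ?thesis unfolding rad_eq by (intro continuous_intros cont_mean_curvature)
qed

lemma weight_eq: "x \<in> \<Sigma> \<Longrightarrow> t \<le> rad x \<Longrightarrow> weight (x, t) = (1 - t / rad x) ^ CARD('n)"
  using rad_pos[of x] by (simp add: weight_alt max_def)

lemma weight_nonneg: "weight z \<ge> 0" by (simp add: weight_alt)

lemma borel_weight: "weight \<in> borel_measurable borel"
proof -
  have "continuous_on \<Sigma> (\<lambda>x. 1 / rad x)"
    using rad_pos by (intro continuous_intros cont_rad) force
  then have "(\<lambda>x. indicator \<Sigma> x *\<^sub>R (1 / rad x)) \<in> borel_measurable borel"
    using closed\<Sigma> by (intro borel_measurable_continuous_on_indicator) auto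
  then have "(\<lambda>x. if x \<in> \<Sigma> then 1 / rad x else 0) \<in> borel_measurable borel"
    by (rule measurable_cong[THEN iffD1, rotated]) (auto simp: indicator_def)
  from measurable_compose[OF borel_measurable_continuous_onI[OF continuous_on_fst[OF continuous_on_id]] this]
  have f: "(\<lambda>z::'a \<times> real. if fst z \<in> \<Sigma> then 1 / rad (fst z) else 0) \<in> borel_measurable borel" .
  have "(\<lambda>z::'a \<times> real. snd z) \<in> borel_measurable borel"
    by (intro borel_measurable_continuous_onI continuous_intros)
  then show ?thesis unfolding weight_alt by (intro borel_measurable_power borel_measurable_max borel_measurable_diff borel_measurable_times f) auto
qed

text \<open>The source of the constant of the theorem: up to \<open>rad x\<close> the weight is a
  power of \<open>1 - t / rad x\<close>, with antiderivative \<open>G\<close>.\<close>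

lemma weight_integral:
  assumes x: "x \<in> \<Sigma>"
  shows "(\<integral>\<^sup>+t. ennreal (weight (x, t)) * indicator {0..rad x} t \<partial>lborel) = ennreal (rad x / (CARD('n) + 1))"
proof -
  note R = rad_pos[OF x]
  define G where "G t = - (rad x / (CARD('n) + 1)) * (1 - t / rad x) ^ Suc (CARD('n))" for t
  have "(\<integral>\<^sup>+t. ennreal (weight (x, t)) * indicator {0..rad x} t \<partial>lborel) = ennreal (G (rad x) - G 0)"
  proof (rule nn_integral_FTC_Icc)
    show "(\<lambda>t. weight (x, t)) \<in> borel_measurable borel"
      by (rule measurable_compose[OF _ borel_weight]) (intro borel_measurable_continuous_onI continuous_intros)
    fix t assume "t \<in> {0..rad x}"
    then have t: "0 \<le> t" "t \<le> rad x" by auto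
    have d: "((\<lambda>t. 1 - t / rad x) has_field_derivative - (1 / rad x)) (at t)" using R by (auto intro!: derivative_eq_intros)
    have "(G has_field_derivative - (rad x / (CARD('n) + 1)) * ((1 + CARD('n)) * (- (1 / rad x) * (1 - t / rad x) ^ CARD('n)))) (at t)"
      unfolding G_def of_nat_add of_nat_1 by (rule DERIV_cmult[OF DERIV_power_Suc[OF d]])
    moreover have "- (R / (k + 1)) * ((1 + k) * (- (1 / R) * X)) = X" if "R > 0" "k > 0" for R k X :: real
    proof -
      have "- (R / (k + 1)) * ((1 + k) * (- (1 / R) * X)) = (R / R) * ((1 + k) / (1 + k)) * X" by (simp add: add.commute)
      then show ?thesis using that by simp
    qed
    from this[OF R npos] have "- (rad x / (CARD('n) + 1)) * ((1 + CARD('n)) * (- (1 / rad x) * (1 - t / rad x) ^ CARD('n))) = weight (x, t)"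
      using weight_eq[OF x t(2)] by (simp only: of_nat_add of_nat_1)
    ultimately show "(G has_real_derivative weight (x, t)) (at t)" by simp
  qed (use R weight_nonneg in auto)
  then show ?thesis using R by (simp add: G_def)
qed

lemma borel_touch: "touch \<in> sets borel" "touch \<subseteq> \<Sigma> \<times> UNIV"
proof -
  show sub: "touch \<subseteq> \<Sigma> \<times> UNIV" using hs_interior_subset by (auto simp: touch_def)
  obtain Y where Y: "open Y" "hs_interior \<Sigma> = \<Sigma> \<inter> Y" by (rule hs_interior_eq)
  let ?S = "\<Sigma> \<times> (UNIV :: real set)"
  obtain Z where Z: "open Z" "?S \<inter> \<zeta> -` \<Omega> = ?S \<inter> Z"
    using continuous_openin_preimage_gen[OF cont_\<zeta> \<Omega>_sub(4)] unfolding openin_open by blast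
  have "closedin (top_of_set ?S) {z\<in>?S. snd z - infdist (\<zeta> z) \<Sigma> \<le> 0}"
    using continuous_closedin_preimage[OF continuous_on_diff[OF continuous_on_snd[OF continuous_on_id] cont_infdist_\<zeta>], of "{..0}"]
    by (simp add: Int_def vimage_def)
  then have c: "closed {z\<in>?S. snd z - infdist (\<zeta> z) \<Sigma> \<le> 0}" using closedin_closed_trans closed_\<Sigma>UNIV by blast
  have "touch = {z\<in>?S. snd z - infdist (\<zeta> z) \<Sigma> \<le> 0} \<inter> Z \<inter> (Y \<times> {0<..})"
    using Z(2) Y(2) by (auto simp: touch_def)
  moreover have "{z\<in>?S. snd z - infdist (\<zeta> z) \<Sigma> \<le> 0} \<inter> Z \<inter> (Y \<times> {0<..}) \<in> sets borel"
    by (rule sets.Int[OF sets.Int[OF borel_closed[OF c] borel_open[OF Z(1)]] borel_open[OF open_Times[OF Y(1) open_greaterThan]]])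
  ultimately show "touch \<in> sets borel" by simp
qed

text \<open>A nearest point exists since \<Sigma> is compact. The displacement from it is normal by
  \<open>nearest_point_normal\<close> or \<open>nearest_boundary_point\<close>, and inward by
  \<open>nearest_point_outward\<close>.\<close>

lemma \<Omega>_covered: "\<Omega> \<subseteq> \<zeta> ` touch \<union> \<zeta> ` (hs_boundary \<Sigma> \<times> UNIV)"
proof
  fix y assume y: "y \<in> \<Omega>"
  obtain x where x: "x \<in> \<Sigma>" "infdist y \<Sigma> = dist y x" by (rule infdist_attains_inf[OF closed\<Sigma> ne\<Sigma>])
  have near: "dist y x \<le> dist y z" if "z \<in> \<Sigma>" for z using infdist_le[OF that, of y] x(2) by simp
  define t where "t = - ((y - x) \<bullet> \<nu> x)"
  have t0: "t \<ge> 0" using nearest_point_outward[OF x(1) y near] by (simp add: t_def)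
  have "y - x = ((y - x) \<bullet> \<nu> x) *\<^sub>R \<nu> x"
    using nearest_boundary_point[OF _ y near] nearest_point_normal[OF _ near] x(1) by (auto simp: hs_boundary_def)
  then have yx: "y - x = - (t *\<^sub>R \<nu> x)" by (simp add: t_def)
  then have yt: "y = \<zeta> (x, t)" by (simp add: \<zeta>_def algebra_simps)
  have "dist y x = t" using yx t0 norm\<nu>[OF x(1)] by (simp add: dist_norm)
  moreover have "t \<noteq> 0"
  proof
    assume "t = 0"
    then have "y \<in> \<Sigma>" using yx x(1) by simp
    then show False using y \<Omega>_sub(1) by blast
  qed
  ultimately have "(x, t) \<in> touch" if "x \<in> hs_interior \<Sigma>"
    using that t0 y yt x(2) by (simp add: touch_def)
  then show "y \<in> \<zeta> ` touch \<union> \<zeta> ` (hs_boundary \<Sigma> \<times> UNIV)"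
    using x(1) yt by (cases "x \<in> hs_interior \<Sigma>") (auto simp: hs_boundary_def)
qed

text \<open>The touching ball makes all factors \<open>1 - t * l e\<close> nonnegative. Their sum
  gives \<open>t \<le> rad x\<close>, and the inequality between geometric and arithmetic mean
  bounds their product.\<close>

lemma touch_bounds:
  assumes z: "(x, t) \<in> touch"
  shows "t \<le> rad x" "eqn U g \<Longrightarrow> x \<in> U \<Longrightarrow> absdet (focal_map g x t) \<le> weight (x, t)"
proof -
  have x: "x \<in> hs_interior \<Sigma>" "x \<in> \<Sigma>" and t: "0 < t" and touch: "\<And>z. z \<in> \<Sigma> \<Longrightarrow> t \<le> dist (x - t *\<^sub>R \<nu> x) z"
    using z hs_interior_subset by (auto simp: touch_def \<zeta>_def le_infdist_iff[OF closed\<Sigma> ne\<Sigma>])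
  have main: "t \<le> rad x \<and> absdet (focal_map g x t) \<le> weight (x, t)" if g: "eqn U g" "x \<in> U" for U g
  proof -
    obtain E l where E: "finite E" "card E = DIM('a) - 1"
      "\<forall>e\<in>E. e \<bullet> unit_gradient g x = 0 \<and> norm e = 1 \<and> shape g x e = l e *\<^sub>R e"
      "(\<Sum>e\<in>E. l e) = shape_trace g x" "\<forall>t. absdet (focal_map g x t) = \<bar>\<Prod>e\<in>E. (1 - t * l e)\<bar>"
      using principal_curvatures[OF eqnD(1)[OF g(1)] g(2)] by blast
    have cE: "card E = CARD('n)" using E(2) dim by simp
    have le: "t * l e \<le> 1" if e: "e \<in> E" for e
    proof -
      have "e \<bullet> \<nu> x = 0" "norm e = 1" "shape g x e = l e *\<^sub>R e" using E(3) e eqnD(2)[OF g(1) x(2) g(2)] by auto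
      then show ?thesis using touching_ball_shape[OF x(1) g _ touch, of e] t by (simp add: dot_square_norm)
    qed
    have H: "(\<Sum>e\<in>E. l e) = mean_curvature \<Sigma> \<nu> x" using E(4) mean_curvature_eq[OF x(2) g] by simp
    have S: "(\<Sum>e\<in>E. (1 - t * l e)) = CARD('n) - t * mean_curvature \<Sigma> \<nu> x"
      using cE H by (simp add: sum_subtractf sum_distrib_left[symmetric])
    then have nn: "CARD('n) - t * mean_curvature \<Sigma> \<nu> x \<ge> 0" using le by (metis (no_types, lifting) diff_ge_0_iff_ge sum_nonneg)
    have Hp: "mean_curvature \<Sigma> \<nu> x > 0" using mean_convex x(2) by blast
    have 1: "t \<le> rad x" using nn Hp by (simp add: rad_eq field_simps)
    have "absdet (focal_map g x t) = (\<Prod>e\<in>E. (1 - t * l e))" using E(5) le by (simp add: prod_nonneg)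
    also have "\<dots> \<le> ((\<Sum>e\<in>E. (1 - t * l e)) / card E) ^ card E"
      using le cE by (intro prod_le_mean_power E(1)) auto
    also have "\<dots> = weight (x, t)"
      unfolding weight_eq[OF x(2) 1] S cE using npos by (simp add: rad_eq diff_divide_distrib)
    finally show ?thesis using 1 by simp
  qed
  show "eqn U g \<Longrightarrow> x \<in> U \<Longrightarrow> absdet (focal_map g x t) \<le> weight (x, t)" using main by blast
  show "t \<le> rad x" using eqn_exists[OF x(2)] main by blast
qed

lemma emeasure_\<zeta>_touch:
  assumes "Q \<in> sets borel" "Q \<subseteq> touch"
  shows "\<zeta> ` Q \<in> sets lebesgue"
    "emeasure lebesgue (\<zeta> ` Q) \<le> (\<integral>\<^sup>+x. \<integral>\<^sup>+t. ennreal (weight (x, t)) * indicator Q (x, t) \<partial>lborel \<partial>area)"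
proof -
  have Q: "Q \<subseteq> \<Sigma> \<times> UNIV" using assms(2) borel_touch(2) by blast
  show "\<zeta> ` Q \<in> sets lebesgue" by (rule tube(1)[OF assms(1) Q borel_weight])
  show "emeasure lebesgue (\<zeta> ` Q) \<le> (\<integral>\<^sup>+x. \<integral>\<^sup>+t. ennreal (weight (x, t)) * indicator Q (x, t) \<partial>lborel \<partial>area)"
    by (rule tube(2)[OF assms(1) Q borel_weight]) (use touch_bounds(2) assms(2) in blast)
qed

lemma emeasure_covered:
  assumes Q: "Q \<in> sets borel" "Q \<subseteq> touch" and A: "A \<subseteq> \<zeta> ` Q \<union> \<zeta> ` (hs_boundary \<Sigma> \<times> UNIV)"
  shows "emeasure lebesgue A \<le> (\<integral>\<^sup>+x. \<integral>\<^sup>+t. ennreal (weight (x, t)) * indicator Q (x, t) \<partial>lborel \<partial>area)"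
proof -
  let ?N = "\<zeta> ` (hs_boundary \<Sigma> \<times> UNIV)"
  have N: "?N \<in> null_sets lebesgue" using boundary_null(2) by (simp add: negligible_iff_null_sets)
  have "emeasure lebesgue A \<le> emeasure lebesgue (\<zeta> ` Q \<union> ?N)"
    using A emeasure_\<zeta>_touch(1)[OF Q] N by (intro emeasure_mono) auto
  also have "\<dots> = emeasure lebesgue (\<zeta> ` Q)" by (rule emeasure_Un_null_set[OF emeasure_\<zeta>_touch(1)[OF Q] N])
  also note emeasure_\<zeta>_touch(2)[OF Q]
  finally show ?thesis .
qed

lemma integrable_rad: "integrable area rad"
proof -
  interpret finite_measure area by (rule finite_area)
  have "compact (rad ` \<Sigma>)" by (rule compact_continuous_image[OF cont_rad compact\<Sigma>])
  then obtain B where "\<forall>y\<in>rad ` \<Sigma>. norm y \<le> B" using compact_imp_bounded[of "rad ` \<Sigma>"] unfolding bounded_iff by blast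
  then have B: "\<And>x. x \<in> \<Sigma> \<Longrightarrow> norm (rad x) \<le> B" by blast
  have "rad \<in> borel_measurable area"
    using borel_measurable_continuous_on_restrict[OF cont_rad] measurable_cong_sets[OF sets_area refl] by blast
  moreover have "AE x in area. norm (rad x) \<le> B" using B by (intro AE_I2) (simp add: space_area)
  ultimately show ?thesis by (intro integrable_const_bound[of rad B])
qed

lemma nn_integral_rad: "(\<integral>\<^sup>+x. ennreal (rad x / (CARD('n) + 1)) \<partial>area) = ennreal ((\<integral>x. rad x \<partial>area) / (CARD('n) + 1))"
proof -
  have "(\<integral>\<^sup>+x. ennreal (rad x / (CARD('n) + 1)) \<partial>area) = ennreal (\<integral>x. rad x / (CARD('n) + 1) \<partial>area)"
    using integrable_rad rad_pos by (intro nn_integral_eq_integral integrable_divide AE_I2) (auto simp: space_area less_imp_le)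
  then show ?thesis by simp
qed

lemma \<Omega>_finite: "emeasure lebesgue \<Omega> = ennreal (measure lebesgue \<Omega>)"
proof -
  have "\<Omega> \<in> lmeasurable" by (intro bounded_set_imp_lmeasurable \<Omega>(2)) (use \<Omega>_sub(4) in auto)
  then show ?thesis by (intro emeasure_eq_ennreal_measure) (auto simp: fmeasurable_def)
qed

text \<open>Parameters in \<open>I\<close> are missed by \<open>Q\<close> and carry weight at least
  \<open>h\<close>, so the fibre integral falls short of its maximum by at least \<open>h\<close>
  times the length of \<open>I\<close>. The case of empty \<open>I\<close> gives the plain fibre
  bound.\<close>

lemma inner_bound:
  assumes x: "x \<in> \<Sigma>" and Q: "Q \<subseteq> touch" and N: "\<And>t. t \<in> I \<Longrightarrow> 0 \<le> t \<and> t \<le> rad x \<and> (x, t) \<notin> Q \<and> h \<le> weight (x, t)"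
    and I: "I \<in> sets borel" and QB: "Q \<in> sets borel"
  shows "(\<integral>\<^sup>+t. ennreal (weight (x, t)) * indicator Q (x, t) \<partial>lborel) + ennreal h * emeasure lborel I \<le> ennreal (rad x / (CARD('n) + 1))"
proof -
  have "(\<lambda>z. ennreal (weight z) * indicator Q z) \<in> borel_measurable borel" using borel_weight QB by simp
  moreover have "(\<lambda>t. (x, t)) \<in> borel_measurable (lborel :: real measure)"
    using borel_measurable_continuous_onI[of "\<lambda>t::real. (x, t)"] by (simp add: continuous_on_Pair)
  ultimately have m: "(\<lambda>t. ennreal (weight (x, t)) * indicator Q (x, t)) \<in> borel_measurable lborel"
    by (rule measurable_compose[rotated])
  have "(\<integral>\<^sup>+t. ennreal (weight (x, t)) * indicator Q (x, t) \<partial>lborel) + ennreal h * emeasure lborel I =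
      (\<integral>\<^sup>+t. ennreal (weight (x, t)) * indicator Q (x, t) + ennreal h * indicator I t \<partial>lborel)"
    using m I by (simp add: nn_integral_add nn_integral_cmult_indicator)
  also have "\<dots> \<le> (\<integral>\<^sup>+t. ennreal (weight (x, t)) * indicator {0..rad x} t \<partial>lborel)"
  proof (rule nn_integral_mono)
    fix t
    show "ennreal (weight (x, t)) * indicator Q (x, t) + ennreal h * indicator I t \<le> ennreal (weight (x, t)) * indicator {0..rad x} t"
    proof (cases "(x, t) \<in> Q")
      case True
      then have "(x, t) \<in> touch" "t \<notin> I" using Q N by blast+
      then show ?thesis using True touch_bounds(1)[of x t] by (simp add: touch_def)
    next
      case False
      then show ?thesis using N[of t] by (cases "t \<in> I") (auto intro: ennreal_leI)
    qed
  qed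
  finally show ?thesis by (simp add: weight_integral[OF x])
qed

lemma volume_le_integral_rad: "measure lebesgue \<Omega> \<le> (\<integral>x. rad x \<partial>area) / (CARD('n) + 1)"
proof -
  have "emeasure lebesgue \<Omega> \<le> (\<integral>\<^sup>+x. \<integral>\<^sup>+t. ennreal (weight (x, t)) * indicator touch (x, t) \<partial>lborel \<partial>area)"
    by (rule emeasure_covered[OF borel_touch(1) order_refl \<Omega>_covered])
  also have "\<dots> \<le> (\<integral>\<^sup>+x. ennreal (rad x / (CARD('n) + 1)) \<partial>area)"
    using inner_bound[where I = "{}" and h = 0 and Q = touch] borel_touch(1)
    by (intro nn_integral_mono) (simp add: space_area)
  finally have "ennreal (measure lebesgue \<Omega>) \<le> ennreal ((\<integral>x. rad x \<partial>area) / (CARD('n) + 1))"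
    unfolding \<Omega>_finite nn_integral_rad .
  moreover have "(\<integral>x. rad x \<partial>area) \<ge> 0" by (intro integral_nonneg_AE AE_I2) (simp add: space_area rad_pos less_imp_le)
  ultimately show ?thesis by (simp add: ennreal_le_iff)
qed

section \<open>Equality: the full normal tube is used\<close>

text \<open>In the equality case no open part of the normal tube \<open>{(x, t). 0 < t < rad x}\<close> can be missed.\<close>

lemma equality_interior:
  assumes eq: "measure lebesgue \<Omega> = (\<integral>x. rad x \<partial>area) / (CARD('n) + 1)"
    and x0: "x0 \<in> \<Sigma>" and t0: "0 < t0" "t0 < rad x0"
  shows "\<zeta> (x0, t0) \<in> closure \<Omega> \<and> t0 \<le> infdist (\<zeta> (x0, t0)) \<Sigma>"
proof (rule ccontr)
  assume neg: "\<not> (\<zeta> (x0, t0) \<in> closure \<Omega> \<and> t0 \<le> infdist (\<zeta> (x0, t0)) \<Sigma>)"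
  let ?S = "\<Sigma> \<times> (UNIV :: real set)"
  \<comment> \<open>The pairs violating the claim. This set is relatively open and disjoint from
    \<open>touch\<close>.\<close>
  define Z where "Z = (?S \<inter> \<zeta> -` (- closure \<Omega>)) \<union> (?S \<inter> (\<lambda>z. infdist (\<zeta> z) \<Sigma> - snd z) -` {..<0})"
  have cr: "continuous_on ?S (\<lambda>z. rad (fst z) - snd z)"
    by (intro continuous_intros continuous_on_compose2[OF cont_rad]) auto
  define Z' where "Z' = Z \<inter> (?S \<inter> (\<lambda>z. rad (fst z) - snd z) -` {(rad x0 - t0) / 2<..})"
  have "openin (top_of_set ?S) Z'"
    unfolding Z'_def Z_def
    by (rule openin_Int[OF openin_Un[OF continuous_openin_preimage_gen[OF cont_\<zeta>]
        continuous_openin_preimage_gen[OF continuous_on_diff[OF cont_infdist_\<zeta> continuous_on_snd[OF continuous_on_id]]]]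
        continuous_openin_preimage_gen[OF cr]]) auto
  then obtain Y where Y: "open Y" "Z' = ?S \<inter> Y" unfolding openin_open by blast
  have "(x0, t0) \<in> Z'" using neg x0 t0 by (auto simp: Z'_def Z_def)
  then obtain N D where ND: "open N" "open D" "x0 \<in> N" "t0 \<in> D" "N \<times> D \<subseteq> Y" 
  proof -
    have "(x0, t0) \<in> Y" using Y(2) \<open>(x0, t0) \<in> Z'\<close> by blast
    from open_prod_elim[OF Y(1) this] obtain N D where "open N" "open D" "(x0, t0) \<in> N \<times> D" "N \<times> D \<subseteq> Y" .
    then show thesis using that by blast
  qed
  obtain e where e: "e > 0" "cball t0 e \<subseteq> D" using ND(2,4) open_contains_cball by blast
  define d where "d = min (min e (t0 / 2)) ((rad x0 - t0) / 2)"
  have d: "d > 0" "d \<le> e" "d \<le> t0 / 2" using e(1) t0 by (auto simp: d_def)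
  define I where "I = {t0 - d..t0 + d}"
  have I: "0 < t" "(x, t) \<in> Z" "t < rad x" "rad x - t \<ge> (rad x0 - t0) / 2" if "x \<in> \<Sigma> \<inter> N" "t \<in> I" for x t
  proof -
    have "t \<in> cball t0 e" using that(2) d by (auto simp: I_def dist_real_def)
    then have "(x, t) \<in> Z'" using that(1) e(2) ND(5) Y(2) by blast
    then show "(x, t) \<in> Z" "rad x - t \<ge> (rad x0 - t0) / 2" "t < rad x" using t0 by (auto simp: Z'_def)
    show "0 < t" using that(2) d t0 by (auto simp: I_def)
  qed
  obtain B where B: "B > 0" "\<And>x. x \<in> \<Sigma> \<Longrightarrow> rad x \<le> B"
  proof -
    have "compact (rad ` \<Sigma>)" by (rule compact_continuous_image[OF cont_rad compact\<Sigma>])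
    then obtain b where b: "b > 0" "\<forall>y\<in>rad ` \<Sigma>. norm y \<le> b" using compact_imp_bounded[of "rad ` \<Sigma>"] unfolding bounded_pos by blast
    show thesis by (rule that[OF b(1)]) (use b(2) in force)
  qed
  \<comment> \<open>A lower bound for the weight on the box of pairs with base point in
    \<open>\<Sigma> \<inter> N\<close> and parameter in \<open>I\<close>, where
    \<open>rad x - t\<close> stays bounded below and \<open>rad x\<close> bounded above.\<close>
  define h where "h = ((rad x0 - t0) / 2 / B) ^ CARD('n)"
  have h: "h > 0" using t0 B(1) by (simp add: h_def)
  have w: "h \<le> weight (x, t)" if "x \<in> \<Sigma> \<inter> N" "t \<in> I" for x t
  proof -
    have xS: "x \<in> \<Sigma>" using that by blast
    note R = rad_pos[OF xS]
    have "(rad x0 - t0) / 2 / B \<le> (rad x0 - t0) / 2 / rad x" using B(2)[OF xS] R t0 by (intro divide_left_mono) auto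
    also have "\<dots> \<le> (rad x - t) / rad x" using I(4)[OF that] R by (intro divide_right_mono) auto
    also have "\<dots> = 1 - t / rad x" using R by (simp add: diff_divide_distrib)
    finally show ?thesis unfolding h_def weight_eq[OF xS less_imp_le[OF I(3)[OF that]]]
      using t0 B(1) by (intro power_mono) auto
  qed
  have notin: "(x, t) \<notin> touch" if "x \<in> \<Sigma> \<inter> N" "t \<in> I" for x t
    using I(2)[OF that] closure_subset[of \<Omega>] by (auto simp: Z_def touch_def)
  define f where "f x = (\<integral>\<^sup>+t. ennreal (weight (x, t)) * indicator touch (x, t) \<partial>lborel)" for x
  have "(\<lambda>z. ennreal (weight z) * indicator touch z) \<in> borel_measurable borel" using borel_weight borel_touch(1) by simp
  then have mf: "f \<in> borel_measurable area" unfolding f_def by (intro measurable_area fibre_integral_borel)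
  have SN: "\<Sigma> \<inter> N \<in> sets area" using ND(1) closed\<Sigma> by (auto simp: in_sets_area)
  let ?c = "ennreal h * emeasure lborel I"
  have Ipos: "emeasure lborel I = ennreal (2 * d)" using d(1) by (simp add: I_def)
  \<comment> \<open>The weight wasted on the missed box can be added to the volume without exceeding
    the total, which by assumption equals the volume. So the box would have a base of zero area,
    against \<open>area_full_support\<close>.\<close>
  have "emeasure lebesgue \<Omega> + ?c * emeasure area (\<Sigma> \<inter> N) \<le> integral\<^sup>N area f + ?c * emeasure area (\<Sigma> \<inter> N)"
    unfolding f_def by (intro add_right_mono emeasure_covered[OF borel_touch(1) order_refl \<Omega>_covered])
  also have "\<dots> = (\<integral>\<^sup>+x. f x + ?c * indicator (\<Sigma> \<inter> N) x \<partial>area)"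
    using mf SN by (simp add: nn_integral_add nn_integral_cmult_indicator)
  also have "\<dots> \<le> (\<integral>\<^sup>+x. ennreal (rad x / (CARD('n) + 1)) \<partial>area)"
  proof (rule nn_integral_mono)
    fix x assume "x \<in> space area"
    then have x: "x \<in> \<Sigma>" by (simp add: space_area)
    show "f x + ?c * indicator (\<Sigma> \<inter> N) x \<le> ennreal (rad x / (CARD('n) + 1))"
    proof (cases "x \<in> N")
      case True
      then have xN: "x \<in> \<Sigma> \<inter> N" using x by blast
      have "0 \<le> t \<and> t \<le> rad x \<and> (x, t) \<notin> touch \<and> h \<le> weight (x, t)" if t: "t \<in> I" for t
        using I(1,3)[OF xN t] w[OF xN t] notin[OF xN t] by simp
      moreover have "I \<in> sets borel" by (simp add: I_def)
      ultimately have "f x + ?c \<le> ennreal (rad x / (CARD('n) + 1))"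
        unfolding f_def using inner_bound[OF x order_refl _ _ borel_touch(1)] by blast
      then show ?thesis using x True by simp
    next
      case False
      then show ?thesis using inner_bound[OF x order_refl, of "{}" 0] borel_touch(1) by (simp add: f_def)
    qed
  qed
  also have "\<dots> = emeasure lebesgue \<Omega>" unfolding nn_integral_rad \<Omega>_finite eq ..
  finally have "emeasure lebesgue \<Omega> + ?c * emeasure area (\<Sigma> \<inter> N) \<le> emeasure lebesgue \<Omega> + 0" by simp
  then have "?c * emeasure area (\<Sigma> \<inter> N) \<le> 0" unfolding \<Omega>_finite by (simp only: ennreal_add_left_cancel_le) simp
  moreover have "ennreal h \<noteq> 0" "emeasure lborel I \<noteq> 0" using h d(1) Ipos by simp_all
  ultimately have "emeasure area (\<Sigma> \<inter> N) = 0" by simp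
  then show False using area_full_support[OF x0 ND(1,3)] by simp
qed

text \<open>Limit of \<open>equality_interior\<close> as the parameter increases to
  \<open>rad x\<close>.\<close>

lemma equality_touch:
  assumes eq: "measure lebesgue \<Omega> = (\<integral>x. rad x \<partial>area) / (CARD('n) + 1)" and x: "x \<in> \<Sigma>"
  shows "\<zeta> (x, rad x) \<in> closure \<Omega>" "rad x \<le> infdist (\<zeta> (x, rad x)) \<Sigma>"
proof -
  note R = rad_pos[OF x]
  have ev: "\<forall>\<^sub>F t in at_left (rad x). 0 < t \<and> t < rad x"
    using R unfolding eventually_at_left_field by (intro exI[of _ 0]) simp
  have l1: "((\<lambda>t. \<zeta> (x, t)) \<longlongrightarrow> \<zeta> (x, rad x)) (at_left (rad x))"
    unfolding \<zeta>_def prod.case by (intro tendsto_intros)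
  have l2: "((\<lambda>t. infdist (\<zeta> (x, t)) \<Sigma> - t) \<longlongrightarrow> infdist (\<zeta> (x, rad x)) \<Sigma> - rad x) (at_left (rad x))"
    by (intro tendsto_intros l1)
  show "\<zeta> (x, rad x) \<in> closure \<Omega>"
    by (rule Lim_in_closed_set[OF closed_closure _ _ l1])
      (use ev equality_interior[OF eq x] in \<open>auto elim: eventually_mono\<close>)
  have "\<forall>\<^sub>F t in at_left (rad x). 0 \<le> infdist (\<zeta> (x, t)) \<Sigma> - t"
    using ev by eventually_elim (use equality_interior[OF eq x] in auto)
  then have "0 \<le> infdist (\<zeta> (x, rad x)) \<Sigma> - rad x" by (rule tendsto_lowerbound[OF l2]) simp
  then show "rad x \<le> infdist (\<zeta> (x, rad x)) \<Sigma>" by simp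
qed

end

section \<open>Inner directions at a point; hypersurfaces contained in spheres\<close>

text \<open>For convex \<open>K\<close> and \<open>y\<close> in its closure this is the interior of
  the tangent cone at \<open>y\<close>.\<close>

definition inner_cone :: "'a::euclidean_space set \<Rightarrow> 'a \<Rightarrow> 'a set" where
  "inner_cone K y = {v. \<exists>\<tau>>0. y + \<tau> *\<^sub>R v \<in> interior K}"

lemma interior_segment:
  fixes K :: "'a::euclidean_space set"
  assumes "convex K" "y \<in> closure K" "y + t *\<^sub>R v \<in> interior K" "0 < s" "s \<le> t"
  shows "y + s *\<^sub>R v \<in> interior K"
proof -
  have "y - (s / t) *\<^sub>R (y - (y + t *\<^sub>R v)) \<in> interior K"
    by (rule mem_interior_closure_convex_shrink[OF assms(1,3,2)]) (use assms in auto)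
  then show ?thesis using assms by simp
qed

lemma inner_cone_scale: "v \<in> inner_cone K y \<Longrightarrow> s > 0 \<Longrightarrow> s *\<^sub>R v \<in> inner_cone K y"
  unfolding inner_cone_def
proof clarify
  fix t :: real assume "s > 0" "t > 0" "y + t *\<^sub>R v \<in> interior K"
  then show "\<exists>t>0. y + t *\<^sub>R s *\<^sub>R v \<in> interior K" by (intro exI[of _ "t / s"]) simp
qed

lemma inner_coneI: "z \<in> interior K \<Longrightarrow> z - y \<in> inner_cone K y"
  unfolding inner_cone_def by (auto intro: exI[of _ 1])

lemma inner_cone_open: "open (inner_cone K y)"
proof -
  have "inner_cone K y = (\<Union>t\<in>{0<..}. (\<lambda>v. y + t *\<^sub>R v) -` interior K)" by (auto simp: inner_cone_def)
  then show ?thesis by (auto intro!: open_UN open_vimage continuous_intros)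
qed

lemma inner_cone_convex:
  assumes K: "convex K" "y \<in> closure K" shows "convex (inner_cone K y)"
proof (rule convexI)
  fix v w and a b :: real assume vw: "v \<in> inner_cone K y" "w \<in> inner_cone K y" and ab: "0 \<le> a" "0 \<le> b" "a + b = 1"
  obtain t \<sigma> where t: "t > 0" "y + t *\<^sub>R v \<in> interior K" and \<sigma>: "\<sigma> > 0" "y + \<sigma> *\<^sub>R w \<in> interior K"
    using vw by (auto simp: inner_cone_def)
  let ?s = "min t \<sigma>"
  have "y + ?s *\<^sub>R v \<in> interior K" "y + ?s *\<^sub>R w \<in> interior K"
    using interior_segment[OF K t(2)] interior_segment[OF K \<sigma>(2)] t(1) \<sigma>(1) by auto
  then have "a *\<^sub>R (y + ?s *\<^sub>R v) + b *\<^sub>R (y + ?s *\<^sub>R w) \<in> interior K"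
    using ab convexD[OF convex_interior[OF K(1)]] by blast
  moreover have "a *\<^sub>R (y + ?s *\<^sub>R v) + b *\<^sub>R (y + ?s *\<^sub>R w) = (a + b) *\<^sub>R y + ?s *\<^sub>R (a *\<^sub>R v + b *\<^sub>R w)"
    by (simp add: algebra_simps)
  ultimately show "a *\<^sub>R v + b *\<^sub>R w \<in> inner_cone K y" using t(1) \<sigma>(1) ab(3) by (auto simp: inner_cone_def intro!: exI[of _ ?s])
qed

lemma inner_cone_closure_sgn:
  fixes K :: "'a::euclidean_space set"
  assumes z: "z \<in> closure (inner_cone K y)" "z \<noteq> 0"
  shows "sgn z \<in> closure (inner_cone K y \<inter> sphere 0 1)"
proof -
  obtain xs where xs: "\<And>k. xs k \<in> inner_cone K y" "xs \<longlonglongrightarrow> z" using z(1) closure_sequential by blast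
  have "(\<lambda>k. sgn (xs k)) \<longlonglongrightarrow> sgn z" by (rule tendsto_sgn[OF xs(2) z(2)])
  moreover have "\<forall>\<^sub>F k in sequentially. xs k \<noteq> 0" using tendsto_imp_eventually_ne[OF xs(2) z(2)] .
  then have "\<forall>\<^sub>F k in sequentially. sgn (xs k) \<in> closure (inner_cone K y \<inter> sphere 0 1)"
  proof eventually_elim
    case (elim k)
    then have "inverse (norm (xs k)) *\<^sub>R xs k \<in> inner_cone K y" by (intro inner_cone_scale[OF xs(1)]) simp
    then have "sgn (xs k) \<in> inner_cone K y" by (simp only: sgn_div_norm)
    moreover have "norm (sgn (xs k)) = 1" using elim by (simp add: norm_sgn)
    ultimately have "sgn (xs k) \<in> inner_cone K y \<inter> sphere 0 1" by simp
    then show ?case by (rule subsetD[OF closure_subset])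
  qed
  ultimately show ?thesis by (intro Lim_in_closed_set[OF closed_closure]) auto
qed

lemma sphere_equation:
  fixes c :: "'a::euclidean_space"
  assumes U: "open U" "c \<notin> U" and \<Sigma>: "\<Sigma> \<subseteq> sphere c r"
  shows "C2_equation \<Sigma> U (\<lambda>y. (y - c) \<bullet> (y - c) - r\<^sup>2)"
proof -
  define g where "g = (\<lambda>y. (y - c) \<bullet> (y - c) - r\<^sup>2)"
  have d: "(g has_derivative (\<lambda>v. 2 * ((y - c) \<bullet> v))) (at y)" for y
    unfolding g_def by (auto intro!: derivative_eq_intros simp: inner_commute)
  have fd: "frechet_derivative g (at y) = (\<lambda>v. 2 * ((y - c) \<bullet> v))" for y
    using frechet_derivative_at[OF d] by simp
  have d2: "((\<lambda>y. 2 * ((y - c) \<bullet> v)) has_derivative (\<lambda>w. 2 * (w \<bullet> v))) (at y)" for v y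
    by (auto intro!: derivative_eq_intros)
  have fd2: "frechet_derivative (\<lambda>y. 2 * ((y - c) \<bullet> v)) (at y) = (\<lambda>w. 2 * (w \<bullet> v))" for v y
    using frechet_derivative_at[OF d2] by simp
  have diff: "g differentiable (at y)" "(\<lambda>y. 2 * ((y - c) \<bullet> v)) differentiable (at y)" for y v
    using d d2 differentiableI by blast+
  have "Ck_on 2 g U"
    unfolding numeral_2_eq_2 Ck_on.simps fd fd2 using diff by simp
  moreover have "gradient g y \<noteq> 0" if y: "y \<in> U" for y
  proof
    assume 0: "gradient g y = 0"
    from gradient_works(1)[OF diff(1), of y "y - c"] have "2 * ((y - c) \<bullet> (y - c)) = 0" by (simp only: fd 0 inner_zero_left)
    then show False using y U(2) by auto
  qed
  moreover have "g y = 0" if "y \<in> \<Sigma>" for y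
  proof -
    have "norm (y - c) = r" using \<Sigma> that by (auto simp: dist_norm norm_minus_commute)
    then show ?thesis by (simp add: g_def dot_square_norm)
  qed
  ultimately have "C2_equation \<Sigma> U g" using U by (simp add: C2_equation_def)
  then show ?thesis by (simp only: g_def)
qed

context oriented_hypersurface
begin

text \<open>The formula for \<nu> holds on \<Sigma> only, so it is differentiated along a curve in
  \<Sigma> with velocity a multiple of \<open>v\<close>.\<close>

lemma sphere_shape:
  assumes x: "x \<in> hs_interior \<Sigma>" and g: "eqn U g" "x \<in> U" and N: "open N" "x \<in> N"
    and k: "\<And>y. y \<in> \<Sigma> \<inter> N \<Longrightarrow> \<nu> y = k *\<^sub>R (y - c)" and v: "v \<bullet> \<nu> x = 0"
  shows "shape g x v = k *\<^sub>R v"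
proof -
  note E = eqnD(1)[OF g(1)]
  obtain r w where r: "r > 0" and w: "w 0 = x" "w ` {0..1} \<subseteq> \<Sigma>"
    and d: "(w has_vector_derivative r *\<^sub>R v) (at 0 within {0..1::real})"
    using interior_velocity[OF x v] by blast
  have "((\<lambda>s. unit_gradient g (w s)) has_derivative (\<lambda>h. shape g x (h *\<^sub>R (r *\<^sub>R v)))) (at 0 within {0..1})"
    using has_derivative_compose[OF d[unfolded has_vector_derivative_def], of "unit_gradient g" "shape g x"]
      unit_gradient_C1(5)[OF E g(2)] w(1) by simp
  then have "((\<lambda>s. unit_gradient g (w s)) has_vector_derivative shape g x (r *\<^sub>R v)) (at 0 within {0..1})"
    using linear_cmul[OF shape_linear[OF E g(2)]] by (simp add: has_vector_derivative_def)
  from vector_derivative_limit[OF this]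
  have 1: "((\<lambda>s. (unit_gradient g (w s) - unit_gradient g (w 0)) /\<^sub>R s) \<longlongrightarrow> shape g x (r *\<^sub>R v)) (at_right 0)"
    unfolding at_0_within_unit .
  have 2: "((\<lambda>s. k *\<^sub>R ((w s - w 0) /\<^sub>R s)) \<longlongrightarrow> k *\<^sub>R (r *\<^sub>R v)) (at_right 0)"
    using vector_derivative_limit[OF d] unfolding at_0_within_unit by (rule tendsto_scaleR[OF tendsto_const])
  have "continuous (at 0 within {0..1}) w" using d has_vector_derivative_continuous by blast
  then have cw: "(w \<longlongrightarrow> x) (at_right 0)" using w(1) unfolding continuous_within at_0_within_unit by simp
  have "open (U \<inter> N)" "x \<in> U \<inter> N" using C2_equationD(1)[OF E] N g(2) by auto
  then have "\<forall>\<^sub>F s in at_right 0. w s \<in> U \<inter> N" using topological_tendstoD[OF cw] by blast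
  moreover have "\<forall>\<^sub>F s in at_right 0. 0 < s \<and> s < (1::real)" unfolding eventually_at_right_field by (intro exI[of _ 1]) auto
  ultimately have "\<forall>\<^sub>F s in at_right 0. k *\<^sub>R ((w s - w 0) /\<^sub>R s) = (unit_gradient g (w s) - unit_gradient g (w 0)) /\<^sub>R s"
  proof eventually_elim
    case (elim s)
    have ug: "unit_gradient g y = k *\<^sub>R (y - c)" if "y \<in> \<Sigma>" "y \<in> U" "y \<in> N" for y
      using eqnD(2)[OF g(1) that(1,2)] k that by simp
    have "w s \<in> \<Sigma>" using w(2) elim by auto
    then have ug': "unit_gradient g (w s) = k *\<^sub>R (w s - c)" "unit_gradient g (w 0) = k *\<^sub>R (w 0 - c)"
      using elim ug w(1) g(2) N(2) hs_interior_subset[OF x] by auto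
    have "unit_gradient g (w s) - unit_gradient g (w 0) = k *\<^sub>R (w s - w 0)"
      unfolding ug' by (simp add: scaleR_diff_right)
    then show ?case by (simp add: mult.commute)
  qed
  then have "((\<lambda>s. (unit_gradient g (w s) - unit_gradient g (w 0)) /\<^sub>R s) \<longlongrightarrow> k *\<^sub>R (r *\<^sub>R v)) (at_right 0)"
    by (rule Lim_transform_eventually[OF 2])
  from tendsto_unique[OF trivial_limit_at_right_real 1 this]
  have "shape g x (r *\<^sub>R v) = k *\<^sub>R (r *\<^sub>R v)" .
  then have "r *\<^sub>R shape g x v = r *\<^sub>R (k *\<^sub>R v)"
    using linear_cmul[OF shape_linear[OF E g(2)]] by (simp add: scaleR_left_commute)
  then show ?thesis using r by (simp only: scaleR_cancel_left) simp
qed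

lemma sphere_curvature:
  fixes k :: real
  assumes x: "x \<in> hs_interior \<Sigma>" and N: "open N" "x \<in> N" and k: "\<And>y. y \<in> \<Sigma> \<inter> N \<Longrightarrow> \<nu> y = k *\<^sub>R (y - c)"
  shows "mean_curvature \<Sigma> \<nu> x = CARD('n) * k"
    "eqn U g \<Longrightarrow> x \<in> U \<Longrightarrow> absdet (focal_map g x t) = \<bar>1 - t * k\<bar> ^ CARD('n)"
proof -
  have xS: "x \<in> \<Sigma>" using hs_interior_subset[OF x] .
  have main: "mean_curvature \<Sigma> \<nu> x = CARD('n) * k \<and> absdet (focal_map g x t) = \<bar>1 - t * k\<bar> ^ CARD('n)"
    if g: "eqn U g" "x \<in> U" for U g
  proof -
    obtain E l where E: "finite E" "card E = DIM('a) - 1"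
      "\<forall>e\<in>E. e \<bullet> unit_gradient g x = 0 \<and> norm e = 1 \<and> shape g x e = l e *\<^sub>R e"
      "(\<Sum>e\<in>E. l e) = shape_trace g x" "\<forall>t. absdet (focal_map g x t) = \<bar>\<Prod>e\<in>E. (1 - t * l e)\<bar>"
      using principal_curvatures[OF eqnD(1)[OF g(1)] g(2)] by blast
    have l: "l e = k" if e: "e \<in> E" for e
    proof -
      have e': "e \<bullet> \<nu> x = 0" "norm e = 1" "shape g x e = l e *\<^sub>R e" using E(3) e eqnD(2)[OF g(1) xS g(2)] by auto
      have "shape g x e = k *\<^sub>R e" by (rule sphere_shape[OF x g N k e'(1)])
      then have "l e *\<^sub>R e = k *\<^sub>R e" using e'(3) by simp
      moreover have "e \<noteq> 0" using e'(2) by auto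
      ultimately show ?thesis by simp
    qed
    show ?thesis using E(2,4,5) l dim mean_curvature_eq[OF xS g] by (simp add: power_abs)
  qed
  show "eqn U g \<Longrightarrow> x \<in> U \<Longrightarrow> absdet (focal_map g x t) = \<bar>1 - t * k\<bar> ^ CARD('n)" using main by blast
  show "mean_curvature \<Sigma> \<nu> x = CARD('n) * k" using eqn_exists[OF xS] main by blast
qed

text \<open>All points of \<Sigma> have the same distance from \<open>c\<close>, so each interior
  point is a nearest point of \<open>c\<close> and \<nu> is radial there; density extends this to
  \<Sigma>. Where \<nu> pointed towards \<open>c\<close>, the mean curvature would be negative by
  \<open>sphere_curvature\<close>.\<close>

lemma sphere_normal:
  assumes S: "\<Sigma> \<subseteq> sphere c r" and r: "r > 0" and H: "\<forall>x\<in>\<Sigma>. mean_curvature \<Sigma> \<nu> x > 0" and x: "x \<in> \<Sigma>"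
  shows "\<nu> x = (1 / r) *\<^sub>R (x - c)"
proof -
  define a where "a y = (y - c) \<bullet> \<nu> y" for y
  have dist: "dist c y = r" if "y \<in> \<Sigma>" for y using S that by auto
  have ca: "continuous_on \<Sigma> a" unfolding a_def by (intro continuous_intros cont\<nu>)
  have cl: "closure (hs_interior \<Sigma>) = \<Sigma>"
    by (rule antisym[OF closure_minimal[OF _ closed\<Sigma>] dense]) (use hs_interior_subset in blast)
  have par: "y - c = a y *\<^sub>R \<nu> y" if y: "y \<in> \<Sigma>" for y
  proof -
    have "(y - c) - a y *\<^sub>R \<nu> y = 0"
    proof (rule continuous_constant_on_closure[of "hs_interior \<Sigma>" "\<lambda>y. (y - c) - a y *\<^sub>R \<nu> y"])
      show "continuous_on (closure (hs_interior \<Sigma>)) (\<lambda>y. (y - c) - a y *\<^sub>R \<nu> y)"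
        unfolding cl by (intro continuous_intros ca cont\<nu>)
      fix z assume z: "z \<in> hs_interior \<Sigma>"
      have "dist c z \<le> dist c w" if "w \<in> \<Sigma>" for w using dist[OF that] dist[OF hs_interior_subset[OF z]] by simp
      from nearest_point_normal[OF z this] have "c - z = ((c - z) \<bullet> \<nu> z) *\<^sub>R \<nu> z" by simp
      moreover have "(c - z) \<bullet> \<nu> z = - a z" by (simp add: a_def inner_diff_left)
      ultimately have "c - z = - (a z *\<^sub>R \<nu> z)" by simp
      then show "(z - c) - a z *\<^sub>R \<nu> z = 0" by (simp add: algebra_simps)
    qed (use cl y in simp)
    then show ?thesis by simp
  qed
  have abs: "\<bar>a y\<bar> = r" if y: "y \<in> \<Sigma>" for y
  proof -
    have "norm (y - c) = \<bar>a y\<bar> * norm (\<nu> y)" using par[OF y] by (metis norm_scaleR)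
    then show ?thesis using dist[OF y] norm\<nu>[OF y] by (simp add: dist_norm norm_minus_commute)
  qed
  have "a x > 0"
  proof (rule ccontr)
    assume "\<not> a x > 0"
    then have neg: "a x < 0" using abs[OF x] r by linarith
    have "openin (top_of_set \<Sigma>) (\<Sigma> \<inter> a -` {..<0})"
      by (rule continuous_openin_preimage_gen[OF ca]) simp
    then obtain N where N: "open N" "\<Sigma> \<inter> a -` {..<0} = \<Sigma> \<inter> N" unfolding openin_open by blast
    have k: "\<nu> y = (- (1 / r)) *\<^sub>R (y - c)" if y: "y \<in> \<Sigma> \<inter> N" for y
    proof -
      have "a y < 0" "y \<in> \<Sigma>" using y N(2) by auto
      then have "a y = - r" using abs[of y] by simp
      then have "y - c = (- r) *\<^sub>R \<nu> y" using par[of y] y by simp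
      then show ?thesis using r by simp
    qed
    have "x \<in> N \<inter> closure (hs_interior \<Sigma>)" using neg x N(2) cl by auto
    then obtain x' where x': "x' \<in> hs_interior \<Sigma>" "x' \<in> N" using open_Int_closure_eq_empty[OF N(1)] by blast
    have "mean_curvature \<Sigma> \<nu> x' = CARD('n) * (- (1 / r))" by (rule sphere_curvature(1)[OF x'(1) N(1) x'(2) k])
    also have "\<dots> < 0" using r by (simp add: zero_less_divide_iff)
    finally show False using H hs_interior_subset[OF x'(1)] by force
  qed
  then have "a x = r" using abs[OF x] by simp
  then have "x - c = r *\<^sub>R \<nu> x" using par[OF x] by simp
  then show ?thesis using r by simp
qed

end

context heintze_karcher
begin

text \<open>A supporting hyperplane at \<open>x\<close> leaves \<open>c\<close> on its inner side,
  so the radial vector \<nu> has nonnegative product with every outer normal. The assumed sign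
  conditions give the opposite inequality.\<close>

lemma free_boundary_sphere:
  assumes S: "\<Sigma> \<subseteq> sphere c r" and r: "r > 0" and c: "c \<in> closure K"
  shows "free_boundary J u \<Psi> K \<Sigma> \<nu>"
proof -
  have ge: "\<nu> x \<bullet> N \<ge> 0" if x: "x \<in> \<Sigma>" and N: "N \<in> normal_cone K x" for x N
  proof -
    have "N \<bullet> (c - x) \<le> 0" by (rule normal_cone_closure[OF N c])
    then have "(x - c) \<bullet> N \<ge> 0" by (simp add: inner_diff_left inner_diff_right inner_commute)
    then show ?thesis using sphere_normal[OF S r mean_convex x] r by simp
  qed
  show ?thesis
    unfolding free_boundary_def
  proof (intro conjI ballI)
    fix x assume x: "x \<in> hs_boundary \<Sigma> \<inter> Reg J u \<Psi>"
    then show "\<nu> x \<bullet> outer_normal K (frontier K) x = 0"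
      using ge[of x] boundary_facts(1)[of x] boundary_normals_in_normal_cone(1)[of x] regular by force
  next
    fix ij assume ij: "ij \<in> edge_indices J u"
    obtain i j where e: "ij = (i, j)" by force
    show "case ij of (i, j) \<Rightarrow> \<forall>x\<in>hs_boundary \<Sigma> \<inter> edge_interior J u \<Psi> i j.
        \<nu> x \<bullet> outer_normal K (piece J u \<Psi> i) x = 0 \<and> \<nu> x \<bullet> outer_normal K (piece J u \<Psi> j) x = 0"
      unfolding e prod.case
    proof
      fix x assume x: "x \<in> hs_boundary \<Sigma> \<inter> edge_interior J u \<Psi> i j"
      have "\<nu> x \<bullet> outer_normal K (piece J u \<Psi> i) x \<le> 0 \<and> \<nu> x \<bullet> outer_normal K (piece J u \<Psi> j) x \<le> 0"
        using singular ij e x by blast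
      moreover have "\<nu> x \<bullet> outer_normal K (piece J u \<Psi> i) x \<ge> 0" "\<nu> x \<bullet> outer_normal K (piece J u \<Psi> j) x \<ge> 0"
        using ge[of x] boundary_facts(1)[of x] boundary_normals_in_normal_cone(2)[of i j x] ij e x by auto
      ultimately show "\<nu> x \<bullet> outer_normal K (piece J u \<Psi> i) x = 0 \<and> \<nu> x \<bullet> outer_normal K (piece J u \<Psi> j) x = 0" by linarith
    qed
  qed
qed

section \<open>Equality: the sphere about a deepest point\<close>

text \<open>If the sphere about the centre left the hypersurface in an inner direction \<open>v\<close>, then points near the
  centre in direction \<open>v\<close> would have their nearest points in the shells \<open>r0 < dist y0 x \<le> r0 + 2 * \<epsilon>\<close>, whose
  area tends to zero, while the volume they sweep out is of the full order \<open>\<epsilon> ^ DIM('a)\<close>.\<close>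

lemma cap_in_hypersurface:
  assumes y0: "y0 \<in> closure \<Omega>" "infdist y0 \<Sigma> = r0" "r0 > 0" and max: "\<And>y. y \<in> closure \<Omega> \<Longrightarrow> infdist y \<Sigma> \<le> r0"
    and rad: "\<And>x. x \<in> \<Sigma> \<Longrightarrow> rad x \<le> r0" and v: "norm v = 1" "v \<in> inner_cone K y0"
  shows "y0 + r0 *\<^sub>R v \<in> \<Sigma>"
proof (rule ccontr)
  assume p: "y0 + r0 *\<^sub>R v \<notin> \<Sigma>"
  interpret A: finite_measure area by (rule finite_area)
  have y0K: "y0 \<in> closure K" using y0(1) closure_mono[OF order_trans[OF \<Omega>_sub(1) order_trans[OF Diff_subset interior_subset]]] by blast
  have far: "r0 \<le> dist y0 z" if "z \<in> \<Sigma>" for z using infdist_le[OF that, of y0] y0(2) by simp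
  obtain d where d: "d > 0" "ball (y0 + r0 *\<^sub>R v) d \<inter> \<Sigma> = {}"
    using p closed\<Sigma> open_contains_ball[of "- \<Sigma>"] by (auto simp: open_Compl) blast
  obtain s where s: "s > 0" "y0 + s *\<^sub>R v \<in> interior K" using v(2) by (auto simp: inner_cone_def)
  obtain e where e: "e > 0" "ball (y0 + s *\<^sub>R v) e \<subseteq> interior K" using s(2) open_contains_ball open_interior by blast
  \<comment> \<open>The bounds keep the rescaled directions \<open>v'\<close> nonzero and of length
    below 2, keep \<open>y0 + s *\<^sub>R v'\<close> in the interior of \<open>K\<close>, and keep
    the radial projections to the sphere within \<open>d\<close> of the missing point.\<close>
  define r where "r = min (min (1 / 2) (e / s)) (d / (2 * r0))"
  have r: "r > 0" "r \<le> 1 / 2" "s * r \<le> e" "2 * r0 * r \<le> d"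
  proof -
    show "r > 0" using e(1) s(1) d(1) y0(3) by (simp add: r_def)
    show "r \<le> 1 / 2" unfolding r_def by (rule min.coboundedI1[OF min.cobounded1])
    have "r \<le> e / s" "r \<le> d / (2 * r0)" by (auto simp: r_def)
    then show "s * r \<le> e" "2 * r0 * r \<le> d" using s(1) y0(3) by (simp_all add: pos_le_divide_eq mult.commute)
  qed
  \<comment> \<open>For \<open>m\<close> up to this size the points
    \<open>y0 + m *\<^sub>R v'\<close> lie before \<open>y0 + s *\<^sub>R v'\<close> on a segment
    into \<open>K\<close>, and at distance below \<open>2 * m\<close>, hence below
    \<open>r0\<close>, from \<open>y0\<close>.\<close>
  define m0 where "m0 = min s (r0 / 4)"
  have m0: "m0 > 0" using s(1) y0(3) by (simp add: m0_def)
  define S where "S m = {x\<in>\<Sigma>. r0 < dist y0 x \<and> dist y0 x \<le> r0 + 2 * m}" for m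
  have Sb: "S m \<in> sets area" for m
  proof -
    have "S m = \<Sigma> \<inter> cball y0 (r0 + 2 * m) - cball y0 r0" by (auto simp: S_def)
    then show ?thesis using closed\<Sigma> by (auto simp: in_sets_area)
  qed
  define cov where "cov m = touch \<inter> {z. r0 < dist y0 (fst z) \<and> dist y0 (fst z) \<le> r0 + 2 * m \<and> r0 - 2 * m \<le> snd z \<and> snd z \<le> r0}" for m
  have covered: "ball (y0 + m *\<^sub>R v) (m * r) \<subseteq> \<zeta> ` cov m \<union> \<zeta> ` (hs_boundary \<Sigma> \<times> UNIV)"
    if m: "0 < m" "m \<le> m0" for m
  proof
    fix y assume y: "y \<in> ball (y0 + m *\<^sub>R v) (m * r)"
    define v' where "v' = (1 / m) *\<^sub>R (y - y0)"
    have yv: "y = y0 + m *\<^sub>R v'" using m(1) by (simp add: v'_def)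
    have "norm (m *\<^sub>R (v' - v)) < m * r" using y unfolding yv by (simp add: dist_norm norm_minus_commute algebra_simps)
    then have vv: "norm (v' - v) < r" using m(1) by simp
    have nv: "\<bar>norm v' - 1\<bar> < r" using norm_triangle_ineq3[of v' v] vv v(1) by simp
    then have v'0: "v' \<noteq> 0" "norm v' < 2" using r(2) by auto
    have dy: "dist y y0 < 2 * m" using v'0(2) m(1) by (simp add: yv dist_norm)
    have "norm (s *\<^sub>R v' - s *\<^sub>R v) = s * norm (v' - v)" using s(1) by (simp flip: scaleR_diff_right)
    also have "\<dots> < s * r" using vv s(1) by simp
    finally have "y0 + s *\<^sub>R v' \<in> ball (y0 + s *\<^sub>R v) e" using r(3) by (simp add: dist_norm norm_minus_commute)
    then have "y0 + s *\<^sub>R v' \<in> interior K" using e(2) by blast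
    then have yK: "y \<in> interior K" unfolding yv by (rule interior_segment[OF convK y0K]) (use m in \<open>auto simp: m0_def\<close>)
    have "ball y0 r0 \<inter> \<Sigma> = {}" using far by force
    from ball_subset_\<Omega>[OF y0(1) this y0(3)] have y\<Omega>: "y \<in> \<Omega>"
      using yK dy m by (auto simp: m0_def dist_commute)
    show "y \<in> \<zeta> ` cov m \<union> \<zeta> ` (hs_boundary \<Sigma> \<times> UNIV)"
    proof (cases "y \<in> \<zeta> ` (hs_boundary \<Sigma> \<times> UNIV)")
      case False
      then obtain x t where xt: "(x, t) \<in> touch" "y = \<zeta> (x, t)" using \<Omega>_covered y\<Omega> by force
      have x: "x \<in> hs_interior \<Sigma>" "x \<in> \<Sigma>" and t: "0 < t" "t \<le> infdist y \<Sigma>" and yx: "y = x - t *\<^sub>R \<nu> x"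
        using xt hs_interior_subset by (auto simp: touch_def \<zeta>_def)
      have dyx: "dist y x = t" using yx t(1) norm\<nu>[OF x(2)] by (simp add: dist_norm)
      then have it: "infdist y \<Sigma> = t" using infdist_le[OF x(2), of y] t(2) by simp
      have tr: "t \<le> r0" using max[of y] y\<Omega> closure_subset it by blast
      have tl: "r0 - 2 * m \<le> t" using infdist_triangle[of y0 \<Sigma> y] y0(2) it dy by (simp add: dist_commute)
      have xu: "dist y0 x \<le> r0 + 2 * m" using dist_triangle[of y0 x y] dyx dy tr by (simp add: dist_commute)
      \<comment> \<open>Otherwise \<open>x\<close> is a nearest point of \<open>y0\<close> too, and
        \<open>y0\<close> and \<open>y\<close> lie on the same normal line. Then \<open>x\<close> is
        the radial projection of \<open>y\<close>, within \<open>d\<close> of the missing point,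
        although that ball avoids \<Sigma>.\<close>
      have "dist y0 x \<noteq> r0"
      proof
        assume eq: "dist y0 x = r0"
        have "dist y0 x \<le> dist y0 z" if "z \<in> \<Sigma>" for z using far[OF that] eq by simp
        from nearest_point_normal[OF x(1) this] obtain a where a: "y0 - x = a *\<^sub>R \<nu> x" by blast
        have "\<bar>a\<bar> * norm (\<nu> x) = r0" using eq unfolding dist_norm a by simp
        then have aa: "\<bar>a\<bar> = r0" using norm\<nu>[OF x(2)] by simp
        have y0e: "y0 = x + a *\<^sub>R \<nu> x" using a by (simp add: algebra_simps)
        have yy: "y - y0 = - ((t + a) *\<^sub>R \<nu> x)" unfolding yx by (subst y0e) (simp add: algebra_simps)
        then have "dist y y0 = \<bar>t + a\<bar>" using norm\<nu>[OF x(2)] by (simp add: dist_norm)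
        then have "\<bar>t + a\<bar> < 2 * m" using dy by simp
        then have a': "a = - r0" using aa tl m t(1) by (auto simp: m0_def)
        have yy': "m *\<^sub>R v' = (r0 - t) *\<^sub>R \<nu> x" using yy a' yv by (simp add: algebra_simps)
        then have "r0 - t \<noteq> 0" using v'0(1) m(1) by auto
        then have "r0 - t > 0" using tr by simp
        then have "sgn (m *\<^sub>R v') = \<nu> x" unfolding yy' using norm\<nu>[OF x(2)] by (simp add: sgn_scaleR sgn_div_norm)
        then have sg: "sgn v' = \<nu> x" using m(1) by (simp add: sgn_scaleR)
        have "x = y0 + r0 *\<^sub>R sgn v'" using y0e a' sg by simp
        moreover have "norm (sgn v' - v) < 2 * r"
        proof -
          have "sgn v' - v' = (1 / norm v' - 1) *\<^sub>R v'" by (simp add: sgn_div_norm algebra_simps divide_inverse)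
          then have "norm (sgn v' - v') = \<bar>1 / norm v' - 1\<bar> * norm v'" by simp
          also have "\<dots> = \<bar>(1 / norm v' - 1) * norm v'\<bar>" by (simp add: abs_mult)
          also have "\<dots> = \<bar>1 - norm v'\<bar>" using v'0(1) by (simp add: left_diff_distrib)
          finally have "norm (sgn v' - v') < r" using nv by linarith
          then show ?thesis using norm_triangle_ineq[of "sgn v' - v'" "v' - v"] vv by simp
        qed
        then have "r0 * norm (sgn v' - v) < r0 * (2 * r)" using y0(3) by (rule mult_strict_left_mono)
        then have "r0 * norm (sgn v' - v) < d" using r(4) by (simp add: mult_ac)
        then have "norm (r0 *\<^sub>R sgn v' - r0 *\<^sub>R v) < d" using y0(3) by (simp flip: scaleR_diff_right)
        ultimately have "x \<in> ball (y0 + r0 *\<^sub>R v) d" by (simp add: dist_norm norm_minus_commute)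
        then show False using d(2) x(2) by blast
      qed
      then have "r0 < dist y0 x" using far[OF x(2)] by simp
      then have "(x, t) \<in> cov m" using xt(1) xu tl tr by (simp add: cov_def)
      then show ?thesis using xt(2) by blast
    qed blast
  qed
  have covb: "cov m \<in> sets borel" "cov m \<subseteq> touch" for m
  proof -
    have "{z::'a \<times> real. r0 < dist y0 (fst z) \<and> dist y0 (fst z) \<le> r0 + 2 * m \<and> r0 - 2 * m \<le> snd z \<and> snd z \<le> r0} =
      (cball y0 (r0 + 2 * m) \<times> {r0 - 2 * m..r0}) - (cball y0 r0 \<times> UNIV)" by auto
    moreover have "closed (cball y0 (r0 + 2 * m) \<times> {r0 - 2 * m..r0})" "closed (cball y0 r0 \<times> (UNIV :: real set))"
      by (intro closed_Times closed_cball closed_UNIV closed_atLeastAtMost)+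
    ultimately show "cov m \<in> sets borel" unfolding cov_def using borel_touch(1) by (simp add: sets.Int sets.Diff)
    show "cov m \<subseteq> touch" by (auto simp: cov_def)
  qed
  define b where "b = measure lborel (ball (0::'a) 1)"
  have b: "b > 0" unfolding b_def by (rule content_ball_pos) simp
  \<comment> \<open>A lower bound for the shell areas independent of \<open>m\<close>: volume and
    swept weight are both proportional to \<open>m ^ DIM('a)\<close>, which cancels.\<close>
  define l where "l = b * r ^ DIM('a) * r0 ^ CARD('n) / 2 ^ DIM('a)"
  have l: "l > 0" using b r(1) y0(3) by (simp add: l_def)
  have bound: "l \<le> measure area (S m)" if m: "0 < m" "m \<le> m0" for m
  proof -
    \<comment> \<open>Bounds the weight on \<open>cov m\<close>: as \<open>rad x \<le> r0\<close>
      and \<open>r0 - 2 * m \<le> t\<close>, the base \<open>1 - t / rad x\<close> is at most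
      \<open>2 * m / r0\<close>.\<close>
    define w where "w = (2 * m / r0) ^ CARD('n)"
    have w0: "w \<ge> 0" using m y0(3) by (simp add: w_def)
    have "emeasure lebesgue (ball (y0 + m *\<^sub>R v) (m * r)) \<le> (\<integral>\<^sup>+x. \<integral>\<^sup>+t. ennreal (weight (x, t)) * indicator (cov m) (x, t) \<partial>lborel \<partial>area)"
      by (rule emeasure_covered[OF covb covered[OF m]])
    also have "\<dots> \<le> (\<integral>\<^sup>+x. ennreal (w * (2 * m)) * indicator (S m) x \<partial>area)"
    proof (rule nn_integral_mono)
      fix x assume "x \<in> space area"
      then have x: "x \<in> \<Sigma>" by (simp add: space_area)
      have "(\<integral>\<^sup>+t. ennreal (weight (x, t)) * indicator (cov m) (x, t) \<partial>lborel) \<le>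
          (\<integral>\<^sup>+t. (ennreal w * indicator (S m) x) * indicator {r0 - 2 * m..r0} t \<partial>lborel)"
      proof (rule nn_integral_mono)
        fix t
        show "ennreal (weight (x, t)) * indicator (cov m) (x, t) \<le> (ennreal w * indicator (S m) x) * indicator {r0 - 2 * m..r0} t"
        proof (cases "(x, t) \<in> cov m")
          case True
          then have c: "(x, t) \<in> touch" "x \<in> S m" "t \<in> {r0 - 2 * m..r0}" using x by (auto simp: cov_def S_def)
          have tR: "t \<le> rad x" "t > 0" using touch_bounds(1)[OF c(1)] c(1) by (auto simp: touch_def)
          note R = rad_pos[OF x]
          have "t / r0 \<le> t / rad x" using tR R rad[OF x] y0(3) by (intro divide_left_mono) auto
          moreover have "(r0 - t) / r0 \<le> 2 * m / r0" using c(3) y0(3) by (intro divide_right_mono) auto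
          then have "1 - t / r0 \<le> 2 * m / r0" using y0(3) by (simp add: diff_divide_distrib)
          ultimately have "1 - t / rad x \<le> 2 * m / r0" by linarith
          then have "weight (x, t) \<le> w" unfolding weight_eq[OF x tR(1)] w_def using R tR by (intro power_mono) auto
          then show ?thesis using True c by (simp add: ennreal_leI)
        qed simp
      qed
      also have "\<dots> = (ennreal w * indicator (S m) x) * emeasure lborel {r0 - 2 * m..r0}"
        by (rule nn_integral_cmult_indicator) simp
      also have "emeasure lborel {r0 - 2 * m..r0} = ennreal (2 * m)" using m by simp
      also have "(ennreal w * indicator (S m) x) * ennreal (2 * m) = ennreal (w * (2 * m)) * indicator (S m) x"
        unfolding ennreal_mult'[OF w0] by (simp only: mult_ac)
      finally show "(\<integral>\<^sup>+t. ennreal (weight (x, t)) * indicator (cov m) (x, t) \<partial>lborel) \<le> ennreal (w * (2 * m)) * indicator (S m) x" .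
    qed
    also have "\<dots> = ennreal (w * (2 * m) * measure area (S m))"
      using Sb w0 m by (simp add: nn_integral_cmult_indicator A.emeasure_eq_measure ennreal_mult)
    also have "emeasure lebesgue (ball (y0 + m *\<^sub>R v) (m * r)) = ennreal ((m * r) ^ DIM('a) * b)"
    proof -
      have "emeasure lebesgue (ball (y0 + m *\<^sub>R v) (m * r)) = emeasure lborel (ball (y0 + m *\<^sub>R v) (m * r))" by simp
      also have "\<dots> = ennreal (measure lborel (ball (y0 + m *\<^sub>R v) (m * r)))"
        using emeasure_lborel_ball_finite[of "y0 + m *\<^sub>R v" "m * r"] by (intro emeasure_eq_ennreal_measure) simp
      finally show ?thesis unfolding b_def using content_ball_conv_unit_ball[of "m * r" "y0 + m *\<^sub>R v"] m r(1) by simp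
    qed
    finally have "(m * r) ^ DIM('a) * b \<le> w * (2 * m) * measure area (S m)"
      using w0 m by (simp add: ennreal_le_iff mult_nonneg_nonneg)
    also have "w * (2 * m) = (2 * m) ^ DIM('a) / r0 ^ CARD('n)" unfolding w_def dim by (simp add: power_divide)
    finally have "m ^ DIM('a) * (r ^ DIM('a) * b) \<le> m ^ DIM('a) * (2 ^ DIM('a) / r0 ^ CARD('n) * measure area (S m))"
      by (simp add: power_mult_distrib mult_ac)
    then have "r ^ DIM('a) * b \<le> 2 ^ DIM('a) / r0 ^ CARD('n) * measure area (S m)"
      by (rule mult_left_le_imp_le) (use m in simp)
    then show ?thesis using y0(3) by (simp add: l_def field_simps)
  qed
  \<comment> \<open>Shells decreasing to the empty set, because their inner radius inequality is
    strict; finiteness of the area makes their areas tend to 0.\<close>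
  define D where "D k = S (m0 / real (Suc k))" for k
  have "(\<lambda>k. measure area (D k)) \<longlonglongrightarrow> measure area (\<Inter>k. D k)"
  proof (rule A.finite_Lim_measure_decseq)
    show "range D \<subseteq> sets area" using Sb by (auto simp: D_def)
    show "decseq D"
    proof (rule decseq_SucI, rule subsetI)
      fix k x assume x: "x \<in> D (Suc k)"
      have "m0 / real (Suc (Suc k)) \<le> m0 / real (Suc k)" using m0 by (intro divide_left_mono) auto
      then show "x \<in> D k" using x by (auto simp: D_def S_def)
    qed
  qed
  moreover have "(\<Inter>k. D k) = {}"
  proof (rule ccontr)
    assume "(\<Inter>k. D k) \<noteq> {}"
    then obtain x where x: "\<And>k. x \<in> D k" by blast
    have gt: "dist y0 x - r0 > 0" using x[of 0] by (auto simp: D_def S_def)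
    then obtain k :: nat where k: "2 * m0 / (dist y0 x - r0) < real k" using reals_Archimedean2 by blast
    have "dist y0 x - r0 \<le> 2 * (m0 / real (Suc k))" using x[of k] by (auto simp: D_def S_def)
    then have "(dist y0 x - r0) * real (Suc k) \<le> 2 * m0" by (simp add: field_simps)
    moreover have "2 * m0 < real k * (dist y0 x - r0)" using k gt by (simp add: field_simps)
    ultimately show False using gt by (simp add: algebra_simps)
  qed
  ultimately have "(\<lambda>k. measure area (D k)) \<longlonglongrightarrow> 0" by simp
  moreover have "l \<le> measure area (D k)" for k
    unfolding D_def using m0 by (intro bound) (auto simp: field_simps)
  ultimately have "l \<le> 0" by (intro LIMSEQ_le_const) auto
  then show False using l by simp
qed

end

section \<open>Equality forces a spherical cap and a cone\<close>

context heintze_karcher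
begin

lemma \<Omega>_in_K: "closure \<Omega> \<subseteq> closure K" "z \<in> \<Omega> \<Longrightarrow> z \<in> interior K"
proof -
  show "closure \<Omega> \<subseteq> closure K"
    by (rule closure_mono) (use \<Omega>_sub(1) interior_subset in blast)
  show "z \<in> \<Omega> \<Longrightarrow> z \<in> interior K" using \<Omega>_sub(1) by blast
qed

text \<open>The distance to \<Sigma> attains its maximum on the compact closure of \<Omega>. By
  \<open>equality_touch\<close> each \<open>rad x\<close> is the radius of a touching ball centred
  there, hence bounded by the maximum.\<close>

lemma center_exists:
  assumes eq: "measure lebesgue \<Omega> = (\<integral>x. rad x \<partial>area) / (CARD('n) + 1)"
  obtains y0 r0 where "y0 \<in> closure \<Omega>" "infdist y0 \<Sigma> = r0" "r0 > 0" "\<And>y. y \<in> closure \<Omega> \<Longrightarrow> infdist y \<Sigma> \<le> r0"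
    "\<And>x. x \<in> \<Sigma> \<Longrightarrow> rad x \<le> r0"
proof -
  have "compact (closure \<Omega>)" using \<Omega>(2) by simp
  moreover have "closure \<Omega> \<noteq> {}" using \<Omega>_sub(3) by simp
  moreover have "continuous_on (closure \<Omega>) (\<lambda>y. infdist y \<Sigma>)" by (intro continuous_intros)
  ultimately obtain y0 where y0: "y0 \<in> closure \<Omega>" "\<forall>y\<in>closure \<Omega>. infdist y \<Sigma> \<le> infdist y0 \<Sigma>"
    using continuous_attains_sup by blast
  have le: "rad x \<le> infdist y0 \<Sigma>" if x: "x \<in> \<Sigma>" for x
    using equality_touch[OF eq x] y0(2) by (meson order_trans)
  obtain x where "x \<in> \<Sigma>" using ne\<Sigma> by blast
  then have "infdist y0 \<Sigma> > 0" using le[of x] rad_pos[of x] by linarith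
  then show thesis using that[OF y0(1) refl] y0(2) le by blast
qed

text \<open>Seen from the deepest point \<open>y0\<close>, \<Sigma> contains the sphere of radius
  \<open>r0\<close> in all inner directions \<open>W\<close>. Connectedness confines \<Omega>, and
  thus \<Sigma>, to the closed ball, while the minimal distance keeps \<Sigma> outside the open
  ball. The sector is the closure of \<open>W\<close>, and points of the frontier of
  \<open>K\<close> near \<Omega> are limits of inner directions that are not inner
  themselves.\<close>

lemma equality_cap:
  assumes eq: "measure lebesgue \<Omega> = (\<integral>x. rad x \<partial>area) / (CARD('n) + 1)"
  shows "\<exists>c r. r > 0 \<and> \<Sigma> \<subseteq> sphere c r \<and> free_boundary J u \<Psi> K \<Sigma> \<nu> \<and>
    spherically_convex_domain (sector_of c \<Sigma>) \<and> frontier K \<inter> closure \<Omega> \<subseteq> frontier (cone_over c (sector_of c \<Sigma>))"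
proof -
  obtain y0 r0 where y0: "y0 \<in> closure \<Omega>" "infdist y0 \<Sigma> = r0" "r0 > 0"
    and max: "\<And>y. y \<in> closure \<Omega> \<Longrightarrow> infdist y \<Sigma> \<le> r0" and rad: "\<And>x. x \<in> \<Sigma> \<Longrightarrow> rad x \<le> r0"
    using center_exists[OF eq] by blast
  have y0K: "y0 \<in> closure K" using y0(1) \<Omega>_in_K(1) by blast
  define C where "C = inner_cone K y0"
  define W where "W = C \<inter> sphere 0 1"
  have oC: "open C" and cC: "convex C" unfolding C_def by (rule inner_cone_open, rule inner_cone_convex[OF convK y0K])
  have cap: "y0 + r0 *\<^sub>R v \<in> \<Sigma>" if "v \<in> W" for v
    using cap_in_hypersurface[OF y0 max rad] that by (auto simp: W_def C_def)
  have sgnW: "sgn v \<in> W" if "v \<in> C" "v \<noteq> 0" for v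
    using inner_cone_scale[of v K y0 "inverse (norm v)"] that by (simp add: C_def W_def norm_sgn) (simp add: sgn_div_norm)
  have far: "r0 \<le> dist y0 z" if "z \<in> \<Sigma>" for z using infdist_le[OF that, of y0] y0(2) by simp
  have \<Omega>C: "y - y0 \<in> C" if "y \<in> \<Omega>" for y using inner_coneI[OF \<Omega>_in_K(2)[OF that]] by (simp add: C_def)
  \<comment> \<open>If \<Omega> left the ball, it would meet the sphere in an inner direction of
    \<open>y0\<close>, that is, in a point of \<Sigma>.\<close>
  have \<Omega>b: "\<Omega> \<subseteq> ball y0 r0"
  proof (rule ccontr)
    assume "\<not> \<Omega> \<subseteq> ball y0 r0"
    moreover have "\<Omega> \<inter> ball y0 r0 \<noteq> {}"
      using y0(1,3) open_Int_closure_eq_empty[OF open_ball, of y0 r0 \<Omega>] centre_in_ball by (metis Int_commute IntI empty_iff)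
    ultimately have "\<Omega> \<inter> frontier (ball y0 r0) \<noteq> {}" by (intro connected_Int_frontier[OF \<Omega>_sub(2)]) auto
    then obtain y where y: "y \<in> \<Omega>" "dist y0 y = r0" unfolding frontier_ball[OF y0(3)] mem_sphere[symmetric] by blast
    have "y - y0 \<noteq> 0" using y(2) y0(3) by auto
    then have "y0 + r0 *\<^sub>R sgn (y - y0) \<in> \<Sigma>" using cap sgnW \<Omega>C[OF y(1)] by blast
    moreover have "r0 *\<^sub>R sgn (y - y0) = y - y0" using y(2) y0(3) by (simp add: sgn_div_norm dist_norm norm_minus_commute)
    ultimately show False using y(1) \<Omega>_sub(1) by auto
  qed
  have cl\<Omega>: "closure \<Omega> \<subseteq> cball y0 r0" by (rule closure_minimal) (use \<Omega>b in auto)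
  have S\<Omega>: "\<Sigma> \<subseteq> closure \<Omega>" using \<Omega>(3) by (auto simp: frontier_def)
  have S: "\<Sigma> \<subseteq> sphere y0 r0"
  proof
    fix x assume x: "x \<in> \<Sigma>"
    then have "x \<in> cball y0 r0" using S\<Omega> cl\<Omega> by blast
    then show "x \<in> sphere y0 r0" using far[OF x] by simp
  qed
  define b where "b = sector_of y0 \<Sigma>"
  have sec: "sgn (x - y0) = (1 / r0) *\<^sub>R (x - y0)" if "x \<in> \<Sigma>" for x
  proof -
    have "norm (x - y0) = r0" using S that by (auto simp: dist_norm norm_minus_commute)
    then show ?thesis by (simp add: sgn_div_norm divide_inverse)
  qed
  have beq: "b = (\<lambda>x. (1 / r0) *\<^sub>R (x - y0)) ` \<Sigma>" unfolding b_def sector_of_def using sec by (rule image_cong[OF refl])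
  have "compact b" unfolding beq by (intro compact_continuous_image compact\<Sigma> continuous_intros)
  then have cb: "closed b" by (rule compact_imp_closed)
  have Wb: "W \<subseteq> b"
  proof
    fix v assume "v \<in> W"
    then show "v \<in> b" unfolding beq using cap y0(3) by (intro image_eqI[of _ _ "y0 + r0 *\<^sub>R v"]) auto
  qed
  have clW: "closure W \<subseteq> b" using Wb cb by (rule closure_minimal)
  have clC: "sgn z \<in> b" "sgn z \<in> closure W" if "z \<in> closure C" "z \<noteq> 0" for z
    using inner_cone_closure_sgn[of z K y0] that clW by (auto simp: C_def W_def)
  have cl: "z - y0 \<in> closure C" if "z \<in> closure \<Omega>" for z
  proof -
    have "(\<lambda>z. z - y0) ` closure \<Omega> \<subseteq> closure C"
      by (rule image_closure_subset) (use \<Omega>C closure_subset in \<open>auto intro!: continuous_intros\<close>)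
    then show ?thesis using that by blast
  qed
  have C0: "s *\<^sub>R z \<in> closure C" if "z \<in> closure C" "s > 0" for z s
  proof -
    have "(*\<^sub>R) s ` closure C \<subseteq> closure C"
      by (rule image_closure_subset)
        (use inner_cone_scale[of _ K y0 s] that(2) closure_subset in \<open>auto intro!: continuous_intros simp: C_def\<close>)
    then show ?thesis using that(1) by blast
  qed
  have bC: "b \<subseteq> closure C" and b1: "b \<subseteq> sphere 0 1"
  proof -
    show "b \<subseteq> closure C" unfolding beq using C0[OF cl] S\<Omega> y0(3) by auto
    show "b \<subseteq> sphere 0 1" unfolding beq using S y0(3) by (auto simp: dist_norm norm_minus_commute)
  qed
  have neC: "C \<noteq> {}" using \<Omega>C \<Omega>_sub(3) by blast
  \<comment> \<open>Removing the origin does not disconnect an open connected set because the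
    dimension is at least 2.\<close>
  have "connected (C - {0})" by (rule connected_open_delete[OF oC convex_connected[OF cC]]) (use dim in simp)
  then have "connected (sgn ` (C - {0}))"
    by (rule connected_continuous_image[rotated]) (auto intro!: continuous_intros)
  moreover have "sgn ` (C - {0}) = W"
  proof
    show "sgn ` (C - {0}) \<subseteq> W" using sgnW by blast
    show "W \<subseteq> sgn ` (C - {0})"
    proof
      fix v assume v: "v \<in> W"
      then have "sgn v = v" "v \<in> C - {0}" by (auto simp: W_def sgn_div_norm)
      then show "v \<in> sgn ` (C - {0})" by (metis image_eqI)
    qed
  qed
  ultimately have cW: "connected W" by simp
  have "C \<noteq> {0}" using oC not_open_singleton by metis
  then obtain v0 where "v0 \<in> C" "v0 \<noteq> 0" using neC by blast
  then have neW: "W \<noteq> {}" using sgnW by blast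
  have oW: "openin (top_of_set (sphere 0 1)) W" unfolding W_def using oC by (subst Int_commute) (rule openin_open_Int)
  have "b \<subseteq> closure W"
  proof
    fix z assume z: "z \<in> b"
    then have "z \<in> closure C" "norm z = 1" using bC b1 by auto
    moreover from this have "z \<noteq> 0" by auto
    ultimately show "z \<in> closure W" using clC(2)[of z] by (simp add: sgn_div_norm)
  qed
  moreover have "sgn ((1 - s) *\<^sub>R x + s *\<^sub>R y) \<in> b" if xy: "x \<in> b" "y \<in> b" "x + y \<noteq> 0" and s: "s \<in> {0..1}" for x y s
  proof (rule clC(1))
    have "x \<in> closure C" "y \<in> closure C" using xy(1,2) bC by auto
    then show "(1 - s) *\<^sub>R x + s *\<^sub>R y \<in> closure C" using convexD[OF convex_closure[OF cC], of x y "1 - s" s] s by auto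
    show "(1 - s) *\<^sub>R x + s *\<^sub>R y \<noteq> 0"
    proof
      assume 0: "(1 - s) *\<^sub>R x + s *\<^sub>R y = 0"
      then have "(1 - s) *\<^sub>R x = - (s *\<^sub>R y)" by (simp add: add_eq_0_iff)
      then have "norm ((1 - s) *\<^sub>R x) = norm (s *\<^sub>R y)" by simp
      moreover have "norm x = 1" "norm y = 1" using xy(1,2) b1 by auto
      ultimately have "1 - s = s" using s by simp
      moreover from this have "s *\<^sub>R (x + y) = 0" using 0 by (simp only: scaleR_add_right)
      moreover have "s \<noteq> 0" using calculation(1) by auto
      ultimately show False using xy(3) by simp
    qed
  qed
  ultimately have sph: "spherically_convex_domain b"
    unfolding spherically_convex_domain_def using b1 oW cW neW Wb by blast
  \<comment> \<open>Around such a point \<Sigma> is the whole sphere, so the point is interior to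
    \<Sigma> and \<open>hs_interior_in_K\<close> applies. Segments from \<open>y0\<close> to it then
    run inside the interior of \<open>K\<close>.\<close>
  have capK: "y0 + r0 *\<^sub>R v \<in> interior K" if v: "v \<in> W" for v
  proof (rule hs_interior_in_K)
    let ?U = "(\<lambda>x. x - y0) -` C - {y0}" and ?g = "\<lambda>y. (y - y0) \<bullet> (y - y0) - r0\<^sup>2"
    have oU: "open ?U" by (intro open_delete open_vimage oC continuous_intros)
    have E: "C2_equation \<Sigma> ?U ?g" by (rule sphere_equation[OF oU _ S]) simp
    have "y \<in> \<Sigma>" if y: "y \<in> ?U" "?g y = 0" for y
    proof -
      have "norm (y - y0) = r0" using y(2) y0(3) by (simp add: dot_square_norm)
      then have "y = y0 + r0 *\<^sub>R sgn (y - y0)" using y0(3) by (simp add: sgn_div_norm)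
      then show ?thesis using cap[OF sgnW[of "y - y0"]] y(1) by auto
    qed
    then have "\<Sigma> \<inter> ?U = {y\<in>?U. ?g y = 0}" using E by (auto simp: C2_equation_def)
    moreover have "y0 + r0 *\<^sub>R v \<in> ?U" using v y0(3) inner_cone_scale[of v K y0 r0] by (auto simp: W_def C_def)
    ultimately show "y0 + r0 *\<^sub>R v \<in> hs_interior \<Sigma>" using cap[OF v] E unfolding hs_interior_def by blast
  qed
  have "frontier K \<inter> closure \<Omega> \<subseteq> frontier (cone_over y0 b)"
  proof
    fix z assume z: "z \<in> frontier K \<inter> closure \<Omega>"
    have zC: "z - y0 \<in> closure C" using cl z by blast
    have "z \<in> cone_over y0 b"
    proof (cases "z = y0")
      case True
      obtain v where "v \<in> b" using neW Wb by blast
      moreover have "z = y0 + 0 *\<^sub>R v" using True by simp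
      ultimately show ?thesis unfolding cone_over_def using order_refl[of "0::real"] by blast
    next
      case False
      then have "sgn (z - y0) \<in> b" using clC(1)[OF zC] by simp
      moreover have "z = y0 + norm (z - y0) *\<^sub>R sgn (z - y0)" using False by (simp add: sgn_div_norm)
      ultimately show ?thesis unfolding cone_over_def using norm_ge_zero by blast
    qed
    \<comment> \<open>An interior point of the cone is seen from \<open>y0\<close> in an inner
      direction, hence lies on a segment from \<open>y0\<close> to a point of the open cap, or is
      \<open>y0\<close> itself; either way it would be interior to \<open>K\<close>.\<close>
    moreover have "z \<notin> interior (cone_over y0 b)"
    proof
      assume zi: "z \<in> interior (cone_over y0 b)"
      have "cone_over y0 b \<subseteq> (+) y0 ` closure C"
      proof
        fix w assume "w \<in> cone_over y0 b"
        then obtain t v where w: "w = y0 + t *\<^sub>R v" "t \<ge> 0" "v \<in> b" by (auto simp: cone_over_def)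
        have "t *\<^sub>R v \<in> closure C"
        proof (cases "t = 0")
          case True
          have "v \<in> closure C" using w(3) bC by blast
          have "((\<lambda>s. s *\<^sub>R v) \<longlongrightarrow> 0 *\<^sub>R v) (at_right 0)" by (intro tendsto_intros)
          then have "0 *\<^sub>R v \<in> closure C"
            by (rule Lim_in_closed_set[OF closed_closure, rotated 2])
              (use C0[OF \<open>v \<in> closure C\<close>] in \<open>auto simp: eventually_at_right_field intro: exI[of _ 1]\<close>)
          then show ?thesis using True by simp
        next
          case False then show ?thesis using C0 w bC by auto
        qed
        then show "w \<in> (+) y0 ` closure C" using w(1) by blast
      qed
      from interior_mono[OF this] have "z \<in> (+) y0 ` interior (closure C)" using zi unfolding interior_translation by blast
      then have zC': "z - y0 \<in> C" using convex_interior_closure[OF cC] interior_open[OF oC] by auto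
      have "z \<in> interior K"
      proof (cases "z = y0")
        case True
        then show ?thesis using zC' by (auto simp: C_def inner_cone_def)
      next
        case False
        have "z = y0 + norm (z - y0) *\<^sub>R sgn (z - y0)" using False by (simp add: sgn_div_norm)
        moreover have "y0 + norm (z - y0) *\<^sub>R sgn (z - y0) \<in> interior K"
        proof (rule interior_segment[OF convK y0K capK])
          show "sgn (z - y0) \<in> W" using sgnW[OF zC'] False by simp
          show "norm (z - y0) \<le> r0" using cl\<Omega> z by (auto simp: dist_norm norm_minus_commute)
        qed (use False in simp)
        ultimately show ?thesis by simp
      qed
      then show False using z by (auto simp: frontier_def)
    qed
    ultimately show "z \<in> frontier (cone_over y0 b)" using closure_subset by (auto simp: frontier_def)
  qed
  then show ?thesis using y0(3) S sph free_boundary_sphere[OF S y0(3) y0K] unfolding b_def by blast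
qed

section \<open>Caps with conical container attain equality\<close>

text \<open>For a cap all principal curvatures are \<open>1 / r\<close>, so the Jacobian equals the
  weight and \<open>rad\<close> is \<open>r\<close> on interior points. The normal map is radial,
  injective for parameters below \<open>r\<close>, and keeps its values in \<Omega>; the tube
  formula then bounds the volume from below by the full integral.\<close>

lemma cap_equality:
  assumes r: "r > 0" and S: "\<Sigma> \<subseteq> sphere c r"
    and fr: "frontier K \<inter> closure \<Omega> \<subseteq> frontier (cone_over c (sector_of c \<Sigma>))"
  shows "(\<integral>x. rad x \<partial>area) / (CARD('n) + 1) \<le> measure lebesgue \<Omega>"
proof -
  interpret A: finite_measure area by (rule finite_area)
  have \<nu>: "\<nu> x = (1 / r) *\<^sub>R (x - c)" if "x \<in> \<Sigma>" for x by (rule sphere_normal[OF S r mean_convex that])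
  have dist: "norm (x - c) = r" if "x \<in> \<Sigma>" for x using S that by (auto simp: dist_norm norm_minus_commute)
  have \<zeta>: "\<zeta> (x, t) = c + (1 - t / r) *\<^sub>R (x - c)" if "x \<in> \<Sigma>" for x t
    unfolding \<zeta>_def prod.case \<nu>[OF that] by (simp add: algebra_simps)
  have curv: "mean_curvature \<Sigma> \<nu> x = CARD('n) * (1 / r)" "eqn U g \<Longrightarrow> x \<in> U \<Longrightarrow> absdet (focal_map g x t) = \<bar>1 - t * (1 / r)\<bar> ^ CARD('n)"
    if x: "x \<in> hs_interior \<Sigma>" for x t U g
    using sphere_curvature[OF x open_UNIV, of "1 / r" c] \<nu> by auto
  have radr: "rad x = r" if "x \<in> hs_interior \<Sigma>" for x
    using curv(1)[OF that] r by (simp add: rad_eq)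
  have inside: "\<zeta> (x, t) \<in> \<Omega>" if x: "x \<in> hs_interior \<Sigma>" and t: "0 < t" "t < r" for x t
  proof -
    have xS: "x \<in> \<Sigma>" using hs_interior_subset[OF x] .
    have xc: "x \<noteq> c" using dist[OF xS] r by auto
    \<comment> \<open>The open radius from \<open>c\<close> to \<open>x\<close>, parametrised from
      the centre; it carries all \<open>\<zeta> (x, t)\<close> with
      \<open>0 < t < r\<close>.\<close>
    define L where "L = (\<lambda>s. c + s *\<^sub>R (x - c)) ` {0<..<1}"
    have "connected L" unfolding L_def by (intro connected_continuous_image continuous_intros) auto
    have LS: "L \<inter> \<Sigma> = {}"
    proof -
      have "c + s *\<^sub>R (x - c) \<notin> \<Sigma>" if "0 < s" "s < 1" for s
      proof
        assume "c + s *\<^sub>R (x - c) \<in> \<Sigma>"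
        then have "s * norm (x - c) = r" using dist[of "c + s *\<^sub>R (x - c)"] that by simp
        then show False using dist[OF xS] r that by simp
      qed
      then show ?thesis by (auto simp: L_def)
    qed
    \<comment> \<open>Near \<open>x\<close> the hypersurface fills the sphere, so all directions
      close to that of \<open>x\<close> belong to the sector.\<close>
    have Lcone: "L \<subseteq> interior (cone_over c (sector_of c \<Sigma>))"
    proof -
      let ?g = "\<lambda>y. (y - c) \<bullet> (y - c) - r\<^sup>2"
      have "C2_equation \<Sigma> (- {c}) ?g" by (rule sphere_equation[OF _ _ S]) auto
      from hs_interior_any_equation[OF dim this x] xc
      obtain W where W: "open W" "x \<in> W" "\<Sigma> \<inter> W = {y\<in>W. ?g y = 0}" by auto
      have "open ((- {c}) \<inter> (\<lambda>z. c + r *\<^sub>R sgn (z - c)) -` W)"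
        by (intro continuous_open_preimage W(1)) (auto intro!: continuous_intros)
      moreover have "L \<subseteq> (- {c}) \<inter> (\<lambda>z. c + r *\<^sub>R sgn (z - c)) -` W"
      proof
        fix z assume "z \<in> L"
        then obtain s where s: "0 < s" "s < 1" "z = c + s *\<^sub>R (x - c)" by (auto simp: L_def)
        have "z - c = s *\<^sub>R (x - c)" using s(3) by simp
        then have "sgn (z - c) = sgn (x - c)" using s(1) by (simp add: sgn_scaleR)
        then have "c + r *\<^sub>R sgn (z - c) = x" using r dist[OF xS] by (simp add: sgn_div_norm)
        then show "z \<in> (- {c}) \<inter> (\<lambda>z. c + r *\<^sub>R sgn (z - c)) -` W" using s xc W(2) by auto
      qed
      moreover have "(- {c}) \<inter> (\<lambda>z. c + r *\<^sub>R sgn (z - c)) -` W \<subseteq> cone_over c (sector_of c \<Sigma>)"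
      proof
        fix z assume z: "z \<in> (- {c}) \<inter> (\<lambda>z. c + r *\<^sub>R sgn (z - c)) -` W"
        let ?y = "c + r *\<^sub>R sgn (z - c)"
        have "norm (r *\<^sub>R sgn (z - c)) = r" using z r by (simp add: norm_sgn)
        then have "?g ?y = 0" by (simp add: dot_square_norm)
        then have "?y \<in> \<Sigma>" using W(3) z by blast
        moreover have "sgn (?y - c) = sgn (z - c)" using r z by (simp add: sgn_scaleR sgn_div_norm[of "sgn _"] norm_sgn)
        ultimately have "sgn (z - c) \<in> sector_of c \<Sigma>" unfolding sector_of_def by (metis (no_types, lifting) image_eqI)
        moreover have "z = c + norm (z - c) *\<^sub>R sgn (z - c)" using z by (simp add: sgn_div_norm)
        ultimately show "z \<in> cone_over c (sector_of c \<Sigma>)" unfolding cone_over_def using norm_ge_zero by blast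
      qed
      ultimately show ?thesis using interior_maximal by blast
    qed
    have "\<forall>\<^sub>F s in at_right 0. x - s *\<^sub>R \<nu> x \<in> \<Omega>"
      using outward x unfolding outward_unit_normal_field_def by (auto elim: eventually_mono)
    then obtain b where b: "b > 0" "\<And>s. 0 < s \<Longrightarrow> s < b \<Longrightarrow> x - s *\<^sub>R \<nu> x \<in> \<Omega>"
      unfolding eventually_at_right_field by blast
    define s where "s = min (b / 2) (r / 2)"
    have s: "0 < s" "s < b" "s < r" using b(1) r by (auto simp: s_def)
    have inL: "\<zeta> (x, t) \<in> L" if "0 < t" "t < r" for t
      unfolding \<zeta>[OF xS] L_def using that r by (intro image_eqI[OF refl]) auto
    have "\<zeta> (x, s) \<in> \<Omega>" using b(2)[OF s(1,2)] by (simp add: \<zeta>_def)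
    then have "L \<inter> \<Omega> \<noteq> {}" using inL[OF s(1,3)] by blast
    \<comment> \<open>Off \<Sigma>, a frontier point of \<Omega> lies on the frontier of
      \<open>K\<close> and so by assumption on that of the cone. The radius avoids both, and it
      meets \<Omega> close to \<open>x\<close> because \<nu> points outward.\<close>
    have "L \<subseteq> \<Omega>"
    proof (rule ccontr)
      assume "\<not> L \<subseteq> \<Omega>"
      then have "L \<inter> frontier \<Omega> \<noteq> {}"
        using \<open>L \<inter> \<Omega> \<noteq> {}\<close> by (intro connected_Int_frontier[OF \<open>connected L\<close>]) auto
      then obtain z where z: "z \<in> L" "z \<in> frontier \<Omega>" by blast
      have zc: "z \<in> closure \<Omega>" "z \<notin> \<Omega>" using z(2) \<Omega>_sub(4) by (auto simp: frontier_def interior_open)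
      have "z \<notin> interior K"
      proof
        assume zK: "z \<in> interior K"
        have "open (interior K - \<Sigma>)" by (intro open_Diff open_interior closed\<Sigma>)
        moreover have "z \<in> interior K - \<Sigma>" using zK z(1) LS by blast
        ultimately obtain e where e: "e > 0" "ball z e \<subseteq> interior K - \<Sigma>" using open_contains_ball by blast
        have "ball z e \<inter> \<Sigma> = {}" using e(2) by blast
        from ball_subset_\<Omega>[OF zc(1) this e(1)] show False using zK centre_in_ball[of z e] e(1) zc(2) by blast
      qed
      then have "z \<in> frontier K" using zc(1) \<Omega>_in_K(1) by (auto simp: frontier_def)
      then have "z \<in> frontier (cone_over c (sector_of c \<Sigma>))" using fr zc(1) by blast
      then show False using Lcone z(1) by (auto simp: frontier_def)
    qed
    then show ?thesis using inL[OF t] by blast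
  qed
  define Q where "Q = hs_interior \<Sigma> \<times> {0<..<r}"
  obtain Y where Y: "open Y" "hs_interior \<Sigma> = \<Sigma> \<inter> Y" by (rule hs_interior_eq)
  have ib: "hs_interior \<Sigma> \<in> sets borel" unfolding Y(2) using Y(1) closed\<Sigma> by auto
  have QB: "Q \<in> sets borel"
  proof -
    have "Q = (\<Sigma> \<times> UNIV) \<inter> (Y \<times> {0<..<r})" using Y(2) by (auto simp: Q_def)
    moreover have "(\<Sigma> \<times> (UNIV :: real set)) \<inter> (Y \<times> {0<..<r}) \<in> sets borel"
      by (rule sets.Int[OF borel_closed[OF closed_\<Sigma>UNIV] borel_open[OF open_Times[OF Y(1) open_greaterThanLessThan]]])
    ultimately show ?thesis by simp
  qed
  have QS: "Q \<subseteq> \<Sigma> \<times> UNIV" using hs_interior_subset by (auto simp: Q_def)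
  have inj: "inj_on \<zeta> Q"
  proof (rule inj_onI)
    fix z w assume zw: "z \<in> Q" "w \<in> Q" "\<zeta> z = \<zeta> w"
    obtain x t y s where z: "z = (x, t)" and w: "w = (y, s)" by (metis prod.exhaust)
    have x: "x \<in> \<Sigma>" "y \<in> \<Sigma>" and ts: "0 < t" "t < r" "0 < s" "s < r" using zw(1,2) hs_interior_subset z w by (auto simp: Q_def)
    have eq: "(1 - t / r) *\<^sub>R (x - c) = (1 - s / r) *\<^sub>R (y - c)" using zw(3) \<zeta> x by (simp add: z w)
    then have "norm ((1 - t / r) *\<^sub>R (x - c)) = norm ((1 - s / r) *\<^sub>R (y - c))" by simp
    moreover have p: "1 - t / r > 0" "1 - s / r > 0" using ts r by auto
    ultimately have st: "1 - t / r = 1 - s / r" using dist x r by simp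
    have "(1 - t / r) *\<^sub>R (x - c) = (1 - t / r) *\<^sub>R (y - c)" using eq by (simp only: st)
    then have "x - c = y - c" using ts(2) by auto
    then show "z = w" using st r by (simp add: z w)
  qed
  have "\<zeta> ` Q \<subseteq> \<Omega>" using inside by (auto simp: Q_def)
  moreover have "\<Omega> \<in> sets lebesgue" using \<Omega>_sub(4) by auto
  ultimately have "emeasure lebesgue (\<zeta> ` Q) \<le> emeasure lebesgue \<Omega>" by (rule emeasure_mono)
  moreover have "emeasure lebesgue (\<zeta> ` Q) = (\<integral>\<^sup>+x. \<integral>\<^sup>+t. ennreal (weight (x, t)) * indicator Q (x, t) \<partial>lborel \<partial>area)"
  proof (rule tube(3)[OF QB QS borel_weight _ inj])
    fix x t U g assume xt: "(x, t) \<in> Q" "eqn U g" "x \<in> U"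
    then have x: "x \<in> hs_interior \<Sigma>" "x \<in> \<Sigma>" and t: "0 < t" "t < r" using hs_interior_subset by (auto simp: Q_def)
    have "absdet (focal_map g x t) = \<bar>1 - t * (1 / r)\<bar> ^ CARD('n)" by (rule curv(2)[OF x(1) xt(2,3)])
    moreover have "\<bar>1 - t * (1 / r)\<bar> = 1 - t / r" using t r by simp
    moreover have "weight (x, t) = (1 - t / r) ^ CARD('n)" using weight_eq[OF x(2), of t] radr[OF x(1)] t by simp
    ultimately show "absdet (focal_map g x t) = weight (x, t)" by simp
  qed
  moreover have "(\<integral>\<^sup>+x. \<integral>\<^sup>+t. ennreal (weight (x, t)) * indicator Q (x, t) \<partial>lborel \<partial>area) = (\<integral>\<^sup>+x. ennreal (rad x / (CARD('n) + 1)) \<partial>area)"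
  proof (rule nn_integral_cong_AE)
    have "AE x in area. x \<notin> hs_boundary \<Sigma>" using boundary_null(1) by (rule AE_not_in)
    moreover have "AE x in area. x \<in> \<Sigma>" by (intro AE_I2) (simp add: space_area)
    ultimately show "AE x in area. (\<integral>\<^sup>+t. ennreal (weight (x, t)) * indicator Q (x, t) \<partial>lborel) = ennreal (rad x / (CARD('n) + 1))"
    proof eventually_elim
      case (elim x)
      then have x: "x \<in> hs_interior \<Sigma>" by (simp add: hs_boundary_def)
      have "(\<integral>\<^sup>+t. ennreal (weight (x, t)) * indicator Q (x, t) \<partial>lborel) = (\<integral>\<^sup>+t. ennreal (weight (x, t)) * indicator {0..rad x} t \<partial>lborel)"
      proof (rule nn_integral_cong_AE)
        have "AE t in lborel. t \<noteq> (0::real)" "AE t in lborel. t \<noteq> r" by (rule AE_lborel_singleton)+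
        then show "AE t in lborel. ennreal (weight (x, t)) * indicator Q (x, t) = ennreal (weight (x, t)) * indicator {0..rad x} t"
          by eventually_elim (use x radr[OF x] in \<open>auto simp: Q_def indicator_def\<close>)
      qed
      then show ?case using weight_integral elim by simp
    qed
  qed
  ultimately have "ennreal ((\<integral>x. rad x \<partial>area) / (CARD('n) + 1)) \<le> ennreal (measure lebesgue \<Omega>)"
    unfolding \<Omega>_finite nn_integral_rad by simp
  then show ?thesis by (simp add: ennreal_le_iff)
qed

end

section \<open>Assembly: rescaling \<open>rad\<close> to the reciprocal mean curvature\<close>

theorem theorem1p3:
  fixes J :: "'j set" and u :: "'j \<Rightarrow> 'a::euclidean_space \<Rightarrow> real" and \<Psi> :: "'a \<Rightarrow> 'a"
    and K \<Sigma> \<Omega> :: "'a set" and \<nu> :: "'a \<Rightarrow> 'a"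
  assumes dim: "DIM('a) = CARD('n::finite) + 1"
    and K: "polytope_type_domain J u \<Psi> K"
    and hypersurface: "compact_C2_hypersurface \<Sigma>"
    and subset: "\<Sigma> \<subseteq> closure K"
    and enclosed: "enclosed_domain K \<Sigma> \<Omega>"
    and normal: "outward_unit_normal_field \<Sigma> \<Omega> \<nu>"
    and mean_convex: "\<forall>x\<in>\<Sigma>. mean_curvature \<Sigma> \<nu> x > 0"
    and boundary: "hs_boundary \<Sigma> \<subseteq> Reg J u \<Psi> \<union> Sing0 J u \<Psi>"
    and transversal: "transversal_to_boundary J u \<Psi> \<Sigma>"
    and regular: "\<forall>x\<in>hs_boundary \<Sigma> \<inter> Reg J u \<Psi>. \<nu> x \<bullet> outer_normal K (frontier K) x \<le> 0"
    and singular: "\<forall>(i, j)\<in>edge_indices J u. \<forall>x\<in>hs_boundary \<Sigma> \<inter> edge_interior J u \<Psi> i j.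
        \<nu> x \<bullet> outer_normal K (piece J u \<Psi> i) x \<le> 0 \<and>
        \<nu> x \<bullet> outer_normal K (piece J u \<Psi> j) x \<le> 0"
  shows "(\<integral>x. 1 / mean_curvature \<Sigma> \<nu> x \<partial>(area_measure TYPE('n) \<Sigma>))
           \<ge> (real CARD('n) + 1) / real CARD('n) * measure lebesgue \<Omega> \<and>
         ((\<integral>x. 1 / mean_curvature \<Sigma> \<nu> x \<partial>(area_measure TYPE('n) \<Sigma>))
             = (real CARD('n) + 1) / real CARD('n) * measure lebesgue \<Omega> \<longleftrightarrow>
          (\<exists>c r. r > 0 \<and> \<Sigma> \<subseteq> sphere c r \<and> free_boundary J u \<Psi> K \<Sigma> \<nu> \<and>
             spherically_convex_domain (sector_of c \<Sigma>) \<and>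
             frontier K \<inter> closure \<Omega> \<subseteq> frontier (cone_over c (sector_of c \<Sigma>))))"
proof -
  interpret heintze_karcher "TYPE('n)" \<Sigma> \<nu> J u \<Psi> K \<Omega>
  proof
    show "DIM('a) = CARD('n) + 1" by (rule dim)
    show "compact_C2_hypersurface \<Sigma>" by (rule hypersurface)
    show "\<forall>x\<in>\<Sigma>. \<exists>U g. x \<in> U \<and> C2_equation \<Sigma> U g \<and> (\<forall>y\<in>\<Sigma> \<inter> U. \<nu> y = sgn (gradient g y))"
      using normal by (simp add: outward_unit_normal_field_def)
  qed (use K subset enclosed normal mean_convex boundary transversal regular singular in \<open>auto simp: polytope_type_domain_def\<close>)
  let ?I = "\<integral>x. 1 / mean_curvature \<Sigma> \<nu> x \<partial>area"
  have "(\<integral>x. rad x \<partial>area) = (\<integral>x. CARD('n) * (1 / mean_curvature \<Sigma> \<nu> x) \<partial>area)" by (simp add: rad_eq)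
  also have "\<dots> = CARD('n) * ?I" by (rule integral_mult_right_zero)
  finally have I: "(\<integral>x. rad x \<partial>area) = CARD('n) * ?I" .
  have le: "measure lebesgue \<Omega> \<le> (\<integral>x. rad x \<partial>area) / (CARD('n) + 1)" by (rule volume_le_integral_rad)
  have iff: "?I = (real CARD('n) + 1) / real CARD('n) * measure lebesgue \<Omega> \<longleftrightarrow> measure lebesgue \<Omega> = (\<integral>x. rad x \<partial>area) / (CARD('n) + 1)"
    unfolding I by (simp add: field_simps) argo
  show ?thesis
  proof (intro conjI iffI)
    show "?I \<ge> (real CARD('n) + 1) / real CARD('n) * measure lebesgue \<Omega>"
      using le npos unfolding I by (simp add: field_simps)
  next
    assume "?I = (real CARD('n) + 1) / real CARD('n) * measure lebesgue \<Omega>"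
    then show "\<exists>c r. r > 0 \<and> \<Sigma> \<subseteq> sphere c r \<and> free_boundary J u \<Psi> K \<Sigma> \<nu> \<and>
             spherically_convex_domain (sector_of c \<Sigma>) \<and>
             frontier K \<inter> closure \<Omega> \<subseteq> frontier (cone_over c (sector_of c \<Sigma>))"
      unfolding iff by (rule equality_cap)
  next
    assume "\<exists>c r. r > 0 \<and> \<Sigma> \<subseteq> sphere c r \<and> free_boundary J u \<Psi> K \<Sigma> \<nu> \<and>
             spherically_convex_domain (sector_of c \<Sigma>) \<and>
             frontier K \<inter> closure \<Omega> \<subseteq> frontier (cone_over c (sector_of c \<Sigma>))"
    then show "?I = (real CARD('n) + 1) / real CARD('n) * measure lebesgue \<Omega>"
      unfolding iff using le cap_equality by (meson order_antisym)
  qed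
qed

end
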